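(* Let $R$ be a local ring and $\mathfrak{a}$ be an ideal of $R$. Let $M,N$ be two finitely generated $R$-modules. Suppose that $p := \operatorname{pd}_R M < \infty$, and let $n := \operatorname{cd}(\mathfrak{a},N)$. Then: (a) $H^i_{\mathfrak{a}}(M,N) = 0$ for all $i > p+n$. (b) $H^{p+n}_{\mathfrak{a}}(M,N) \cong \operatorname{Ext}_R^p(M,H^n_{\mathfrak{a}}(N)) \cong \operatorname{Ext}_R^p(M,R) \otimes_R H^n_{\mathfrak{a}}(N)$.
   Context: All rings are Noetherian, commutative, with $1 \neq 0$. For an ideal $\mathfrak{a}$ and $R$-modules $M,N$, the generalized local cohomology modules are $H^i_{\mathfrak{a}}(M,N) = \varinjlim_n \operatorname{Ext}^i_R(M/\mathfrak{a}^nM,N)$, with direct system induced by the natural maps $M/\mathfrak{a}^{n+1}M \to M/\mathfrak{a}^nM$; $H^i_{\mathfrak{a}}(N)=H^i_{\mathfrak{a}}(R,N)$ is ordinary local cohomology. The cohomological dimension of $N$ with respect to $\mathfrak{a}$ is $\operatorname{cd}(\mathfrak{a},N) = \sup\{i \in \mathbb{N} \mid H^i_{\mathfrak{a}}(N) \neq 0\}$. *)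

theory Defs
  imports "HOL-Library.Extended_Real" "HOL-Algebra.Module" "HOL-Algebra.Ideal_Product"
    "HOL-Algebra.Ring_Divisibility"
begin

text \<open>Modules over a commutative ring are those of \<^locale>\<open>module\<close>.  The record type of modules extends
  that of rings; the fields \<open>mult\<close> and \<open>one\<close> play no role for a module and are left undefined in
  the constructions below.\<close>

definition noetherian_local_ring :: "('a, 'r) ring_scheme \<Rightarrow> bool" where
  "noetherian_local_ring R \<longleftrightarrow> cring R \<and> noetherian_ring R \<and> (\<exists>!\<mm>. maximalideal \<mm> R)"


section \<open>Modules\<close>

definition ring_module :: "('a, 'r) ring_scheme \<Rightarrow> ('a, 'a) module" where
  "ring_module R = \<lparr>carrier = carrier R, monoid.mult = undefined, one = undefined,
     ring.zero = \<zero>\<^bsub>R\<^esub>, add = add R, smult = (\<otimes>\<^bsub>R\<^esub>)\<rparr>"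

definition zero_module :: "('a, 'b, 'm) module_scheme \<Rightarrow> bool" where
  "zero_module M \<longleftrightarrow> carrier M = {\<zero>\<^bsub>M\<^esub>}"

text \<open>Homomorphisms are normalised to be \<open>undefined\<close> off the carrier, so that equal maps are equal
  functions.\<close>

definition mod_hom ::
    "('a, 'r) ring_scheme \<Rightarrow> ('a, 'b, 'm) module_scheme \<Rightarrow> ('a, 'c, 'n) module_scheme \<Rightarrow> ('b \<Rightarrow> 'c) set"
  where "mod_hom R M N = {f \<in> carrier M \<rightarrow>\<^sub>E carrier N.
     (\<forall>x\<in>carrier M. \<forall>y\<in>carrier M. f (x \<oplus>\<^bsub>M\<^esub> y) = f x \<oplus>\<^bsub>N\<^esub> f y) \<and>
     (\<forall>a\<in>carrier R. \<forall>x\<in>carrier M. f (a \<odot>\<^bsub>M\<^esub> x) = a \<odot>\<^bsub>N\<^esub> f x)}"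

definition mod_iso ::
    "('a, 'r) ring_scheme \<Rightarrow> ('a, 'b, 'm) module_scheme \<Rightarrow> ('a, 'c, 'n) module_scheme \<Rightarrow> bool"
  where "mod_iso R M N \<longleftrightarrow> (\<exists>f\<in>mod_hom R M N. bij_betw f (carrier M) (carrier N))"

definition hom_module ::
    "('a, 'r) ring_scheme \<Rightarrow> ('a, 'b, 'm) module_scheme \<Rightarrow> ('a, 'c, 'n) module_scheme
      \<Rightarrow> ('a, 'b \<Rightarrow> 'c) module"
  where "hom_module R M N = \<lparr>carrier = mod_hom R M N, monoid.mult = undefined, one = undefined,
     ring.zero = (\<lambda>x\<in>carrier M. \<zero>\<^bsub>N\<^esub>),
     add = (\<lambda>f g. \<lambda>x\<in>carrier M. f x \<oplus>\<^bsub>N\<^esub> g x),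
     smult = (\<lambda>a f. \<lambda>x\<in>carrier M. a \<odot>\<^bsub>N\<^esub> f x)\<rparr>"

definition mod_span ::
    "('a, 'r) ring_scheme \<Rightarrow> ('a, 'b, 'm) module_scheme \<Rightarrow> 'b set \<Rightarrow> 'b set"
  where "mod_span R M S = \<Inter>{H. submodule H R M \<and> S \<subseteq> H}"

definition fin_gen :: "('a, 'r) ring_scheme \<Rightarrow> ('a, 'b, 'm) module_scheme \<Rightarrow> bool" where
  "fin_gen R M \<longleftrightarrow> (\<exists>S\<subseteq>carrier M. finite S \<and> mod_span R M S = carrier M)"

definition ideal_smult ::
    "('a, 'r) ring_scheme \<Rightarrow> 'a set \<Rightarrow> ('a, 'b, 'm) module_scheme \<Rightarrow> 'b set"
  where "ideal_smult R I M = mod_span R M {a \<odot>\<^bsub>M\<^esub> x | a x. a \<in> I \<and> x \<in> carrier M}"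

definition mod_quot :: "('a, 'b, 'm) module_scheme \<Rightarrow> 'b set \<Rightarrow> ('a, 'b set) module" where
  "mod_quot M H = \<lparr>carrier = a_rcosets\<^bsub>M\<^esub> H, monoid.mult = undefined, one = undefined,
     ring.zero = H, add = set_add M,
     smult = (\<lambda>a X. \<Union>x\<in>X. H +>\<^bsub>M\<^esub> (a \<odot>\<^bsub>M\<^esub> x))\<rparr>"

definition direct_sum :: "'i set \<Rightarrow> ('i \<Rightarrow> ('a, 'b, 'm) module_scheme) \<Rightarrow> ('a, 'i \<Rightarrow> 'b) module" where
  "direct_sum I M = \<lparr>carrier = {f \<in> (\<Pi>\<^sub>E i\<in>I. carrier (M i)). finite {i \<in> I. f i \<noteq> \<zero>\<^bsub>M i\<^esub>}},
     monoid.mult = undefined, one = undefined,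
     ring.zero = (\<lambda>i\<in>I. \<zero>\<^bsub>M i\<^esub>),
     add = (\<lambda>f g. \<lambda>i\<in>I. f i \<oplus>\<^bsub>M i\<^esub> g i),
     smult = (\<lambda>a f. \<lambda>i\<in>I. a \<odot>\<^bsub>M i\<^esub> f i)\<rparr>"

definition sum_inj :: "'i set \<Rightarrow> ('i \<Rightarrow> ('a, 'b, 'm) module_scheme) \<Rightarrow> 'i \<Rightarrow> 'b \<Rightarrow> 'i \<Rightarrow> 'b" where
  "sum_inj I M i x = (\<lambda>j\<in>I. if j = i then x else \<zero>\<^bsub>M j\<^esub>)"

definition free_module :: "('a, 'r) ring_scheme \<Rightarrow> 'x set \<Rightarrow> ('a, 'x \<Rightarrow> 'a) module" where
  "free_module R X = direct_sum X (\<lambda>_. ring_module R)"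

definition free_basis :: "('a, 'r) ring_scheme \<Rightarrow> 'x set \<Rightarrow> 'x \<Rightarrow> 'x \<Rightarrow> 'a" where
  "free_basis R X x = sum_inj X (\<lambda>_. ring_module R) x \<one>\<^bsub>R\<^esub>"

text \<open>The tensor product is the free module on \<open>M \<times> N\<close> modulo the bilinearity relations.\<close>

definition tensor_relations ::
    "('a, 'r) ring_scheme \<Rightarrow> ('a, 'b, 'm) module_scheme \<Rightarrow> ('a, 'c, 'n) module_scheme
      \<Rightarrow> ('b \<times> 'c \<Rightarrow> 'a) set"
  where "tensor_relations R M N =
    (let F = free_module R (carrier M \<times> carrier N);
         e = (\<lambda>x y. free_basis R (carrier M \<times> carrier N) (x, y))
     in {e (x \<oplus>\<^bsub>M\<^esub> x') y \<ominus>\<^bsub>F\<^esub> (e x y \<oplus>\<^bsub>F\<^esub> e x' y) | x x' y.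
           x \<in> carrier M \<and> x' \<in> carrier M \<and> y \<in> carrier N}
      \<union> {e x (y \<oplus>\<^bsub>N\<^esub> y') \<ominus>\<^bsub>F\<^esub> (e x y \<oplus>\<^bsub>F\<^esub> e x y') | x y y'.
           x \<in> carrier M \<and> y \<in> carrier N \<and> y' \<in> carrier N}
      \<union> {e (a \<odot>\<^bsub>M\<^esub> x) y \<ominus>\<^bsub>F\<^esub> a \<odot>\<^bsub>F\<^esub> e x y | a x y.
           a \<in> carrier R \<and> x \<in> carrier M \<and> y \<in> carrier N}
      \<union> {e x (a \<odot>\<^bsub>N\<^esub> y) \<ominus>\<^bsub>F\<^esub> a \<odot>\<^bsub>F\<^esub> e x y | a x y.
           a \<in> carrier R \<and> x \<in> carrier M \<and> y \<in> carrier N})"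

definition tensor ::
    "('a, 'r) ring_scheme \<Rightarrow> ('a, 'b, 'm) module_scheme \<Rightarrow> ('a, 'c, 'n) module_scheme
      \<Rightarrow> ('a, ('b \<times> 'c \<Rightarrow> 'a) set) module"
  where "tensor R M N =
    (let F = free_module R (carrier M \<times> carrier N)
     in mod_quot F (mod_span R F (tensor_relations R M N)))"

text \<open>The direct limit of a sequence \<open>E 0 \<rightarrow> E 1 \<rightarrow> E 2 \<rightarrow> \<dots>\<close> with transition maps
  \<open>t n : E n \<rightarrow> E (n + 1)\<close>, as the quotient of the direct sum that identifies \<open>x\<close> with \<open>t n x\<close>.\<close>

definition direct_limit ::
    "('a, 'r) ring_scheme \<Rightarrow> (nat \<Rightarrow> ('a, 'b, 'm) module_scheme) \<Rightarrow> (nat \<Rightarrow> 'b \<Rightarrow> 'b)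
      \<Rightarrow> ('a, (nat \<Rightarrow> 'b) set) module"
  where "direct_limit R E t =
    (let S = direct_sum UNIV E
     in mod_quot S (mod_span R S
          {sum_inj UNIV E (Suc n) (t n x) \<ominus>\<^bsub>S\<^esub> sum_inj UNIV E n x | n x. x \<in> carrier (E n)}))"


section \<open>Projective resolutions and projective dimension\<close>

text \<open>A projective module is a direct summand of a free module.  It suffices to consider index sets
  consisting of elements of the type of \<open>P\<close>: a direct summand of any free module is one of the free
  module on \<open>carrier P\<close>.\<close>

definition projective :: "('a, 'r) ring_scheme \<Rightarrow> ('a, 'b, 'm) module_scheme \<Rightarrow> bool" where
  "projective R P \<longleftrightarrow> module R P \<and>
     (\<exists>X :: 'b set. \<exists>s\<in>mod_hom R P (free_module R X). \<exists>q\<in>mod_hom R (free_module R X) P.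
        \<forall>x\<in>carrier P. q (s x) = x)"

text \<open>\<open>\<dots> \<rightarrow> P 2 \<rightarrow> P 1 \<rightarrow> P 0 \<rightarrow> M \<rightarrow> 0\<close> with \<open>d i : P (i + 1) \<rightarrow> P i\<close> and augmentation \<open>e : P 0 \<rightarrow> M\<close>.\<close>

definition proj_resolution ::
    "('a, 'r) ring_scheme \<Rightarrow> ('a, 'b, 'm) module_scheme \<Rightarrow> (nat \<Rightarrow> ('a, 'f, 'n) module_scheme)
      \<Rightarrow> (nat \<Rightarrow> 'f \<Rightarrow> 'f) \<Rightarrow> ('f \<Rightarrow> 'b) \<Rightarrow> bool"
  where "proj_resolution R M P d e \<longleftrightarrow>
     (\<forall>i. projective R (P i)) \<and>
     (\<forall>i. d i \<in> mod_hom R (P (Suc i)) (P i)) \<and>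
     e \<in> mod_hom R (P 0) M \<and>
     e ` carrier (P 0) = carrier M \<and>
     d 0 ` carrier (P (Suc 0)) = a_kernel (P 0) M e \<and>
     (\<forall>i. d (Suc i) ` carrier (P (Suc (Suc i))) = a_kernel (P (Suc i)) (P i) (d i))"

text \<open>A type large enough to hold projective resolutions of all modules on a type \<open>'b\<close> over rings on
  a type \<open>'a\<close>.  The generators \<open>Gen m\<close> serve for a free module covering \<open>M\<close>.  As \<open>Lin\<close> embeds
  finite formal linear combinations of generators into the generators, every submodule of a free
  module on such generators is again covered by a free module on such generators.  The same holds
  for resolutions of minimal length: if a syzygy is projective, it can itself be taken as the last
  term.\<close>

datatype ('a, 'b) generator = Gen 'b | Lin "('a \<times> ('a, 'b) generator) list"

type_synonym ('a, 'b) res_elt = "('a, 'b) generator \<Rightarrow> 'a"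

definition proj_dim :: "('a, 'r) ring_scheme \<Rightarrow> ('a, 'b, 'm) module_scheme \<Rightarrow> enat" where
  "proj_dim R M = Inf {enat n | n.
     \<exists>(P :: nat \<Rightarrow> ('a, ('a, 'b) res_elt) module) d e.
       proj_resolution R M P d e \<and> (\<forall>i>n. zero_module (P i))}"

definition chosen_res ::
    "('a, 'r) ring_scheme \<Rightarrow> ('a, 'b, 'm) module_scheme
      \<Rightarrow> (nat \<Rightarrow> ('a, ('a, 'b) res_elt) module)
        \<times> (nat \<Rightarrow> ('a, 'b) res_elt \<Rightarrow> ('a, 'b) res_elt) \<times> (('a, 'b) res_elt \<Rightarrow> 'b)"
  where "chosen_res R M = (SOME (P, d, e). proj_resolution R M P d e)"

definition res_mod ::
    "('a, 'r) ring_scheme \<Rightarrow> ('a, 'b, 'm) module_scheme \<Rightarrow> nat \<Rightarrow> ('a, ('a, 'b) res_elt) module"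
  where "res_mod R M = fst (chosen_res R M)"

definition res_diff ::
    "('a, 'r) ring_scheme \<Rightarrow> ('a, 'b, 'm) module_scheme
      \<Rightarrow> nat \<Rightarrow> ('a, 'b) res_elt \<Rightarrow> ('a, 'b) res_elt"
  where "res_diff R M = fst (snd (chosen_res R M))"

definition res_aug ::
    "('a, 'r) ring_scheme \<Rightarrow> ('a, 'b, 'm) module_scheme \<Rightarrow> ('a, 'b) res_elt \<Rightarrow> 'b"
  where "res_aug R M = snd (snd (chosen_res R M))"


section \<open>Ext\<close>

definition ext_cocycles ::
    "('a, 'r) ring_scheme \<Rightarrow> nat \<Rightarrow> ('a, 'b, 'm) module_scheme \<Rightarrow> ('a, 'c, 'n) module_scheme
      \<Rightarrow> (('a, 'b) res_elt \<Rightarrow> 'c) set"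
  where "ext_cocycles R i M N =
    {h \<in> mod_hom R (res_mod R M i) N.
       \<forall>x\<in>carrier (res_mod R M (Suc i)). h (res_diff R M i x) = \<zero>\<^bsub>N\<^esub>}"

definition ext_coboundaries ::
    "('a, 'r) ring_scheme \<Rightarrow> nat \<Rightarrow> ('a, 'b, 'm) module_scheme \<Rightarrow> ('a, 'c, 'n) module_scheme
      \<Rightarrow> (('a, 'b) res_elt \<Rightarrow> 'c) set"
  where "ext_coboundaries R i M N =
    (case i of
       0 \<Rightarrow> {\<zero>\<^bsub>hom_module R (res_mod R M 0) N\<^esub>}
     | Suc j \<Rightarrow> (\<lambda>\<psi>. compose (carrier (res_mod R M (Suc j))) \<psi> (res_diff R M j))
                 ` mod_hom R (res_mod R M j) N)"

definition Ext ::
    "('a, 'r) ring_scheme \<Rightarrow> nat \<Rightarrow> ('a, 'b, 'm) module_scheme \<Rightarrow> ('a, 'c, 'n) module_scheme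
      \<Rightarrow> ('a, (('a, 'b) res_elt \<Rightarrow> 'c) set) module"
  where "Ext R i M N =
    mod_quot ((hom_module R (res_mod R M i) N)\<lparr>carrier := ext_cocycles R i M N\<rparr>)
      (ext_coboundaries R i M N)"

definition chain_lift ::
    "('a, 'r) ring_scheme \<Rightarrow> ('a, 'b, 'm) module_scheme \<Rightarrow> ('a, 'c, 'n) module_scheme \<Rightarrow> ('b \<Rightarrow> 'c)
      \<Rightarrow> (nat \<Rightarrow> ('a, 'b) res_elt \<Rightarrow> ('a, 'c) res_elt) \<Rightarrow> bool"
  where "chain_lift R M M' f g \<longleftrightarrow>
     (\<forall>i. g i \<in> mod_hom R (res_mod R M i) (res_mod R M' i)) \<and>
     (\<forall>x\<in>carrier (res_mod R M 0). res_aug R M' (g 0 x) = f (res_aug R M x)) \<and>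
     (\<forall>i. \<forall>x\<in>carrier (res_mod R M (Suc i)).
        res_diff R M' i (g (Suc i) x) = g i (res_diff R M i x))"

text \<open>The map \<open>Ext i f N : Ext i M' N \<rightarrow> Ext i M N\<close> induced by \<open>f : M \<rightarrow> M'\<close>, sending the class of
  \<open>h\<close> to the class of \<open>h \<circ> g i\<close> for a chain map \<open>g\<close> lifting \<open>f\<close>.  The union below is one of equal
  cosets.\<close>

definition ext_map ::
    "('a, 'r) ring_scheme \<Rightarrow> nat \<Rightarrow> ('a, 'b, 'm) module_scheme \<Rightarrow> ('a, 'c, 'k) module_scheme
      \<Rightarrow> ('a, 'd, 'n) module_scheme \<Rightarrow> ('b \<Rightarrow> 'c)
      \<Rightarrow> (('a, 'c) res_elt \<Rightarrow> 'd) set \<Rightarrow> (('a, 'b) res_elt \<Rightarrow> 'd) set"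
  where "ext_map R i M M' N f =
    (let g = (SOME g. chain_lift R M M' f g)
     in (\<lambda>c\<in>carrier (Ext R i M' N). \<Union>h\<in>c.
          ext_coboundaries R i M N +>\<^bsub>hom_module R (res_mod R M i) N\<^esub>
            compose (carrier (res_mod R M i)) h (g i)))"


section \<open>Generalized local cohomology\<close>

text \<open>The power \<open>\<aa>\<^sup>n\<close> is taken in the semiring of ideals; in particular \<open>\<aa>\<^sup>0 = R\<close>.\<close>

definition ideal_power_smult ::
    "('a, 'r) ring_scheme \<Rightarrow> 'a set \<Rightarrow> nat \<Rightarrow> ('a, 'b, 'm) module_scheme \<Rightarrow> 'b set"
  where "ideal_power_smult R \<aa> n M = ideal_smult R (\<aa> [^]\<^bsub>ideals_set R\<^esub> n) M"

definition adic_quot ::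
    "('a, 'r) ring_scheme \<Rightarrow> 'a set \<Rightarrow> ('a, 'b, 'm) module_scheme \<Rightarrow> nat \<Rightarrow> ('a, 'b set) module"
  where "adic_quot R \<aa> M n = mod_quot M (ideal_power_smult R \<aa> n M)"

definition adic_proj ::
    "('a, 'r) ring_scheme \<Rightarrow> 'a set \<Rightarrow> ('a, 'b, 'm) module_scheme \<Rightarrow> nat \<Rightarrow> 'b set \<Rightarrow> 'b set"
  where "adic_proj R \<aa> M n =
    (\<lambda>X\<in>carrier (adic_quot R \<aa> M (Suc n)). \<Union>x\<in>X. ideal_power_smult R \<aa> n M +>\<^bsub>M\<^esub> x)"

definition gen_local_cohomology ::
    "('a, 'r) ring_scheme \<Rightarrow> 'a set \<Rightarrow> nat \<Rightarrow> ('a, 'b, 'm) module_scheme \<Rightarrow> ('a, 'c, 'n) module_scheme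
      \<Rightarrow> ('a, (nat \<Rightarrow> (('a, 'b set) res_elt \<Rightarrow> 'c) set) set) module"
  where "gen_local_cohomology R \<aa> i M N =
    direct_limit R (\<lambda>n. Ext R i (adic_quot R \<aa> M n) N)
      (\<lambda>n. ext_map R i (adic_quot R \<aa> M (Suc n)) (adic_quot R \<aa> M n) N (adic_proj R \<aa> M n))"

definition local_cohomology ::
    "('a, 'r) ring_scheme \<Rightarrow> 'a set \<Rightarrow> nat \<Rightarrow> ('a, 'c, 'n) module_scheme
      \<Rightarrow> ('a, (nat \<Rightarrow> (('a, 'a set) res_elt \<Rightarrow> 'c) set) set) module"
  where "local_cohomology R \<aa> i N = gen_local_cohomology R \<aa> i (ring_module R) N"

text \<open>With values in \<^typ>\<open>ereal\<close>, so that the supremum of the empty set is \<open>-\<infinity>\<close>.\<close>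

definition coh_dim :: "('a, 'r) ring_scheme \<Rightarrow> 'a set \<Rightarrow> ('a, 'c, 'n) module_scheme \<Rightarrow> ereal" where
  "coh_dim R \<aa> N = (SUP i\<in>{i. \<not> zero_module (local_cohomology R \<aa> i N)}. ereal (real i))"

end

(* Let F be a minimal free resolution of M, so that F_i = 0 for i > p, and let Q_m be a projective resolution of
   R/a^m.  By Artin-Rees the homology of F (x) R/a^m in positive degrees is pro-zero in m, so the total complexes
   Tot (F (x) Q_m) resolve the modules M/a^m M up to transition maps, and such a pro-resolution is as good as
   resolutions of the individual modules: H^k_a(M,N) is the colimit over m of H^k Hom (Tot (F (x) Q_m), N).  Its
   i-th column computes Hom (F_i, H^j_a(N)), which vanishes for j > n.  Hence a cocycle of degree k can be
   modified, after passing to a larger m, by a coboundary so as to vanish on all columns i with k - i > n.  For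
   k > p + n no column remains.  For k = p + n only column p remains, and the classes it carries modulo those coming
   from column p - 1 form the cokernel of Hom (F_(p-1), H) -> Hom (F_p, H) with H = H^n_a(N).  This is Ext^p(M,H),
   and it is Ext^p(M,R) (x) H because Hom (F_i, H) = Hom (F_i, R) (x) H for the finite free modules F_i. *)

theory Submission
  imports Defs
begin

section \<open>Modules over a commutative ring: linear maps, submodules, quotients and spans\<close>

section \<open>Linear maps\<close>

text \<open>The obstacle is that F (x) R/a^m has homology Tor_i(M, R/a^m), which need not vanish for
  a fixed m. Only the transition maps kill it, after a shift of the index that depends on the
  degree. Hence complexes are compared up to a finite degree and up to a shift, and cohomology
  modules enter through the relation \<open>presents\<close>, which records what a colimit of
  cohomology remembers: classes, when a class is zero, and that every element is a class at some
  index. One comparison theorem, \<open>presents_transfer\<close>, then serves three purposes: it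
  replaces the chosen resolutions of M/a^m M by the total complexes, it replaces the chosen
  resolution of M by F in Ext, and it shows that F stops at p. The last point is where locality
  enters: Ext^(p+1) of M into the image of F_(p+1) in F_p vanishes, so this image is a retract of
  F_p, while minimality puts it into the maximal ideal times F_p; Nakayama's lemma makes it
  zero.\<close>

definition lin ::
    "('a, 'r) ring_scheme \<Rightarrow> ('a, 'b, 'm) module_scheme \<Rightarrow> ('a, 'c, 'n) module_scheme \<Rightarrow> ('b \<Rightarrow> 'c) \<Rightarrow> bool"
  where "lin R M N f \<longleftrightarrow> (\<forall>x\<in>carrier M. f x \<in> carrier N) \<and>
     (\<forall>x\<in>carrier M. \<forall>y\<in>carrier M. f (x \<oplus>\<^bsub>M\<^esub> y) = f x \<oplus>\<^bsub>N\<^esub> f y) \<and>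
     (\<forall>a\<in>carrier R. \<forall>x\<in>carrier M. f (a \<odot>\<^bsub>M\<^esub> x) = a \<odot>\<^bsub>N\<^esub> f x)"

lemma linI:
  assumes "\<And>x. x \<in> carrier M \<Longrightarrow> f x \<in> carrier N"
    and "\<And>x y. x \<in> carrier M \<Longrightarrow> y \<in> carrier M \<Longrightarrow> f (x \<oplus>\<^bsub>M\<^esub> y) = f x \<oplus>\<^bsub>N\<^esub> f y"
    and "\<And>a x. a \<in> carrier R \<Longrightarrow> x \<in> carrier M \<Longrightarrow> f (a \<odot>\<^bsub>M\<^esub> x) = a \<odot>\<^bsub>N\<^esub> f x"
  shows "lin R M N f"
  using assms by (auto simp: lin_def)

text \<open>\<open>lin\<close> leaves the values off the carrier free, so composites and sums of
  linear maps can be written as plain lambda terms. The normalised homomorphisms of the statement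
  are recovered by restriction.\<close>

lemma mod_hom_iff_lin: "f \<in> mod_hom R M N \<longleftrightarrow> lin R M N f \<and> f \<in> extensional (carrier M)"
  by (auto simp: mod_hom_def lin_def PiE_def)

lemma mod_hom_lin: "f \<in> mod_hom R M N \<Longrightarrow> lin R M N f"
  by (simp add: mod_hom_iff_lin)

lemma lin_comp: "lin R M N f \<Longrightarrow> lin R N K g \<Longrightarrow> lin R M K (\<lambda>x. g (f x))"
  by (auto simp: lin_def)

lemma lin_id: "lin R M M (\<lambda>x. x)"
  by (auto simp: lin_def)

text \<open>Only the ring is fixed; the modules stay variables, because one argument involves
  modules on many carrier types. The rules below restate the module laws with
  \<open>module R M\<close> as a premise, so that the simplifier can apply them to every module at
  hand.\<close>

locale modules = R?: cring R for R (structure)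

context modules
begin

context
  fixes M :: "('a, 'x, 'm) module_scheme"
  assumes M: "module R M"
begin

interpretation M: module R M by (rule M)

lemma mm_add [simp]: "x \<in> carrier M \<Longrightarrow> y \<in> carrier M \<Longrightarrow> x \<oplus>\<^bsub>M\<^esub> y \<in> carrier M"
  by simp

lemma mm_zero [simp]: "\<zero>\<^bsub>M\<^esub> \<in> carrier M"
  by simp

lemma mm_neg [simp]: "x \<in> carrier M \<Longrightarrow> \<ominus>\<^bsub>M\<^esub> x \<in> carrier M"
  by simp

lemma mm_minus [simp]: "x \<in> carrier M \<Longrightarrow> y \<in> carrier M \<Longrightarrow> x \<ominus>\<^bsub>M\<^esub> y \<in> carrier M"
  by simp

lemma mm_smult [simp]: "a \<in> carrier R \<Longrightarrow> x \<in> carrier M \<Longrightarrow> a \<odot>\<^bsub>M\<^esub> x \<in> carrier M"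
  by simp

lemma mm_l_zero [simp]: "x \<in> carrier M \<Longrightarrow> \<zero>\<^bsub>M\<^esub> \<oplus>\<^bsub>M\<^esub> x = x"
  by simp

lemma mm_r_zero [simp]: "x \<in> carrier M \<Longrightarrow> x \<oplus>\<^bsub>M\<^esub> \<zero>\<^bsub>M\<^esub> = x"
  by simp

lemma mm_l_neg [simp]: "x \<in> carrier M \<Longrightarrow> \<ominus>\<^bsub>M\<^esub> x \<oplus>\<^bsub>M\<^esub> x = \<zero>\<^bsub>M\<^esub>"
  by (simp add: M.M.l_neg)

lemma mm_r_neg [simp]: "x \<in> carrier M \<Longrightarrow> x \<oplus>\<^bsub>M\<^esub> \<ominus>\<^bsub>M\<^esub> x = \<zero>\<^bsub>M\<^esub>"
  by (simp add: M.M.r_neg)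

lemma mm_minus_self [simp]: "x \<in> carrier M \<Longrightarrow> x \<ominus>\<^bsub>M\<^esub> x = \<zero>\<^bsub>M\<^esub>"
  by (simp add: M.M.r_neg a_minus_def)

lemma mm_minus_zero [simp]: "x \<in> carrier M \<Longrightarrow> x \<ominus>\<^bsub>M\<^esub> \<zero>\<^bsub>M\<^esub> = x"
  by (simp add: a_minus_def)

lemma mm_neg_zero [simp]: "\<ominus>\<^bsub>M\<^esub> \<zero>\<^bsub>M\<^esub> = \<zero>\<^bsub>M\<^esub>"
  by simp

lemma mm_neg_neg [simp]: "x \<in> carrier M \<Longrightarrow> \<ominus>\<^bsub>M\<^esub> (\<ominus>\<^bsub>M\<^esub> x) = x"
  by simp

lemma mm_smult_zero [simp]: "a \<in> carrier R \<Longrightarrow> a \<odot>\<^bsub>M\<^esub> \<zero>\<^bsub>M\<^esub> = \<zero>\<^bsub>M\<^esub>"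
  by simp

lemma mm_zero_smult [simp]: "x \<in> carrier M \<Longrightarrow> \<zero> \<odot>\<^bsub>M\<^esub> x = \<zero>\<^bsub>M\<^esub>"
  by simp

lemma mm_one_smult [simp]: "x \<in> carrier M \<Longrightarrow> \<one> \<odot>\<^bsub>M\<^esub> x = x"
  by simp

lemma mm_smult_neg: "a \<in> carrier R \<Longrightarrow> x \<in> carrier M \<Longrightarrow> a \<odot>\<^bsub>M\<^esub> (\<ominus>\<^bsub>M\<^esub> x) = \<ominus>\<^bsub>M\<^esub> (a \<odot>\<^bsub>M\<^esub> x)"
  by (simp add: M.smult_r_minus)

lemma mm_smult_add: "a \<in> carrier R \<Longrightarrow> x \<in> carrier M \<Longrightarrow> y \<in> carrier M \<Longrightarrow>
    a \<odot>\<^bsub>M\<^esub> (x \<oplus>\<^bsub>M\<^esub> y) = a \<odot>\<^bsub>M\<^esub> x \<oplus>\<^bsub>M\<^esub> a \<odot>\<^bsub>M\<^esub> y"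
  by (simp add: M.smult_r_distr)

lemma mm_add_smult: "a \<in> carrier R \<Longrightarrow> b \<in> carrier R \<Longrightarrow> x \<in> carrier M \<Longrightarrow>
    (a \<oplus> b) \<odot>\<^bsub>M\<^esub> x = a \<odot>\<^bsub>M\<^esub> x \<oplus>\<^bsub>M\<^esub> b \<odot>\<^bsub>M\<^esub> x"
  by (simp add: M.smult_l_distr)

lemma mm_smult_smult: "a \<in> carrier R \<Longrightarrow> b \<in> carrier R \<Longrightarrow> x \<in> carrier M \<Longrightarrow>
    (a \<otimes> b) \<odot>\<^bsub>M\<^esub> x = a \<odot>\<^bsub>M\<^esub> (b \<odot>\<^bsub>M\<^esub> x)"
  by (simp add: M.smult_assoc1)

lemma mm_assoc: "x \<in> carrier M \<Longrightarrow> y \<in> carrier M \<Longrightarrow> z \<in> carrier M \<Longrightarrow>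
    (x \<oplus>\<^bsub>M\<^esub> y) \<oplus>\<^bsub>M\<^esub> z = x \<oplus>\<^bsub>M\<^esub> (y \<oplus>\<^bsub>M\<^esub> z)"
  by (simp add: M.M.a_assoc)

lemma mm_comm: "x \<in> carrier M \<Longrightarrow> y \<in> carrier M \<Longrightarrow> x \<oplus>\<^bsub>M\<^esub> y = y \<oplus>\<^bsub>M\<^esub> x"
  by (simp add: M.M.a_comm)

lemma mm_lcomm: "x \<in> carrier M \<Longrightarrow> y \<in> carrier M \<Longrightarrow> z \<in> carrier M \<Longrightarrow>
    x \<oplus>\<^bsub>M\<^esub> (y \<oplus>\<^bsub>M\<^esub> z) = y \<oplus>\<^bsub>M\<^esub> (x \<oplus>\<^bsub>M\<^esub> z)"
  by (simp add: M.M.a_lcomm)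

lemma mm_neg_add: "x \<in> carrier M \<Longrightarrow> y \<in> carrier M \<Longrightarrow> \<ominus>\<^bsub>M\<^esub> (x \<oplus>\<^bsub>M\<^esub> y) = \<ominus>\<^bsub>M\<^esub> x \<oplus>\<^bsub>M\<^esub> \<ominus>\<^bsub>M\<^esub> y"
  by (simp add: M.M.minus_add)

lemma mm_cancel1 [simp]: "x \<in> carrier M \<Longrightarrow> y \<in> carrier M \<Longrightarrow> x \<oplus>\<^bsub>M\<^esub> (\<ominus>\<^bsub>M\<^esub> x \<oplus>\<^bsub>M\<^esub> y) = y"
  by (simp add: M.M.r_neg2 M.M.r_neg1)

lemma mm_cancel2 [simp]: "x \<in> carrier M \<Longrightarrow> y \<in> carrier M \<Longrightarrow> \<ominus>\<^bsub>M\<^esub> x \<oplus>\<^bsub>M\<^esub> (x \<oplus>\<^bsub>M\<^esub> y) = y"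
  by (simp add: M.M.r_neg2 M.M.r_neg1)

lemma mm_minus_eq_zero: "x \<in> carrier M \<Longrightarrow> y \<in> carrier M \<Longrightarrow> x \<ominus>\<^bsub>M\<^esub> y = \<zero>\<^bsub>M\<^esub> \<longleftrightarrow> x = y"
  by (metis M.M.add.inv_solve_right' M.M.l_zero M.M.zero_closed a_minus_def)

lemma mm_minus_add_cancel [simp]: "x \<in> carrier M \<Longrightarrow> y \<in> carrier M \<Longrightarrow> (x \<ominus>\<^bsub>M\<^esub> y) \<oplus>\<^bsub>M\<^esub> y = x"
  by (simp add: a_minus_def M.M.a_assoc M.M.l_neg)

lemma mm_neg_one: "x \<in> carrier M \<Longrightarrow> (\<ominus> \<one>) \<odot>\<^bsub>M\<^esub> x = \<ominus>\<^bsub>M\<^esub> x"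
  by (simp add: M.smult_l_minus)

end

lemmas mm_ac = mm_assoc mm_comm mm_lcomm

lemma mm_minus_minus:
  assumes "module R M" "x \<in> carrier M" "y \<in> carrier M"
  shows "x \<ominus>\<^bsub>M\<^esub> (x \<ominus>\<^bsub>M\<^esub> y) = y"
    "\<ominus>\<^bsub>M\<^esub> (x \<ominus>\<^bsub>M\<^esub> y) = y \<ominus>\<^bsub>M\<^esub> x" "x \<ominus>\<^bsub>M\<^esub> \<ominus>\<^bsub>M\<^esub> y = x \<oplus>\<^bsub>M\<^esub> y"
  using assms by (simp_all add: a_minus_def mm_neg_add mm_comm[of M x "\<ominus>\<^bsub>M\<^esub> y"] mm_comm[of M "\<ominus>\<^bsub>M\<^esub> x" y]
      mm_lcomm[of M x y "\<ominus>\<^bsub>M\<^esub> x"])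

text \<open>Additive inverses are supplied by the scalar -1, so the existence of inverses reduces to
  closure under scalars and to \<open>inv\<close>.\<close>

lemma mk_module:
  fixes M (structure)
  assumes "\<And>x y. x \<in> carrier M \<Longrightarrow> y \<in> carrier M \<Longrightarrow> x \<oplus>\<^bsub>M\<^esub> y \<in> carrier M"
    and "\<zero>\<^bsub>M\<^esub> \<in> carrier M"
    and "\<And>x y z. x \<in> carrier M \<Longrightarrow> y \<in> carrier M \<Longrightarrow> z \<in> carrier M \<Longrightarrow>
      (x \<oplus>\<^bsub>M\<^esub> y) \<oplus>\<^bsub>M\<^esub> z = x \<oplus>\<^bsub>M\<^esub> (y \<oplus>\<^bsub>M\<^esub> z)"
    and "\<And>x y. x \<in> carrier M \<Longrightarrow> y \<in> carrier M \<Longrightarrow> x \<oplus>\<^bsub>M\<^esub> y = y \<oplus>\<^bsub>M\<^esub> x"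
    and "\<And>x. x \<in> carrier M \<Longrightarrow> \<zero>\<^bsub>M\<^esub> \<oplus>\<^bsub>M\<^esub> x = x"
    and sm: "\<And>a x. a \<in> carrier R \<Longrightarrow> x \<in> carrier M \<Longrightarrow> a \<odot>\<^bsub>M\<^esub> x \<in> carrier M"
    and inv: "\<And>x. x \<in> carrier M \<Longrightarrow> ((\<ominus>\<^bsub>R\<^esub> \<one>\<^bsub>R\<^esub>) \<odot>\<^bsub>M\<^esub> x) \<oplus>\<^bsub>M\<^esub> x = \<zero>\<^bsub>M\<^esub>"
    and "\<And>a b x. \<lbrakk>a \<in> carrier R; b \<in> carrier R; x \<in> carrier M\<rbrakk> \<Longrightarrow>
      (a \<oplus>\<^bsub>R\<^esub> b) \<odot>\<^bsub>M\<^esub> x = (a \<odot>\<^bsub>M\<^esub> x) \<oplus>\<^bsub>M\<^esub> (b \<odot>\<^bsub>M\<^esub> x)"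
    and "\<And>a x y. \<lbrakk>a \<in> carrier R; x \<in> carrier M; y \<in> carrier M\<rbrakk> \<Longrightarrow>
      a \<odot>\<^bsub>M\<^esub> (x \<oplus>\<^bsub>M\<^esub> y) = (a \<odot>\<^bsub>M\<^esub> x) \<oplus>\<^bsub>M\<^esub> (a \<odot>\<^bsub>M\<^esub> y)"
    and "\<And>a b x. \<lbrakk>a \<in> carrier R; b \<in> carrier R; x \<in> carrier M\<rbrakk> \<Longrightarrow>
      (a \<otimes>\<^bsub>R\<^esub> b) \<odot>\<^bsub>M\<^esub> x = a \<odot>\<^bsub>M\<^esub> (b \<odot>\<^bsub>M\<^esub> x)"
    and "\<And>x. x \<in> carrier M \<Longrightarrow> \<one>\<^bsub>R\<^esub> \<odot>\<^bsub>M\<^esub> x = x"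
  shows "module R M"
proof (rule moduleI)
  show "cring R" by (rule is_cring)
  show "abelian_group M"
  proof (rule abelian_groupI)
    show "\<exists>y\<in>carrier M. y \<oplus>\<^bsub>M\<^esub> x = \<zero>\<^bsub>M\<^esub>" if "x \<in> carrier M" for x
      using inv[OF that] sm[OF _ that] R.a_inv_closed[OF R.one_closed] by blast
  qed (use assms in blast)+
qed (use assms in auto)

lemma lin_rules:
  assumes "lin R M N f"
  shows "x \<in> carrier M \<Longrightarrow> f x \<in> carrier N"
    and "x \<in> carrier M \<Longrightarrow> y \<in> carrier M \<Longrightarrow> f (x \<oplus>\<^bsub>M\<^esub> y) = f x \<oplus>\<^bsub>N\<^esub> f y"
    and "a \<in> carrier R \<Longrightarrow> x \<in> carrier M \<Longrightarrow> f (a \<odot>\<^bsub>M\<^esub> x) = a \<odot>\<^bsub>N\<^esub> f x"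
    and "module R M \<Longrightarrow> module R N \<Longrightarrow> f \<zero>\<^bsub>M\<^esub> = \<zero>\<^bsub>N\<^esub>"
    and "module R M \<Longrightarrow> module R N \<Longrightarrow> x \<in> carrier M \<Longrightarrow> f (\<ominus>\<^bsub>M\<^esub> x) = \<ominus>\<^bsub>N\<^esub> f x"
    and "module R M \<Longrightarrow> module R N \<Longrightarrow> x \<in> carrier M \<Longrightarrow> y \<in> carrier M \<Longrightarrow>
      f (x \<ominus>\<^bsub>M\<^esub> y) = f x \<ominus>\<^bsub>N\<^esub> f y"
proof -
  show c: "f x \<in> carrier N" if "x \<in> carrier M" for x using assms that by (simp add: lin_def)
  show ad: "f (x \<oplus>\<^bsub>M\<^esub> y) = f x \<oplus>\<^bsub>N\<^esub> f y" if "x \<in> carrier M" "y \<in> carrier M" for x y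
    using assms that by (simp add: lin_def)
  show s: "f (a \<odot>\<^bsub>M\<^esub> x) = a \<odot>\<^bsub>N\<^esub> f x" if "a \<in> carrier R" "x \<in> carrier M" for a x
    using assms that by (simp add: lin_def)
  show "f \<zero>\<^bsub>M\<^esub> = \<zero>\<^bsub>N\<^esub>" if "module R M" "module R N"
    using s[of \<zero> "\<zero>\<^bsub>M\<^esub>"] that c by simp
  show n: "f (\<ominus>\<^bsub>M\<^esub> x) = \<ominus>\<^bsub>N\<^esub> f x" if "module R M" "module R N" "x \<in> carrier M" for x
    using s[of "\<ominus> \<one>" x] that c by (simp add: mm_neg_one)
  show "f (x \<ominus>\<^bsub>M\<^esub> y) = f x \<ominus>\<^bsub>N\<^esub> f y"
    if "module R M" "module R N" "x \<in> carrier M" "y \<in> carrier M"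
    using that ad n by (simp add: a_minus_def)
qed

lemma lin_restrict: "module R M \<Longrightarrow> lin R M N f \<Longrightarrow> restrict f (carrier M) \<in> mod_hom R M N"
  by (auto simp: mod_hom_iff_lin lin_def)

lemma lin_cong: "module R M \<Longrightarrow> (\<And>x. x \<in> carrier M \<Longrightarrow> f x = g x) \<Longrightarrow> lin R M N f \<longleftrightarrow> lin R M N g"
  by (auto simp: lin_def)

lemma lin_zero: "module R N \<Longrightarrow> lin R M N (\<lambda>_. \<zero>\<^bsub>N\<^esub>)"
  by (auto simp: lin_def)

lemma lin_add:
  assumes "module R N" "lin R M N f" "lin R M N g"
  shows "lin R M N (\<lambda>x. f x \<oplus>\<^bsub>N\<^esub> g x)"
  using assms by (auto simp: lin_def mm_smult_add mm_ac)

lemma lin_smult: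
  assumes "module R N" "lin R M N f" "a \<in> carrier R"
  shows "lin R M N (\<lambda>x. a \<odot>\<^bsub>N\<^esub> f x)"
  using assms by (auto simp: lin_def mm_smult_add mm_smult_smult[symmetric] R.m_comm)

lemma lin_neg:
  assumes "module R N" "lin R M N f"
  shows "lin R M N (\<lambda>x. \<ominus>\<^bsub>N\<^esub> f x)"
  using assms by (auto simp: lin_def mm_neg_add mm_smult_neg)

lemma lin_minus:
  assumes "module R N" "lin R M N f" "lin R M N g"
  shows "lin R M N (\<lambda>x. f x \<ominus>\<^bsub>N\<^esub> g x)"
  unfolding a_minus_def by (intro lin_add lin_neg assms)

lemma lin_smult_elt: "module R N \<Longrightarrow> x \<in> carrier N \<Longrightarrow> lin R (ring_module R) N (\<lambda>a. a \<odot>\<^bsub>N\<^esub> x)"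
  by (auto simp: lin_def ring_module_def mm_add_smult mm_smult_smult)

lemma ring_module_simps [simp]:
  "carrier (ring_module R) = carrier R" "\<zero>\<^bsub>ring_module R\<^esub> = \<zero>"
  "x \<oplus>\<^bsub>ring_module R\<^esub> y = x \<oplus> y" "x \<odot>\<^bsub>ring_module R\<^esub> y = x \<otimes> y"
  by (simp_all add: ring_module_def)

lemma ring_module_module [simp]: "module R (ring_module R)"
  by (rule mk_module) (auto simp: R.m_assoc R.a_assoc R.a_comm R.a_lcomm R.l_distr R.r_distr R.l_minus R.l_neg R.r_neg)

lemma hom_module_module:
  assumes "module R M" "module R N"
  shows "module R (hom_module R M N)"
proof -
  have neg: "a \<in> carrier N \<Longrightarrow> (\<ominus>\<^bsub>R\<^esub> \<one>\<^bsub>R\<^esub>) \<odot>\<^bsub>N\<^esub> a \<oplus>\<^bsub>N\<^esub> a = \<zero>\<^bsub>N\<^esub>" for a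
    using assms by (simp add: mm_neg_one)
  show ?thesis
    by (rule mk_module)
      (use assms neg in \<open>auto simp: hom_module_def mod_hom_iff_lin lin_def extensional_def restrict_def
        mm_smult_add mm_add_smult mm_ac mm_smult_smult[symmetric] R.m_comm fun_eq_iff\<close>)
qed

lemma submodule_iff:
  assumes "module R M"
  shows "submodule H R M \<longleftrightarrow> H \<subseteq> carrier M \<and> \<zero>\<^bsub>M\<^esub> \<in> H \<and> (\<forall>x\<in>H. \<forall>y\<in>H. x \<oplus>\<^bsub>M\<^esub> y \<in> H) \<and>
    (\<forall>a\<in>carrier R. \<forall>x\<in>H. a \<odot>\<^bsub>M\<^esub> x \<in> H)"
proof -
  interpret M: module R M by fact
  show ?thesis
  proof
    assume H: "submodule H R M"
    then obtain x where "x \<in> H" using M.submoduleE(2) by blast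
    then have "\<zero> \<odot>\<^bsub>M\<^esub> x \<in> H" "x \<in> carrier M" using M.submoduleE(1,4)[OF H] by auto
    then show "H \<subseteq> carrier M \<and> \<zero>\<^bsub>M\<^esub> \<in> H \<and> (\<forall>x\<in>H. \<forall>y\<in>H. x \<oplus>\<^bsub>M\<^esub> y \<in> H) \<and>
      (\<forall>a\<in>carrier R. \<forall>x\<in>H. a \<odot>\<^bsub>M\<^esub> x \<in> H)"
      using M.submoduleE[OF H] by auto
  next
    assume *: "H \<subseteq> carrier M \<and> \<zero>\<^bsub>M\<^esub> \<in> H \<and> (\<forall>x\<in>H. \<forall>y\<in>H. x \<oplus>\<^bsub>M\<^esub> y \<in> H) \<and>
      (\<forall>a\<in>carrier R. \<forall>x\<in>H. a \<odot>\<^bsub>M\<^esub> x \<in> H)"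
    have "\<ominus>\<^bsub>M\<^esub> x \<in> H" if "x \<in> H" for x
      using * that mm_neg_one[OF assms, of x] R.a_inv_closed[OF R.one_closed] by (metis subsetD)
    then show "submodule H R M" using * by (intro M.submoduleI) auto
  qed
qed

lemma submodule_rules:
  assumes "submodule H R M" "module R M"
  shows "x \<in> H \<Longrightarrow> x \<in> carrier M" "\<zero>\<^bsub>M\<^esub> \<in> H"
    "x \<in> H \<Longrightarrow> y \<in> H \<Longrightarrow> x \<oplus>\<^bsub>M\<^esub> y \<in> H" "a \<in> carrier R \<Longrightarrow> x \<in> H \<Longrightarrow> a \<odot>\<^bsub>M\<^esub> x \<in> H"
    "x \<in> H \<Longrightarrow> \<ominus>\<^bsub>M\<^esub> x \<in> H" "x \<in> H \<Longrightarrow> y \<in> H \<Longrightarrow> x \<ominus>\<^bsub>M\<^esub> y \<in> H"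
proof -
  note * = assms(1)[unfolded submodule_iff[OF assms(2)]]
  show n: "\<ominus>\<^bsub>M\<^esub> x \<in> H" if "x \<in> H" for x
    using * that mm_neg_one[OF assms(2), of x] R.a_inv_closed[OF R.one_closed] by (metis subsetD)
  show "x \<in> H \<Longrightarrow> x \<in> carrier M" "\<zero>\<^bsub>M\<^esub> \<in> H"
    "x \<in> H \<Longrightarrow> y \<in> H \<Longrightarrow> x \<oplus>\<^bsub>M\<^esub> y \<in> H" "a \<in> carrier R \<Longrightarrow> x \<in> H \<Longrightarrow> a \<odot>\<^bsub>M\<^esub> x \<in> H"
    using * by auto
  show "x \<in> H \<Longrightarrow> y \<in> H \<Longrightarrow> x \<ominus>\<^bsub>M\<^esub> y \<in> H" using * n by (simp add: a_minus_def)
qed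

lemma lin_image_submodule:
  assumes "lin R M N f" "module R M" "module R N"
  shows "submodule (f ` carrier M) R N"
  unfolding submodule_iff[OF assms(3)]
proof (intro conjI ballI)
  show "f ` carrier M \<subseteq> carrier N" using lin_rules[OF assms(1)] by auto
  show "\<zero>\<^bsub>N\<^esub> \<in> f ` carrier M" using lin_rules(4)[OF assms(1)] assms by (metis imageI mm_zero)
  show "x \<oplus>\<^bsub>N\<^esub> y \<in> f ` carrier M" if "x \<in> f ` carrier M" "y \<in> f ` carrier M" for x y
    using that lin_rules(2)[OF assms(1)] assms by (auto intro!: image_eqI[OF sym])
  show "a \<odot>\<^bsub>N\<^esub> x \<in> f ` carrier M" if "a \<in> carrier R" "x \<in> f ` carrier M" for a x
    using that lin_rules(3)[OF assms(1)] assms by (auto intro!: image_eqI[OF sym])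
qed

lemma lin_kernel_submodule:
  assumes "lin R M N f" "module R M" "module R N"
  shows "submodule {x \<in> carrier M. f x = \<zero>\<^bsub>N\<^esub>} R M"
  unfolding submodule_iff[OF assms(2)] using lin_rules[OF assms(1)] assms by auto

lemma a_kernel_eq: "a_kernel M N f = {x \<in> carrier M. f x = \<zero>\<^bsub>N\<^esub>}"
  by (simp add: a_kernel_def kernel_def)

lemma submodule_module:
  assumes "submodule H R M" "module R M"
  shows "module R (M\<lparr>carrier := H\<rparr>)"
  using submodule.submodule_is_module[OF assms] .

text \<open>The pairs \<open>(f i, g i)\<close> form the graph of the isomorphism: a linear relation
  that is onto on both sides and in which zero is paired only with zero. The index set carries no
  module structure of its own, which matters when its elements are cocycles living at different
  stages of a colimit.\<close>

lemma mod_iso_rel: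
  assumes A: "module R A" and B: "module R B"
    and c: "\<And>i. i \<in> I \<Longrightarrow> f i \<in> carrier A" "\<And>i. i \<in> I \<Longrightarrow> g i \<in> carrier B"
    and add: "\<And>i j. i \<in> I \<Longrightarrow> j \<in> I \<Longrightarrow> \<exists>k\<in>I. f k = f i \<oplus>\<^bsub>A\<^esub> f j \<and> g k = g i \<oplus>\<^bsub>B\<^esub> g j"
    and sm: "\<And>a i. a \<in> carrier R \<Longrightarrow> i \<in> I \<Longrightarrow> \<exists>k\<in>I. f k = a \<odot>\<^bsub>A\<^esub> f i \<and> g k = a \<odot>\<^bsub>B\<^esub> g i"
    and sA: "\<And>x. x \<in> carrier A \<Longrightarrow> \<exists>i\<in>I. f i = x"
    and sB: "\<And>x. x \<in> carrier B \<Longrightarrow> \<exists>i\<in>I. g i = x"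
    and k: "\<And>i. i \<in> I \<Longrightarrow> f i = \<zero>\<^bsub>A\<^esub> \<longleftrightarrow> g i = \<zero>\<^bsub>B\<^esub>"
  shows "mod_iso R A B"
proof -
  \<comment> \<open>Agreement of values is reduced to \<open>k\<close> by passing to an index for
    the difference, formed with the scalar -1.\<close>
  have eq: "f i = f j \<longleftrightarrow> g i = g j" if i: "i \<in> I" and j: "j \<in> I" for i j
  proof -
    obtain j' where j': "j' \<in> I" "f j' = (\<ominus> \<one>) \<odot>\<^bsub>A\<^esub> f j" "g j' = (\<ominus> \<one>) \<odot>\<^bsub>B\<^esub> g j"
      using sm[of "\<ominus> \<one>" j] j by auto
    obtain l where l: "l \<in> I" "f l = f i \<oplus>\<^bsub>A\<^esub> f j'" "g l = g i \<oplus>\<^bsub>B\<^esub> g j'"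
      using add[OF i j'(1)] by auto
    have "f l = f i \<ominus>\<^bsub>A\<^esub> f j" "g l = g i \<ominus>\<^bsub>B\<^esub> g j"
      using l j' c i j A B by (simp_all add: mm_neg_one a_minus_def)
    then show ?thesis using k[OF l(1)] mm_minus_eq_zero[OF A] mm_minus_eq_zero[OF B] c i j by metis
  qed
  define F where "F = (\<lambda>x\<in>carrier A. g (SOME i. i \<in> I \<and> f i = x))"
  have F: "F (f i) = g i" if "i \<in> I" for i
  proof -
    have "(SOME j. j \<in> I \<and> f j = f i) \<in> I \<and> f (SOME j. j \<in> I \<and> f j = f i) = f i"
      using someI[of "\<lambda>j. j \<in> I \<and> f j = f i" i] that by simp
    then show ?thesis using that eq c by (auto simp: F_def)
  qed
  have "lin R A B F"
  proof (rule linI)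
    show "F x \<in> carrier B" if "x \<in> carrier A" for x using sA[OF that] F c by auto
    show "F (x \<oplus>\<^bsub>A\<^esub> y) = F x \<oplus>\<^bsub>B\<^esub> F y" if "x \<in> carrier A" "y \<in> carrier A" for x y
      using sA[OF that(1)] sA[OF that(2)] F add by metis
    show "F (a \<odot>\<^bsub>A\<^esub> x) = a \<odot>\<^bsub>B\<^esub> F x" if "a \<in> carrier R" "x \<in> carrier A" for a x
      using sA[OF that(2)] F sm[OF that(1)] by metis
  qed
  moreover have "F \<in> extensional (carrier A)" by (simp add: F_def)
  moreover have "bij_betw F (carrier A) (carrier B)"
  proof (rule bij_betwI')
    show "F x = F y \<longleftrightarrow> x = y" if "x \<in> carrier A" "y \<in> carrier A" for x y
      using sA[OF that(1)] sA[OF that(2)] F eq by metis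
    show "F x \<in> carrier B" if "x \<in> carrier A" for x using sA[OF that] F c by auto
    show "\<exists>x\<in>carrier A. y = F x" if "y \<in> carrier B" for y using sB[OF that] F c by metis
  qed
  ultimately show ?thesis by (auto simp: mod_iso_def mod_hom_iff_lin)
qed

subsection \<open>Quotients\<close>

lemma mem_coset: "z \<in> H +>\<^bsub>M\<^esub> x \<longleftrightarrow> (\<exists>h\<in>H. z = h \<oplus>\<^bsub>M\<^esub> x)"
  by (auto simp: a_r_coset_def')

lemma coset_eq_iff:
  assumes "submodule H R M" "module R M" "x \<in> carrier M" "y \<in> carrier M"
  shows "H +>\<^bsub>M\<^esub> x = H +>\<^bsub>M\<^esub> y \<longleftrightarrow> x \<ominus>\<^bsub>M\<^esub> y \<in> H"
proof
  note S = submodule_rules[OF assms(1,2)]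
  { assume "H +>\<^bsub>M\<^esub> x = H +>\<^bsub>M\<^esub> y"
    moreover have "x \<in> H +>\<^bsub>M\<^esub> x" using S assms by (auto simp: mem_coset intro!: bexI[of _ "\<zero>\<^bsub>M\<^esub>"])
    ultimately obtain h where "h \<in> H" "x = h \<oplus>\<^bsub>M\<^esub> y" by (auto simp: mem_coset)
    then show "x \<ominus>\<^bsub>M\<^esub> y \<in> H" using S assms by (simp add: a_minus_def mm_assoc) }
  { assume h: "x \<ominus>\<^bsub>M\<^esub> y \<in> H"
    show "H +>\<^bsub>M\<^esub> x = H +>\<^bsub>M\<^esub> y"
    proof (intro Set.set_eqI iffI)
      fix z assume "z \<in> H +>\<^bsub>M\<^esub> x"
      then obtain k where k: "k \<in> H" "z = k \<oplus>\<^bsub>M\<^esub> x" by (auto simp: mem_coset)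
      then have "z = (k \<oplus>\<^bsub>M\<^esub> (x \<ominus>\<^bsub>M\<^esub> y)) \<oplus>\<^bsub>M\<^esub> y" using assms h S by (simp add: mm_assoc)
      then show "z \<in> H +>\<^bsub>M\<^esub> y" using S k h by (auto simp: mem_coset)
    next
      fix z assume "z \<in> H +>\<^bsub>M\<^esub> y"
      then obtain k where k: "k \<in> H" "z = k \<oplus>\<^bsub>M\<^esub> y" by (auto simp: mem_coset)
      then have "z = (k \<ominus>\<^bsub>M\<^esub> (x \<ominus>\<^bsub>M\<^esub> y)) \<oplus>\<^bsub>M\<^esub> x"
        using assms h S by (simp add: mm_assoc mm_minus_minus(2) a_minus_def mm_neg_add mm_comm[of M y x])
      then show "z \<in> H +>\<^bsub>M\<^esub> x" using S k h by (auto simp: mem_coset)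
    qed }
qed

lemma quot_ops:
  assumes "submodule H R M" "module R M"
  shows "carrier (mod_quot M H) = (\<lambda>x. H +>\<^bsub>M\<^esub> x) ` carrier M"
    and "\<zero>\<^bsub>mod_quot M H\<^esub> = H +>\<^bsub>M\<^esub> \<zero>\<^bsub>M\<^esub>"
    and "x \<in> carrier M \<Longrightarrow> y \<in> carrier M \<Longrightarrow>
      (H +>\<^bsub>M\<^esub> x) \<oplus>\<^bsub>mod_quot M H\<^esub> (H +>\<^bsub>M\<^esub> y) = H +>\<^bsub>M\<^esub> (x \<oplus>\<^bsub>M\<^esub> y)"
    and "a \<in> carrier R \<Longrightarrow> x \<in> carrier M \<Longrightarrow> a \<odot>\<^bsub>mod_quot M H\<^esub> (H +>\<^bsub>M\<^esub> x) = H +>\<^bsub>M\<^esub> (a \<odot>\<^bsub>M\<^esub> x)"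
proof -
  note S = submodule_rules[OF assms]
  show "carrier (mod_quot M H) = (\<lambda>x. H +>\<^bsub>M\<^esub> x) ` carrier M"
    by (auto simp: mod_quot_def A_RCOSETS_def')
  show "\<zero>\<^bsub>mod_quot M H\<^esub> = H +>\<^bsub>M\<^esub> \<zero>\<^bsub>M\<^esub>"
    using S assms by (auto simp: mod_quot_def a_r_coset_def')
  show "(H +>\<^bsub>M\<^esub> x) \<oplus>\<^bsub>mod_quot M H\<^esub> (H +>\<^bsub>M\<^esub> y) = H +>\<^bsub>M\<^esub> (x \<oplus>\<^bsub>M\<^esub> y)"
    if "x \<in> carrier M" "y \<in> carrier M"
  proof (intro Set.set_eqI iffI)
    fix z assume "z \<in> (H +>\<^bsub>M\<^esub> x) \<oplus>\<^bsub>mod_quot M H\<^esub> (H +>\<^bsub>M\<^esub> y)"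
    then obtain h k where hk: "h \<in> H" "k \<in> H" "z = (h \<oplus>\<^bsub>M\<^esub> x) \<oplus>\<^bsub>M\<^esub> (k \<oplus>\<^bsub>M\<^esub> y)"
      by (auto simp: mod_quot_def set_add_def' mem_coset)
    then have "z = (h \<oplus>\<^bsub>M\<^esub> k) \<oplus>\<^bsub>M\<^esub> (x \<oplus>\<^bsub>M\<^esub> y)" using S assms that by (simp add: mm_ac)
    then show "z \<in> H +>\<^bsub>M\<^esub> (x \<oplus>\<^bsub>M\<^esub> y)" using hk S by (auto simp: mem_coset)
  next
    fix z assume "z \<in> H +>\<^bsub>M\<^esub> (x \<oplus>\<^bsub>M\<^esub> y)"
    then obtain h where hk: "h \<in> H" "z = h \<oplus>\<^bsub>M\<^esub> (x \<oplus>\<^bsub>M\<^esub> y)" by (auto simp: mem_coset)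
    then have "z = (h \<oplus>\<^bsub>M\<^esub> x) \<oplus>\<^bsub>M\<^esub> (\<zero>\<^bsub>M\<^esub> \<oplus>\<^bsub>M\<^esub> y)" using S assms that by (simp add: mm_ac)
    moreover have "h \<oplus>\<^bsub>M\<^esub> x \<in> H +>\<^bsub>M\<^esub> x" "\<zero>\<^bsub>M\<^esub> \<oplus>\<^bsub>M\<^esub> y \<in> H +>\<^bsub>M\<^esub> y"
      using hk S(2) by (auto simp: mem_coset)
    ultimately show "z \<in> (H +>\<^bsub>M\<^esub> x) \<oplus>\<^bsub>mod_quot M H\<^esub> (H +>\<^bsub>M\<^esub> y)"
      by (auto simp: mod_quot_def set_add_def')
  qed
  show "a \<odot>\<^bsub>mod_quot M H\<^esub> (H +>\<^bsub>M\<^esub> x) = H +>\<^bsub>M\<^esub> (a \<odot>\<^bsub>M\<^esub> x)" if a: "a \<in> carrier R" "x \<in> carrier M"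
  proof -
    \<comment> \<open>The union defining scalar multiplication on cosets runs over the
      representatives of one coset, and all its members coincide.\<close>
    have "H +>\<^bsub>M\<^esub> (a \<odot>\<^bsub>M\<^esub> y) = H +>\<^bsub>M\<^esub> (a \<odot>\<^bsub>M\<^esub> x)" if y: "y \<in> H +>\<^bsub>M\<^esub> x" for y
    proof -
      obtain h where h: "h \<in> H" "y = h \<oplus>\<^bsub>M\<^esub> x" using y by (auto simp: mem_coset)
      then have "a \<odot>\<^bsub>M\<^esub> y \<ominus>\<^bsub>M\<^esub> a \<odot>\<^bsub>M\<^esub> x = a \<odot>\<^bsub>M\<^esub> h"
        using S assms a by (simp add: mm_smult_add a_minus_def mm_assoc)
      then have "a \<odot>\<^bsub>M\<^esub> y \<ominus>\<^bsub>M\<^esub> a \<odot>\<^bsub>M\<^esub> x \<in> H" using S(4) h a by simp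
      moreover have "y \<in> carrier M" using S(1) h assms a by simp
      ultimately show ?thesis using coset_eq_iff[OF assms, of "a \<odot>\<^bsub>M\<^esub> y" "a \<odot>\<^bsub>M\<^esub> x"] assms a by simp
    qed
    moreover have "x \<in> H +>\<^bsub>M\<^esub> x"
      unfolding mem_coset by (rule bexI[of _ "\<zero>\<^bsub>M\<^esub>"]) (use S(2) assms(2) a in simp_all)
    ultimately have "(\<Union>y\<in>H +>\<^bsub>M\<^esub> x. H +>\<^bsub>M\<^esub> (a \<odot>\<^bsub>M\<^esub> y)) = H +>\<^bsub>M\<^esub> (a \<odot>\<^bsub>M\<^esub> x)"
      by (intro SUP_eq_const) blast+
    then show ?thesis by (simp add: mod_quot_def)
  qed
qed

lemma quot_module:
  assumes "submodule H R M" "module R M"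
  shows "module R (mod_quot M H)"
proof -
  have "\<ominus> \<one> \<in> carrier R" by simp
  then show ?thesis
    by (intro mk_module)
      (use assms in \<open>auto simp: quot_ops mm_smult_add mm_add_smult mm_smult_smult mm_ac mm_neg_one\<close>)
qed

lemma quot_lin:
  assumes "submodule H R M" "module R M"
  shows "lin R M (mod_quot M H) (\<lambda>x. H +>\<^bsub>M\<^esub> x)"
  using assms by (auto simp: lin_def quot_ops)

lemma quot_zero_iff:
  assumes "submodule H R M" "module R M" "x \<in> carrier M"
  shows "H +>\<^bsub>M\<^esub> x = \<zero>\<^bsub>mod_quot M H\<^esub> \<longleftrightarrow> x \<in> H"
  using assms coset_eq_iff[OF assms(1,2,3), of "\<zero>\<^bsub>M\<^esub>"] by (simp add: quot_ops)

lemma coset_self: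
  assumes "submodule H R M" "module R M" "x \<in> carrier M"
  shows "x \<in> H +>\<^bsub>M\<^esub> x"
  using assms submodule_rules(2)[OF assms(1,2)] by (auto simp: mem_coset intro!: bexI[of _ "\<zero>\<^bsub>M\<^esub>"])

lemma coset_memD:
  assumes "submodule H R M" "module R M" "x \<in> carrier M" "y \<in> H +>\<^bsub>M\<^esub> x"
  shows "y \<in> carrier M" "y \<ominus>\<^bsub>M\<^esub> x \<in> H" "H +>\<^bsub>M\<^esub> y = H +>\<^bsub>M\<^esub> x"
proof -
  note S = submodule_rules[OF assms(1,2)]
  obtain h where h: "h \<in> H" "y = h \<oplus>\<^bsub>M\<^esub> x" using assms(4) by (auto simp: mem_coset)
  then show y: "y \<in> carrier M" using S assms by simp
  show "y \<ominus>\<^bsub>M\<^esub> x \<in> H" using h S assms by (simp add: a_minus_def mm_assoc)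
  then show "H +>\<^bsub>M\<^esub> y = H +>\<^bsub>M\<^esub> x" using coset_eq_iff[OF assms(1,2) y assms(3)] by simp
qed

subsection \<open>Spans\<close>

lemma mod_span_submodule:
  assumes "module R M" "S \<subseteq> carrier M"
  shows "submodule (mod_span R M S) R M"
proof -
  have "submodule (carrier M) R M" using assms by (simp add: submodule_iff)
  then show ?thesis using assms(2) unfolding mod_span_def submodule_iff[OF assms(1)] by auto
qed

lemma mod_span_superset: "x \<in> S \<Longrightarrow> x \<in> mod_span R M S"
  by (auto simp: mod_span_def)

lemma mod_span_least: "submodule H R M \<Longrightarrow> S \<subseteq> H \<Longrightarrow> mod_span R M S \<subseteq> H"
  by (auto simp: mod_span_def)

lemma mod_span_lin_zero:
  assumes "lin R M N f" "module R M" "module R N" "S \<subseteq> carrier M" "\<And>x. x \<in> S \<Longrightarrow> f x = \<zero>\<^bsub>N\<^esub>"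
    "x \<in> mod_span R M S"
  shows "f x = \<zero>\<^bsub>N\<^esub>"
  using mod_span_least[OF lin_kernel_submodule[OF assms(1-3)], of S] assms(4-6) by auto

end

section \<open>Direct sums, free modules and the lifting property of projectives\<close>

section \<open>Direct sums and projective modules\<close>

text \<open>The map out of a direct sum with components \<open>u i\<close>. Summing over the support
  covers infinite \<open>I\<close> as well; since the support changes with \<open>z\<close>,
  computations first pass to a larger finite set by \<open>ds_map_eq\<close>.\<close>

definition ds_map ::
    "'i set \<Rightarrow> ('i \<Rightarrow> ('a, 'b, 'm) module_scheme) \<Rightarrow> ('a, 'c, 'n) module_scheme \<Rightarrow> ('i \<Rightarrow> 'b \<Rightarrow> 'c)
      \<Rightarrow> ('i \<Rightarrow> 'b) \<Rightarrow> 'c"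
  where "ds_map I M N u z = finsum N (\<lambda>i. u i (z i)) {i \<in> I. z i \<noteq> \<zero>\<^bsub>M i\<^esub>}"

text \<open>Projectivity with an index set of arbitrary type. A direct sum of projectives is
  naturally a retract of a free module on pairs, which is not the index type that
  \<open>projective\<close> prescribes; \<open>retract_free_projective\<close> leads back.\<close>

definition retract_free :: "('a, 'r) ring_scheme \<Rightarrow> ('a, 'b, 'm) module_scheme \<Rightarrow> 'x set \<Rightarrow> bool" where
  "retract_free R P X \<longleftrightarrow> (\<exists>s q. lin R P (free_module R X) s \<and> lin R (free_module R X) P q \<and>
     (\<forall>x\<in>carrier P. q (s x) = x))"

definition free_map ::
    "('a, 'r) ring_scheme \<Rightarrow> 'x set \<Rightarrow> ('a, 'b, 'm) module_scheme \<Rightarrow> ('x \<Rightarrow> 'b) \<Rightarrow> ('x \<Rightarrow> 'a) \<Rightarrow> 'b"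
  where "free_map R X N u = ds_map X (\<lambda>_. ring_module R) N (\<lambda>x a. a \<odot>\<^bsub>N\<^esub> u x)"

context modules
begin

lemma direct_sum_simps:
  "carrier (direct_sum I M) = {f \<in> (\<Pi>\<^sub>E i\<in>I. carrier (M i)). finite {i \<in> I. f i \<noteq> \<zero>\<^bsub>M i\<^esub>}}"
  "\<zero>\<^bsub>direct_sum I M\<^esub> = (\<lambda>i\<in>I. \<zero>\<^bsub>M i\<^esub>)"
  "f \<oplus>\<^bsub>direct_sum I M\<^esub> g = (\<lambda>i\<in>I. f i \<oplus>\<^bsub>M i\<^esub> g i)"
  "a \<odot>\<^bsub>direct_sum I M\<^esub> f = (\<lambda>i\<in>I. a \<odot>\<^bsub>M i\<^esub> f i)"
  by (simp_all add: direct_sum_def)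

lemma direct_sum_carrier_finite:
  "finite I \<Longrightarrow> carrier (direct_sum I M) = (\<Pi>\<^sub>E i\<in>I. carrier (M i))"
  by (auto simp: direct_sum_simps)

lemma direct_sum_carrierD:
  "f \<in> carrier (direct_sum I M) \<Longrightarrow> i \<in> I \<Longrightarrow> f i \<in> carrier (M i)"
  by (auto simp: direct_sum_simps)

lemma direct_sum_eqI:
  assumes "f \<in> carrier (direct_sum I M)" "g \<in> carrier (direct_sum I M)" "\<And>i. i \<in> I \<Longrightarrow> f i = g i"
  shows "f = g"
  using assms by (auto simp: direct_sum_simps intro: PiE_ext)

lemma direct_sum_module:
  assumes M: "\<And>i. i \<in> I \<Longrightarrow> module R (M i)"
  shows "module R (direct_sum I M)"
proof (rule mk_module)
  let ?S = "direct_sum I M"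
  show "x \<oplus>\<^bsub>?S\<^esub> y \<in> carrier ?S" if "x \<in> carrier ?S" "y \<in> carrier ?S" for x y
  proof -
    have "{i \<in> I. x i \<oplus>\<^bsub>M i\<^esub> y i \<noteq> \<zero>\<^bsub>M i\<^esub>} \<subseteq> {i \<in> I. x i \<noteq> \<zero>\<^bsub>M i\<^esub>} \<union> {i \<in> I. y i \<noteq> \<zero>\<^bsub>M i\<^esub>}"
      using M by auto
    then have "finite {i \<in> I. x i \<oplus>\<^bsub>M i\<^esub> y i \<noteq> \<zero>\<^bsub>M i\<^esub>}"
      using that by (auto simp: direct_sum_simps intro: finite_subset)
    moreover have "{i \<in> I. (i \<in> I \<longrightarrow> x i \<oplus>\<^bsub>M i\<^esub> y i \<noteq> \<zero>\<^bsub>M i\<^esub>) \<and> i \<in> I} = {i \<in> I. x i \<oplus>\<^bsub>M i\<^esub> y i \<noteq> \<zero>\<^bsub>M i\<^esub>}"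
      by auto
    ultimately show ?thesis using that M by (auto simp: direct_sum_simps Pi_iff PiE_iff cong: conj_cong)
  qed
  show "a \<odot>\<^bsub>?S\<^esub> x \<in> carrier ?S" if "a \<in> carrier R" "x \<in> carrier ?S" for a x
  proof -
    have "{i \<in> I. a \<odot>\<^bsub>M i\<^esub> x i \<noteq> \<zero>\<^bsub>M i\<^esub>} \<subseteq> {i \<in> I. x i \<noteq> \<zero>\<^bsub>M i\<^esub>}"
      using M that by auto
    then have "finite {i \<in> I. a \<odot>\<^bsub>M i\<^esub> x i \<noteq> \<zero>\<^bsub>M i\<^esub>}"
      using that by (auto simp: direct_sum_simps intro: finite_subset)
    then show ?thesis using that M by (auto simp: direct_sum_simps PiE_iff cong: conj_cong)
  qed
  show "\<zero>\<^bsub>?S\<^esub> \<in> carrier ?S" using M by (auto simp: direct_sum_simps cong: conj_cong)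
  fix x assume x: "x \<in> carrier ?S"
  then have xi: "x i \<in> carrier (M i)" if "i \<in> I" for i using that by (simp add: direct_sum_carrierD)
  have xe: "x \<in> extensional I" using x by (auto simp: direct_sum_simps PiE_def)
  show "\<zero>\<^bsub>?S\<^esub> \<oplus>\<^bsub>?S\<^esub> x = x"
    by (rule extensionalityI[OF _ xe]) (use M xi in \<open>auto simp: direct_sum_simps\<close>)
  show "\<one>\<^bsub>R\<^esub> \<odot>\<^bsub>?S\<^esub> x = x"
    by (rule extensionalityI[OF _ xe]) (use M xi in \<open>auto simp: direct_sum_simps\<close>)
  show "(\<ominus>\<^bsub>R\<^esub> \<one>\<^bsub>R\<^esub> \<odot>\<^bsub>?S\<^esub> x) \<oplus>\<^bsub>?S\<^esub> x = \<zero>\<^bsub>?S\<^esub>"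
    using M xi by (auto simp: direct_sum_simps fun_eq_iff mm_neg_one)
  show "(a \<oplus>\<^bsub>R\<^esub> b) \<odot>\<^bsub>?S\<^esub> x = a \<odot>\<^bsub>?S\<^esub> x \<oplus>\<^bsub>?S\<^esub> b \<odot>\<^bsub>?S\<^esub> x" if "a \<in> carrier R" "b \<in> carrier R" for a b
    using M xi that by (auto simp: direct_sum_simps fun_eq_iff mm_add_smult)
  show "(a \<otimes>\<^bsub>R\<^esub> b) \<odot>\<^bsub>?S\<^esub> x = a \<odot>\<^bsub>?S\<^esub> (b \<odot>\<^bsub>?S\<^esub> x)" if "a \<in> carrier R" "b \<in> carrier R" for a b
    using M xi that by (auto simp: direct_sum_simps fun_eq_iff mm_smult_smult)
  fix y assume y: "y \<in> carrier ?S"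
  then have yi: "y i \<in> carrier (M i)" if "i \<in> I" for i using that by (simp add: direct_sum_carrierD)
  show "x \<oplus>\<^bsub>?S\<^esub> y = y \<oplus>\<^bsub>?S\<^esub> x"
    using M xi yi by (auto simp: direct_sum_simps fun_eq_iff mm_comm[of "M _" "x _"])
  show "a \<odot>\<^bsub>?S\<^esub> (x \<oplus>\<^bsub>?S\<^esub> y) = a \<odot>\<^bsub>?S\<^esub> x \<oplus>\<^bsub>?S\<^esub> a \<odot>\<^bsub>?S\<^esub> y" if "a \<in> carrier R" for a
    using M xi yi that by (auto simp: direct_sum_simps fun_eq_iff mm_smult_add)
  fix z assume z: "z \<in> carrier ?S"
  then have zi: "z i \<in> carrier (M i)" if "i \<in> I" for i using that by (simp add: direct_sum_carrierD)
  show "(x \<oplus>\<^bsub>?S\<^esub> y) \<oplus>\<^bsub>?S\<^esub> z = x \<oplus>\<^bsub>?S\<^esub> (y \<oplus>\<^bsub>?S\<^esub> z)"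
    using M xi yi zi by (auto simp: direct_sum_simps fun_eq_iff mm_assoc)
qed

lemma lin_component: "i \<in> I \<Longrightarrow> lin R (direct_sum I M) (M i) (\<lambda>f. f i)"
  by (auto simp: lin_def direct_sum_simps)

lemma sum_inj_carrier:
  assumes "\<And>i. i \<in> I \<Longrightarrow> module R (M i)" "i \<in> I" "x \<in> carrier (M i)"
  shows "sum_inj I M i x \<in> carrier (direct_sum I M)"
proof -
  have "{j \<in> I. sum_inj I M i x j \<noteq> \<zero>\<^bsub>M j\<^esub>} \<subseteq> {i}" by (auto simp: sum_inj_def)
  then have "finite {j \<in> I. sum_inj I M i x j \<noteq> \<zero>\<^bsub>M j\<^esub>}" by (rule finite_subset) simp
  then show ?thesis using assms by (auto simp: direct_sum_simps sum_inj_def)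
qed

lemma sum_inj_lin:
  assumes "\<And>i. i \<in> I \<Longrightarrow> module R (M i)" "i \<in> I"
  shows "lin R (M i) (direct_sum I M) (sum_inj I M i)"
  using assms sum_inj_carrier[OF assms(1,2)]
  by (auto simp: lin_def direct_sum_simps(2-) sum_inj_def fun_eq_iff)

lemma finsum_lin:
  assumes "module R N" "finite A" "\<And>i x. i \<in> A \<Longrightarrow> x \<in> carrier M \<Longrightarrow> f i x \<in> carrier N"
    "\<And>i. i \<in> A \<Longrightarrow> lin R M N (f i)"
  shows "lin R M N (\<lambda>x. finsum N (\<lambda>i. f i x) A)"
proof -
  interpret N: module R N by fact
  show ?thesis
  proof (rule linI)
    show "finsum N (\<lambda>i. f i x) A \<in> carrier N" if "x \<in> carrier M" for x
      using that assms by (intro N.M.finsum_closed) auto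
    show "finsum N (\<lambda>i. f i (x \<oplus>\<^bsub>M\<^esub> y)) A = finsum N (\<lambda>i. f i x) A \<oplus>\<^bsub>N\<^esub> finsum N (\<lambda>i. f i y) A"
      if "x \<in> carrier M" "y \<in> carrier M" for x y
    proof -
      have "finsum N (\<lambda>i. f i (x \<oplus>\<^bsub>M\<^esub> y)) A = finsum N (\<lambda>i. f i x \<oplus>\<^bsub>N\<^esub> f i y) A"
        using that assms by (intro N.M.finsum_cong') (auto simp: lin_def)
      also have "\<dots> = finsum N (\<lambda>i. f i x) A \<oplus>\<^bsub>N\<^esub> finsum N (\<lambda>i. f i y) A"
        using that assms by (intro N.M.finsum_addf) auto
      finally show ?thesis .
    qed
    show "finsum N (\<lambda>i. f i (a \<odot>\<^bsub>M\<^esub> x)) A = a \<odot>\<^bsub>N\<^esub> finsum N (\<lambda>i. f i x) A"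
      if "a \<in> carrier R" "x \<in> carrier M" for a x
    proof -
      have "finsum N (\<lambda>i. f i (a \<odot>\<^bsub>M\<^esub> x)) A = finsum N (\<lambda>i. a \<odot>\<^bsub>N\<^esub> f i x) A"
        using that assms by (intro N.M.finsum_cong') (auto simp: lin_def)
      also have "\<dots> = a \<odot>\<^bsub>N\<^esub> finsum N (\<lambda>i. f i x) A"
        using that assms by (intro N.finsum_smult_ldistr[symmetric]) auto
      finally show ?thesis .
    qed
  qed
qed

lemma ds_map_eq:
  assumes M: "\<And>i. i \<in> I \<Longrightarrow> module R (M i)" and N: "module R N"
    and u: "\<And>i. i \<in> I \<Longrightarrow> lin R (M i) N (u i)" and z: "z \<in> carrier (direct_sum I M)"
    and A: "finite A" "{i \<in> I. z i \<noteq> \<zero>\<^bsub>M i\<^esub>} \<subseteq> A" "A \<subseteq> I"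
  shows "ds_map I M N u z = finsum N (\<lambda>i. u i (z i)) A"
proof -
  interpret N: module R N by fact
  have zi: "i \<in> I \<Longrightarrow> z i \<in> carrier (M i)" for i using z by (simp add: direct_sum_carrierD)
  have "u i (z i) = \<zero>\<^bsub>N\<^esub>" if "i \<in> A - {i \<in> I. z i \<noteq> \<zero>\<^bsub>M i\<^esub>}" for i
  proof -
    have "i \<in> I" "z i = \<zero>\<^bsub>M i\<^esub>" using that A by auto
    then show ?thesis using lin_rules(4)[OF u[of i]] M N by simp
  qed
  moreover have "u i (z i) \<in> carrier N" if "i \<in> A" for i using that A u zi by (auto simp: lin_def)
  ultimately show ?thesis unfolding ds_map_def
    by (intro N.M.add.finprod_mono_neutral_cong_left[folded finsum_def, simplified]) (use A in auto)
qed

lemma ds_map_lin: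
  assumes M: "\<And>i. i \<in> I \<Longrightarrow> module R (M i)" and N: "module R N"
    and u: "\<And>i. i \<in> I \<Longrightarrow> lin R (M i) N (u i)"
  shows "lin R (direct_sum I M) N (ds_map I M N u)"
proof (rule linI)
  let ?S = "direct_sum I M" and ?U = "ds_map I M N u"
  let ?s = "\<lambda>z. {i \<in> I. z i \<noteq> \<zero>\<^bsub>M i\<^esub>}"
  have fin: "finite (?s z)" if "z \<in> carrier ?S" for z using that by (auto simp: direct_sum_simps)
  have S: "module R ?S" using M by (rule direct_sum_module)
  have comp: "lin R ?S N (\<lambda>z. u i (z i))" if "i \<in> I" for i
    using lin_comp[OF lin_component[of i I M, OF that] u[OF that]] .
  have L: "lin R ?S N (\<lambda>z. finsum N (\<lambda>i. u i (z i)) A)" if "finite A" "A \<subseteq> I" for A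
  proof (rule finsum_lin[OF N that(1)])
    fix i assume "i \<in> A"
    then have i: "i \<in> I" using that(2) by auto
    show "lin R ?S N (\<lambda>z. u i (z i))" by (rule comp[OF i])
    show "u i (z i) \<in> carrier N" if "z \<in> carrier ?S" for z by (rule lin_rules(1)[OF comp[OF i] that])
  qed
  show "?U z \<in> carrier N" if z: "z \<in> carrier ?S" for z
    using lin_rules(1)[OF L[of "?s z"] z] fin[OF z] by (simp add: ds_map_def)
  show "?U (y \<oplus>\<^bsub>?S\<^esub> z) = ?U y \<oplus>\<^bsub>N\<^esub> ?U z" if y: "y \<in> carrier ?S" and z: "z \<in> carrier ?S" for y z
  proof -
    \<comment> \<open>One finite set carries all three sums, so additivity becomes that of a fixed
      finite sum.\<close>
    let ?A = "?s y \<union> ?s z \<union> ?s (y \<oplus>\<^bsub>?S\<^esub> z)"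
    have yz: "y \<oplus>\<^bsub>?S\<^esub> z \<in> carrier ?S" using S y z by simp
    have A: "finite ?A" "?A \<subseteq> I" using fin y z yz by auto
    have E: "?U w = finsum N (\<lambda>i. u i (w i)) ?A" if "w \<in> carrier ?S" "?s w \<subseteq> ?A" for w
      using ds_map_eq[OF M N u that(1) A(1) that(2) A(2)] by simp
    have "?U y = finsum N (\<lambda>i. u i (y i)) ?A" "?U z = finsum N (\<lambda>i. u i (z i)) ?A"
      "?U (y \<oplus>\<^bsub>?S\<^esub> z) = finsum N (\<lambda>i. u i ((y \<oplus>\<^bsub>?S\<^esub> z) i)) ?A"
      by (rule E[OF y] E[OF z] E[OF yz], blast)+
    then show ?thesis using lin_rules(2)[OF L[OF A] y z] by simp
  qed
  show "?U (a \<odot>\<^bsub>?S\<^esub> z) = a \<odot>\<^bsub>N\<^esub> ?U z" if a: "a \<in> carrier R" and z: "z \<in> carrier ?S" for a z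
  proof -
    let ?A = "?s z \<union> ?s (a \<odot>\<^bsub>?S\<^esub> z)"
    have yz: "a \<odot>\<^bsub>?S\<^esub> z \<in> carrier ?S" using S a z by simp
    have A: "finite ?A" "?A \<subseteq> I" using fin z yz by auto
    have E: "?U w = finsum N (\<lambda>i. u i (w i)) ?A" if "w \<in> carrier ?S" "?s w \<subseteq> ?A" for w
      using ds_map_eq[OF M N u that(1) A(1) that(2) A(2)] by simp
    have "?U z = finsum N (\<lambda>i. u i (z i)) ?A"
      "?U (a \<odot>\<^bsub>?S\<^esub> z) = finsum N (\<lambda>i. u i ((a \<odot>\<^bsub>?S\<^esub> z) i)) ?A"
      by (rule E[OF z] E[OF yz], blast)+
    then show ?thesis using lin_rules(3)[OF L[OF A] a z] by simp
  qed
qed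

lemma ds_map_inj:
  assumes M: "\<And>i. i \<in> I \<Longrightarrow> module R (M i)" and N: "module R N"
    and u: "\<And>i. i \<in> I \<Longrightarrow> lin R (M i) N (u i)" and i: "i \<in> I" "x \<in> carrier (M i)"
  shows "ds_map I M N u (sum_inj I M i x) = u i x"
proof -
  interpret N: module R N by fact
  have "ds_map I M N u (sum_inj I M i x) = finsum N (\<lambda>j. u j (sum_inj I M i x j)) {i}"
    by (rule ds_map_eq[OF M N u sum_inj_carrier[of I M, OF M i]]) (use i in \<open>auto simp: sum_inj_def\<close>)
  then show ?thesis using i u by (auto simp: sum_inj_def lin_def)
qed

lemma direct_sum_induct:
  assumes M: "\<And>i. i \<in> I \<Longrightarrow> module R (M i)" and z: "z \<in> carrier (direct_sum I M)"
    and "P \<zero>\<^bsub>direct_sum I M\<^esub>" and "\<And>i x. i \<in> I \<Longrightarrow> x \<in> carrier (M i) \<Longrightarrow> P (sum_inj I M i x)"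
    and "\<And>x y. x \<in> carrier (direct_sum I M) \<Longrightarrow> y \<in> carrier (direct_sum I M) \<Longrightarrow> P x \<Longrightarrow> P y \<Longrightarrow>
      P (x \<oplus>\<^bsub>direct_sum I M\<^esub> y)"
  shows "P z"
proof -
  let ?S = "direct_sum I M"
  have S: "module R ?S" using M by (rule direct_sum_module)
  have "finite {i \<in> I. z i \<noteq> \<zero>\<^bsub>M i\<^esub>}" using z by (auto simp: direct_sum_simps)
  \<comment> \<open>The induction runs over a finite set containing the support, with the element
    itself left general.\<close>
  then have "\<forall>z\<in>carrier ?S. {i \<in> I. z i \<noteq> \<zero>\<^bsub>M i\<^esub>} \<subseteq> A \<longrightarrow> P z" if "A = {i \<in> I. z i \<noteq> \<zero>\<^bsub>M i\<^esub>}" for A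
    unfolding that
  proof (induction rule: finite_induct)
    case empty
    have *: "z = \<zero>\<^bsub>?S\<^esub>" if "z \<in> carrier ?S" "{i \<in> I. z i \<noteq> \<zero>\<^bsub>M i\<^esub>} \<subseteq> {}" for z
      using that by (intro direct_sum_eqI[OF that(1) mm_zero[OF S]]) (auto simp: direct_sum_simps(2))
    show ?case
    proof (intro ballI impI)
      fix z assume "z \<in> carrier ?S" "{i \<in> I. z i \<noteq> \<zero>\<^bsub>M i\<^esub>} \<subseteq> {}"
      then have "z = \<zero>\<^bsub>?S\<^esub>" by (rule *)
      then show "P z" using assms(3) by simp
    qed
  next
    case (insert j A)
    show ?case
    proof (intro ballI impI)
      fix z assume z: "z \<in> carrier ?S" "{i \<in> I. z i \<noteq> \<zero>\<^bsub>M i\<^esub>} \<subseteq> insert j A"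
      show "P z"
      proof (cases "j \<in> I")
        case True
        \<comment> \<open>Subtracting the component at \<open>j\<close> moves the support into
          \<open>A\<close>.\<close>
        let ?y = "sum_inj I M j (z j)"
        have zj: "z j \<in> carrier (M j)" using z True by (simp add: direct_sum_carrierD)
        have y: "?y \<in> carrier ?S" using M True zj by (rule sum_inj_carrier)
        have w: "z \<ominus>\<^bsub>?S\<^esub> ?y \<in> carrier ?S" using S z y by simp
        have wi: "(z \<ominus>\<^bsub>?S\<^esub> ?y) i = z i \<ominus>\<^bsub>M i\<^esub> ?y i" if "i \<in> I" for i
          using lin_rules(6)[OF lin_component[OF that] S M[OF that] z(1) y] .
        have "{i \<in> I. (z \<ominus>\<^bsub>?S\<^esub> ?y) i \<noteq> \<zero>\<^bsub>M i\<^esub>} \<subseteq> A"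
        proof (intro subsetI, elim CollectE conjE)
          fix i assume i: "i \<in> I" "(z \<ominus>\<^bsub>?S\<^esub> ?y) i \<noteq> \<zero>\<^bsub>M i\<^esub>"
          then have "i \<noteq> j" using wi zj M[OF True] by (auto simp: sum_inj_def)
          then have "z i \<noteq> \<zero>\<^bsub>M i\<^esub>" using i wi M by (auto simp: sum_inj_def)
          then show "i \<in> A" using z(2) i \<open>i \<noteq> j\<close> by auto
        qed
        then have "P (z \<ominus>\<^bsub>?S\<^esub> ?y)" using insert.IH w by blast
        moreover have "z = (z \<ominus>\<^bsub>?S\<^esub> ?y) \<oplus>\<^bsub>?S\<^esub> ?y" using S z y by simp
        ultimately show ?thesis using assms(4)[OF True zj] assms(5)[OF w y] by metis
      next
        case False
        then have "{i \<in> I. z i \<noteq> \<zero>\<^bsub>M i\<^esub>} \<subseteq> A" using z by auto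
        then show ?thesis using insert.IH z by blast
      qed
    qed
  qed
  then show ?thesis using z by blast
qed

lemma direct_sum_lin_ext:
  assumes M: "\<And>i. i \<in> I \<Longrightarrow> module R (M i)" and N: "module R N"
    and f: "lin R (direct_sum I M) N f" and g: "lin R (direct_sum I M) N g"
    and eq: "\<And>i x. i \<in> I \<Longrightarrow> x \<in> carrier (M i) \<Longrightarrow> f (sum_inj I M i x) = g (sum_inj I M i x)"
    and z: "z \<in> carrier (direct_sum I M)"
  shows "f z = g z"
  using M z
proof (rule direct_sum_induct)
  have S: "module R (direct_sum I M)" using M by (rule direct_sum_module)
  show "f \<zero>\<^bsub>direct_sum I M\<^esub> = g \<zero>\<^bsub>direct_sum I M\<^esub>"
    using lin_rules(4)[OF f S N] lin_rules(4)[OF g S N] by simp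
  show "f (x \<oplus>\<^bsub>direct_sum I M\<^esub> y) = g (x \<oplus>\<^bsub>direct_sum I M\<^esub> y)"
    if "x \<in> carrier (direct_sum I M)" "y \<in> carrier (direct_sum I M)" "f x = g x" "f y = g y" for x y
    using that lin_rules(2)[OF f] lin_rules(2)[OF g] by simp
qed (use eq in auto)

subsection \<open>Free modules\<close>

lemma free_module_module [simp]: "module R (free_module R X)"
  by (simp add: free_module_def direct_sum_module)

lemma free_module_simps:
  "\<zero>\<^bsub>free_module R X\<^esub> = (\<lambda>i\<in>X. \<zero>)"
  "f \<oplus>\<^bsub>free_module R X\<^esub> g = (\<lambda>i\<in>X. f i \<oplus> g i)"
  "a \<odot>\<^bsub>free_module R X\<^esub> f = (\<lambda>i\<in>X. a \<otimes> f i)"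
  by (simp_all add: free_module_def direct_sum_simps)

lemma free_basis_carrier [simp]: "x \<in> X \<Longrightarrow> free_basis R X x \<in> carrier (free_module R X)"
  by (simp add: free_basis_def free_module_def sum_inj_carrier)

lemma free_carrierD [simp]: "z \<in> carrier (free_module R X) \<Longrightarrow> x \<in> X \<Longrightarrow> z x \<in> carrier R"
  by (auto simp: free_module_def direct_sum_simps)

lemma free_inj_eq:
  "x \<in> X \<Longrightarrow> a \<in> carrier R \<Longrightarrow> sum_inj X (\<lambda>_. ring_module R) x a = a \<odot>\<^bsub>free_module R X\<^esub> free_basis R X x"
  by (auto simp: sum_inj_def free_basis_def free_module_def direct_sum_simps fun_eq_iff)

lemma free_map_lin:
  "module R N \<Longrightarrow> (\<And>x. x \<in> X \<Longrightarrow> u x \<in> carrier N) \<Longrightarrow> lin R (free_module R X) N (free_map R X N u)"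
  unfolding free_module_def free_map_def by (intro ds_map_lin) (auto simp: lin_smult_elt)

lemma free_map_basis:
  assumes "module R N" "\<And>x. x \<in> X \<Longrightarrow> u x \<in> carrier N" "x \<in> X"
  shows "free_map R X N u (free_basis R X x) = u x"
proof -
  have "free_map R X N u (free_basis R X x) = \<one> \<odot>\<^bsub>N\<^esub> u x"
    unfolding free_basis_def free_map_def by (rule ds_map_inj) (use assms in \<open>auto simp: lin_smult_elt\<close>)
  then show ?thesis using assms by simp
qed

lemma free_lin_ext:
  assumes N: "module R N" and f: "lin R (free_module R X) N f" and g: "lin R (free_module R X) N g"
    and eq: "\<And>x. x \<in> X \<Longrightarrow> f (free_basis R X x) = g (free_basis R X x)"
    and z: "z \<in> carrier (free_module R X)"
  shows "f z = g z"
proof (rule direct_sum_lin_ext[OF _ N f[unfolded free_module_def] g[unfolded free_module_def] _ z[unfolded free_module_def]])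
  show "f (sum_inj X (\<lambda>_. ring_module R) x a) = g (sum_inj X (\<lambda>_. ring_module R) x a)"
    if "x \<in> X" "a \<in> carrier (ring_module R)" for x a
    using that eq lin_rules(3)[OF f] lin_rules(3)[OF g] by (simp add: free_inj_eq)
qed simp

lemma free_induct:
  assumes z: "z \<in> carrier (free_module R X)" and H: "submodule H R (free_module R X)"
    and b: "\<And>x. x \<in> X \<Longrightarrow> free_basis R X x \<in> H"
  shows "z \<in> H"
proof (rule direct_sum_induct[OF _ z[unfolded free_module_def], of "\<lambda>z. z \<in> H"])
  note S = submodule_rules[OF H free_module_module]
  show "\<zero>\<^bsub>direct_sum X (\<lambda>i. ring_module R)\<^esub> \<in> H" using S(2) by (simp add: free_module_def)
  show "sum_inj X (\<lambda>i. ring_module R) i x \<in> H" if "i \<in> X" "x \<in> carrier (ring_module R)" for i x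
    using that b S(4) by (simp add: free_inj_eq)
  show "x \<oplus>\<^bsub>direct_sum X (\<lambda>i. ring_module R)\<^esub> y \<in> H" if "x \<in> H" "y \<in> H" for x y
    using S(3)[OF that] by (simp add: free_module_def)
qed simp

lemma free_retract: "retract_free R (free_module R X) X"
  unfolding retract_free_def using lin_id by blast

lemma projective_retract:
  fixes P :: "('a, 'c, 'm) module_scheme"
  shows "projective R P \<longleftrightarrow> module R P \<and> (\<exists>X :: 'c set. retract_free R P X)"
proof
  assume "projective R P"
  then show "module R P \<and> (\<exists>X :: 'c set. retract_free R P X)"
    unfolding projective_def retract_free_def by (blast dest: mod_hom_lin)
next
  assume *: "module R P \<and> (\<exists>X :: 'c set. retract_free R P X)"
  then obtain X :: "'c set" and s q where sq: "lin R P (free_module R X) s" "lin R (free_module R X) P q"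
    "\<forall>x\<in>carrier P. q (s x) = x" unfolding retract_free_def by blast
  have "restrict q (carrier (free_module R X)) (restrict s (carrier P) x) = x" if "x \<in> carrier P" for x
    using sq that lin_rules(1)[OF sq(1) that] by simp
  then show "projective R P"
    unfolding projective_def
    using * lin_restrict[OF _ sq(1)] lin_restrict[OF free_module_module sq(2)]
    by (intro conjI exI[of _ X] bexI[of _ "restrict s (carrier P)"]
        bexI[of _ "restrict q (carrier (free_module R X))"] ballI) auto
qed

text \<open>Preimages are chosen for the basis elements only, extended linearly, and pulled back
  along the section \<open>s\<close>. The condition concerns the image of \<open>f\<close> instead
  of surjectivity of \<open>d\<close>, because \<open>d\<close> will be a differential, which
  reaches only cycles.\<close>

lemma retract_free_lift:
  assumes P: "module R P" "retract_free R P X" and E: "module R E" and D: "module R D"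
    and f: "lin R P D f" and d: "lin R E D d" and im: "\<And>x. x \<in> carrier P \<Longrightarrow> f x \<in> d ` carrier E"
  obtains g where "lin R P E g" "\<And>x. x \<in> carrier P \<Longrightarrow> d (g x) = f x"
proof -
  obtain s q where s: "lin R P (free_module R X) s" and q: "lin R (free_module R X) P q"
    and sq: "\<And>x. x \<in> carrier P \<Longrightarrow> q (s x) = x"
    using P(2) by (auto simp: retract_free_def)
  have "\<forall>x\<in>X. \<exists>e. e \<in> carrier E \<and> d e = f (q (free_basis R X x))"
  proof
    fix x assume "x \<in> X"
    then have "f (q (free_basis R X x)) \<in> d ` carrier E" by (intro im lin_rules(1)[OF q]) simp
    then show "\<exists>e. e \<in> carrier E \<and> d e = f (q (free_basis R X x))" by (auto simp: eq_commute)
  qed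
  then obtain u where u: "\<And>x. x \<in> X \<Longrightarrow> u x \<in> carrier E"
    "\<And>x. x \<in> X \<Longrightarrow> d (u x) = f (q (free_basis R X x))" by metis
  let ?U = "free_map R X E u"
  have U: "lin R (free_module R X) E ?U" using E u by (intro free_map_lin)
  have dU: "d (?U z) = f (q z)" if "z \<in> carrier (free_module R X)" for z
    by (rule free_lin_ext[OF D lin_comp[OF U d] lin_comp[OF q f] _ that])
      (use free_map_basis[OF E, of X u] u in simp)
  show ?thesis
  proof (rule that)
    show "lin R P E (\<lambda>x. ?U (s x))" by (rule lin_comp[OF s U])
    show "d (?U (s x)) = f x" if "x \<in> carrier P" for x
      using dU lin_rules(1)[OF s that] sq[OF that] by simp
  qed
qed

text \<open>Sections and retractions are assembled summand by summand; the basis of the sum is the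
  disjoint union of the bases, hence \<open>Sigma I X\<close>. The map \<open>J i\<close> includes
  the free module of the \<open>i\<close>-th summand into the large one.\<close>

lemma retract_free_direct_sum:
  fixes X :: "'i \<Rightarrow> 'x set"
  assumes I: "finite I" and M: "\<And>i. i \<in> I \<Longrightarrow> module R (M i)" and X: "\<And>i. i \<in> I \<Longrightarrow> retract_free R (M i) (X i)"
  shows "retract_free R (direct_sum I M) (Sigma I X)"
proof -
  let ?F = "\<lambda>i. free_module R (X i)" and ?G = "free_module R (Sigma I X)"
  have "\<forall>i\<in>I. \<exists>sq. lin R (M i) (?F i) (fst sq) \<and> lin R (?F i) (M i) (snd sq) \<and>
      (\<forall>x\<in>carrier (M i). snd sq (fst sq x) = x)"
  proof
    fix i assume "i \<in> I"
    then obtain s q where "lin R (M i) (?F i) s" "lin R (?F i) (M i) q" "\<forall>x\<in>carrier (M i). q (s x) = x"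
      using X[of i] unfolding retract_free_def by blast
    then show "\<exists>sq. lin R (M i) (?F i) (fst sq) \<and> lin R (?F i) (M i) (snd sq) \<and>
      (\<forall>x\<in>carrier (M i). snd sq (fst sq x) = x)" by (intro exI[of _ "(s, q)"]) simp
  qed
  then obtain sq where sq: "\<And>i. i \<in> I \<Longrightarrow> lin R (M i) (?F i) (fst (sq i))"
    "\<And>i. i \<in> I \<Longrightarrow> lin R (?F i) (M i) (snd (sq i))"
    "\<And>i x. i \<in> I \<Longrightarrow> x \<in> carrier (M i) \<Longrightarrow> snd (sq i) (fst (sq i) x) = x" by metis
  define J where "J = (\<lambda>i. free_map R (X i) ?G (\<lambda>x. free_basis R (Sigma I X) (i, x)))"
  have J: "lin R (?F i) ?G (J i)" if "i \<in> I" for i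
    unfolding J_def using that by (intro free_map_lin) auto
  define s where "s = ds_map I M ?G (\<lambda>i x. J i (fst (sq i) x))"
  have sl: "lin R (M i) ?G (\<lambda>x. J i (fst (sq i) x))" if "i \<in> I" for i
    using lin_comp[OF sq(1)[OF that] J[OF that]] .
  have s: "lin R (direct_sum I M) ?G s" unfolding s_def by (rule ds_map_lin[OF M _ sl]) simp_all
  define q where "q = free_map R (Sigma I X) (direct_sum I M)
    (\<lambda>(i, x). sum_inj I M i (snd (sq i) (free_basis R (X i) x)))"
  have S: "module R (direct_sum I M)" using M by (rule direct_sum_module)
  have qc: "sum_inj I M i (snd (sq i) (free_basis R (X i) x)) \<in> carrier (direct_sum I M)"
    if "i \<in> I" "x \<in> X i" for i x
    using sum_inj_carrier[OF M that(1)] lin_rules(1)[OF sq(2)[OF that(1)]] that by simp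
  have q: "lin R ?G (direct_sum I M) q" unfolding q_def using S qc by (intro free_map_lin) auto
  have qJ: "q (J i y) = sum_inj I M i (snd (sq i) y)" if "i \<in> I" "y \<in> carrier (?F i)" for i y
  proof (rule free_lin_ext[OF S lin_comp[OF J[OF that(1)] q] lin_comp[OF sq(2)[OF that(1)] sum_inj_lin[of I M, OF M that(1)]] _ that(2)])
    fix x assume x: "x \<in> X i"
    have "J i (free_basis R (X i) x) = free_basis R (Sigma I X) (i, x)"
      unfolding J_def using that x by (intro free_map_basis) auto
    moreover have "q (free_basis R (Sigma I X) (i, x)) = sum_inj I M i (snd (sq i) (free_basis R (X i) x))"
      unfolding q_def by (subst free_map_basis) (use S qc that x in auto)
    ultimately show "q (J i (free_basis R (X i) x)) = sum_inj I M i (snd (sq i) (free_basis R (X i) x))"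
      by simp
  qed
  have "q (s z) = z" if "z \<in> carrier (direct_sum I M)" for z
  proof (rule direct_sum_lin_ext[OF M S lin_comp[OF s q] lin_id _ that])
    fix i x assume i: "i \<in> I" "x \<in> carrier (M i)"
    have "s (sum_inj I M i x) = J i (fst (sq i) x)"
      unfolding s_def using ds_map_inj[of I M ?G "\<lambda>i x. J i (fst (sq i) x)" i x] M sl i by simp
    then show "q (s (sum_inj I M i x)) = sum_inj I M i x"
      using qJ[OF i(1) lin_rules(1)[OF sq(1)[OF i(1)] i(2)]] sq(3)[OF i] by simp
  qed
  then show ?thesis unfolding retract_free_def using s q by blast
qed

end

section \<open>Comparison of pro-resolutions and invariance of the colimit of cohomology\<close>

section \<open>Pro-systems of complexes\<close>

text \<open>\<open>cx S m\<close> is the \<open>m\<close>-th complex, with differential \<open>df S m k\<close> from degree \<open>k + 1\<close> to degree \<open>k\<close>, and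
  \<open>tr S m n\<close> is the transition map from the \<open>n\<close>-th to the \<open>m\<close>-th complex for \<open>m \<le> n\<close>.\<close>

record ('a, 'x, 'y) pro_complex =
  cx :: "nat \<Rightarrow> nat \<Rightarrow> ('a, 'x) module"
  df :: "nat \<Rightarrow> nat \<Rightarrow> 'x \<Rightarrow> 'x"
  tr :: "nat \<Rightarrow> nat \<Rightarrow> nat \<Rightarrow> 'x \<Rightarrow> 'x"
  aug :: "nat \<Rightarrow> 'x \<Rightarrow> 'y"

text \<open>Cycles of the augmented complex: in degree 0 the augmentation takes the part of a
  differential.\<close>

definition aug_cycle ::
    "(nat \<Rightarrow> ('a, 'y, 's) module_scheme) \<Rightarrow> ('a, 'x, 'y) pro_complex \<Rightarrow> nat \<Rightarrow> nat \<Rightarrow> 'x \<Rightarrow> bool"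
  where "aug_cycle A S m k x \<longleftrightarrow>
    (case k of 0 \<Rightarrow> aug S m x = \<zero>\<^bsub>A m\<^esub> | Suc j \<Rightarrow> df S m j x = \<zero>\<^bsub>cx S m j\<^esub>)"

definition cocyc ::
    "('a, 'r) ring_scheme \<Rightarrow> ('a, 'c, 'n) module_scheme \<Rightarrow> ('a, 'x, 'y) pro_complex \<Rightarrow> nat \<Rightarrow> nat
      \<Rightarrow> ('x \<Rightarrow> 'c) \<Rightarrow> bool"
  where "cocyc R N S m k h \<longleftrightarrow> lin R (cx S m k) N h \<and> (\<forall>x\<in>carrier (cx S m (Suc k)). h (df S m k x) = \<zero>\<^bsub>N\<^esub>)"

definition cobd ::
    "('a, 'r) ring_scheme \<Rightarrow> ('a, 'c, 'n) module_scheme \<Rightarrow> ('a, 'x, 'y) pro_complex \<Rightarrow> nat \<Rightarrow> nat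
      \<Rightarrow> ('x \<Rightarrow> 'c) \<Rightarrow> bool"
  where "cobd R N S m k h \<longleftrightarrow> (case k of 0 \<Rightarrow> \<forall>x\<in>carrier (cx S m 0). h x = \<zero>\<^bsub>N\<^esub>
     | Suc j \<Rightarrow> \<exists>g. lin R (cx S m j) N g \<and> (\<forall>x\<in>carrier (cx S m (Suc j)). h x = g (df S m j x)))"

text \<open>\<open>H\<close> is the colimit over \<open>m\<close> of the \<open>k\<close>-th cohomology of \<open>Hom(cx S m, N)\<close>, where \<open>\<phi> m\<close> sends a cocycle
  to its class.\<close>

definition presents ::
    "('a, 'r) ring_scheme \<Rightarrow> ('a, 'c, 'n) module_scheme \<Rightarrow> ('a, 'x, 'y) pro_complex \<Rightarrow> nat
      \<Rightarrow> ('a, 'h, 'k) module_scheme \<Rightarrow> (nat \<Rightarrow> ('x \<Rightarrow> 'c) \<Rightarrow> 'h) \<Rightarrow> bool"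
  where "presents R N S k H \<phi> \<longleftrightarrow>
    (\<forall>m h. cocyc R N S m k h \<longrightarrow> \<phi> m h \<in> carrier H) \<and>
    (\<forall>m h h'. cocyc R N S m k h \<longrightarrow> (\<forall>x\<in>carrier (cx S m k). h x = h' x) \<longrightarrow> \<phi> m h = \<phi> m h') \<and>
    (\<forall>m h h'. cocyc R N S m k h \<longrightarrow> cocyc R N S m k h' \<longrightarrow>
      \<phi> m (\<lambda>x. h x \<oplus>\<^bsub>N\<^esub> h' x) = \<phi> m h \<oplus>\<^bsub>H\<^esub> \<phi> m h') \<and>
    (\<forall>m c h. c \<in> carrier R \<longrightarrow> cocyc R N S m k h \<longrightarrow> \<phi> m (\<lambda>x. c \<odot>\<^bsub>N\<^esub> h x) = c \<odot>\<^bsub>H\<^esub> \<phi> m h) \<and>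
    (\<forall>m n h. m \<le> n \<longrightarrow> cocyc R N S m k h \<longrightarrow> \<phi> n (\<lambda>x. h (tr S m n k x)) = \<phi> m h) \<and>
    (\<forall>y\<in>carrier H. \<exists>m h. cocyc R N S m k h \<and> \<phi> m h = y) \<and>
    (\<forall>m h. cocyc R N S m k h \<longrightarrow>
      \<phi> m h = \<zero>\<^bsub>H\<^esub> \<longleftrightarrow> (\<exists>n\<ge>m. cobd R N S n k (\<lambda>x. h (tr S m n k x))))"

text \<open>A chain map from index \<open>n\<close> of \<open>S\<close> to index \<open>m\<close> of
  \<open>S'\<close> over the transition \<open>a m n\<close>, in degrees up to \<open>K\<close>
  only. Each degree may cost a further shift of the index, so a single \<open>n\<close> need not
  admit a map in all degrees.\<close>

definition chmap ::
    "('a, 'r) ring_scheme \<Rightarrow> (nat \<Rightarrow> nat \<Rightarrow> 'y \<Rightarrow> 'y) \<Rightarrow> ('a, 'x, 'y) pro_complex \<Rightarrow> ('a, 'z, 'y) pro_complex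
      \<Rightarrow> nat \<Rightarrow> nat \<Rightarrow> nat \<Rightarrow> (nat \<Rightarrow> 'x \<Rightarrow> 'z) \<Rightarrow> bool"
  where "chmap R a S S' n m K f \<longleftrightarrow> (\<forall>k\<le>K. lin R (cx S n k) (cx S' m k) (f k)) \<and>
    (\<forall>x\<in>carrier (cx S n 0). aug S' m (f 0 x) = a m n (aug S n x)) \<and>
    (\<forall>k<K. \<forall>x\<in>carrier (cx S n (Suc k)). df S' m k (f (Suc k) x) = f k (df S n k x))"

locale pro_cx = modules R for R (structure) +
  fixes S :: "('a, 'x, 'y) pro_complex"
  assumes cx_module [simp]: "module R (cx S m k)"
    and df_lin: "lin R (cx S m (Suc k)) (cx S m k) (df S m k)"
    and df_df: "x \<in> carrier (cx S m (Suc (Suc k))) \<Longrightarrow> df S m k (df S m (Suc k) x) = \<zero>\<^bsub>cx S m k\<^esub>"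
    and tr_lin: "m \<le> n \<Longrightarrow> lin R (cx S n k) (cx S m k) (tr S m n k)"
    and tr_refl [simp]: "x \<in> carrier (cx S m k) \<Longrightarrow> tr S m m k x = x"
    and tr_tr [simp]: "l \<le> m \<Longrightarrow> m \<le> n \<Longrightarrow> x \<in> carrier (cx S n k) \<Longrightarrow> tr S l m k (tr S m n k x) = tr S l n k x"
    and df_tr: "m \<le> n \<Longrightarrow> x \<in> carrier (cx S n (Suc k)) \<Longrightarrow>
      df S m k (tr S m n (Suc k) x) = tr S m n k (df S n k x)"
begin

lemma df_rules [simp]:
  "x \<in> carrier (cx S m (Suc k)) \<Longrightarrow> df S m k x \<in> carrier (cx S m k)"
  "df S m k \<zero>\<^bsub>cx S m (Suc k)\<^esub> = \<zero>\<^bsub>cx S m k\<^esub>"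
  using lin_rules(1,4)[OF df_lin] by auto

lemma tr_rules [simp]:
  "m \<le> n \<Longrightarrow> x \<in> carrier (cx S n k) \<Longrightarrow> tr S m n k x \<in> carrier (cx S m k)"
  "m \<le> n \<Longrightarrow> tr S m n k \<zero>\<^bsub>cx S n k\<^esub> = \<zero>\<^bsub>cx S m k\<^esub>"
  using lin_rules(1,4)[OF tr_lin] by auto

lemma cobd_cocyc:
  assumes N: "module R N" and h: "cobd R N S m k h"
  shows "cocyc R N S m k h"
proof (cases k)
  case 0
  then have h: "\<forall>x\<in>carrier (cx S m 0). h x = \<zero>\<^bsub>N\<^esub>" using h by (simp add: cobd_def)
  then have "lin R (cx S m 0) N h" using lin_cong[of "cx S m 0" h "\<lambda>_. \<zero>\<^bsub>N\<^esub>" N] lin_zero[OF N] by simp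
  then show ?thesis using 0 h by (simp add: cocyc_def)
next
  case (Suc j)
  then obtain g where g: "lin R (cx S m j) N g" "\<forall>x\<in>carrier (cx S m (Suc j)). h x = g (df S m j x)"
    using h by (auto simp: cobd_def)
  have "lin R (cx S m (Suc j)) N h"
    using lin_cong[of "cx S m (Suc j)" h "\<lambda>x. g (df S m j x)" N] lin_comp[OF df_lin g(1)] g(2) by simp
  then show ?thesis using Suc g lin_rules(4)[OF g(1)] N by (simp add: cocyc_def df_df)
qed

lemma cobd_cong:
  assumes "\<And>x. x \<in> carrier (cx S m k) \<Longrightarrow> h x = h' x"
  shows "cobd R N S m k h \<longleftrightarrow> cobd R N S m k h'"
  using assms by (cases k) (auto simp: cobd_def)

lemma cobd_tr:
  assumes N: "module R N" and h: "cobd R N S m k h" and mn: "m \<le> n"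
  shows "cobd R N S n k (\<lambda>x. h (tr S m n k x))"
proof (cases k)
  case 0
  then show ?thesis using h mn by (simp add: cobd_def)
next
  case (Suc j)
  then obtain g where g: "lin R (cx S m j) N g" "\<forall>x\<in>carrier (cx S m (Suc j)). h x = g (df S m j x)"
    using h by (auto simp: cobd_def)
  have "lin R (cx S n j) N (\<lambda>x. g (tr S m n j x))" using lin_comp[OF tr_lin[OF mn] g(1)] .
  moreover have "\<forall>x\<in>carrier (cx S n (Suc j)). h (tr S m n (Suc j) x) = g (tr S m n j (df S n j x))"
    using g(2) mn by (simp add: df_tr)
  ultimately show ?thesis using Suc by (auto simp: cobd_def)
qed

lemma cocyc_tr:
  assumes h: "cocyc R N S m k h" and mn: "m \<le> n"
  shows "cocyc R N S n k (\<lambda>x. h (tr S m n k x))"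
  using h lin_comp[OF tr_lin[OF mn]] mn by (auto simp: cocyc_def df_tr[symmetric])

lemma cobd_zero: "module R N \<Longrightarrow> cobd R N S m k (\<lambda>_. \<zero>\<^bsub>N\<^esub>)"
  by (cases k) (auto simp: cobd_def intro!: exI[of _ "\<lambda>_. \<zero>\<^bsub>N\<^esub>"] lin_zero)

lemma cobd_add:
  assumes N: "module R N" and h: "cobd R N S m k h" and h': "cobd R N S m k h'"
  shows "cobd R N S m k (\<lambda>x. h x \<oplus>\<^bsub>N\<^esub> h' x)"
proof (cases k)
  case 0
  then show ?thesis using h h' N by (simp add: cobd_def)
next
  case (Suc j)
  then obtain g g' where "lin R (cx S m j) N g" "\<forall>x\<in>carrier (cx S m (Suc j)). h x = g (df S m j x)"
    "lin R (cx S m j) N g'" "\<forall>x\<in>carrier (cx S m (Suc j)). h' x = g' (df S m j x)"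
    using h h' by (auto simp: cobd_def)
  then show ?thesis using Suc lin_add[OF N, of _ g g'] by (auto simp: cobd_def)
qed

lemma cobd_smult:
  assumes N: "module R N" and h: "cobd R N S m k h" and c: "c \<in> carrier R"
  shows "cobd R N S m k (\<lambda>x. c \<odot>\<^bsub>N\<^esub> h x)"
proof (cases k)
  case 0
  then show ?thesis using h c N by (simp add: cobd_def)
next
  case (Suc j)
  then obtain g where "lin R (cx S m j) N g" "\<forall>x\<in>carrier (cx S m (Suc j)). h x = g (df S m j x)"
    using h by (auto simp: cobd_def)
  then show ?thesis using Suc lin_smult[OF N _ c, of _ g] by (auto simp: cobd_def)
qed

lemma cocyc_ops:
  assumes N: "module R N" and h: "cocyc R N S m k h"
  shows "cocyc R N S m k h' \<Longrightarrow> cocyc R N S m k (\<lambda>x. h x \<oplus>\<^bsub>N\<^esub> h' x)"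
    and "cocyc R N S m k h' \<Longrightarrow> cocyc R N S m k (\<lambda>x. h x \<ominus>\<^bsub>N\<^esub> h' x)"
    and "c \<in> carrier R \<Longrightarrow> cocyc R N S m k (\<lambda>x. c \<odot>\<^bsub>N\<^esub> h x)"
  using assms lin_add[OF N] lin_minus[OF N] lin_smult[OF N] by (auto simp: cocyc_def)

lemma presents_rules:
  assumes "presents R N S k H \<phi>" and N: "module R N" and H: "module R H" and h: "cocyc R N S m k h"
  shows "\<phi> m h \<in> carrier H"
    and "(\<And>x. x \<in> carrier (cx S m k) \<Longrightarrow> h x = h' x) \<Longrightarrow> \<phi> m h = \<phi> m h'"
    and "cocyc R N S m k h' \<Longrightarrow> \<phi> m (\<lambda>x. h x \<oplus>\<^bsub>N\<^esub> h' x) = \<phi> m h \<oplus>\<^bsub>H\<^esub> \<phi> m h'"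
    and "c \<in> carrier R \<Longrightarrow> \<phi> m (\<lambda>x. c \<odot>\<^bsub>N\<^esub> h x) = c \<odot>\<^bsub>H\<^esub> \<phi> m h"
    and "m \<le> n \<Longrightarrow> \<phi> n (\<lambda>x. h (tr S m n k x)) = \<phi> m h"
    and "\<phi> m h = \<zero>\<^bsub>H\<^esub> \<longleftrightarrow> (\<exists>n\<ge>m. cobd R N S n k (\<lambda>x. h (tr S m n k x)))"
    and "cobd R N S m k h \<Longrightarrow> \<phi> m h = \<zero>\<^bsub>H\<^esub>"
    and "cocyc R N S m k h' \<Longrightarrow> cobd R N S m k (\<lambda>x. h x \<ominus>\<^bsub>N\<^esub> h' x) \<Longrightarrow> \<phi> m h = \<phi> m h'"
proof -
  note P = assms(1)[unfolded presents_def]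
  note P1 = P[THEN conjunct1, rule_format] and Pr = P[THEN conjunct2]
  note P2 = Pr[THEN conjunct1, rule_format] and Pr = Pr[THEN conjunct2]
  note P3 = Pr[THEN conjunct1, rule_format] and Pr = Pr[THEN conjunct2]
  note P4 = Pr[THEN conjunct1, rule_format] and Pr = Pr[THEN conjunct2]
  note P5 = Pr[THEN conjunct1, rule_format] and Pr = Pr[THEN conjunct2]
  note z = Pr[THEN conjunct2, rule_format]
  show "\<phi> m h \<in> carrier H" by (rule P1[OF h])
  show "\<phi> m h = \<phi> m h'" if "\<And>x. x \<in> carrier (cx S m k) \<Longrightarrow> h x = h' x"
    by (rule P2[OF h that])
  show "\<phi> m (\<lambda>x. h x \<oplus>\<^bsub>N\<^esub> h' x) = \<phi> m h \<oplus>\<^bsub>H\<^esub> \<phi> m h'" if "cocyc R N S m k h'"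
    by (rule P3[OF h that])
  show "\<phi> m (\<lambda>x. c \<odot>\<^bsub>N\<^esub> h x) = c \<odot>\<^bsub>H\<^esub> \<phi> m h" if "c \<in> carrier R" by (rule P4[OF that h])
  show "\<phi> n (\<lambda>x. h (tr S m n k x)) = \<phi> m h" if "m \<le> n" by (rule P5[OF that h])
  show "\<phi> m h = \<zero>\<^bsub>H\<^esub> \<longleftrightarrow> (\<exists>n\<ge>m. cobd R N S n k (\<lambda>x. h (tr S m n k x)))" by (rule z[OF h])
  have zz: "\<phi> m h = \<zero>\<^bsub>H\<^esub>" if "cobd R N S m k h" for h
  proof -
    have "cobd R N S m k (\<lambda>x. h (tr S m m k x))"
      using that cobd_cong[of m k "\<lambda>x. h (tr S m m k x)" h N] by simp
    then show ?thesis using z[OF cobd_cocyc[OF N that]] by blast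
  qed
  then show "cobd R N S m k h \<Longrightarrow> \<phi> m h = \<zero>\<^bsub>H\<^esub>" .
  show "\<phi> m h = \<phi> m h'" if h': "cocyc R N S m k h'" "cobd R N S m k (\<lambda>x. h x \<ominus>\<^bsub>N\<^esub> h' x)"
  proof -
    have c: "h x \<in> carrier N" "h' x \<in> carrier N" if "x \<in> carrier (cx S m k)" for x
      using h h' that by (auto simp: cocyc_def lin_def)
    have "\<phi> m h = \<phi> m (\<lambda>x. (h x \<ominus>\<^bsub>N\<^esub> h' x) \<oplus>\<^bsub>N\<^esub> h' x)" by (rule P2[OF h]) (use c N in simp)
    also have "\<dots> = \<phi> m (\<lambda>x. h x \<ominus>\<^bsub>N\<^esub> h' x) \<oplus>\<^bsub>H\<^esub> \<phi> m h'"
      by (rule P3[OF cobd_cocyc[OF N h'(2)] h'(1)])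
    also have "\<dots> = \<phi> m h'" using zz[OF h'(2)] H P1[OF h'(1)] by simp
    finally show ?thesis .
  qed
qed

lemma presents_surj:
  assumes "presents R N S k H \<phi>" "y \<in> carrier H"
  obtains m h where "cocyc R N S m k h" "\<phi> m h = y"
  using assms(1)[unfolded presents_def, THEN conjunct2, THEN conjunct2, THEN conjunct2, THEN conjunct2,
      THEN conjunct2, THEN conjunct1, rule_format, OF assms(2)] by blast

end

text \<open>In a pro-resolution of the system \<open>A\<close> a cycle need not be a boundary, but becomes one after a transition map.\<close>

locale pro_res = pro_cx R S for R (structure) and S :: "('a, 'x, 'y) pro_complex" +
  fixes A :: "nat \<Rightarrow> ('a, 'y, 's) module_scheme" and a :: "nat \<Rightarrow> nat \<Rightarrow> 'y \<Rightarrow> 'y"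
  assumes A_module [simp]: "module R (A m)"
    and a_lin: "m \<le> n \<Longrightarrow> lin R (A n) (A m) (a m n)"
    and a_a: "l \<le> m \<Longrightarrow> m \<le> n \<Longrightarrow> y \<in> carrier (A n) \<Longrightarrow> a l m (a m n y) = a l n y"
    and aug_lin: "lin R (cx S m 0) (A m) (aug S m)"
    and aug_surj: "y \<in> carrier (A m) \<Longrightarrow> y \<in> aug S m ` carrier (cx S m 0)"
    and aug_df: "x \<in> carrier (cx S m (Suc 0)) \<Longrightarrow> aug S m (df S m 0 x) = \<zero>\<^bsub>A m\<^esub>"
    and aug_tr: "m \<le> n \<Longrightarrow> x \<in> carrier (cx S n 0) \<Longrightarrow> aug S m (tr S m n 0 x) = a m n (aug S n x)"
    and proj: "projective R (cx S m k)"
    and exact: "\<exists>n\<ge>m. \<forall>x\<in>carrier (cx S n k). aug_cycle A S n k x \<longrightarrow>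
      tr S m n k x \<in> df S m k ` carrier (cx S m (Suc k))"
begin

lemma lift:
  assumes "module R E" "module R D" "lin R (cx S m k) D f" "lin R E D g"
    "\<And>x. x \<in> carrier (cx S m k) \<Longrightarrow> f x \<in> g ` carrier E"
  shows "\<exists>q. lin R (cx S m k) E q \<and> (\<forall>x\<in>carrier (cx S m k). g (q x) = f x)"
proof -
  obtain X :: "'x set" where "retract_free R (cx S m k) X" using proj projective_retract by blast
  then show ?thesis using retract_free_lift[OF cx_module _ assms] by metis
qed

lemma aug_rules [simp]:
  "x \<in> carrier (cx S m 0) \<Longrightarrow> aug S m x \<in> carrier (A m)"
  using lin_rules(1)[OF aug_lin] by auto

lemma tr_chmap: "m \<le> n \<Longrightarrow> chmap R a S S n m K (tr S m n)"
  by (auto simp: chmap_def tr_lin aug_tr df_tr)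

end

context modules
begin

lemma chmap_comp:
  assumes f: "chmap R a S S' n m K f" and g: "chmap R a S' S'' m l K g"
    and a: "\<And>y. y \<in> carrier (A n) \<Longrightarrow> a l m (a m n y) = a l n y" and aug: "lin R (cx S n 0) (A n) (aug S n)"
    and df: "\<And>k. lin R (cx S n (Suc k)) (cx S n k) (df S n k)"
  shows "chmap R a S S'' n l K (\<lambda>k x. g k (f k x))"
  unfolding chmap_def
proof (intro conjI allI impI ballI)
  have fl: "lin R (cx S n k) (cx S' m k) (f k)" if "k \<le> K" for k using f that by (simp add: chmap_def)
  show "lin R (cx S n k) (cx S'' l k) (\<lambda>x. g k (f k x))" if "k \<le> K" for k
    by (rule lin_comp[OF fl[OF that]]) (use g that in \<open>simp add: chmap_def\<close>)
  show "aug S'' l (g 0 (f 0 x)) = a l n (aug S n x)" if "x \<in> carrier (cx S n 0)" for x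
    using that a lin_rules(1)[OF fl[of 0]] lin_rules(1)[OF aug] f g by (auto simp: chmap_def)
  show "df S'' l k (g (Suc k) (f (Suc k) x)) = g k (f k (df S n k x))"
    if "k < K" "x \<in> carrier (cx S n (Suc k))" for k x
    using that lin_rules(1)[OF fl[of "Suc k"]] f g by (auto simp: chmap_def)
qed

end

locale pro_res_pair = S: pro_res R S A a + S': pro_res R S' A a
  for R (structure) and S :: "('a, 'x, 'y) pro_complex" and S' :: "('a, 'z, 'y) pro_complex"
    and A :: "nat \<Rightarrow> ('a, 'y, 's) module_scheme" and a
begin

text \<open>The comparison theorem for projective resolutions, degree by degree. The obstruction to
  lifting in the next degree is a cycle of \<open>S'\<close> that is a boundary only after a
  transition, so the target index is raised before the induction hypothesis is applied.\<close>

lemma chmap_exists: "\<exists>n0\<ge>m. \<forall>n\<ge>n0. \<exists>f. chmap R a S S' n m K f"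
proof (induction K arbitrary: m)
  case 0
  show ?case
  proof (intro exI[of _ m] conjI allI impI)
    fix n assume mn: "m \<le> n"
    have l: "lin R (cx S n 0) (A m) (\<lambda>x. a m n (aug S n x))" by (rule lin_comp[OF S.aug_lin S.a_lin[OF mn]])
    have im: "a m n (aug S n x) \<in> aug S' m ` carrier (cx S' m 0)" if "x \<in> carrier (cx S n 0)" for x
      using that S.lin_rules(1)[OF S.a_lin[OF mn]] by (intro S'.aug_surj) simp
    obtain f where "lin R (cx S n 0) (cx S' m 0) f"
      "\<forall>x\<in>carrier (cx S n 0). aug S' m (f x) = a m n (aug S n x)"
      using S.lift[OF S'.cx_module S'.A_module l S'.aug_lin im] by blast
    then show "\<exists>f. chmap R a S S' n m 0 f" by (intro exI[of _ "\<lambda>_. f"]) (simp add: chmap_def)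
  qed simp
next
  case (Suc K)
  \<comment> \<open>Room for one more degree: cycles of degree \<open>K\<close> at index
    \<open>m1\<close> become boundaries at index \<open>m\<close>, so the lower part of the map is
    built with target \<open>m1\<close>.\<close>
  obtain m1 where m1: "m1 \<ge> m" "\<And>x. x \<in> carrier (cx S' m1 K) \<Longrightarrow> aug_cycle A S' m1 K x \<Longrightarrow>
      tr S' m m1 K x \<in> df S' m K ` carrier (cx S' m (Suc K))"
    using S'.exact by metis
  obtain n0 where n0: "n0 \<ge> m1" "\<And>n. n \<ge> n0 \<Longrightarrow> \<exists>f. chmap R a S S' n m1 K f" using Suc.IH by metis
  show ?case
  proof (intro exI[of _ n0] conjI allI impI)
    show "m \<le> n0" using m1(1) n0(1) by simp
    fix n assume n: "n0 \<le> n"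
    obtain f where f: "chmap R a S S' n m1 K f" using n0(2)[OF n] by blast
    have mn: "m1 \<le> n" using n n0 by simp
    have fl: "lin R (cx S n k) (cx S' m1 k) (f k)" if "k \<le> K" for k using f that by (simp add: chmap_def)
    have cyc: "aug_cycle A S' m1 K (f K (df S n K x))" if x: "x \<in> carrier (cx S n (Suc K))" for x
    proof (cases K)
      case 0
      then show ?thesis
        using f x S.aug_df S.lin_rules(4)[OF S.a_lin[OF mn]] by (simp add: chmap_def aug_cycle_def)
    next
      case (Suc j)
      then show ?thesis
        using f x S.df_df S.lin_rules(4)[OF fl[of j]] by (simp add: chmap_def aug_cycle_def)
    qed
    have l: "lin R (cx S n (Suc K)) (cx S' m K) (\<lambda>x. tr S' m m1 K (f K (df S n K x)))"
      by (intro lin_comp[OF _ S'.tr_lin[OF m1(1)]] lin_comp[OF S.df_lin] fl) simp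
    have im: "tr S' m m1 K (f K (df S n K x)) \<in> df S' m K ` carrier (cx S' m (Suc K))"
      if "x \<in> carrier (cx S n (Suc K))" for x
      using that by (intro m1(2) cyc S.lin_rules(1)[OF fl]) simp_all
    obtain g where g: "lin R (cx S n (Suc K)) (cx S' m (Suc K)) g"
      "\<forall>x\<in>carrier (cx S n (Suc K)). df S' m K (g x) = tr S' m m1 K (f K (df S n K x))"
      using S.lift[OF S'.cx_module S'.cx_module l S'.df_lin im] by blast
    \<comment> \<open>The new component exists at index \<open>m\<close> only, so the lower ones are
      composed with the transition from \<open>m1\<close> to \<open>m\<close>.\<close>
    let ?f = "\<lambda>k. if k = Suc K then g else (\<lambda>x. tr S' m m1 k (f k x))"
    have tf: "lin R (cx S n k) (cx S' m k) (\<lambda>x. tr S' m m1 k (f k x))" if "k \<le> K" for k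
      by (rule lin_comp[OF fl[OF that] S'.tr_lin[OF m1(1)]])
    have "aug S' m (tr S' m m1 0 (f 0 x)) = a m n (aug S n x)" if "x \<in> carrier (cx S n 0)" for x
      using f that m1(1) mn S.lin_rules(1)[OF fl[of 0] that] by (simp add: S'.aug_tr S'.a_a chmap_def)
    moreover have "df S' m k (tr S' m m1 (Suc k) (f (Suc k) x)) = tr S' m m1 k (f k (df S n k x))"
      if "x \<in> carrier (cx S n (Suc k))" "k < K" for k x
      using f that m1(1) S.lin_rules(1)[OF fl[of "Suc k"]] by (simp add: S'.df_tr chmap_def)
    ultimately have "chmap R a S S' n m (Suc K) ?f"
      unfolding chmap_def using g tf by (auto simp: le_Suc_eq less_Suc_eq)
    then show "\<exists>f. chmap R a S S' n m (Suc K) f" by blast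
  qed
qed

text \<open>A chain map \<open>u\<close> over zero becomes null-homotopic after a transition. The
  quantifiers matter: \<open>m0\<close> depends on \<open>m\<close> and \<open>K\<close> alone and
  serves all sources \<open>n\<close> and all maps \<open>u\<close>, so that it can be fixed before
  any chain map is chosen. The \<open>case\<close> term sets the homotopy in degree -1 to
  zero.\<close>

lemma homotopy_exists:
  "\<exists>m0\<ge>m. \<forall>n u. (\<forall>k\<le>K. lin R (cx S n k) (cx S' m0 k) (u k)) \<longrightarrow>
    (\<forall>x\<in>carrier (cx S n 0). aug S' m0 (u 0 x) = \<zero>\<^bsub>A m0\<^esub>) \<longrightarrow>
    (\<forall>k<K. \<forall>x\<in>carrier (cx S n (Suc k)). df S' m0 k (u (Suc k) x) = u k (df S n k x)) \<longrightarrow>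
    (\<exists>s. (\<forall>k\<le>K. lin R (cx S n k) (cx S' m (Suc k)) (s k)) \<and>
      (\<forall>k\<le>K. \<forall>x\<in>carrier (cx S n k). tr S' m m0 k (u k x) =
        df S' m k (s k x) \<oplus>\<^bsub>cx S' m k\<^esub> (case k of 0 \<Rightarrow> \<zero>\<^bsub>cx S' m k\<^esub> | Suc j \<Rightarrow> s j (df S n j x))))"
proof (induction K arbitrary: m)
  case 0
  obtain m0 where m0: "m0 \<ge> m" "\<And>x. x \<in> carrier (cx S' m0 0) \<Longrightarrow> aug_cycle A S' m0 0 x \<Longrightarrow>
      tr S' m m0 0 x \<in> df S' m 0 ` carrier (cx S' m (Suc 0))"
    using S'.exact by metis
  show ?case
  proof (intro exI[of _ m0] conjI allI impI m0(1))
    fix n u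
    assume u: "\<forall>k\<le>0. lin R (cx S n k) (cx S' m0 k) (u k)"
      "\<forall>x\<in>carrier (cx S n 0). aug S' m0 (u 0 x) = \<zero>\<^bsub>A m0\<^esub>"
    then have ul: "lin R (cx S n 0) (cx S' m0 0) (u 0)" by simp
    have im: "tr S' m m0 0 (u 0 x) \<in> df S' m 0 ` carrier (cx S' m (Suc 0))" if "x \<in> carrier (cx S n 0)" for x
      using that u(2) S.lin_rules(1)[OF ul] by (intro m0(2)) (auto simp: aug_cycle_def)
    obtain s where s: "lin R (cx S n 0) (cx S' m (Suc 0)) s"
      "\<forall>x\<in>carrier (cx S n 0). df S' m 0 (s x) = tr S' m m0 0 (u 0 x)"
      using S.lift[OF S'.cx_module S'.cx_module lin_comp[OF ul S'.tr_lin[OF m0(1)]] S'.df_lin im] by blast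
    then show "\<exists>s. (\<forall>k\<le>0. lin R (cx S n k) (cx S' m (Suc k)) (s k)) \<and>
      (\<forall>k\<le>0. \<forall>x\<in>carrier (cx S n k). tr S' m m0 k (u k x) =
        df S' m k (s k x) \<oplus>\<^bsub>cx S' m k\<^esub> (case k of 0 \<Rightarrow> \<zero>\<^bsub>cx S' m k\<^esub> | Suc j \<Rightarrow> s j (df S n j x)))"
      using S.lin_rules(1)[OF ul] m0(1) by (intro exI[of _ "\<lambda>_. s"]) simp
  qed
next
  case (Suc K)
  obtain m1 where m1: "m1 \<ge> m" "\<And>x. x \<in> carrier (cx S' m1 (Suc K)) \<Longrightarrow> aug_cycle A S' m1 (Suc K) x \<Longrightarrow>
      tr S' m m1 (Suc K) x \<in> df S' m (Suc K) ` carrier (cx S' m (Suc (Suc K)))"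
    using S'.exact by metis
  obtain m0 where m0: "m0 \<ge> m1" and
    IH: "\<And>n u. (\<forall>k\<le>K. lin R (cx S n k) (cx S' m0 k) (u k)) \<Longrightarrow>
    (\<forall>x\<in>carrier (cx S n 0). aug S' m0 (u 0 x) = \<zero>\<^bsub>A m0\<^esub>) \<Longrightarrow>
    (\<forall>k<K. \<forall>x\<in>carrier (cx S n (Suc k)). df S' m0 k (u (Suc k) x) = u k (df S n k x)) \<Longrightarrow>
    (\<exists>s. (\<forall>k\<le>K. lin R (cx S n k) (cx S' m1 (Suc k)) (s k)) \<and>
      (\<forall>k\<le>K. \<forall>x\<in>carrier (cx S n k). tr S' m1 m0 k (u k x) =
        df S' m1 k (s k x) \<oplus>\<^bsub>cx S' m1 k\<^esub> (case k of 0 \<Rightarrow> \<zero>\<^bsub>cx S' m1 k\<^esub> | Suc j \<Rightarrow> s j (df S n j x))))"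
    using Suc.IH[of m1] by blast
  show ?case
  proof (intro exI[of _ m0] conjI allI impI)
    show "m \<le> m0" using m0 m1 by simp
    fix n u
    assume u: "\<forall>k\<le>Suc K. lin R (cx S n k) (cx S' m0 k) (u k)"
      "\<forall>x\<in>carrier (cx S n 0). aug S' m0 (u 0 x) = \<zero>\<^bsub>A m0\<^esub>"
      "\<forall>k<Suc K. \<forall>x\<in>carrier (cx S n (Suc k)). df S' m0 k (u (Suc k) x) = u k (df S n k x)"
    have u': "\<forall>k\<le>K. lin R (cx S n k) (cx S' m0 k) (u k)"
      "\<forall>k<K. \<forall>x\<in>carrier (cx S n (Suc k)). df S' m0 k (u (Suc k) x) = u k (df S n k x)"
      using u(1,3) by simp_all
    obtain s where s0: "\<forall>k\<le>K. lin R (cx S n k) (cx S' m1 (Suc k)) (s k)"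
      and hs0: "\<forall>k\<le>K. \<forall>x\<in>carrier (cx S n k). tr S' m1 m0 k (u k x) =
        df S' m1 k (s k x) \<oplus>\<^bsub>cx S' m1 k\<^esub> (case k of 0 \<Rightarrow> \<zero>\<^bsub>cx S' m1 k\<^esub> | Suc j \<Rightarrow> s j (df S n j x))"
      using IH[OF u'(1) u(2) u'(2)] by blast
    note s = s0[rule_format] and hs = hs0[rule_format]
    have ul: "lin R (cx S n k) (cx S' m0 k) (u k)" if "k \<le> Suc K" for k using u(1) that by blast
    have uc: "u k x \<in> carrier (cx S' m0 k)" if "k \<le> Suc K" "x \<in> carrier (cx S n k)" for k x
      using S.lin_rules(1)[OF ul[OF that(1)] that(2)] .
    have sc: "s k x \<in> carrier (cx S' m1 (Suc k))" if "k \<le> K" "x \<in> carrier (cx S n k)" for k x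
      using S.lin_rules(1)[OF s[OF that(1)] that(2)] .
    \<comment> \<open>What the homotopy found so far leaves over in degree \<open>K + 1\<close>. It
      is a cycle at index \<open>m1\<close>, hence becomes a boundary at index
      \<open>m\<close>.\<close>
    define w where "w x = tr S' m1 m0 (Suc K) (u (Suc K) x) \<ominus>\<^bsub>cx S' m1 (Suc K)\<^esub> s K (df S n K x)" for x
    have wl: "lin R (cx S n (Suc K)) (cx S' m1 (Suc K)) w"
      unfolding w_def by (intro S.lin_minus S'.cx_module lin_comp[OF ul S'.tr_lin[OF m0]] lin_comp[OF S.df_lin s]) simp_all
    have wz: "df S' m1 K (w x) = \<zero>\<^bsub>cx S' m1 K\<^esub>" if x: "x \<in> carrier (cx S n (Suc K))" for x
    proof -
      have "df S' m1 K (w x) = tr S' m1 m0 K (u K (df S n K x)) \<ominus>\<^bsub>cx S' m1 K\<^esub> df S' m1 K (s K (df S n K x))"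
        unfolding w_def using x u(3) uc sc m0 by (simp add: S.lin_rules(6)[OF S'.df_lin] S'.df_tr)
      also have "tr S' m1 m0 K (u K (df S n K x)) = df S' m1 K (s K (df S n K x))"
        using hs[of K "df S n K x"] x sc[of K] S.df_df S.lin_rules(4)[OF s] by (cases K) auto
      finally show ?thesis using x sc[of K] by simp
    qed
    have im: "tr S' m m1 (Suc K) (w x) \<in> df S' m (Suc K) ` carrier (cx S' m (Suc (Suc K)))"
      if "x \<in> carrier (cx S n (Suc K))" for x
      using that wz S.lin_rules(1)[OF wl] by (intro m1(2)) (auto simp: aug_cycle_def)
    obtain v where v: "lin R (cx S n (Suc K)) (cx S' m (Suc (Suc K))) v"
      "\<forall>x\<in>carrier (cx S n (Suc K)). df S' m (Suc K) (v x) = tr S' m m1 (Suc K) (w x)"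
      using S.lift[OF S'.cx_module S'.cx_module lin_comp[OF wl S'.tr_lin[OF m1(1)]] S'.df_lin im] by blast
    let ?s = "\<lambda>k. if k = Suc K then v else (\<lambda>x. tr S' m m1 (Suc k) (s k x))"
    have A1: "lin R (cx S n k) (cx S' m (Suc k)) (?s k)" if "k \<le> Suc K" for k
      using that v(1) lin_comp[OF s S'.tr_lin[OF m1(1)]] by (auto simp: le_Suc_eq)
    have A2: "tr S' m m0 k (u k x) =
        df S' m k (?s k x) \<oplus>\<^bsub>cx S' m k\<^esub> (case k of 0 \<Rightarrow> \<zero>\<^bsub>cx S' m k\<^esub> | Suc j \<Rightarrow> ?s j (df S n j x))"
      if k: "k \<le> Suc K" and x: "x \<in> carrier (cx S n k)" for k x
    proof (cases "k = Suc K")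
      case True
      have x: "x \<in> carrier (cx S n (Suc K))" using x True by simp
      have "tr S' m1 m0 (Suc K) (u (Suc K) x) = w x \<oplus>\<^bsub>cx S' m1 (Suc K)\<^esub> s K (df S n K x)"
        unfolding w_def using x uc[of "Suc K"] sc[of K] m0 by simp
      then have "tr S' m m1 (Suc K) (tr S' m1 m0 (Suc K) (u (Suc K) x)) =
          tr S' m m1 (Suc K) (w x) \<oplus>\<^bsub>cx S' m (Suc K)\<^esub> tr S' m m1 (Suc K) (s K (df S n K x))"
        using S.lin_rules(2)[OF S'.tr_lin[OF m1(1)]] S.lin_rules(1)[OF wl x] sc[of K] x by simp
      then show ?thesis using True v(2) x m0 m1(1) uc[of "Suc K" x] x by simp
    next
      case False
      then have k: "k \<le> K" using k by simp
      have "tr S' m m0 k (u k x) = tr S' m m1 k (tr S' m1 m0 k (u k x))"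
        using uc[of k x] k x m0 m1(1) by simp
      also have "\<dots> = tr S' m m1 k (df S' m1 k (s k x) \<oplus>\<^bsub>cx S' m1 k\<^esub>
          (case k of 0 \<Rightarrow> \<zero>\<^bsub>cx S' m1 k\<^esub> | Suc j \<Rightarrow> s j (df S n j x)))" using hs[OF k x] by simp
      also have "\<dots> = df S' m k (tr S' m m1 (Suc k) (s k x)) \<oplus>\<^bsub>cx S' m k\<^esub>
          (case k of 0 \<Rightarrow> \<zero>\<^bsub>cx S' m k\<^esub> | Suc j \<Rightarrow> tr S' m m1 (Suc j) (s j (df S n j x)))"
        using sc[OF k x] m1(1) sc[of "k - 1"] k x
        by (cases k) (auto simp: S'.df_tr S.lin_rules(2)[OF S'.tr_lin[OF m1(1)]])
      finally show ?thesis using False k by (auto split: nat.split)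
    qed
    show "\<exists>s. (\<forall>k\<le>Suc K. lin R (cx S n k) (cx S' m (Suc k)) (s k)) \<and>
      (\<forall>k\<le>Suc K. \<forall>x\<in>carrier (cx S n k). tr S' m m0 k (u k x) =
        df S' m k (s k x) \<oplus>\<^bsub>cx S' m k\<^esub> (case k of 0 \<Rightarrow> \<zero>\<^bsub>cx S' m k\<^esub> | Suc j \<Rightarrow> s j (df S n j x)))"
      by (rule exI[of _ ?s], intro conjI allI impI ballI; (rule A1 | rule A2); assumption)
  qed
qed

end

context pro_res_pair
begin

text \<open>The map is required up to degree \<open>K + 1\<close>, because the cocycle condition in
  degree \<open>K\<close> is tested on elements of degree \<open>K + 1\<close>.\<close>

lemma pull_cocyc:
  assumes f: "chmap R a S S' n m (Suc K) f" and h: "cocyc R N S' m K h"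
  shows "cocyc R N S n K (\<lambda>x. h (f K x))"
proof -
  have fl: "lin R (cx S n k) (cx S' m k) (f k)" if "k \<le> Suc K" for k using f that by (simp add: chmap_def)
  have "h (f K (df S n K x)) = \<zero>\<^bsub>N\<^esub>" if x: "x \<in> carrier (cx S n (Suc K))" for x
  proof -
    have "f K (df S n K x) = df S' m K (f (Suc K) x)" using f x by (simp add: chmap_def)
    then show ?thesis using h S.lin_rules(1)[OF fl[of "Suc K"] x] by (simp add: cocyc_def)
  qed
  moreover have "lin R (cx S n K) N (\<lambda>x. h (f K x))"
    by (rule lin_comp[OF fl]) (use h in \<open>simp_all add: cocyc_def\<close>)
  ultimately show ?thesis by (simp add: cocyc_def)
qed

lemma pull_cobd:
  assumes f: "chmap R a S S' n m (Suc K) f" and h: "cobd R N S' m K h"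
  shows "cobd R N S n K (\<lambda>x. h (f K x))"
proof (cases K)
  case 0
  have fl: "lin R (cx S n 0) (cx S' m 0) (f 0)" using f by (simp add: chmap_def)
  then show ?thesis using h 0 S.lin_rules(1)[OF fl] by (simp add: cobd_def)
next
  case (Suc j)
  have fl: "lin R (cx S n k) (cx S' m k) (f k)" if "k \<le> Suc K" for k using f that by (simp add: chmap_def)
  obtain g where g: "lin R (cx S' m j) N g" "\<forall>x\<in>carrier (cx S' m (Suc j)). h x = g (df S' m j x)"
    using h Suc by (auto simp: cobd_def)
  have "h (f K x) = g (f j (df S n j x))" if x: "x \<in> carrier (cx S n (Suc j))" for x
  proof -
    have "df S' m j (f (Suc j) x) = f j (df S n j x)" using f x Suc by (simp add: chmap_def)
    then show ?thesis using g(2) S.lin_rules(1)[OF fl[of "Suc j"] x] Suc by simp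
  qed
  moreover have "lin R (cx S n j) N (\<lambda>x. g (f j x))" by (rule lin_comp[OF fl g(1)]) (simp add: Suc)
  ultimately show ?thesis using Suc by (auto simp: cobd_def)
qed

text \<open>Two chain maps over the same transition differ by a null-homotopic map after passing to
  \<open>m0\<close>, so they pull a cocycle of index \<open>m\<close> back to cohomologous ones. The
  maps may end at different indices \<open>m1\<close> and \<open>m2\<close>, as long as both lie
  beyond \<open>m0\<close>.\<close>

lemma homotopic_cobd:
  assumes N: "module R N"
  shows "\<exists>m0\<ge>m. \<forall>n f g m1 m2 h. m0 \<le> m1 \<longrightarrow> m1 \<le> n \<longrightarrow> m0 \<le> m2 \<longrightarrow> m2 \<le> n \<longrightarrow>
    chmap R a S S' n m1 (Suc K) f \<longrightarrow> chmap R a S S' n m2 (Suc K) g \<longrightarrow> cocyc R N S' m K h \<longrightarrow>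
    cobd R N S n K (\<lambda>x. h (tr S' m m1 K (f K x)) \<ominus>\<^bsub>N\<^esub> h (tr S' m m2 K (g K x)))"
proof -
  obtain m0 where m0: "m0 \<ge> m" and H: "\<forall>n u. (\<forall>k\<le>K. lin R (cx S n k) (cx S' m0 k) (u k)) \<longrightarrow>
    (\<forall>x\<in>carrier (cx S n 0). aug S' m0 (u 0 x) = \<zero>\<^bsub>A m0\<^esub>) \<longrightarrow>
    (\<forall>k<K. \<forall>x\<in>carrier (cx S n (Suc k)). df S' m0 k (u (Suc k) x) = u k (df S n k x)) \<longrightarrow>
    (\<exists>s. (\<forall>k\<le>K. lin R (cx S n k) (cx S' m (Suc k)) (s k)) \<and>
      (\<forall>k\<le>K. \<forall>x\<in>carrier (cx S n k). tr S' m m0 k (u k x) =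
        df S' m k (s k x) \<oplus>\<^bsub>cx S' m k\<^esub> (case k of 0 \<Rightarrow> \<zero>\<^bsub>cx S' m k\<^esub> | Suc j \<Rightarrow> s j (df S n j x))))"
    using homotopy_exists[of m K] by blast
  show ?thesis
  proof (intro exI[of _ m0] conjI m0 allI impI)
    fix n f g m1 m2 h
    assume m1: "m0 \<le> m1" "m1 \<le> n" and m2: "m0 \<le> m2" "m2 \<le> n"
      and f: "chmap R a S S' n m1 (Suc K) f" and g: "chmap R a S S' n m2 (Suc K) g" and h: "cocyc R N S' m K h"
    have fl: "lin R (cx S n k) (cx S' m1 k) (f k)" if "k \<le> K" for k using f that by (simp add: chmap_def)
    have gl: "lin R (cx S n k) (cx S' m2 k) (g k)" if "k \<le> K" for k using g that by (simp add: chmap_def)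
    have fc: "f k x \<in> carrier (cx S' m1 k)" if "k \<le> Suc K" "x \<in> carrier (cx S n k)" for k x
      using f that S.lin_rules(1)[of "cx S n k" "cx S' m1 k" "f k"] by (simp add: chmap_def)
    have gc: "g k x \<in> carrier (cx S' m2 k)" if "k \<le> Suc K" "x \<in> carrier (cx S n k)" for k x
      using g that S.lin_rules(1)[of "cx S n k" "cx S' m2 k" "g k"] by (simp add: chmap_def)
    \<comment> \<open>At the common index \<open>m0\<close> the two maps become comparable, and
      their difference has augmentation zero.\<close>
    define u where "u k x = tr S' m0 m1 k (f k x) \<ominus>\<^bsub>cx S' m0 k\<^esub> tr S' m0 m2 k (g k x)" for k x
    have 1: "\<forall>k\<le>K. lin R (cx S n k) (cx S' m0 k) (u k)"
      unfolding u_def using S.lin_minus[OF S'.cx_module lin_comp[OF fl S'.tr_lin[OF m1(1)]] lin_comp[OF gl S'.tr_lin[OF m2(1)]]]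
      by blast
    have 2: "\<forall>x\<in>carrier (cx S n 0). aug S' m0 (u 0 x) = \<zero>\<^bsub>A m0\<^esub>"
    proof
      fix x assume x: "x \<in> carrier (cx S n 0)"
      have "aug S' m0 (tr S' m0 m1 0 (f 0 x)) = a m0 n (aug S n x)"
        using m1 x f fc[of 0 x] by (simp add: S'.aug_tr chmap_def S.a_a)
      moreover have "aug S' m0 (tr S' m0 m2 0 (g 0 x)) = a m0 n (aug S n x)"
        using m2 x g gc[of 0 x] by (simp add: S'.aug_tr chmap_def S.a_a)
      moreover have "a m0 n (aug S n x) \<in> carrier (A m0)"
        using S.lin_rules(1)[OF S.a_lin[of m0 n]] x m1 by simp
      ultimately show "aug S' m0 (u 0 x) = \<zero>\<^bsub>A m0\<^esub>"
        unfolding u_def using x m1 m2 fc[of 0 x] gc[of 0 x] by (simp add: S.lin_rules(6)[OF S'.aug_lin])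
    qed
    have 3: "\<forall>k<K. \<forall>x\<in>carrier (cx S n (Suc k)). df S' m0 k (u (Suc k) x) = u k (df S n k x)"
      unfolding u_def using f g fc gc m1 m2 by (simp add: S.lin_rules(6)[OF S'.df_lin] S'.df_tr chmap_def)
    obtain s where s0: "\<forall>k\<le>K. lin R (cx S n k) (cx S' m (Suc k)) (s k)"
      and hs0: "\<forall>k\<le>K. \<forall>x\<in>carrier (cx S n k). tr S' m m0 k (u k x) =
        df S' m k (s k x) \<oplus>\<^bsub>cx S' m k\<^esub> (case k of 0 \<Rightarrow> \<zero>\<^bsub>cx S' m k\<^esub> | Suc j \<Rightarrow> s j (df S n j x))"
      using H[rule_format, OF 1[rule_format] 2[rule_format] 3[rule_format]] by blast
    note s = s0[rule_format] and hs = hs0[rule_format]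
    have hl: "lin R (cx S' m K) N h" and hz: "\<And>y. y \<in> carrier (cx S' m (Suc K)) \<Longrightarrow> h (df S' m K y) = \<zero>\<^bsub>N\<^esub>"
      using h by (auto simp: cocyc_def)
    note hr = S.lin_rules[OF hl]
    have eq: "h (tr S' m m1 K (f K x)) \<ominus>\<^bsub>N\<^esub> h (tr S' m m2 K (g K x)) =
        h (case K of 0 \<Rightarrow> \<zero>\<^bsub>cx S' m K\<^esub> | Suc j \<Rightarrow> s j (df S n j x))" if x: "x \<in> carrier (cx S n K)" for x
    proof -
      have sc: "s K x \<in> carrier (cx S' m (Suc K))" using S.lin_rules(1)[OF s x] by simp
      have cc: "(case K of 0 \<Rightarrow> \<zero>\<^bsub>cx S' m K\<^esub> | Suc j \<Rightarrow> s j (df S n j x)) \<in> carrier (cx S' m K)"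
        using x S.lin_rules(1)[OF s] by (cases K) auto
      have "h (tr S' m m1 K (f K x)) \<ominus>\<^bsub>N\<^esub> h (tr S' m m2 K (g K x)) = h (tr S' m m0 K (u K x))"
        using m0 m1 m2 x fc[of K x] gc[of K x] N unfolding u_def
        by (simp add: S.lin_rules(6)[OF S'.tr_lin[OF m0]] hr(6))
      also have "\<dots> = h (df S' m K (s K x)) \<oplus>\<^bsub>N\<^esub> h (case K of 0 \<Rightarrow> \<zero>\<^bsub>cx S' m K\<^esub> | Suc j \<Rightarrow> s j (df S n j x))"
        using hs[OF _ x] hr(2) sc cc by simp
      also have "\<dots> = h (case K of 0 \<Rightarrow> \<zero>\<^bsub>cx S' m K\<^esub> | Suc j \<Rightarrow> s j (df S n j x))"
        using hz[OF sc] N hr(1)[OF cc] by simp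
      finally show ?thesis .
    qed
    show "cobd R N S n K (\<lambda>x. h (tr S' m m1 K (f K x)) \<ominus>\<^bsub>N\<^esub> h (tr S' m m2 K (g K x)))"
    proof (cases K)
      case 0
      then show ?thesis using eq hr(4) N by (simp add: cobd_def)
    next
      case (Suc j)
      have "lin R (cx S n j) N (\<lambda>y. h (s j y))" using lin_comp[OF s[of j]] hl Suc by simp
      then show ?thesis using eq Suc by (auto simp: cobd_def)
    qed
  qed
qed

end

lemma pro_res_pairI: "pro_res R S A a \<Longrightarrow> pro_res R S' A a \<Longrightarrow> pro_res_pair R S S' A a"
  by (simp add: pro_res_pair_def)

text \<open>The colimit of cohomology depends only on the system \<open>A\<close> and not on its
  pro-resolution. Chain maps in both directions exist up to degree \<open>K + 1\<close>, and their
  composites are homotopic to transition maps, which become identities in the colimit.\<close>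

theorem presents_transfer:
  assumes S: "pro_res R S A a" and S': "pro_res R S' A a" and N: "module R N" and H: "module R H"
    and P: "presents R N S K H \<phi>"
  shows "\<exists>\<psi>. presents R N S' K H \<psi>"
proof -
  interpret S: pro_res R S A a by fact
  interpret S': pro_res R S' A a by fact
  interpret SS': pro_res_pair R S S' A a using S S' by (rule pro_res_pairI)
  interpret S'S: pro_res_pair R S' S A a using S' S by (rule pro_res_pairI)
  interpret SS: pro_res_pair R S S A a using S S by (rule pro_res_pairI)
  interpret S'S': pro_res_pair R S' S' A a using S' S' by (rule pro_res_pairI)
  note Pr = S.presents_rules[OF P N H]
  define hom1 where "hom1 m m0 \<longleftrightarrow> (\<forall>n f g m1 m2 h. m0 \<le> m1 \<longrightarrow> m1 \<le> n \<longrightarrow> m0 \<le> m2 \<longrightarrow> m2 \<le> n \<longrightarrow>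
    chmap R a S S' n m1 (Suc K) f \<longrightarrow> chmap R a S S' n m2 (Suc K) g \<longrightarrow> cocyc R N S' m K h \<longrightarrow>
    cobd R N S n K (\<lambda>x. h (tr S' m m1 K (f K x)) \<ominus>\<^bsub>N\<^esub> h (tr S' m m2 K (g K x))))" for m m0
  define hom2 where "hom2 m m0 \<longleftrightarrow> (\<forall>n f g m1 m2 h. m0 \<le> m1 \<longrightarrow> m1 \<le> n \<longrightarrow> m0 \<le> m2 \<longrightarrow> m2 \<le> n \<longrightarrow>
    chmap R a S' S' n m1 (Suc K) f \<longrightarrow> chmap R a S' S' n m2 (Suc K) g \<longrightarrow> cocyc R N S' m K h \<longrightarrow>
    cobd R N S' n K (\<lambda>x. h (tr S' m m1 K (f K x)) \<ominus>\<^bsub>N\<^esub> h (tr S' m m2 K (g K x))))" for m m0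
  have "\<exists>m0\<ge>m. hom1 m m0 \<and> hom2 m m0" for m
  proof -
    obtain m1 where m1: "m1 \<ge> m" "hom1 m m1" using SS'.homotopic_cobd[OF N, of m K] unfolding hom1_def by blast
    obtain m2 where m2: "m2 \<ge> m" "hom2 m m2" using S'S'.homotopic_cobd[OF N, of m K] unfolding hom2_def by blast
    have "hom1 m (max m1 m2)" using m1(2) unfolding hom1_def by simp
    moreover have "hom2 m (max m1 m2)" using m2(2) unfolding hom2_def by simp
    ultimately show ?thesis using m1(1) by (intro exI[of _ "max m1 m2"]) simp
  qed
  \<comment> \<open>From the index \<open>\<mu> m\<close> on, any two chain maps induce the same
    class on a cocycle of index \<open>m\<close>, for maps out of \<open>S\<close> as well as out of
    \<open>S'\<close>.\<close>
  then obtain \<mu> where \<mu>: "\<And>m. m \<le> \<mu> m" and h1: "\<And>m. hom1 m (\<mu> m)" and h2: "\<And>m. hom2 m (\<mu> m)" by metis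
  have h1: "cobd R N S n K (\<lambda>x. h (tr S' m m1 K (f K x)) \<ominus>\<^bsub>N\<^esub> h (tr S' m m2 K (g K x)))"
    if "\<mu> m \<le> m1" "m1 \<le> n" "\<mu> m \<le> m2" "m2 \<le> n" "chmap R a S S' n m1 (Suc K) f"
      "chmap R a S S' n m2 (Suc K) g" "cocyc R N S' m K h" for n f g m m1 m2 h
    using h1[of m] that unfolding hom1_def by blast
  have h2: "cobd R N S' n K (\<lambda>x. h (tr S' m m1 K (f K x)) \<ominus>\<^bsub>N\<^esub> h (tr S' m m2 K (g K x)))"
    if "\<mu> m \<le> m1" "m1 \<le> n" "\<mu> m \<le> m2" "m2 \<le> n" "chmap R a S' S' n m1 (Suc K) f"
      "chmap R a S' S' n m2 (Suc K) g" "cocyc R N S' m K h" for n f g m m1 m2 h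
    using h2[of m] that unfolding hom2_def by blast
  have "\<forall>m. \<exists>n g. \<mu> m \<le> n \<and> chmap R a S S' n (\<mu> m) (Suc K) g"
    using SS'.chmap_exists by (meson order_refl)
  then obtain \<eta> G where G: "\<And>m. \<mu> m \<le> \<eta> m" "\<And>m. chmap R a S S' (\<eta> m) (\<mu> m) (Suc K) (G m)" by metis
  \<comment> \<open>A cocycle of index \<open>m\<close> is moved up to \<open>\<mu> m\<close> before
    it is pulled back; this makes its class independent of the chosen map
    \<open>G m\<close>.\<close>
  define \<psi> where "\<psi> m h = \<phi> (\<eta> m) (\<lambda>x. h (tr S' m (\<mu> m) K (G m K x)))" for m h
  have comp: "chmap R a S S' n' m (Suc K) (\<lambda>k x. f k (tr S n n' k x))"
    if "chmap R a S S' n m (Suc K) f" "n \<le> n'" "m \<le> n" for n n' m f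
    by (rule S.chmap_comp[of a S S n' n "Suc K" "tr S n n'" S' m f A, OF S.tr_chmap[OF that(2)] that(1) S.a_a[OF that(3,2)] S.aug_lin S.df_lin])
  have cc: "cocyc R N S n K (\<lambda>x. h (tr S' m m' K (f K x)))"
    if "chmap R a S S' n m' (Suc K) f" "m \<le> m'" "cocyc R N S' m K h" for n m m' f h
    using SS'.pull_cocyc[OF that(1) S'.cocyc_tr[OF that(3,2)]] .
  \<comment> \<open>Both maps are precomposed with transitions to a common source index
    \<open>q\<close>, where \<open>h1\<close> compares them.\<close>
  have indep: "\<phi> n (\<lambda>x. h (tr S' m m' K (f K x))) = \<psi> m h"
    if f: "chmap R a S S' n m' (Suc K) f" and m': "\<mu> m \<le> m'" "m' \<le> n" and h: "cocyc R N S' m K h" for n m m' f h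
  proof -
    define q where "q = max n (\<eta> m)"
    have q: "n \<le> q" "\<eta> m \<le> q" by (auto simp: q_def)
    have mm: "m \<le> m'" using \<mu>[of m] m' by simp
    have cf: "chmap R a S S' q m' (Suc K) (\<lambda>k x. f k (tr S n q k x))" by (rule comp[OF f q(1) m'(2)])
    have cg: "chmap R a S S' q (\<mu> m) (Suc K) (\<lambda>k x. G m k (tr S (\<eta> m) q k x))"
      by (rule comp[OF G(2) q(2) G(1)])
    have "\<phi> n (\<lambda>x. h (tr S' m m' K (f K x))) = \<phi> q (\<lambda>x. h (tr S' m m' K (f K (tr S n q K x))))"
      using Pr(5)[OF cc[OF f mm h] q(1)] by simp
    also have "\<dots> = \<phi> q (\<lambda>x. h (tr S' m (\<mu> m) K (G m K (tr S (\<eta> m) q K x))))"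
      by (rule Pr(8)[OF cc[OF cf mm h] cc[OF cg \<mu> h] h1[OF _ _ _ _ cf cg h]])
        (use m' q G(1)[of m] in auto)
    also have "\<dots> = \<psi> m h" unfolding \<psi>_def using Pr(5)[OF cc[OF G(2) \<mu> h] q(2)] by simp
    finally show ?thesis .
  qed
  have compat: "\<psi> n (\<lambda>x. h (tr S' m n K x)) = \<psi> m h" if h: "cocyc R N S' m K h" and mn: "m \<le> n" for m n h
  proof -
    define m' where "m' = max (\<mu> m) (\<mu> n)"
    have m': "\<mu> m \<le> m'" "\<mu> n \<le> m'" by (auto simp: m'_def)
    obtain q f where f: "m' \<le> q" "chmap R a S S' q m' (Suc K) f" using SS'.chmap_exists by (meson order_refl)
    have fl: "lin R (cx S q K) (cx S' m' K) (f K)" using f by (simp add: chmap_def)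
    have "\<psi> n (\<lambda>x. h (tr S' m n K x)) = \<phi> q (\<lambda>x. h (tr S' m n K (tr S' n m' K (f K x))))"
      using indep[OF f(2) m'(2) f(1) S'.cocyc_tr[OF h mn]] by simp
    also have "\<dots> = \<phi> q (\<lambda>x. h (tr S' m m' K (f K x)))"
      using mn \<mu>[of n] m' S.lin_rules(1)[OF fl]
      by (intro Pr(2) SS'.pull_cocyc[OF f(2)] S'.cocyc_tr[OF S'.cocyc_tr[OF h mn]]) auto
    also have "\<dots> = \<psi> m h" by (rule indep[OF f(2) m'(1) f(1) h])
    finally show ?thesis .
  qed
  have zero: "\<psi> m h = \<zero>\<^bsub>H\<^esub>" if h: "cobd R N S' m K h" for m h
    unfolding \<psi>_def
    by (rule Pr(7)) (use SS'.pull_cocyc[OF G(2) S'.cocyc_tr[OF S'.cobd_cocyc[OF N h] \<mu>]]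
      SS'.pull_cobd[OF G(2) S'.cobd_tr[OF N h \<mu>]] in auto)
  show ?thesis
    unfolding presents_def
  proof (intro exI[of _ \<psi>] conjI allI impI ballI)
    fix m h assume h: "cocyc R N S' m K h"
    show "\<psi> m h \<in> carrier H" unfolding \<psi>_def by (rule Pr(1)[OF cc[OF G(2) \<mu> h]])
    have Gl: "lin R (cx S (\<eta> m) K) (cx S' (\<mu> m) K) (G m K)" using G(2)[of m] by (simp add: chmap_def)
    show "\<psi> m h = \<psi> m h'" if "\<forall>x\<in>carrier (cx S' m K). h x = h' x" for h'
      unfolding \<psi>_def using that \<mu>[of m] S.lin_rules(1)[OF Gl] by (intro Pr(2)[OF cc[OF G(2) \<mu> h]]) simp
    show "\<psi> m (\<lambda>x. h x \<oplus>\<^bsub>N\<^esub> h' x) = \<psi> m h \<oplus>\<^bsub>H\<^esub> \<psi> m h'" if "cocyc R N S' m K h'" for h'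
      unfolding \<psi>_def by (rule Pr(3)[OF cc[OF G(2) \<mu> h] cc[OF G(2) \<mu> that]])
    show "\<psi> m (\<lambda>x. c \<odot>\<^bsub>N\<^esub> h x) = c \<odot>\<^bsub>H\<^esub> \<psi> m h" if "c \<in> carrier R" for c
      unfolding \<psi>_def by (rule Pr(4)[OF cc[OF G(2) \<mu> h] that])
    show "\<psi> n (\<lambda>x. h (tr S' m n K x)) = \<psi> m h" if "m \<le> n" for n by (rule compat[OF h that])
    show "\<psi> m h = \<zero>\<^bsub>H\<^esub> \<longleftrightarrow> (\<exists>n\<ge>m. cobd R N S' n K (\<lambda>x. h (tr S' m n K x)))"
    proof
      assume "\<exists>n\<ge>m. cobd R N S' n K (\<lambda>x. h (tr S' m n K x))"
      then obtain n where n: "n \<ge> m" "cobd R N S' n K (\<lambda>x. h (tr S' m n K x))" by blast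
      show "\<psi> m h = \<zero>\<^bsub>H\<^esub>" using zero[OF n(2)] compat[OF h n(1)] by simp
    next
      assume "\<psi> m h = \<zero>\<^bsub>H\<^esub>"
      then obtain n where n: "n \<ge> \<eta> m" and cn: "cobd R N S n K (\<lambda>x. h (tr S' m (\<mu> m) K (G m K (tr S (\<eta> m) n K x))))"
        unfolding \<psi>_def using Pr(6)[OF cc[OF G(2) \<mu> h]] by blast
      \<comment> \<open>A map from \<open>S'\<close> back into \<open>S\<close> turns the coboundary
        on \<open>S\<close> into one on \<open>S'\<close>; \<open>h2\<close> then compares the round
        trip with the transition map of \<open>S'\<close>.\<close>
      obtain q b where q: "n \<le> q" "chmap R a S' S q n (Suc K) b" using S'S.chmap_exists by (meson order_refl)
      have mn: "\<mu> m \<le> n" using G(1)[of m] n by simp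
      have c1: "chmap R a S S' n (\<mu> m) (Suc K) (\<lambda>k x. G m k (tr S (\<eta> m) n k x))"
        by (rule comp[OF G(2) n G(1)])
      have c2: "chmap R a S' S' q (\<mu> m) (Suc K) (\<lambda>k x. G m k (tr S (\<eta> m) n k (b k x)))"
        by (rule S.chmap_comp[of a S' S q n "Suc K" b S' "\<mu> m" "\<lambda>k x. G m k (tr S (\<eta> m) n k x)" A,
            OF q(2) c1 S.a_a[OF mn q(1)] S'.aug_lin S'.df_lin])
      have c3: "chmap R a S' S' q (\<mu> m) (Suc K) (tr S' (\<mu> m) q)" using mn q by (intro S'.tr_chmap) simp
      have "cobd R N S' q K (\<lambda>x. h (tr S' m (\<mu> m) K (tr S' (\<mu> m) q K x)) \<ominus>\<^bsub>N\<^esub>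
          h (tr S' m (\<mu> m) K (G m K (tr S (\<eta> m) n K (b K x)))))"
        by (rule h2[OF _ _ _ _ c3 c2 h]) (use mn q in auto)
      moreover have "cobd R N S' q K (\<lambda>x. h (tr S' m (\<mu> m) K (G m K (tr S (\<eta> m) n K (b K x)))))"
        by (rule S'S.pull_cobd[OF q(2) cn])
      ultimately have c4: "cobd R N S' q K (\<lambda>x. (h (tr S' m (\<mu> m) K (tr S' (\<mu> m) q K x)) \<ominus>\<^bsub>N\<^esub>
          h (tr S' m (\<mu> m) K (G m K (tr S (\<eta> m) n K (b K x))))) \<oplus>\<^bsub>N\<^esub>
          h (tr S' m (\<mu> m) K (G m K (tr S (\<eta> m) n K (b K x)))))"
        by (rule S'.cobd_add[OF N])
      have hl: "lin R (cx S' m K) N h" using h by (simp add: cocyc_def)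
      have c2l: "lin R (cx S' q K) (cx S' (\<mu> m) K) (\<lambda>x. G m K (tr S (\<eta> m) n K (b K x)))"
        using c2 by (simp add: chmap_def)
      have "cobd R N S' q K (\<lambda>x. h (tr S' m q K x))"
        by (rule S'.cobd_cong[THEN iffD1, OF _ c4])
          (use mn q \<mu>[of m] N S.lin_rules(1)[OF hl] S.lin_rules(1)[OF c2l] in simp)
      then show "\<exists>n\<ge>m. cobd R N S' n K (\<lambda>x. h (tr S' m n K x))" using mn q \<mu>[of m] by (intro exI[of _ q]) simp
    qed
  next
    fix y assume "y \<in> carrier H"
    then obtain n z where z: "cocyc R N S n K z" "\<phi> n z = y" by (rule S.presents_surj[OF P])
    \<comment> \<open>For surjectivity the round trip starts at \<open>S\<close>: the cocycle
      \<open>z\<close> is pulled back to \<open>S'\<close>, and the comparison on \<open>S\<close>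
      shows that its class comes back unchanged.\<close>
    obtain \<nu> where \<nu>: "\<nu> \<ge> n" and h3: "\<forall>q f g m1 m2 h. \<nu> \<le> m1 \<longrightarrow> m1 \<le> q \<longrightarrow> \<nu> \<le> m2 \<longrightarrow> m2 \<le> q \<longrightarrow>
      chmap R a S S q m1 (Suc K) f \<longrightarrow> chmap R a S S q m2 (Suc K) g \<longrightarrow> cocyc R N S n K h \<longrightarrow>
      cobd R N S q K (\<lambda>x. h (tr S n m1 K (f K x)) \<ominus>\<^bsub>N\<^esub> h (tr S n m2 K (g K x)))"
      using SS.homotopic_cobd[OF N, of n K] by blast
    obtain m b where m: "\<nu> \<le> m" "chmap R a S' S m \<nu> (Suc K) b" using S'S.chmap_exists by (meson order_refl)
    define h where "h x = z (tr S n \<nu> K (b K x))" for x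
    have h: "cocyc R N S' m K h"
      unfolding h_def by (rule S'S.pull_cocyc[OF m(2) S.cocyc_tr[OF z(1) \<nu>]])
    have c1: "chmap R a S S' (\<eta> m) m (Suc K) (\<lambda>k x. tr S' m (\<mu> m) k (G m k x))"
      by (rule S.chmap_comp[of a S S' "\<eta> m" "\<mu> m" "Suc K" "G m" S' m "tr S' m (\<mu> m)" A,
          OF G(2) S'.tr_chmap[OF \<mu>] S.a_a[OF \<mu> G(1)] S.aug_lin S.df_lin])
    have me: "m \<le> \<eta> m" using \<mu>[of m] G(1)[of m] by simp
    have c2: "chmap R a S S (\<eta> m) \<nu> (Suc K) (\<lambda>k x. b k (tr S' m (\<mu> m) k (G m k x)))"
      by (rule S.chmap_comp[of a S S' "\<eta> m" m "Suc K" "\<lambda>k x. tr S' m (\<mu> m) k (G m k x)" S \<nu> b A,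
          OF c1 m(2) S.a_a[OF m(1) me] S.aug_lin S.df_lin])
    have c3: "chmap R a S S (\<eta> m) \<nu> (Suc K) (tr S \<nu> (\<eta> m))" using me m by (intro S.tr_chmap) simp
    have me': "\<nu> \<le> \<eta> m" "n \<le> \<eta> m" using me m \<nu> by auto
    have "\<psi> m h = \<phi> (\<eta> m) (\<lambda>x. z (tr S n \<nu> K (b K (tr S' m (\<mu> m) K (G m K x)))))"
      by (simp add: \<psi>_def h_def)
    also have "\<dots> = \<phi> (\<eta> m) (\<lambda>x. z (tr S n \<nu> K (tr S \<nu> (\<eta> m) K x)))"
      by (rule Pr(8)[OF SS.pull_cocyc[OF c2 S.cocyc_tr[OF z(1) \<nu>]] SS.pull_cocyc[OF c3 S.cocyc_tr[OF z(1) \<nu>]]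
        h3[rule_format, OF _ _ _ _ c2 c3 z(1)]]) (use me' in auto)
    also have "\<dots> = \<phi> (\<eta> m) (\<lambda>x. z (tr S n (\<eta> m) K x))"
      by (rule Pr(2)[OF SS.pull_cocyc[OF c3 S.cocyc_tr[OF z(1) \<nu>]]]) (use me' \<nu> in simp)
    also have "\<dots> = y" using Pr(5)[OF z(1) me'(2)] z(2) by simp
    finally show "\<exists>m h. cocyc R N S' m K h \<and> \<psi> m h = y" using h by blast
  qed
qed

section \<open>Free covers inside one type of generators; Ext as the cohomology of a constant
  system\<close>

section \<open>Existence of resolutions\<close>

context modules
begin

text \<open>The identity of \<open>P\<close> lifts through the free module on
  \<open>carrier P\<close>, so any index type can be traded for the one that
  \<open>projective\<close> demands.\<close>

lemma retract_free_projective: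
  fixes P :: "('a, 'c, 'm) module_scheme"
  assumes P: "module R P" and X: "retract_free R P X"
  shows "projective R P"
proof -
  let ?F = "free_module R (carrier P)"
  have q: "lin R ?F P (free_map R (carrier P) P (\<lambda>x. x))" using P by (intro free_map_lin) auto
  have "x \<in> free_map R (carrier P) P (\<lambda>x. x) ` carrier ?F" if "x \<in> carrier P" for x
    using free_map_basis[OF P, of "carrier P" "\<lambda>x. x" x] that free_basis_carrier[OF that]
    by (intro image_eqI[of _ _ "free_basis R (carrier P) x"]) auto
  then obtain s where "lin R P ?F s" "\<And>x. x \<in> carrier P \<Longrightarrow> free_map R (carrier P) P (\<lambda>x. x) (s x) = x"
    using retract_free_lift[OF P X free_module_module P lin_id q] by metis
  then have "retract_free R P (carrier P)" using q by (auto simp: retract_free_def)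
  then show ?thesis using P projective_retract by blast
qed

lemma free_projective: "projective R (free_module R X)"
  by (rule retract_free_projective[OF free_module_module free_retract])

lemma free_map_image:
  assumes N: "module R N" and K: "submodule K R N" and u: "u ` X = K"
  shows "free_map R X N u ` carrier (free_module R X) = K"
proof
  have uN: "u x \<in> carrier N" if "x \<in> X" for x using u that submodule_rules(1)[OF K N] by auto
  have L: "lin R (free_module R X) N (free_map R X N u)" by (rule free_map_lin[OF N uN])
  note S = submodule_rules[OF K N] and Lr = lin_rules[OF L]
  have sub: "submodule {z \<in> carrier (free_module R X). free_map R X N u z \<in> K} R (free_module R X)"
    unfolding submodule_iff[OF free_module_module] using S Lr(2,3,4) N by auto
  show "free_map R X N u ` carrier (free_module R X) \<subseteq> K"
  proof
    fix y assume "y \<in> free_map R X N u ` carrier (free_module R X)"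
    then obtain z where z: "z \<in> carrier (free_module R X)" "y = free_map R X N u z" by auto
    have "z \<in> {z \<in> carrier (free_module R X). free_map R X N u z \<in> K}"
      by (rule free_induct[OF z(1) sub]) (use u free_map_basis[OF N, of X u] uN in auto)
    then show "y \<in> K" using z by simp
  qed
  show "K \<subseteq> free_map R X N u ` carrier (free_module R X)"
  proof
    fix y assume "y \<in> K"
    then obtain x where x: "x \<in> X" "y = u x" using u by auto
    then show "y \<in> free_map R X N u ` carrier (free_module R X)"
      using free_map_basis[OF N, of X u x] uN by (intro image_eqI[of _ _ "free_basis R X x"]) auto
  qed
qed

text \<open>An element is determined by the finite set of pairs of coefficient and generator over
  its support, and \<open>Lin\<close> turns a list of these pairs into a generator.\<close>

lemma ex_generator_code:
  "\<exists>c :: ('a, 'c) res_elt \<Rightarrow> ('a, 'c) generator. inj_on c (carrier (free_module R X))"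
proof -
  let ?s = "\<lambda>k :: ('a, 'c) res_elt. (\<lambda>x. (k x, x)) ` {x \<in> X. k x \<noteq> \<zero>}"
  define c where "c k = Lin (SOME l. set l = ?s k)" for k
  have fin: "finite (?s k)" if "k \<in> carrier (free_module R X)" for k
    using that by (auto simp: free_module_def direct_sum_simps)
  have "k = k'" if k: "k \<in> carrier (free_module R X)" "k' \<in> carrier (free_module R X)" and c: "c k = c k'" for k k'
  proof -
    have S: "set (SOME l. set l = ?s k) = ?s k" if "k \<in> carrier (free_module R X)" for k
      using someI_ex[OF finite_list[OF fin[OF that]]] .
    have "(SOME l. set l = ?s k) = (SOME l. set l = ?s k')" using c by (simp add: c_def)
    from arg_cong[OF this, of set] have s: "?s k = ?s k'" unfolding S[OF k(1)] S[OF k(2)] .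
    show ?thesis
    proof (rule direct_sum_eqI[of k X "\<lambda>_. ring_module R"])
      fix x assume x: "x \<in> X"
      have "k x = \<zero> \<longleftrightarrow> x \<notin> snd ` ?s k" "k' x = \<zero> \<longleftrightarrow> x \<notin> snd ` ?s k'" using x by (simp_all add: image_image)
      moreover have "k x = k' x" if "k x \<noteq> \<zero>"
      proof -
        have "(k x, x) \<in> ?s k'" using that x unfolding s[symmetric] by auto
        then show ?thesis by auto
      qed
      ultimately show "k x = k' x" unfolding s by (cases "k x = \<zero>") simp_all
    qed (use k in \<open>simp_all add: free_module_def\<close>)
  qed
  then show ?thesis by (auto simp: inj_on_def)
qed

text \<open>The generators of the cover are the codes of the elements of \<open>K\<close>, so the
  construction can be iterated without leaving the type.\<close>

lemma ex_free_cover: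
  fixes X :: "('a, 'c) generator set"
  assumes "submodule K R (free_module R X)"
  shows "\<exists>(Y :: ('a, 'c) generator set) d. lin R (free_module R Y) (free_module R X) d \<and>
    d ` carrier (free_module R Y) = K"
proof -
  obtain c :: "('a, 'c) res_elt \<Rightarrow> ('a, 'c) generator" where c: "inj_on c (carrier (free_module R X))"
    using ex_generator_code by blast
  have "K \<subseteq> carrier (free_module R X)" using submodule_rules(1)[OF assms free_module_module] by auto
  then have c: "inj_on c K" using c inj_on_subset by blast
  let ?u = "inv_into K c"
  have u: "?u ` (c ` K) = K" using c by (auto simp: image_image)
  have uN: "?u y \<in> carrier (free_module R X)" if "y \<in> c ` K" for y
    using submodule_rules(1)[OF assms free_module_module] that u by blast
  show ?thesis
    by (intro exI[of _ "c ` K"] exI[of _ "free_map R (c ` K) (free_module R X) ?u"] conjI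
        free_map_image[OF free_module_module assms u] free_map_lin[OF free_module_module uN])
qed

lemma ex_proj_resolution:
  fixes M :: "('a, 'c, 'm) module_scheme"
  assumes M: "module R M"
  shows "\<exists>(P :: nat \<Rightarrow> ('a, ('a, 'c) res_elt) module) d e. proj_resolution R M P d e"
proof -
  define X0 :: "('a, 'c) generator set" where "X0 = Gen ` carrier M"
  define e where "e = free_map R X0 M (\<lambda>x. case x of Gen m \<Rightarrow> m | Lin l \<Rightarrow> \<zero>\<^bsub>M\<^esub>)"
  have eu: "(\<lambda>x. case x of Gen m \<Rightarrow> m | Lin l \<Rightarrow> \<zero>\<^bsub>M\<^esub>) ` X0 = carrier M" by (auto simp: X0_def image_image)
  have Mc: "submodule (carrier M) R M" using M by (simp add: submodule_iff)
  have el: "lin R (free_module R X0) M e" unfolding e_def by (rule free_map_lin[OF M]) (use eu in auto)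
  have ei: "e ` carrier (free_module R X0) = carrier M" unfolding e_def by (rule free_map_image[OF M Mc eu])
  \<comment> \<open>A state of the recursion consists of the index set of the current free module,
    the kernel to be covered next, and the differential into the preceding module. In the initial
    state the third component is a placeholder.\<close>
  define Q where "Q s s' \<longleftrightarrow> lin R (free_module R (fst s')) (free_module R (fst s)) (snd (snd s')) \<and>
    snd (snd s') ` carrier (free_module R (fst s')) = fst (snd s) \<and>
    fst (snd s') = {x \<in> carrier (free_module R (fst s')). snd (snd s') x = \<zero>\<^bsub>free_module R (fst s)\<^esub>}"
    for s s' :: "('a, 'c) generator set \<times> ('a, 'c) res_elt set \<times> (('a, 'c) res_elt \<Rightarrow> ('a, 'c) res_elt)"
  have "\<exists>f. \<forall>n. (submodule (fst (snd (f n))) R (free_module R (fst (f n))) \<and>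
      (n = 0 \<longrightarrow> f n = (X0, {x \<in> carrier (free_module R X0). e x = \<zero>\<^bsub>M\<^esub>}, \<lambda>x. x))) \<and> Q (f n) (f (Suc n))"
  proof (rule dependent_nat_choice)
    show "\<exists>x. submodule (fst (snd x)) R (free_module R (fst x)) \<and>
      (0 = (0::nat) \<longrightarrow> x = (X0, {x \<in> carrier (free_module R X0). e x = \<zero>\<^bsub>M\<^esub>}, \<lambda>x. x))"
      using lin_kernel_submodule[OF el free_module_module M] by simp
    fix s :: "('a, 'c) generator set \<times> ('a, 'c) res_elt set \<times> (('a, 'c) res_elt \<Rightarrow> ('a, 'c) res_elt)"
      and n :: nat
    assume "submodule (fst (snd s)) R (free_module R (fst s)) \<and>
      (n = 0 \<longrightarrow> s = (X0, {x \<in> carrier (free_module R X0). e x = \<zero>\<^bsub>M\<^esub>}, \<lambda>x. x))"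
    then obtain Y :: "('a, 'c) generator set" and d where d: "lin R (free_module R Y) (free_module R (fst s)) d"
      "d ` carrier (free_module R Y) = fst (snd s)" using ex_free_cover by blast
    then show "\<exists>s'. (submodule (fst (snd s')) R (free_module R (fst s')) \<and>
      (Suc n = 0 \<longrightarrow> s' = (X0, {x \<in> carrier (free_module R X0). e x = \<zero>\<^bsub>M\<^esub>}, \<lambda>x. x))) \<and> Q s s'"
      using lin_kernel_submodule[OF d(1) free_module_module free_module_module]
      by (intro exI[of _ "(Y, {x \<in> carrier (free_module R Y). d x = \<zero>\<^bsub>free_module R (fst s)\<^esub>}, d)"])
        (simp add: Q_def)
  qed
  then obtain f where f0: "f 0 = (X0, {x \<in> carrier (free_module R X0). e x = \<zero>\<^bsub>M\<^esub>}, \<lambda>x. x)"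
    and f: "\<And>n. Q (f n) (f (Suc n))" by blast
  let ?P = "\<lambda>n. free_module R (fst (f n))"
  let ?d = "\<lambda>n. restrict (snd (snd (f (Suc n)))) (carrier (?P (Suc n)))"
  have "proj_resolution R M ?P ?d (restrict e (carrier (?P 0)))"
    unfolding proj_resolution_def a_kernel_eq
  proof (intro conjI allI)
    show "projective R (?P i)" for i by (rule free_projective)
    show "?d i \<in> mod_hom R (?P (Suc i)) (?P i)" for i
      by (rule lin_restrict[OF free_module_module]) (use f[of i] in \<open>simp add: Q_def\<close>)
    show "restrict e (carrier (?P 0)) \<in> mod_hom R (?P 0) M"
      using lin_restrict[OF free_module_module el] by (simp add: f0)
    show "restrict e (carrier (?P 0)) ` carrier (?P 0) = carrier M" using ei by (simp add: f0)
    show "?d 0 ` carrier (?P (Suc 0)) = {x \<in> carrier (?P 0). restrict e (carrier (?P 0)) x = \<zero>\<^bsub>M\<^esub>}"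
      using f[of 0] unfolding Q_def by (auto simp: f0)
    show "?d (Suc i) ` carrier (?P (Suc (Suc i))) = {x \<in> carrier (?P (Suc i)). ?d i x = \<zero>\<^bsub>?P i\<^esub>}" for i
      using f[of i] f[of "Suc i"] unfolding Q_def by auto
  qed
  then show ?thesis by blast
qed

lemma chosen_res_resolution:
  fixes M :: "('a, 'c, 'm) module_scheme"
  assumes "module R M"
  shows "proj_resolution R M (res_mod R M) (res_diff R M) (res_aug R M)"
proof -
  have "\<exists>x :: (nat \<Rightarrow> ('a, ('a, 'c) res_elt) module) \<times> (nat \<Rightarrow> ('a, 'c) res_elt \<Rightarrow> ('a, 'c) res_elt) \<times>
      (('a, 'c) res_elt \<Rightarrow> 'c). case x of (P, d, e) \<Rightarrow> proj_resolution R M P d e"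
    using ex_proj_resolution[OF assms] by auto
  from someI_ex[OF this] have "case chosen_res R M of (P, d, e) \<Rightarrow> proj_resolution R M P d e"
    unfolding chosen_res_def .
  then show ?thesis
    unfolding res_mod_def res_diff_def res_aug_def by (cases "chosen_res R M") simp
qed

lemma proj_resolution_rules:
  assumes "proj_resolution R M P d e" and M: "module R M"
  shows "projective R (P i)" "module R (P i)" "lin R (P (Suc i)) (P i) (d i)" "lin R (P 0) M e"
    "e ` carrier (P 0) = carrier M"
    "x \<in> carrier (P 0) \<Longrightarrow> x \<in> d 0 ` carrier (P (Suc 0)) \<longleftrightarrow> e x = \<zero>\<^bsub>M\<^esub>"
    "y \<in> carrier (P (Suc i)) \<Longrightarrow> y \<in> d (Suc i) ` carrier (P (Suc (Suc i))) \<longleftrightarrow> d i y = \<zero>\<^bsub>P i\<^esub>"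
  using assms unfolding proj_resolution_def a_kernel_eq projective_def by (auto simp: mod_hom_lin)

lemma projective_lift:
  fixes P :: "('a, 'c, 'm) module_scheme"
  assumes "projective R P" "module R E" "module R D" "lin R P D f" "lin R E D g"
    "\<And>x. x \<in> carrier P \<Longrightarrow> f x \<in> g ` carrier E"
  shows "\<exists>q. lin R P E q \<and> (\<forall>x\<in>carrier P. g (q x) = f x)"
proof -
  obtain X :: "'c set" where "module R P" "retract_free R P X" using assms(1) projective_retract by blast
  then show ?thesis using retract_free_lift[OF _ _ assms(2-6)] by metis
qed

lemma ex_chain_lift:
  assumes M: "module R M" and M': "module R M'" and f: "lin R M M' f"
  shows "\<exists>g. chain_lift R M M' f g"
proof -
  note P = proj_resolution_rules[OF chosen_res_resolution[OF M] M]
  note P' = proj_resolution_rules[OF chosen_res_resolution[OF M'] M']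
  \<comment> \<open>The invariant records that \<open>g\<close> sends boundaries to boundaries,
    which is exactly what lifting to the next degree requires.\<close>
  define Q where "Q n g \<longleftrightarrow> lin R (res_mod R M n) (res_mod R M' n) g \<and>
    (\<forall>x\<in>carrier (res_mod R M (Suc n)). g (res_diff R M n x) \<in> res_diff R M' n ` carrier (res_mod R M' (Suc n))) \<and>
    (n = 0 \<longrightarrow> (\<forall>x\<in>carrier (res_mod R M 0). res_aug R M' (g x) = f (res_aug R M x)))" for n g
  have "\<exists>g. \<forall>n. Q n (g n) \<and>
      (\<forall>x\<in>carrier (res_mod R M (Suc n)). res_diff R M' n (g (Suc n) x) = g n (res_diff R M n x))"
  proof (rule dependent_nat_choice)
    have "f (res_aug R M x) \<in> res_aug R M' ` carrier (res_mod R M' 0)" if "x \<in> carrier (res_mod R M 0)" for x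
      unfolding P'(5) using lin_rules(1)[OF f] lin_rules(1)[OF P(4)] that by simp
    then obtain g where g: "lin R (res_mod R M 0) (res_mod R M' 0) g"
      "\<forall>x\<in>carrier (res_mod R M 0). res_aug R M' (g x) = f (res_aug R M x)"
      using projective_lift[OF P(1) P'(2) M' lin_comp[OF P(4) f] P'(4)] by blast
    have "g (res_diff R M 0 x) \<in> res_diff R M' 0 ` carrier (res_mod R M' (Suc 0))"
      if x: "x \<in> carrier (res_mod R M (Suc 0))" for x
    proof -
      have dx: "res_diff R M 0 x \<in> carrier (res_mod R M 0)" using lin_rules(1)[OF P(3) x] .
      then have "res_aug R M (res_diff R M 0 x) = \<zero>\<^bsub>M\<^esub>" using P(6)[OF dx] x by blast
      then have "res_aug R M' (g (res_diff R M 0 x)) = \<zero>\<^bsub>M'\<^esub>" using g(2) dx lin_rules(4)[OF f M M'] by simp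
      then show ?thesis using P'(6) lin_rules(1)[OF g(1) dx] by simp
    qed
    then show "\<exists>g. Q 0 g" using g by (auto simp: Q_def)
  next
    fix g n assume g: "Q n g"
    then have gl: "lin R (res_mod R M n) (res_mod R M' n) g"
      and im: "\<And>x. x \<in> carrier (res_mod R M (Suc n)) \<Longrightarrow>
        g (res_diff R M n x) \<in> res_diff R M' n ` carrier (res_mod R M' (Suc n))" by (auto simp: Q_def)
    obtain g' where g': "lin R (res_mod R M (Suc n)) (res_mod R M' (Suc n)) g'"
      "\<forall>x\<in>carrier (res_mod R M (Suc n)). res_diff R M' n (g' x) = g (res_diff R M n x)"
      using projective_lift[OF P(1) P'(2) P'(2) lin_comp[OF P(3) gl] P'(3) im] by blast
    have "g' (res_diff R M (Suc n) x) \<in> res_diff R M' (Suc n) ` carrier (res_mod R M' (Suc (Suc n)))"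
      if x: "x \<in> carrier (res_mod R M (Suc (Suc n)))" for x
    proof -
      have dx: "res_diff R M (Suc n) x \<in> carrier (res_mod R M (Suc n))" using lin_rules(1)[OF P(3) x] .
      then have "res_diff R M n (res_diff R M (Suc n) x) = \<zero>\<^bsub>res_mod R M n\<^esub>" using P(7)[OF dx] x by blast
      then have "res_diff R M' n (g' (res_diff R M (Suc n) x)) = \<zero>\<^bsub>res_mod R M' n\<^esub>"
        using g'(2) dx lin_rules(4)[OF gl P(2) P'(2)] by simp
      then show ?thesis using P'(7) lin_rules(1)[OF g'(1) dx] by simp
    qed
    then show "\<exists>g'. Q (Suc n) g' \<and>
        (\<forall>x\<in>carrier (res_mod R M (Suc n)). res_diff R M' n (g' x) = g (res_diff R M n x))"
      using g' by (auto simp: Q_def)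
  qed
  then obtain g where g: "\<And>n. Q n (g n)"
    "\<And>n x. x \<in> carrier (res_mod R M (Suc n)) \<Longrightarrow> res_diff R M' n (g (Suc n) x) = g n (res_diff R M n x)" by blast
  have "chain_lift R M M' f (\<lambda>n. restrict (g n) (carrier (res_mod R M n)))"
    unfolding chain_lift_def
  proof (intro conjI allI ballI)
    show "restrict (g i) (carrier (res_mod R M i)) \<in> mod_hom R (res_mod R M i) (res_mod R M' i)" for i
      by (rule lin_restrict[OF P(2)]) (use g(1)[of i] in \<open>simp add: Q_def\<close>)
    show "res_aug R M' (restrict (g 0) (carrier (res_mod R M 0)) x) = f (res_aug R M x)"
      if "x \<in> carrier (res_mod R M 0)" for x using g(1)[of 0] that by (simp add: Q_def)
    show "res_diff R M' i (restrict (g (Suc i)) (carrier (res_mod R M (Suc i))) x) =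
        restrict (g i) (carrier (res_mod R M i)) (res_diff R M i x)"
      if "x \<in> carrier (res_mod R M (Suc i))" for i x
      using g(2)[OF that] that lin_rules(1)[OF P(3) that] by simp
  qed
  then show ?thesis by blast
qed

subsection \<open>Constant systems and Ext\<close>

text \<open>An ordinary resolution, viewed as a pro-system with identity transitions. The comparison
  theorem for pro-resolutions then contains the usual independence of Ext from the
  resolution.\<close>

definition const_cx :: "(nat \<Rightarrow> ('a, 'x) module) \<Rightarrow> (nat \<Rightarrow> 'x \<Rightarrow> 'x) \<Rightarrow> ('x \<Rightarrow> 'y) \<Rightarrow> ('a, 'x, 'y) pro_complex"
  where "const_cx P d e = \<lparr>cx = \<lambda>_. P, df = \<lambda>_. d, tr = \<lambda>_ _ _ x. x, aug = \<lambda>_. e\<rparr>"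

lemma const_cx_simps [simp]:
  "cx (const_cx P d e) m = P" "df (const_cx P d e) m = d" "tr (const_cx P d e) m n k = (\<lambda>x. x)"
  "aug (const_cx P d e) m = e"
  by (simp_all add: const_cx_def fun_eq_iff)

lemma const_pro_res:
  assumes "proj_resolution R M P d e" and M: "module R M"
  shows "pro_res R (const_cx P d e) (\<lambda>_. M) (\<lambda>_ _ y. y)"
proof -
  note P = proj_resolution_rules[OF assms]
  have dd: "d k (d (Suc k) x) = \<zero>\<^bsub>P k\<^esub>" if "x \<in> carrier (P (Suc (Suc k)))" for k x
    using P(7)[of "d (Suc k) x" k] lin_rules(1)[OF P(3) that] that by blast
  have ed: "e (d 0 x) = \<zero>\<^bsub>M\<^esub>" if "x \<in> carrier (P (Suc 0))" for x
    using P(6)[of "d 0 x"] lin_rules(1)[OF P(3) that] that by blast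
  have "pro_cx R (const_cx P d e)"
    by (intro pro_cx.intro modules_axioms pro_cx_axioms.intro) (auto simp: P dd lin_id)
  moreover have "\<exists>n\<ge>m. \<forall>x\<in>carrier (cx (const_cx P d e) n k). aug_cycle (\<lambda>_. M) (const_cx P d e) n k x \<longrightarrow>
      tr (const_cx P d e) m n k x \<in> df (const_cx P d e) m k ` carrier (cx (const_cx P d e) m (Suc k))" for m k
    by (intro exI[of _ m]) (cases k; simp add: aug_cycle_def P)
  ultimately show ?thesis
    by (intro pro_res.intro pro_res_axioms.intro) (auto simp: M lin_id P ed)
qed

text \<open>The restriction gives a class to cocycles that are not extensional, such as composites
  written as lambda terms.\<close>

definition ext_class ::
    "nat \<Rightarrow> ('a, 'c, 'm) module_scheme \<Rightarrow> ('a, 'd, 'n) module_scheme \<Rightarrow> (('a, 'c) res_elt \<Rightarrow> 'd)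
      \<Rightarrow> (('a, 'c) res_elt \<Rightarrow> 'd) set"
  where "ext_class i M N h = ext_coboundaries R i M N +>\<^bsub>hom_module R (res_mod R M i) N\<^esub>
    restrict h (carrier (res_mod R M i))"

abbreviation "res_cx M \<equiv> const_cx (res_mod R M) (res_diff R M) (res_aug R M)"

lemma ext_class_cong: "(\<And>x. x \<in> carrier (res_mod R M i) \<Longrightarrow> h x = h' x) \<Longrightarrow> ext_class i M N h = ext_class i M N h'"
  unfolding ext_class_def by (auto cong: restrict_cong)

lemma
  assumes M: "module R M" and N: "module R N"
  shows ext_module: "module R (Ext R i M N)"
    and ext_carrier: "carrier (Ext R i M N) = {ext_class i M N h | h. cocyc R N (res_cx M) m i h}"
    and ext_add: "cocyc R N (res_cx M) m i h \<Longrightarrow> cocyc R N (res_cx M) m i h' \<Longrightarrow>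
      ext_class i M N (\<lambda>x. h x \<oplus>\<^bsub>N\<^esub> h' x) = ext_class i M N h \<oplus>\<^bsub>Ext R i M N\<^esub> ext_class i M N h'"
    and ext_smult: "c \<in> carrier R \<Longrightarrow> cocyc R N (res_cx M) m i h \<Longrightarrow>
      ext_class i M N (\<lambda>x. c \<odot>\<^bsub>N\<^esub> h x) = c \<odot>\<^bsub>Ext R i M N\<^esub> ext_class i M N h"
    and ext_zero_iff: "cocyc R N (res_cx M) m i h \<Longrightarrow>
      ext_class i M N h = \<zero>\<^bsub>Ext R i M N\<^esub> \<longleftrightarrow> cobd R N (res_cx M) m i h"
    and ext_class_mem: "cocyc R N (res_cx M) m i h \<Longrightarrow> q \<in> ext_class i M N h \<Longrightarrow>
      cocyc R N (res_cx M) m i q \<and> cobd R N (res_cx M) m i (\<lambda>x. q x \<ominus>\<^bsub>N\<^esub> h x)"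
    and ext_class_self: "cocyc R N (res_cx M) m i h \<Longrightarrow> restrict h (carrier (res_mod R M i)) \<in> ext_class i M N h"
proof -
  let ?P = "res_mod R M i" and ?H = "hom_module R (res_mod R M i) N"
  let ?Z = "ext_cocycles R i M N" and ?B = "ext_coboundaries R i M N"
  let ?r = "\<lambda>h. restrict h (carrier ?P)"
  interpret S: pro_res R "res_cx M" "\<lambda>_. M" "\<lambda>_ _ y. y"
    by (rule const_pro_res[OF chosen_res_resolution[OF M] M])
  note P = proj_resolution_rules[OF chosen_res_resolution[OF M] M]
  have H: "module R ?H" using P(2) N by (rule hom_module_module)
  have Zr: "?r h \<in> ?Z \<longleftrightarrow> cocyc R N (res_cx M) m i h" for h
    using lin_rules(1)[OF P(3)] lin_cong[OF P(2), of i "?r h" h N]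
    by (auto simp: ext_cocycles_def cocyc_def mod_hom_iff_lin)
  have Zc: "h \<in> ?Z \<longleftrightarrow> cocyc R N (res_cx M) m i h \<and> h = ?r h" for h
    using lin_rules(1)[OF P(3)]
    by (auto simp: ext_cocycles_def cocyc_def mod_hom_iff_lin fun_eq_iff extensional_def)
  have Bc: "h \<in> ?B \<longleftrightarrow> cobd R N (res_cx M) m i h \<and> h = ?r h" for h
  proof (cases i)
    case 0
    then show ?thesis by (auto simp: ext_coboundaries_def cobd_def hom_module_def fun_eq_iff restrict_def)
  next
    case (Suc j)
    show ?thesis
    proof
      assume "h \<in> ?B"
      then obtain g where g: "g \<in> mod_hom R (res_mod R M j) N"
        "h = compose (carrier (res_mod R M (Suc j))) g (res_diff R M j)"
        using Suc by (auto simp: ext_coboundaries_def)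
      then show "cobd R N (res_cx M) m i h \<and> h = ?r h"
        using Suc mod_hom_lin[OF g(1)] by (auto simp: cobd_def compose_def fun_eq_iff)
    next
      assume *: "cobd R N (res_cx M) m i h \<and> h = ?r h"
      then obtain g where g: "lin R (res_mod R M j) N g"
        "\<forall>x\<in>carrier (res_mod R M (Suc j)). h x = g (res_diff R M j x)"
        using Suc by (auto simp: cobd_def)
      have "h = compose (carrier (res_mod R M (Suc j))) (restrict g (carrier (res_mod R M j))) (res_diff R M j)"
      proof
        fix x
        show "h x = compose (carrier (res_mod R M (Suc j))) (restrict g (carrier (res_mod R M j))) (res_diff R M j) x"
        proof (cases "x \<in> carrier (res_mod R M (Suc j))")
          case True
          then show ?thesis using g(2) lin_rules(1)[OF P(3), of x j] by (simp add: compose_def)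
        next
          case False
          have "h = ?r h" by (rule conjunct2[OF *])
          then have "h x = ?r h x" by (rule fun_cong)
          then show ?thesis using False Suc by (simp add: compose_def)
        qed
      qed
      then show "h \<in> ?B" using Suc lin_restrict[OF P(2) g(1)] by (auto simp: ext_coboundaries_def)
    qed
  qed
  have rr: "?r h = ?r (?r h)" for h by (simp add: fun_eq_iff)
  have hc: "h x \<in> carrier N" if "cocyc R N (res_cx M) m i h" "x \<in> carrier ?P" for h x
    using that by (auto simp: cocyc_def lin_def)
  have ops: "\<zero>\<^bsub>?H\<^esub> = ?r (\<lambda>_. \<zero>\<^bsub>N\<^esub>)" "f \<oplus>\<^bsub>?H\<^esub> g = ?r (\<lambda>x. f x \<oplus>\<^bsub>N\<^esub> g x)" "c \<odot>\<^bsub>?H\<^esub> f = ?r (\<lambda>x. c \<odot>\<^bsub>N\<^esub> f x)"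
    for f g c by (auto simp: hom_module_def)
  have cz: "cocyc R N (res_cx M) m i (\<lambda>_. \<zero>\<^bsub>N\<^esub>)" using S.cobd_cocyc[OF N S.cobd_zero[OF N]] .
  have Z: "submodule ?Z R ?H"
    unfolding submodule_iff[OF H]
  proof (intro conjI ballI)
    show "?Z \<subseteq> carrier ?H" by (auto simp: ext_cocycles_def hom_module_def)
    show "\<zero>\<^bsub>?H\<^esub> \<in> ?Z" unfolding ops Zr by (rule cz)
    show "x \<oplus>\<^bsub>?H\<^esub> y \<in> ?Z" if "x \<in> ?Z" "y \<in> ?Z" for x y
      unfolding ops Zr using that S.cocyc_ops(1)[OF N] Zc by blast
    show "a \<odot>\<^bsub>?H\<^esub> x \<in> ?Z" if "a \<in> carrier R" "x \<in> ?Z" for a x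
      unfolding ops Zr using that S.cocyc_ops(3)[OF N] Zc by blast
  qed
  let ?Q = "?H\<lparr>carrier := ?Z\<rparr>"
  have Q: "module R ?Q" by (rule submodule_module[OF Z H])
  have cobd_r: "cobd R N (res_cx M) m i (?r h) \<longleftrightarrow> cobd R N (res_cx M) m i h" for h
    by (rule S.cobd_cong) simp
  have Br: "?r h \<in> ?B \<longleftrightarrow> cobd R N (res_cx M) m i h" for h
    using Bc[of "?r h"] rr[of h] cobd_r by simp
  have B: "submodule ?B R ?Q"
    unfolding submodule_iff[OF Q]
  proof (intro conjI ballI)
    show "?B \<subseteq> carrier ?Q" using Bc Zc S.cobd_cocyc[OF N] by auto
    have "\<zero>\<^bsub>?H\<^esub> \<in> ?B" unfolding ops Br by (rule S.cobd_zero[OF N])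
    then show "\<zero>\<^bsub>?Q\<^esub> \<in> ?B" by simp
    show "x \<oplus>\<^bsub>?Q\<^esub> y \<in> ?B" if "x \<in> ?B" "y \<in> ?B" for x y
      using that S.cobd_add[OF N] Bc Br ops(2) by simp
    show "a \<odot>\<^bsub>?Q\<^esub> x \<in> ?B" if "a \<in> carrier R" "x \<in> ?B" for a x
      using that S.cobd_smult[OF N] Bc Br ops(3) by simp
  qed
  have cos: "?B +>\<^bsub>?Q\<^esub> x = ?B +>\<^bsub>?H\<^esub> x" for x by (simp add: a_r_coset_def')
  have E: "Ext R i M N = mod_quot ?Q ?B" by (simp add: Ext_def)
  have cl: "ext_class i M N h = ?B +>\<^bsub>?Q\<^esub> ?r h" for h by (simp add: ext_class_def cos)
  show "module R (Ext R i M N)" unfolding E by (rule quot_module[OF B Q])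
  show "carrier (Ext R i M N) = {ext_class i M N h | h. cocyc R N (res_cx M) m i h}"
    unfolding E quot_ops(1)[OF B Q] cl
  proof (intro Set.set_eqI iffI)
    fix y assume "y \<in> (\<lambda>x. ?B +>\<^bsub>?Q\<^esub> x) ` carrier ?Q"
    then obtain h where h: "h \<in> ?Z" "y = ?B +>\<^bsub>?Q\<^esub> h" by auto
    then have "?B +>\<^bsub>?Q\<^esub> ?r h = y" using Zc[of h] by simp
    then show "y \<in> {?B +>\<^bsub>?Q\<^esub> ?r h | h. cocyc R N (res_cx M) m i h}" using h(1) Zc[of h] by blast
  next
    fix y assume "y \<in> {?B +>\<^bsub>?Q\<^esub> ?r h | h. cocyc R N (res_cx M) m i h}"
    then show "y \<in> (\<lambda>x. ?B +>\<^bsub>?Q\<^esub> x) ` carrier ?Q" using Zr by auto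
  qed
  show "ext_class i M N (\<lambda>x. h x \<oplus>\<^bsub>N\<^esub> h' x) = ext_class i M N h \<oplus>\<^bsub>Ext R i M N\<^esub> ext_class i M N h'"
    if "cocyc R N (res_cx M) m i h" "cocyc R N (res_cx M) m i h'"
  proof -
    have "?r (\<lambda>x. h x \<oplus>\<^bsub>N\<^esub> h' x) = ?r h \<oplus>\<^bsub>?Q\<^esub> ?r h'" using ops(2)[of "?r h" "?r h'"] by (auto simp: fun_eq_iff)
    then show ?thesis unfolding cl E using quot_ops(3)[OF B Q, of "?r h" "?r h'"] that Zr by simp
  qed
  show "ext_class i M N (\<lambda>x. c \<odot>\<^bsub>N\<^esub> h x) = c \<odot>\<^bsub>Ext R i M N\<^esub> ext_class i M N h"
    if "c \<in> carrier R" "cocyc R N (res_cx M) m i h"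
  proof -
    have "?r (\<lambda>x. c \<odot>\<^bsub>N\<^esub> h x) = c \<odot>\<^bsub>?Q\<^esub> ?r h" using ops(3)[of c "?r h"] by (auto simp: fun_eq_iff)
    then show ?thesis unfolding cl E using quot_ops(4)[OF B Q, of c "?r h"] that Zr by simp
  qed
  show "ext_class i M N h = \<zero>\<^bsub>Ext R i M N\<^esub> \<longleftrightarrow> cobd R N (res_cx M) m i h"
    if "cocyc R N (res_cx M) m i h"
    unfolding cl E using quot_zero_iff[OF B Q, of "?r h"] that Zr Br by simp
  show "restrict h (carrier ?P) \<in> ext_class i M N h" if "cocyc R N (res_cx M) m i h"
    unfolding cl by (rule coset_self[OF B Q]) (use that Zr in simp)
  show "cocyc R N (res_cx M) m i q \<and> cobd R N (res_cx M) m i (\<lambda>x. q x \<ominus>\<^bsub>N\<^esub> h x)"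
    if hm: "cocyc R N (res_cx M) m i h" and qm: "q \<in> ext_class i M N h"
  proof
    obtain b where b: "b \<in> ?B" "q = b \<oplus>\<^bsub>?H\<^esub> ?r h"
      using qm unfolding cl cos by (auto simp: mem_coset)
    have q: "q = ?r (\<lambda>x. b x \<oplus>\<^bsub>N\<^esub> h x)" using b(2) unfolding ops(2) by (auto simp: fun_eq_iff)
    have cb: "cocyc R N (res_cx M) m i b" using b Bc S.cobd_cocyc[OF N] by blast
    have "?r (\<lambda>x. b x \<oplus>\<^bsub>N\<^esub> h x) \<in> ?Z" unfolding Zr by (rule S.cocyc_ops(1)[OF N cb hm])
    then show "cocyc R N (res_cx M) m i q" using q Zc by simp
    have "cobd R N (res_cx M) m i b" using b Bc by blast
    then show "cobd R N (res_cx M) m i (\<lambda>x. q x \<ominus>\<^bsub>N\<^esub> h x)"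
      by (rule S.cobd_cong[THEN iffD1, rotated])
        (use q hc[OF cb] hc[OF hm] N in \<open>simp add: a_minus_def mm_assoc\<close>)
  qed
qed

text \<open>Along identity transitions the colimit is the cohomology itself, so \<open>Ext\<close>
  fits the pattern of \<open>presents\<close>.\<close>

lemma ext_presents:
  assumes M: "module R M" and N: "module R N"
  shows "presents R N (res_cx M) i (Ext R i M N) (\<lambda>_. ext_class i M N)"
proof -
  interpret S: pro_res R "res_cx M" "\<lambda>_. M" "\<lambda>_ _ y. y"
    by (rule const_pro_res[OF chosen_res_resolution[OF M] M])
  show ?thesis
    unfolding presents_def
  proof (intro conjI allI impI ballI)
    fix m h assume h: "cocyc R N (res_cx M) m i h"
    show "ext_class i M N h \<in> carrier (Ext R i M N)" using h ext_carrier[OF M N, of i m] by blast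
    show "ext_class i M N h = \<zero>\<^bsub>Ext R i M N\<^esub> \<longleftrightarrow> (\<exists>n\<ge>m. cobd R N (res_cx M) n i (\<lambda>x. h (tr (res_cx M) m n i x)))"
      unfolding ext_zero_iff[OF M N h]
    proof -
      have "cobd R N (res_cx M) n i h \<longleftrightarrow> cobd R N (res_cx M) m i h" for n
        by (cases i) (simp_all add: cobd_def)
      then show "cobd R N (res_cx M) m i h \<longleftrightarrow> (\<exists>n\<ge>m. cobd R N (res_cx M) n i (\<lambda>x. h (tr (res_cx M) m n i x)))"
        by auto
    qed
    show "ext_class i M N (\<lambda>x. h (tr (res_cx M) m n i x)) = ext_class i M N h" for n by simp
    show "ext_class i M N (\<lambda>x. h x \<oplus>\<^bsub>N\<^esub> h' x) = ext_class i M N h \<oplus>\<^bsub>Ext R i M N\<^esub> ext_class i M N h'"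
      if "cocyc R N (res_cx M) m i h'" for h' by (rule ext_add[OF M N h that])
    show "ext_class i M N (\<lambda>x. c \<odot>\<^bsub>N\<^esub> h x) = c \<odot>\<^bsub>Ext R i M N\<^esub> ext_class i M N h" if "c \<in> carrier R" for c
      by (rule ext_smult[OF M N that h])
    show "ext_class i M N h = ext_class i M N h'" if "\<forall>x\<in>carrier (cx (res_cx M) m i). h x = h' x" for h'
      using that by (intro ext_class_cong) simp
  next
    fix y assume "y \<in> carrier (Ext R i M N)"
    then show "\<exists>m h. cocyc R N (res_cx M) m i h \<and> ext_class i M N h = y"
      unfolding ext_carrier[OF M N, of i 0] by blast
  qed
qed

end

section \<open>Sequential colimits and the tower of chosen resolutions\<close>

section \<open>Direct limits and local cohomology\<close>

text \<open>Both this and \<open>dnt_map\<close> iterate the maps with indices from m to m + j - 1: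
  \<open>upt_map\<close> for maps that raise the index, from m to m + j, and \<open>dnt_map\<close>
  for maps that lower it, from m + j to m.\<close>

primrec upt_map :: "(nat \<Rightarrow> 'x \<Rightarrow> 'x) \<Rightarrow> nat \<Rightarrow> nat \<Rightarrow> 'x \<Rightarrow> 'x" where
  "upt_map t m 0 x = x"
| "upt_map t m (Suc j) x = t (m + j) (upt_map t m j x)"

primrec dnt_map :: "(nat \<Rightarrow> 'x \<Rightarrow> 'x) \<Rightarrow> nat \<Rightarrow> nat \<Rightarrow> 'x \<Rightarrow> 'x" where
  "dnt_map t m 0 x = x"
| "dnt_map t m (Suc j) x = dnt_map t m j (t (m + j) x)"

lemma dnt_map_add: "dnt_map t m (i + j) x = dnt_map t m i (dnt_map t (m + i) j x)"
  by (induction j arbitrary: x) (simp_all add: add.assoc)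

lemma upt_map_shift: "upt_map t m (Suc j) x = upt_map t (Suc m) j (t m x)"
  by (induction j) simp_all

definition dl_rel ::
    "('a, 'r) ring_scheme \<Rightarrow> (nat \<Rightarrow> ('a, 'b, 'm) module_scheme) \<Rightarrow> (nat \<Rightarrow> 'b \<Rightarrow> 'b) \<Rightarrow> (nat \<Rightarrow> 'b) set"
  where "dl_rel R E t = mod_span R (direct_sum UNIV E)
    {sum_inj UNIV E (Suc n) (t n x) \<ominus>\<^bsub>direct_sum UNIV E\<^esub> sum_inj UNIV E n x | n x. x \<in> carrier (E n)}"

definition dl_inj ::
    "('a, 'r) ring_scheme \<Rightarrow> (nat \<Rightarrow> ('a, 'b, 'm) module_scheme) \<Rightarrow> (nat \<Rightarrow> 'b \<Rightarrow> 'b)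
      \<Rightarrow> nat \<Rightarrow> 'b \<Rightarrow> (nat \<Rightarrow> 'b) set"
  where "dl_inj R E t m x = dl_rel R E t +>\<^bsub>direct_sum UNIV E\<^esub> sum_inj UNIV E m x"

context modules
begin

lemma direct_limit_eq: "direct_limit R E t = mod_quot (direct_sum UNIV E) (dl_rel R E t)"
  by (simp add: direct_limit_def dl_rel_def Let_def)

context
  fixes E :: "nat \<Rightarrow> ('a, 'c, 'm) module_scheme" and t :: "nat \<Rightarrow> 'c \<Rightarrow> 'c"
  assumes E [simp]: "\<And>n. module R (E n)" and t: "\<And>n. lin R (E n) (E (Suc n)) (t n)"
begin

lemma upt_lin: "lin R (E m) (E (m + j)) (upt_map t m j)"
proof (induction j)
  case 0
  have "upt_map t m 0 = (\<lambda>x. x)" by (simp add: fun_eq_iff)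
  then show ?case by (simp add: lin_id)
next
  case (Suc j)
  have "upt_map t m (Suc j) = (\<lambda>x. t (m + j) (upt_map t m j x))" by (simp add: fun_eq_iff)
  then show ?case using lin_comp[OF Suc t[of "m + j"]] by simp
qed

lemma ds_module [simp]: "module R (direct_sum UNIV E)"
  by (rule direct_sum_module) simp

lemma inj_lin: "lin R (E m) (direct_sum UNIV E) (sum_inj UNIV E m)"
  by (rule sum_inj_lin) simp_all

lemma dl_rel_submodule: "submodule (dl_rel R E t) R (direct_sum UNIV E)"
  unfolding dl_rel_def
  by (rule mod_span_submodule) (use lin_rules(1)[OF inj_lin] lin_rules(1)[OF t] in auto)

lemma direct_limit_module: "module R (direct_limit R E t)"
  unfolding direct_limit_eq by (rule quot_module[OF dl_rel_submodule]) simp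

lemma dl_inj_lin: "lin R (E m) (direct_limit R E t) (dl_inj R E t m)"
proof -
  have "dl_inj R E t m = (\<lambda>x. dl_rel R E t +>\<^bsub>direct_sum UNIV E\<^esub> sum_inj UNIV E m x)"
    by (simp add: fun_eq_iff dl_inj_def)
  then show ?thesis
    unfolding direct_limit_eq using lin_comp[OF inj_lin quot_lin[OF dl_rel_submodule ds_module]] by simp
qed

lemma dl_inj_step: "x \<in> carrier (E m) \<Longrightarrow> dl_inj R E t (Suc m) (t m x) = dl_inj R E t m x"
  unfolding dl_inj_def
  by (subst coset_eq_iff[OF dl_rel_submodule ds_module])
    (use lin_rules(1)[OF inj_lin] lin_rules(1)[OF t] in \<open>auto simp: dl_rel_def intro!: mod_span_superset\<close>)

lemma dl_inj_upt: "x \<in> carrier (E m) \<Longrightarrow> dl_inj R E t (m + j) (upt_map t m j x) = dl_inj R E t m x"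
  by (induction j) (use dl_inj_step lin_rules(1)[OF upt_lin] in auto)

lemma dl_inj_surj:
  assumes "y \<in> carrier (direct_limit R E t)"
  obtains m x where "x \<in> carrier (E m)" "y = dl_inj R E t m x"
proof -
  let ?S = "direct_sum UNIV E" and ?q = "\<lambda>z. dl_rel R E t +>\<^bsub>direct_sum UNIV E\<^esub> z"
  note ops = quot_ops[OF dl_rel_submodule ds_module]
  obtain z where z: "z \<in> carrier ?S" "y = ?q z"
    using assms unfolding direct_limit_eq ops(1) by auto
  have "\<exists>m x. x \<in> carrier (E m) \<and> ?q z = dl_inj R E t m x"
  proof (rule direct_sum_induct[OF _ z(1)])
    have "sum_inj UNIV E 0 \<zero>\<^bsub>E 0\<^esub> = \<zero>\<^bsub>?S\<^esub>" using lin_rules(4)[OF inj_lin] by simp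
    then have "?q \<zero>\<^bsub>?S\<^esub> = dl_inj R E t 0 \<zero>\<^bsub>E 0\<^esub>" by (simp add: dl_inj_def)
    then show "\<exists>m x. x \<in> carrier (E m) \<and> ?q \<zero>\<^bsub>?S\<^esub> = dl_inj R E t m x" by (meson E mm_zero)
    show "\<exists>n y. y \<in> carrier (E n) \<and> ?q (sum_inj UNIV E m x) = dl_inj R E t n y" if "x \<in> carrier (E m)" for m x
      using that by (auto simp: dl_inj_def)
    fix u v
    assume uv: "u \<in> carrier ?S" "v \<in> carrier ?S" and "\<exists>m x. x \<in> carrier (E m) \<and> ?q u = dl_inj R E t m x"
      "\<exists>m x. x \<in> carrier (E m) \<and> ?q v = dl_inj R E t m x"
    then obtain m x n y where x: "x \<in> carrier (E m)" "?q u = dl_inj R E t m x"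
      and y: "y \<in> carrier (E n)" "?q v = dl_inj R E t n y" by blast
    have x': "upt_map t m n x \<in> carrier (E (m + n))" using lin_rules(1)[OF upt_lin x(1)] .
    have y': "upt_map t n m y \<in> carrier (E (m + n))" using lin_rules(1)[OF upt_lin y(1), of m] by (simp add: add.commute)
    have "?q (u \<oplus>\<^bsub>?S\<^esub> v) = dl_inj R E t m x \<oplus>\<^bsub>direct_limit R E t\<^esub> dl_inj R E t n y"
      using ops(3)[OF uv] x y by (simp add: direct_limit_eq)
    also have "\<dots> = dl_inj R E t (m + n) (upt_map t m n x) \<oplus>\<^bsub>direct_limit R E t\<^esub>
        dl_inj R E t (m + n) (upt_map t n m y)"
      using dl_inj_upt[OF x(1), of n] dl_inj_upt[OF y(1), of m] by (simp add: add.commute)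
    also have "\<dots> = dl_inj R E t (m + n) (upt_map t m n x \<oplus>\<^bsub>E (m + n)\<^esub> upt_map t n m y)"
      using lin_rules(2)[OF dl_inj_lin x' y'] by simp
    finally show "\<exists>m x. x \<in> carrier (E m) \<and> ?q (u \<oplus>\<^bsub>?S\<^esub> v) = dl_inj R E t m x"
      using x' y' by (meson E mm_add)
  qed simp
  then show ?thesis using that z by blast
qed

text \<open>An element that dies in the colimit dies at a finite stage. The maps of the direct sum
  to \<open>E n\<close> given by the transitions respect every relation once \<open>n\<close> is
  large, so all combinations of relations are eventually killed.\<close>

lemma dl_inj_zero_iff:
  assumes x: "x \<in> carrier (E m)"
  shows "dl_inj R E t m x = \<zero>\<^bsub>direct_limit R E t\<^esub> \<longleftrightarrow> (\<exists>j. upt_map t m j x = \<zero>\<^bsub>E (m + j)\<^esub>)"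
proof
  assume "\<exists>j. upt_map t m j x = \<zero>\<^bsub>E (m + j)\<^esub>"
  then obtain j where "upt_map t m j x = \<zero>\<^bsub>E (m + j)\<^esub>" by blast
  then show "dl_inj R E t m x = \<zero>\<^bsub>direct_limit R E t\<^esub>"
    using dl_inj_upt[OF x, of j] lin_rules(4)[OF dl_inj_lin] direct_limit_module by simp
next
  let ?S = "direct_sum UNIV E"
  assume "dl_inj R E t m x = \<zero>\<^bsub>direct_limit R E t\<^esub>"
  then have mem: "sum_inj UNIV E m x \<in> dl_rel R E t"
    unfolding dl_inj_def direct_limit_eq
    using quot_zero_iff[OF dl_rel_submodule ds_module] lin_rules(1)[OF inj_lin x] by simp
  \<comment> \<open>The transition from \<open>l\<close> to \<open>n\<close> where it exists, and
    zero otherwise; for fixed \<open>n\<close> these maps combine to one on the whole direct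
    sum.\<close>
  define u where "u n l y = (if l \<le> n then upt_map t l (n - l) y else \<zero>\<^bsub>E n\<^esub>)" for n l y
  have u: "lin R (E l) (E n) (u n l)" for n l
  proof (cases "l \<le> n")
    case True
    then have "u n l = upt_map t l (n - l)" by (simp add: u_def fun_eq_iff)
    then show ?thesis using upt_lin[of l "n - l"] True by simp
  next
    case False
    then have "u n l = (\<lambda>_. \<zero>\<^bsub>E n\<^esub>)" by (simp add: u_def fun_eq_iff)
    then show ?thesis by (simp add: lin_zero)
  qed
  let ?U = "\<lambda>n. ds_map UNIV E (E n) (u n)"
  have U: "lin R ?S (E n) (?U n)" for n by (rule ds_map_lin) (simp_all add: u)
  have Ui: "?U n (sum_inj UNIV E l y) = u n l y" if "y \<in> carrier (E l)" for n l y
    by (rule ds_map_inj) (simp_all add: u that)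
  \<comment> \<open>The elements that are eventually killed. A relation between \<open>l\<close> and
    \<open>l + 1\<close> belongs to it, as its two terms have the same image in \<open>E n\<close>
    for all \<open>n\<close> beyond \<open>l\<close>.\<close>
  let ?W = "{z \<in> carrier ?S. \<exists>n0. \<forall>n\<ge>n0. ?U n z = \<zero>\<^bsub>E n\<^esub>}"
  have "submodule ?W R ?S"
    unfolding submodule_iff[OF ds_module]
  proof (intro conjI ballI)
    show "?W \<subseteq> carrier ?S" by auto
    show "\<zero>\<^bsub>?S\<^esub> \<in> ?W" using lin_rules(4)[OF U] by simp
    show "y \<oplus>\<^bsub>?S\<^esub> z \<in> ?W" if yz: "y \<in> ?W" "z \<in> ?W" for y z
    proof -
      obtain n0 n1 where n: "\<forall>n\<ge>n0. ?U n y = \<zero>\<^bsub>E n\<^esub>" "\<forall>n\<ge>n1. ?U n z = \<zero>\<^bsub>E n\<^esub>" using yz by blast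
      have "\<forall>n\<ge>max n0 n1. ?U n (y \<oplus>\<^bsub>?S\<^esub> z) = \<zero>\<^bsub>E n\<^esub>" using n yz lin_rules(2)[OF U] by simp
      moreover have "y \<oplus>\<^bsub>?S\<^esub> z \<in> carrier ?S" using yz by simp
      ultimately show ?thesis by (intro CollectI conjI exI[of _ "max n0 n1"])
    qed
    show "c \<odot>\<^bsub>?S\<^esub> z \<in> ?W" if cz: "c \<in> carrier R" "z \<in> ?W" for c z
    proof -
      obtain n0 where n: "\<forall>n\<ge>n0. ?U n z = \<zero>\<^bsub>E n\<^esub>" using cz by blast
      have "\<forall>n\<ge>n0. ?U n (c \<odot>\<^bsub>?S\<^esub> z) = \<zero>\<^bsub>E n\<^esub>" using n cz lin_rules(3)[OF U] by simp
      moreover have "c \<odot>\<^bsub>?S\<^esub> z \<in> carrier ?S" using cz by simp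
      ultimately show ?thesis by (intro CollectI conjI exI[of _ n0])
    qed
  qed
  moreover have "sum_inj UNIV E (Suc l) (t l y) \<ominus>\<^bsub>?S\<^esub> sum_inj UNIV E l y \<in> ?W" if y: "y \<in> carrier (E l)" for l y
  proof -
    have ty: "t l y \<in> carrier (E (Suc l))" using lin_rules(1)[OF t y] .
    have "?U n (sum_inj UNIV E (Suc l) (t l y) \<ominus>\<^bsub>?S\<^esub> sum_inj UNIV E l y) = \<zero>\<^bsub>E n\<^esub>" if n: "n \<ge> Suc l" for n
    proof -
      have "n - l = Suc (n - Suc l)" using n by simp
      then have "u n l y = u n (Suc l) (t l y)" using n upt_map_shift[of t l "n - Suc l" y] by (simp add: u_def)
      then show ?thesis
        using lin_rules(6)[OF U ds_module E lin_rules(1)[OF inj_lin ty] lin_rules(1)[OF inj_lin y], of n]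
          Ui ty y lin_rules(1)[OF u ty, of n] by simp
    qed
    then show ?thesis using ds_module lin_rules(1)[OF inj_lin] ty y by auto
  qed
  ultimately have "dl_rel R E t \<subseteq> ?W" unfolding dl_rel_def by (intro mod_span_least) auto
  then obtain n0 where "\<forall>n\<ge>n0. ?U n (sum_inj UNIV E m x) = \<zero>\<^bsub>E n\<^esub>" using mem by blast
  \<comment> \<open>The index \<open>m + n0\<close> is at least \<open>n0\<close> and at least
    \<open>m\<close>, so \<open>u\<close> is a genuine transition there.\<close>
  then have "u (m + n0) m x = \<zero>\<^bsub>E (m + n0)\<^esub>" using Ui[OF x, of "m + n0"] by simp
  then show "\<exists>j. upt_map t m j x = \<zero>\<^bsub>E (m + j)\<^esub>" by (auto simp: u_def)
qed

end

text \<open>Literally the choice made inside \<open>ext_map\<close>, so that unfolding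
  \<open>ext_map\<close> produces this map.\<close>

definition lift_map ::
    "('a, 'c, 'm) module_scheme \<Rightarrow> ('a, 'd, 'k) module_scheme \<Rightarrow> ('c \<Rightarrow> 'd)
      \<Rightarrow> nat \<Rightarrow> ('a, 'c) res_elt \<Rightarrow> ('a, 'd) res_elt"
  where "lift_map M M' f = (SOME g. chain_lift R M M' f g)"

lemma lift_map_rules:
  assumes "module R M" "module R M'" "lin R M M' f"
  shows "lin R (res_mod R M i) (res_mod R M' i) (lift_map M M' f i)"
    and "x \<in> carrier (res_mod R M 0) \<Longrightarrow> res_aug R M' (lift_map M M' f 0 x) = f (res_aug R M x)"
    and "y \<in> carrier (res_mod R M (Suc i)) \<Longrightarrow>
      res_diff R M' i (lift_map M M' f (Suc i) y) = lift_map M M' f i (res_diff R M i y)"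
proof -
  have "chain_lift R M M' f (lift_map M M' f)"
    unfolding lift_map_def by (rule someI_ex[OF ex_chain_lift[OF assms]])
  then show "lin R (res_mod R M i) (res_mod R M' i) (lift_map M M' f i)"
    "x \<in> carrier (res_mod R M 0) \<Longrightarrow> res_aug R M' (lift_map M M' f 0 x) = f (res_aug R M x)"
    "y \<in> carrier (res_mod R M (Suc i)) \<Longrightarrow>
      res_diff R M' i (lift_map M M' f (Suc i) y) = lift_map M M' f i (res_diff R M i y)"
    by (auto simp: chain_lift_def mod_hom_lin)
qed

lemma ext_map_class:
  assumes M: "module R M" and M': "module R M'" and f: "lin R M M' f" and N: "module R N"
    and h: "cocyc R N (res_cx M') m i h"
  shows "cocyc R N (res_cx M) m i (\<lambda>x. h (lift_map M M' f i x))"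
    and "ext_map R i M M' N f (ext_class i M' N h) = ext_class i M N (\<lambda>x. h (lift_map M M' f i x))"
proof -
  let ?g = "lift_map M M' f"
  note g = lift_map_rules[OF M M' f]
  note P = proj_resolution_rules[OF chosen_res_resolution[OF M] M]
  interpret S: pro_res R "res_cx M" "\<lambda>_. M" "\<lambda>_ _ y. y"
    by (rule const_pro_res[OF chosen_res_resolution[OF M] M])
  have gc: "cocyc R N (res_cx M) m i (\<lambda>x. q (?g i x))" if "cocyc R N (res_cx M') m i q" for q
  proof -
    have "lin R (res_mod R M i) N (\<lambda>x. q (?g i x))"
      by (rule lin_comp[OF g(1)]) (use that in \<open>simp add: cocyc_def\<close>)
    then show ?thesis using that g(3) lin_rules(1)[OF g(1)] by (auto simp: cocyc_def g(3)[symmetric])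
  qed
  then show gch: "cocyc R N (res_cx M) m i (\<lambda>x. h (?g i x))" using h by blast
  have gb: "cobd R N (res_cx M) m i (\<lambda>x. w (?g i x))" if w: "cobd R N (res_cx M') m i w" for w
  proof (cases i)
    case 0
    then show ?thesis using w lin_rules(1)[OF g(1)] by (simp add: cobd_def)
  next
    case (Suc j)
    then obtain v where v: "lin R (res_mod R M' j) N v"
      "\<forall>x\<in>carrier (res_mod R M' (Suc j)). w x = v (res_diff R M' j x)" using w by (auto simp: cobd_def)
    have "lin R (res_mod R M j) N (\<lambda>x. v (?g j x))" by (rule lin_comp[OF g(1) v(1)])
    moreover have "\<forall>x\<in>carrier (res_mod R M (Suc j)). w (?g (Suc j) x) = v (?g j (res_diff R M j x))"
      using v(2) lin_rules(1)[OF g(1)] g(3) by simp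
    ultimately show ?thesis using Suc by (auto simp: cobd_def)
  qed
  have "ext_coboundaries R i M N +>\<^bsub>hom_module R (res_mod R M i) N\<^esub> compose (carrier (res_mod R M i)) q (?g i) =
      ext_class i M N (\<lambda>x. h (?g i x))" if q: "q \<in> ext_class i M' N h" for q
  proof -
    have "ext_coboundaries R i M N +>\<^bsub>hom_module R (res_mod R M i) N\<^esub> compose (carrier (res_mod R M i)) q (?g i) =
        ext_class i M N (\<lambda>x. q (?g i x))"
      by (simp add: ext_class_def compose_def)
    also have "\<dots> = ext_class i M N (\<lambda>x. h (?g i x))"
      by (rule S.presents_rules(8)[OF ext_presents[OF M N] N ext_module[OF M N] gc gch])
        (use ext_class_mem[OF M' N h q] gb in auto)
    finally show ?thesis .
  qed
  then have "(\<Union>q\<in>ext_class i M' N h. ext_coboundaries R i M N +>\<^bsub>hom_module R (res_mod R M i) N\<^esub>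
      compose (carrier (res_mod R M i)) q (?g i)) = ext_class i M N (\<lambda>x. h (?g i x))"
    using ext_class_self[OF M' N h] by (intro SUP_eq_const) blast+
  moreover have "ext_class i M' N h \<in> carrier (Ext R i M' N)"
    using h ext_carrier[OF M' N, of i m] by blast
  ultimately show "ext_map R i M M' N f (ext_class i M' N h) = ext_class i M N (\<lambda>x. h (?g i x))"
    by (simp add: ext_map_def lift_map_def[symmetric])
qed

text \<open>The transitions are composites of the chosen one-step lifts. They therefore compose
  strictly, although a chosen lift of a composite map would agree with the composite of the chosen
  lifts only up to homotopy.\<close>

definition res_tower ::
    "(nat \<Rightarrow> ('a, 'c, 'm) module_scheme) \<Rightarrow> (nat \<Rightarrow> 'c \<Rightarrow> 'c) \<Rightarrow> ('a, ('a, 'c) res_elt, 'c) pro_complex"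
  where "res_tower A \<alpha> = \<lparr>cx = \<lambda>m. res_mod R (A m), df = \<lambda>m. res_diff R (A m),
    tr = \<lambda>m n k. dnt_map (\<lambda>l. lift_map (A (Suc l)) (A l) (\<alpha> l) k) m (n - m), aug = \<lambda>m. res_aug R (A m)\<rparr>"

context
  fixes A :: "nat \<Rightarrow> ('a, 'c, 'm) module_scheme" and \<alpha> :: "nat \<Rightarrow> 'c \<Rightarrow> 'c"
  assumes A [simp]: "\<And>n. module R (A n)" and \<alpha>: "\<And>n. lin R (A (Suc n)) (A n) (\<alpha> n)"
begin

lemma dnt_lin:
  assumes "\<And>n. lin R (B (Suc n)) (B n) (\<beta> n)"
  shows "lin R (B (m + j)) (B m) (dnt_map \<beta> m j)"
proof (induction j)
  case 0
  have "dnt_map \<beta> m 0 = (\<lambda>x. x)" by (simp add: fun_eq_iff)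
  then show ?case by (simp add: lin_id)
next
  case (Suc j)
  have "dnt_map \<beta> m (Suc j) = (\<lambda>x. dnt_map \<beta> m j (\<beta> (m + j) x))" by (simp add: fun_eq_iff)
  then show ?case using lin_comp[OF assms Suc] by simp
qed

lemma res_tower_pro_res: "pro_res R (res_tower A \<alpha>) A (\<lambda>m n. dnt_map \<alpha> m (n - m))"
proof -
  note P = proj_resolution_rules[OF chosen_res_resolution[OF A] A]
  note g = lift_map_rules[OF A A \<alpha>]
  let ?g = "\<lambda>k l. lift_map (A (Suc l)) (A l) (\<alpha> l) k"
  have dd: "res_diff R (A m) k (res_diff R (A m) (Suc k) x) = \<zero>\<^bsub>res_mod R (A m) k\<^esub>"
    if "x \<in> carrier (res_mod R (A m) (Suc (Suc k)))" for m k x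
    using P(7)[of "res_diff R (A m) (Suc k) x"] lin_rules(1)[OF P(3) that] that by blast
  have ed: "res_aug R (A m) (res_diff R (A m) 0 x) = \<zero>\<^bsub>A m\<^esub>"
    if "x \<in> carrier (res_mod R (A m) (Suc 0))" for m x
    using P(6)[of "res_diff R (A m) 0 x"] lin_rules(1)[OF P(3) that] that by blast
  have trl: "lin R (res_mod R (A (m + j)) k) (res_mod R (A m) k) (dnt_map (?g k) m j)" for m j k
    using dnt_lin[of "\<lambda>n. res_mod R (A n) k" "?g k"] g(1) by blast
  have dtr: "res_diff R (A m) k (dnt_map (?g (Suc k)) m j x) = dnt_map (?g k) m j (res_diff R (A (m + j)) k x)"
    if "x \<in> carrier (res_mod R (A (m + j)) (Suc k))" for m j k x
    using that
  proof (induction j arbitrary: x)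
    case (Suc j)
    then show ?case using g(3) lin_rules(1)[OF g(1)] by simp
  qed simp
  have etr: "res_aug R (A m) (dnt_map (?g 0) m j x) = dnt_map \<alpha> m j (res_aug R (A (m + j)) x)"
    if "x \<in> carrier (res_mod R (A (m + j)) 0)" for m j x
    using that
  proof (induction j arbitrary: x)
    case (Suc j)
    then show ?case using g(2) lin_rules(1)[OF g(1)] by simp
  qed simp
  have comp: "dnt_map u l (m - l) (dnt_map u m (n - m) x) = dnt_map u l (n - l) x" if "l \<le> m" "m \<le> n"
    for u :: "nat \<Rightarrow> 'z \<Rightarrow> 'z" and l m n x
    using dnt_map_add[of u l "m - l" "n - m" x] that by simp
  have sum: "m + (n - m) = n" if "m \<le> n" for m n :: nat using that by simp
  have "pro_cx R (res_tower A \<alpha>)"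
  proof (intro pro_cx.intro modules_axioms pro_cx_axioms.intro)
    show "lin R (cx (res_tower A \<alpha>) n k) (cx (res_tower A \<alpha>) m k) (tr (res_tower A \<alpha>) m n k)" if "m \<le> n" for m n k
      using trl[of m "n - m" k] that by (simp add: res_tower_def)
    show "df (res_tower A \<alpha>) m k (tr (res_tower A \<alpha>) m n (Suc k) x) = tr (res_tower A \<alpha>) m n k (df (res_tower A \<alpha>) n k x)"
      if "m \<le> n" "x \<in> carrier (cx (res_tower A \<alpha>) n (Suc k))" for m n k x
      using dtr[of x m "n - m" k] that by (simp add: res_tower_def)
  qed (simp_all add: res_tower_def P dd comp)
  moreover have "\<exists>n\<ge>m. \<forall>x\<in>carrier (cx (res_tower A \<alpha>) n k). aug_cycle A (res_tower A \<alpha>) n k x \<longrightarrow>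
      tr (res_tower A \<alpha>) m n k x \<in> df (res_tower A \<alpha>) m k ` carrier (cx (res_tower A \<alpha>) m (Suc k))" for m k
    by (intro exI[of _ m]) (cases k; simp add: aug_cycle_def P res_tower_def)
  moreover have "lin R (A n) (A m) (dnt_map \<alpha> m (n - m))" if "m \<le> n" for m n
    using dnt_lin[of A \<alpha> m "n - m"] \<alpha> that by simp
  moreover have "aug (res_tower A \<alpha>) m (tr (res_tower A \<alpha>) m n 0 x) = dnt_map \<alpha> m (n - m) (aug (res_tower A \<alpha>) n x)"
    if "m \<le> n" "x \<in> carrier (cx (res_tower A \<alpha>) n 0)" for m n x
    using etr[of x m "n - m"] that by (simp add: res_tower_def)
  ultimately show ?thesis
    by (intro pro_res.intro pro_res_axioms.intro) (simp_all add: comp res_tower_def P ed)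
qed

text \<open>The defining colimit of Ext modules becomes the cohomology of a single pro-complex.
  Passing to Hom reverses arrows: going up along \<open>upt_map\<close> on Ext is precomposition
  with \<open>dnt_map\<close> on the resolutions.\<close>

lemma direct_limit_ext_presents:
  assumes N: "module R N"
  shows "\<exists>\<phi>. presents R N (res_tower A \<alpha>) i
    (direct_limit R (\<lambda>n. Ext R i (A n) N) (\<lambda>n. ext_map R i (A (Suc n)) (A n) N (\<alpha> n))) \<phi>"
    and "module R (direct_limit R (\<lambda>n. Ext R i (A n) N) (\<lambda>n. ext_map R i (A (Suc n)) (A n) N (\<alpha> n)))"
proof -
  let ?S = "res_tower A \<alpha>" and ?E = "\<lambda>n. Ext R i (A n) N" and ?t = "\<lambda>n. ext_map R i (A (Suc n)) (A n) N (\<alpha> n)"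
  let ?L = "direct_limit R ?E ?t" and ?g = "\<lambda>k l. lift_map (A (Suc l)) (A l) (\<alpha> l) k"
  interpret S: pro_res R ?S A "\<lambda>m n. dnt_map \<alpha> m (n - m)" by (rule res_tower_pro_res)
  have cS: "cocyc R N ?S m i h \<longleftrightarrow> cocyc R N (res_cx (A m)) 0 i h" for m h
    by (simp add: cocyc_def res_tower_def)
  have bS: "cobd R N ?S m i h \<longleftrightarrow> cobd R N (res_cx (A m)) 0 i h" for m h
    by (cases i) (simp_all add: cobd_def res_tower_def)
  have E: "module R (?E n)" for n by (rule ext_module[OF A N])
  have Ec: "\<exists>h. cocyc R N (res_cx (A n)) 0 i h \<and> x = ext_class i (A n) N h" if "x \<in> carrier (?E n)" for n x
    using that unfolding ext_carrier[OF A N, where m = 0] by blast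
  have tc: "?t n (ext_class i (A n) N h) = ext_class i (A (Suc n)) N (\<lambda>x. h (?g i n x))"
    "cocyc R N (res_cx (A (Suc n))) 0 i (\<lambda>x. h (?g i n x))"
    if "cocyc R N (res_cx (A n)) 0 i h" for n h
    using ext_map_class[OF A A \<alpha> N that] by auto
  have cE: "ext_class i (A n) N h \<in> carrier (?E n)" if "cocyc R N (res_cx (A n)) 0 i h" for n h
    using that unfolding ext_carrier[OF A N, where m = 0] by blast
  have t: "lin R (?E n) (?E (Suc n)) (?t n)" for n
  proof (rule linI)
    show "?t n x \<in> carrier (?E (Suc n))" if "x \<in> carrier (?E n)" for x
      using Ec[OF that] tc cE by metis
    show "?t n (x \<oplus>\<^bsub>?E n\<^esub> y) = ?t n x \<oplus>\<^bsub>?E (Suc n)\<^esub> ?t n y" if xy: "x \<in> carrier (?E n)" "y \<in> carrier (?E n)" for x y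
    proof -
      obtain h where h: "cocyc R N (res_cx (A n)) 0 i h" "x = ext_class i (A n) N h" using Ec xy by blast
      obtain k where k: "cocyc R N (res_cx (A n)) 0 i k" "y = ext_class i (A n) N k" using Ec xy by blast
      have "cocyc R N (res_cx (A n)) 0 i (\<lambda>x. h x \<oplus>\<^bsub>N\<^esub> k x)"
        using S.cocyc_ops(1)[OF N, of n i h k] h k cS by simp
      from tc(1)[OF this] show ?thesis
        using h k tc ext_add[OF A N h(1) k(1)] ext_add[OF A N tc(2)[OF h(1)] tc(2)[OF k(1)]] by simp
    qed
    show "?t n (c \<odot>\<^bsub>?E n\<^esub> x) = c \<odot>\<^bsub>?E (Suc n)\<^esub> ?t n x" if c: "c \<in> carrier R" and x: "x \<in> carrier (?E n)" for c x
    proof -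
      obtain h where h: "cocyc R N (res_cx (A n)) 0 i h" "x = ext_class i (A n) N h" using Ec x by blast
      have "cocyc R N (res_cx (A n)) 0 i (\<lambda>x. c \<odot>\<^bsub>N\<^esub> h x)"
        using S.cocyc_ops(3)[OF N, of n i h c] h c cS by simp
      from tc(1)[OF this] show ?thesis
        using h tc ext_smult[OF A N c h(1)] ext_smult[OF A N c tc(2)[OF h(1)]] by simp
    qed
  qed
  show L: "module R ?L" by (rule direct_limit_module[where E = ?E and t = ?t, OF E t])
  have up: "upt_map ?t m j (ext_class i (A m) N h) = ext_class i (A (m + j)) N (\<lambda>x. h (dnt_map (?g i) m j x)) \<and>
      cocyc R N (res_cx (A (m + j))) 0 i (\<lambda>x. h (dnt_map (?g i) m j x))"
    if h: "cocyc R N (res_cx (A m)) 0 i h" for m j h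
  proof (induction j)
    case 0
    then show ?case using h by simp
  next
    case (Suc j)
    then show ?case using tc[of "m + j" "\<lambda>x. h (dnt_map (?g i) m j x)"] by simp
  qed
  have trS: "tr ?S m n i = dnt_map (?g i) m (n - m)" for m n by (simp add: res_tower_def)
  show "\<exists>\<phi>. presents R N ?S i ?L \<phi>"
    unfolding presents_def
  proof (intro exI[of _ "\<lambda>m h. dl_inj R ?E ?t m (ext_class i (A m) N h)"] conjI allI impI ballI)
    fix m h assume "cocyc R N ?S m i h"
    then have h: "cocyc R N (res_cx (A m)) 0 i h" using cS by blast
    show "dl_inj R ?E ?t m (ext_class i (A m) N h) \<in> carrier ?L"
      by (rule lin_rules(1)[OF dl_inj_lin[where E = ?E and t = ?t, OF E t] cE[OF h]])
    show "dl_inj R ?E ?t m (ext_class i (A m) N h) = dl_inj R ?E ?t m (ext_class i (A m) N h')"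
      if "\<forall>x\<in>carrier (cx ?S m i). h x = h' x" for h'
      using ext_class_cong[of "A m" i h h' N] that by (simp add: res_tower_def)
    show "dl_inj R ?E ?t m (ext_class i (A m) N (\<lambda>x. h x \<oplus>\<^bsub>N\<^esub> h' x)) =
        dl_inj R ?E ?t m (ext_class i (A m) N h) \<oplus>\<^bsub>?L\<^esub> dl_inj R ?E ?t m (ext_class i (A m) N h')"
      if "cocyc R N ?S m i h'" for h'
      using that cS ext_add[OF A N h] lin_rules(2)[OF dl_inj_lin[where E = ?E and t = ?t, OF E t]] cE h by simp
    show "dl_inj R ?E ?t m (ext_class i (A m) N (\<lambda>x. c \<odot>\<^bsub>N\<^esub> h x)) =
        c \<odot>\<^bsub>?L\<^esub> dl_inj R ?E ?t m (ext_class i (A m) N h)" if "c \<in> carrier R" for c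
      using that ext_smult[OF A N that h] lin_rules(3)[OF dl_inj_lin[where E = ?E and t = ?t, OF E t]] cE h by simp
    show "dl_inj R ?E ?t n (ext_class i (A n) N (\<lambda>x. h (tr ?S m n i x))) = dl_inj R ?E ?t m (ext_class i (A m) N h)"
      if "m \<le> n" for n
      using up[OF h, of "n - m"] dl_inj_upt[where E = ?E and t = ?t, OF E t cE[OF h], of "n - m"] that by (simp add: trS)
    have "upt_map ?t m j (ext_class i (A m) N h) = \<zero>\<^bsub>?E (m + j)\<^esub> \<longleftrightarrow>
        cobd R N ?S (m + j) i (\<lambda>x. h (tr ?S m (m + j) i x))" for j
      using up[OF h, of j] ext_zero_iff[OF A N, of "m + j" 0 i "\<lambda>x. h (dnt_map (?g i) m j x)"]
      by (simp add: trS bS)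
    moreover have "(\<exists>j. Q (m + j)) \<longleftrightarrow> (\<exists>n\<ge>m. Q n)" for Q by (metis le_add1 le_iff_add)
    ultimately show "dl_inj R ?E ?t m (ext_class i (A m) N h) = \<zero>\<^bsub>?L\<^esub> \<longleftrightarrow>
        (\<exists>n\<ge>m. cobd R N ?S n i (\<lambda>x. h (tr ?S m n i x)))"
      unfolding dl_inj_zero_iff[where E = ?E and t = ?t, OF E t cE[OF h]] by simp
  next
    fix y assume "y \<in> carrier ?L"
    then obtain m x where x: "x \<in> carrier (?E m)" "y = dl_inj R ?E ?t m x" by (rule dl_inj_surj[where E = ?E and t = ?t, OF E t])
    then obtain h where "cocyc R N (res_cx (A m)) 0 i h" "x = ext_class i (A m) N h" using Ec by blast
    then show "\<exists>m h. cocyc R N ?S m i h \<and> dl_inj R ?E ?t m (ext_class i (A m) N h) = y"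
      using x cS by blast
  qed
qed

end

end

section \<open>Chain conditions on finite free modules, and minimal free covers\<close>

section \<open>Noetherian and local rings\<close>

text \<open>Otherwise dependent choice builds a strictly increasing chain in the family.\<close>

lemma increasing_chain_max:
  assumes ne: "X0 \<in> \<Phi>"
    and acc: "\<And>H :: nat \<Rightarrow> 'x set. (\<And>n. H n \<in> \<Phi>) \<Longrightarrow> (\<And>n. H n \<subseteq> H (Suc n)) \<Longrightarrow> \<exists>n. H (Suc n) = H n"
  shows "\<exists>L\<in>\<Phi>. \<forall>L'\<in>\<Phi>. L \<subseteq> L' \<longrightarrow> L' = L"
proof (rule ccontr)
  assume "\<not> ?thesis"
  then have *: "\<And>L. L \<in> \<Phi> \<Longrightarrow> \<exists>L'. L' \<in> \<Phi> \<and> L \<subset> L'" by blast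
  have "\<exists>H. \<forall>n. H n \<in> \<Phi> \<and> H n \<subset> H (Suc n)"
    by (rule dependent_nat_choice) (use ne * in blast)+
  then obtain H where "\<And>n. H n \<in> \<Phi>" "\<And>n. H n \<subset> H (Suc n)" by blast
  then show False using acc[of H] by (metis psubset_eq)
qed

context modules
begin

lemma ideal_iff_submodule: "ideal I R \<longleftrightarrow> submodule I R (ring_module R)"
proof
  assume I: "ideal I R"
  interpret I: ideal I R by fact
  show "submodule I R (ring_module R)"
    unfolding submodule_iff[OF ring_module_module] using I.I_l_closed I.Icarr by auto
next
  assume S: "submodule I R (ring_module R)"
  note Sr = submodule_rules[OF S ring_module_module]
  have neg: "\<ominus> x \<in> I" if "x \<in> I" for x
    using Sr(4)[of "\<ominus> \<one>" x] Sr(1)[OF that] that by (simp add: R.l_minus)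
  show "ideal I R"
  proof (rule idealI)
    show "ring R" by (rule R.ring_axioms)
    show "subgroup I (add_monoid R)"
      by (rule R.add.subgroupI) (use Sr(1,2,3) neg in \<open>auto simp: a_inv_def\<close>)
    fix a x assume "a \<in> I" "x \<in> carrier R"
    then show "x \<otimes> a \<in> I" "a \<otimes> x \<in> I" using Sr(1)[of a] Sr(4)[of x a] R.m_comm[of a x] by auto
  qed
qed

lemmas ideal_rules = submodule_rules[OF iffD1[OF ideal_iff_submodule] ring_module_module, simplified]

lemma finsum_submodule:
  assumes M: "module R M" and H: "submodule H R M" and f: "\<And>i. i \<in> A \<Longrightarrow> f i \<in> H"
  shows "finsum M f A \<in> H"
proof -
  interpret M: module R M by fact
  note S = submodule_rules[OF H M]
  show ?thesis
  proof (cases "finite A")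
    case True
    then show ?thesis using f
    proof (induction A rule: finite_induct)
      case empty
      then show ?case using S(2) by simp
    next
      case (insert i A)
      then have "finsum M f (insert i A) = f i \<oplus>\<^bsub>M\<^esub> finsum M f A"
        using S(1) by (intro M.M.finsum_insert) auto
      then show ?case using insert S(3) by simp
    qed
  next
    case False
    then show ?thesis using S(2) by (simp add: M.M.finsum_infinite)
  qed
qed

lemma free_map_in_submodule:
  assumes N: "module R N" and H: "submodule H R N" and u: "\<And>x. x \<in> X \<Longrightarrow> u x \<in> carrier N"
    and z: "z \<in> carrier (free_module R X)" and mem: "\<And>x. x \<in> X \<Longrightarrow> z x \<odot>\<^bsub>N\<^esub> u x \<in> H"
  shows "free_map R X N u z \<in> H"
  unfolding free_map_def ds_map_def by (rule finsum_submodule[OF N H]) (use mem in auto)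

lemma free_map_eq:
  assumes N: "module R N" and f: "lin R (free_module R X) N f" and z: "z \<in> carrier (free_module R X)"
  shows "f z = free_map R X N (\<lambda>x. f (free_basis R X x)) z"
proof (rule free_lin_ext[OF N f _ _ z])
  have c: "f (free_basis R X x) \<in> carrier N" if "x \<in> X" for x using lin_rules(1)[OF f] that by simp
  then show "lin R (free_module R X) N (free_map R X N (\<lambda>x. f (free_basis R X x)))" by (rule free_map_lin[OF N])
  show "f (free_basis R X x) = free_map R X N (\<lambda>x. f (free_basis R X x)) (free_basis R X x)" if "x \<in> X" for x
    using free_map_basis[OF N c that] by simp
qed

text \<open>The products are tested and not the values on the basis, so the coefficients of
  \<open>z\<close> may be what brings a term into \<open>H\<close>; this is how memberships in an
  ideal times a module are obtained.\<close>

lemma lin_in_submodule: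
  assumes N: "module R N" and H: "submodule H R N" and f: "lin R (free_module R X) N f"
    and z: "z \<in> carrier (free_module R X)" and mem: "\<And>x. x \<in> X \<Longrightarrow> z x \<odot>\<^bsub>N\<^esub> f (free_basis R X x) \<in> H"
  shows "f z \<in> H"
  unfolding free_map_eq[OF N f z]
  by (rule free_map_in_submodule[OF N H _ z mem]) (use lin_rules(1)[OF f] in simp_all)

lemma free_map_span:
  assumes N: "module R N" and u: "\<And>x. x \<in> X \<Longrightarrow> u x \<in> carrier N"
  shows "free_map R X N u ` carrier (free_module R X) = mod_span R N (u ` X)"
proof
  have L: "lin R (free_module R X) N (free_map R X N u)" by (rule free_map_lin[OF N u])
  have S: "submodule (mod_span R N (u ` X)) R N" by (rule mod_span_submodule[OF N]) (use u in auto)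
  show "free_map R X N u ` carrier (free_module R X) \<subseteq> mod_span R N (u ` X)"
  proof (intro image_subsetI free_map_in_submodule[OF N S u])
    fix z x assume "z \<in> carrier (free_module R X)" "x \<in> X"
    then show "z x \<odot>\<^bsub>N\<^esub> u x \<in> mod_span R N (u ` X)"
      by (intro submodule_rules(4)[OF S N] mod_span_superset) auto
  qed
  show "mod_span R N (u ` X) \<subseteq> free_map R X N u ` carrier (free_module R X)"
  proof (rule mod_span_least[OF lin_image_submodule[OF L free_module_module N]], rule image_subsetI)
    fix x assume "x \<in> X"
    then show "u x \<in> free_map R X N u ` carrier (free_module R X)"
      using free_map_basis[where u = u and X = X, OF N u] by (intro image_eqI[of _ _ "free_basis R X x"]) auto
  qed
qed

lemma ex_free_span:
  assumes N: "module R N" and S: "finite S" "S \<subseteq> carrier N"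
  shows "\<exists>(r::nat) d. lin R (free_module R {..<r}) N d \<and> d ` carrier (free_module R {..<r}) = mod_span R N S"
proof -
  obtain u where u: "bij_betw u {..<card S} S" using ex_bij_betw_nat_finite[OF S(1)] by (auto simp: lessThan_atLeast0)
  have uS: "u ` {..<card S} = S" using u by (simp add: bij_betw_def)
  have uN: "u x \<in> carrier N" if "x \<in> {..<card S}" for x using uS S(2) that by blast
  show ?thesis
    using free_map_lin[where X = "{..<card S}" and u = u, OF N uN]
      free_map_span[where X = "{..<card S}" and u = u, OF N uN] uS by (intro exI conjI) auto
qed

text \<open>A relation with a unit coefficient expresses one generator through the others.\<close>

lemma unit_relation_drop:
  fixes r :: nat
  assumes N: "module R N" and d: "lin R (free_module R {..<r}) N d"
    and l: "l \<in> carrier (free_module R {..<r})" "d l = \<zero>\<^bsub>N\<^esub>" and j: "j < r" "l j \<in> Units R"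
  shows "\<exists>d'. lin R (free_module R {..<r - 1}) N d' \<and>
    d' ` carrier (free_module R {..<r - 1}) = d ` carrier (free_module R {..<r})"
proof -
  let ?F = "free_module R {..<r}" and ?e = "free_basis R {..<r}"
  have dc: "d (?e s) \<in> carrier N" if "s < r" for s using lin_rules(1)[OF d] that by simp
  \<comment> \<open>The images of the basis vectors other than the \<open>j\<close>-th,
    renumbered.\<close>
  define u where "u = (\<lambda>k. d (?e (if k < j then k else Suc k)))"
  have uc: "u k \<in> carrier N" if "k \<in> {..<r - 1}" for k unfolding u_def using that j by (intro dc) auto
  let ?W = "mod_span R N (u ` {..<r - 1})"
  have W: "submodule ?W R N" by (rule mod_span_submodule[OF N]) (use uc in auto)
  note Wr = submodule_rules[OF W N]
  have sW: "d (?e s) \<in> ?W" if "s < r" "s \<noteq> j" for s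
  proof (rule mod_span_superset)
    show "d (?e s) \<in> u ` {..<r - 1}"
    proof (cases "s < j")
      case True
      then show ?thesis using j by (intro image_eqI[of _ _ s]) (auto simp: u_def)
    next
      case False
      then show ?thesis using that by (intro image_eqI[of _ _ "s - 1"]) (auto simp: u_def)
    qed
  qed
  \<comment> \<open>\<open>d\<close> without the contribution of the \<open>j\<close>-th generator,
    so its values lie in the span of the others. At the relation \<open>l\<close> it equals minus a
    unit multiple of the \<open>j\<close>-th generator.\<close>
  define f where "f = (\<lambda>z. d z \<ominus>\<^bsub>N\<^esub> z j \<odot>\<^bsub>N\<^esub> d (?e j))"
  have comp: "lin R ?F (ring_module R) (\<lambda>z. z j)"
    unfolding free_module_def by (rule lin_component) (use j in simp)
  have fl: "lin R ?F N f"
    unfolding f_def by (rule lin_minus[OF N d lin_comp[OF comp lin_smult_elt[OF N dc[OF j(1)]]]])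
  have fz: "f z \<in> ?W" if z: "z \<in> carrier ?F" for z
  proof (rule lin_in_submodule[OF N W fl z])
    fix s assume s: "s \<in> {..<r}"
    have "f (?e s) \<in> ?W"
    proof (cases "s = j")
      case True
      have "?e j j = \<one>" using j by (simp add: free_basis_def sum_inj_def)
      then show ?thesis using True Wr(2) N dc[OF j(1)] by (simp add: f_def)
    next
      case False
      have "?e s j = \<zero>" using j False by (simp add: free_basis_def sum_inj_def)
      then show ?thesis using sW[of s] s False N dc[OF j(1)] dc[of s] by (simp add: f_def)
    qed
    then show "z s \<odot>\<^bsub>N\<^esub> f (?e s) \<in> ?W" using Wr(4) z s by simp
  qed
  have lj: "l j \<in> carrier R" "inv (l j) \<in> carrier R" "inv (l j) \<otimes> l j = \<one>" using j by auto
  have "\<ominus>\<^bsub>N\<^esub> (l j \<odot>\<^bsub>N\<^esub> d (?e j)) \<in> ?W"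
    using fz[OF l(1)] l(2) lj dc[OF j(1)] N by (simp add: f_def a_minus_def)
  then have "l j \<odot>\<^bsub>N\<^esub> d (?e j) \<in> ?W" using Wr(5) lj dc[OF j(1)] N by fastforce
  then have "inv (l j) \<odot>\<^bsub>N\<^esub> (l j \<odot>\<^bsub>N\<^esub> d (?e j)) \<in> ?W" by (rule Wr(4)[OF lj(2)])
  then have "d (?e j) \<in> ?W" using lj dc[OF j(1)] N by (simp add: mm_smult_smult[symmetric])
  then have dW: "d z \<in> ?W" if z: "z \<in> carrier ?F" for z
    by (intro lin_in_submodule[OF N W d z] Wr(4)) (use sW z in auto)
  have "?W \<subseteq> d ` carrier ?F"
    by (rule mod_span_least[OF lin_image_submodule[OF d free_module_module N]])
      (auto simp: u_def intro!: imageI free_basis_carrier)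
  then have "?W = d ` carrier ?F" using dW by blast
  then show ?thesis using free_map_span[where u = u, OF N uc] free_map_lin[where u = u, OF N uc] by metis
qed

end

locale noeth_modules = modules R + noetherian_ring R for R (structure)
begin

lemma ideal_chain:
  assumes I: "\<And>n :: nat. ideal (I n) R" and inc: "\<And>n. I n \<subseteq> I (Suc n)"
  shows "\<exists>n. \<forall>m\<ge>n. I m = I n"
proof -
  have mono: "I m \<subseteq> I n" if "m \<le> n" for m n using lift_Suc_mono_le[of I, OF inc that] .
  have "subset.chain {I. ideal I R} (range I)"
    unfolding subset_chain_def using I mono by (auto, meson linear subsetD)
  then have "\<Union> (range I) \<in> range I" by (intro ideal_chain_is_trivial) auto
  then obtain n where "\<Union> (range I) = I n" by blast
  then have "\<forall>m\<ge>n. I m = I n" using mono by blast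
  then show ?thesis by blast
qed

text \<open>Noetherianity of R^q by induction on the number \<open>i\<close> of coordinates that may
  be nonzero. The ideals of values of the last such coordinate become stationary, and so do the
  submodules on which it vanishes; together they determine a member of an increasing chain. All
  submodules stay inside one R^q, so no change of module is needed in the induction.\<close>

lemma free_chain:
  fixes H :: "nat \<Rightarrow> (nat \<Rightarrow> 'a) set"
  assumes "i \<le> q" and "\<And>n. submodule (H n) R (free_module R {..<q})" and "\<And>n. H n \<subseteq> H (Suc n)"
    and "\<And>n x s. x \<in> H n \<Longrightarrow> i \<le> s \<Longrightarrow> s < q \<Longrightarrow> x s = \<zero>"
  shows "\<exists>n. \<forall>m\<ge>n. H m = H n"
  using assms
proof (induction i arbitrary: H)
  case 0
  let ?G = "free_module R {..<q}"
  have "H n = {\<zero>\<^bsub>?G\<^esub>}" for n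
  proof -
    have "x = \<zero>\<^bsub>?G\<^esub>" if "x \<in> H n" for x
      using that 0(4)[OF that] submodule_rules(1)[OF 0(2) free_module_module that] mm_zero[OF free_module_module, of "{..<q}"]
      unfolding free_module_def by (intro direct_sum_eqI) (auto simp: direct_sum_simps(2))
    then show ?thesis using submodule_rules(2)[OF 0(2) free_module_module] by blast
  qed
  then show ?case by blast
next
  case (Suc i)
  let ?G = "free_module R {..<q}"
  note S = submodule_rules[OF Suc.prems(2) free_module_module]
  have comp: "lin R ?G (ring_module R) (\<lambda>z. z i)"
    unfolding free_module_def by (rule lin_component) (use Suc.prems in simp)
  have mono: "H m \<subseteq> H n" if "m \<le> n" for m n using lift_Suc_mono_le[of H, OF Suc.prems(3) that] .
  define I where "I n = (\<lambda>x. x i) ` H n" for n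
  have "ideal (I n) R" for n
  proof -
    have "lin R (?G\<lparr>carrier := H n\<rparr>) (ring_module R) (\<lambda>z. z i)"
      using comp S(1)[of _ n] by (auto simp: lin_def)
    from lin_image_submodule[OF this submodule_module[OF Suc.prems(2) free_module_module] ring_module_module]
    show ?thesis by (simp add: ideal_iff_submodule I_def)
  qed
  moreover have "I n \<subseteq> I (Suc n)" for n unfolding I_def using Suc.prems(3) by blast
  ultimately obtain n1 where n1: "\<forall>m\<ge>n1. I m = I n1" using ideal_chain by blast
  define K where "K n = {x \<in> H n. x i = \<zero>}" for n
  have "\<exists>n. \<forall>m\<ge>n. K m = K n"
  proof (rule Suc.IH)
    show "i \<le> q" using Suc.prems by simp
    show "submodule (K n) R ?G" for n
      unfolding submodule_iff[OF free_module_module] K_def using S(1-4) lin_rules(1-4)[OF comp] by auto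
    show "K n \<subseteq> K (Suc n)" for n unfolding K_def using Suc.prems(3) by blast
    show "x s = \<zero>" if "x \<in> K n" "i \<le> s" "s < q" for n x s
      using that Suc.prems(4)[of x n s] by (cases "s = i") (auto simp: K_def)
  qed
  then obtain n2 where n2: "\<forall>m\<ge>n2. K m = K n2" by blast
  let ?n = "max n1 n2"
  have "H m \<subseteq> H ?n" if m: "m \<ge> ?n" for m
  proof
    fix x assume x: "x \<in> H m"
    have "I m = I ?n" using n1[rule_format, of m] n1[rule_format, of ?n] m by simp
    moreover have "x i \<in> I m" using x by (auto simp: I_def)
    ultimately have "x i \<in> (\<lambda>x. x i) ` H ?n" by (simp add: I_def)
    then obtain y where y: "y \<in> H ?n" "y i = x i" by auto
    have ym: "y \<in> H m" using y mono[OF m] by blast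
    have xc: "x \<in> carrier ?G" "y \<in> carrier ?G" using S(1) x ym by auto
    have "(x \<ominus>\<^bsub>?G\<^esub> y) i = x i \<ominus>\<^bsub>ring_module R\<^esub> y i" using lin_rules(6)[OF comp _ _ xc] by simp
    then have "(x \<ominus>\<^bsub>?G\<^esub> y) i = \<zero>" using y lin_rules(1)[OF comp xc(1)] mm_minus_self[OF ring_module_module] by simp
    then have "x \<ominus>\<^bsub>?G\<^esub> y \<in> K m" using S(6)[OF x ym] by (simp add: K_def)
    moreover have "K m = K ?n" using n2[rule_format, of m] n2[rule_format, of ?n] m by simp
    ultimately have "x \<ominus>\<^bsub>?G\<^esub> y \<in> K ?n" by simp
    then have "x \<ominus>\<^bsub>?G\<^esub> y \<in> H ?n" by (simp add: K_def)
    from S(3)[OF this y(1)] show "x \<in> H ?n" using xc by simp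
  qed
  then have "\<forall>m\<ge>?n. H m = H ?n" using mono by blast
  then show ?case by blast
qed

lemma free_max_submodule:
  fixes X0 :: "(nat \<Rightarrow> 'a) set"
  assumes "X0 \<in> \<Phi>" and "\<And>X. X \<in> \<Phi> \<Longrightarrow> submodule X R (free_module R {..<q})"
  shows "\<exists>L\<in>\<Phi>. \<forall>L'\<in>\<Phi>. L \<subseteq> L' \<longrightarrow> L' = L"
proof (rule increasing_chain_max[OF assms(1)])
  fix H :: "nat \<Rightarrow> (nat \<Rightarrow> 'a) set"
  assume "\<And>n. H n \<in> \<Phi>" "\<And>n. H n \<subseteq> H (Suc n)"
  then have "\<exists>n. \<forall>m\<ge>n. H m = H n" using assms(2) by (intro free_chain[of q q H]) auto
  then show "\<exists>n. H (Suc n) = H n" by (meson le_SucI order_refl)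
qed

lemma ideal_max:
  assumes "I0 \<in> \<Phi>" and "\<And>I. I \<in> \<Phi> \<Longrightarrow> ideal I R"
  shows "\<exists>L\<in>\<Phi>. \<forall>L'\<in>\<Phi>. L \<subseteq> L' \<longrightarrow> L' = L"
proof (rule increasing_chain_max[OF assms(1)])
  fix H :: "nat \<Rightarrow> 'a set"
  assume "\<And>n. H n \<in> \<Phi>" "\<And>n. H n \<subseteq> H (Suc n)"
  then have "\<exists>n. \<forall>m\<ge>n. H m = H n" using assms(2) by (intro ideal_chain) auto
  then show "\<exists>n. H (Suc n) = H n" by (meson le_SucI order_refl)
qed

text \<open>A maximal finitely generated submodule of \<open>K\<close> is all of \<open>K\<close>,
  since adjoining one more element keeps it finitely generated.\<close>

lemma free_submodule_cover:
  fixes K :: "(nat \<Rightarrow> 'a) set"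
  assumes K: "submodule K R (free_module R {..<q})"
  shows "\<exists>(r::nat) d. lin R (free_module R {..<r}) (free_module R {..<q}) d \<and>
    d ` carrier (free_module R {..<r}) = K"
proof -
  let ?G = "free_module R {..<q}"
  define \<Phi> where "\<Phi> = {mod_span R ?G S | S. finite S \<and> S \<subseteq> K}"
  have KG: "K \<subseteq> carrier ?G" using submodule_rules(1)[OF K free_module_module] by blast
  have sub: "submodule X R ?G" if "X \<in> \<Phi>" for X
    using that KG mod_span_submodule[OF free_module_module] unfolding \<Phi>_def by blast
  have "mod_span R ?G {} \<in> \<Phi>" by (auto simp: \<Phi>_def)
  from free_max_submodule[OF this sub]
  obtain L where L: "L \<in> \<Phi>" "\<And>L'. L' \<in> \<Phi> \<Longrightarrow> L \<subseteq> L' \<Longrightarrow> L' = L" by blast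
  then obtain S where S: "finite S" "S \<subseteq> K" "L = mod_span R ?G S" unfolding \<Phi>_def by blast
  have "x \<in> L" if "x \<in> K" for x
  proof -
    have "mod_span R ?G (insert x S) \<in> \<Phi>" unfolding \<Phi>_def using S that by blast
    moreover have "L \<subseteq> mod_span R ?G (insert x S)" unfolding S(3) mod_span_def by blast
    ultimately have "mod_span R ?G (insert x S) = L" using L(2) by blast
    then show ?thesis using mod_span_superset[of x "insert x S"] by blast
  qed
  moreover have "L \<subseteq> K" unfolding S(3) by (rule mod_span_least[OF K S(2)])
  ultimately have "mod_span R ?G S = K" using S(3) by blast
  then show ?thesis using ex_free_span[OF free_module_module S(1), of "{..<q}"] S(2) KG by auto
qed

text \<open>Minimality counts generators among all finite free covers of the same submodule
  \<open>K\<close> of \<open>N\<close>. By \<open>min_cover_no_unit\<close> it forces the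
  coordinates of all relations to be nonunits, which is the form needed for Nakayama's
  lemma.\<close>

definition min_cover :: "nat \<Rightarrow> ('a, 'c, 'm) module_scheme \<Rightarrow> 'c set \<Rightarrow> ((nat \<Rightarrow> 'a) \<Rightarrow> 'c) \<Rightarrow> bool" where
  "min_cover r N K d \<longleftrightarrow> lin R (free_module R {..<r}) N d \<and> d ` carrier (free_module R {..<r}) = K \<and>
    (\<forall>q d'. lin R (free_module R {..<q}) N d' \<and> d' ` carrier (free_module R {..<q}) = K \<longrightarrow> r \<le> q)"

lemma ex_min_cover:
  assumes "\<exists>(r::nat) d. lin R (free_module R {..<r}) N d \<and> d ` carrier (free_module R {..<r}) = K"
  shows "\<exists>r d. min_cover r N K d"
proof -
  let ?P = "\<lambda>r::nat. \<exists>d. lin R (free_module R {..<r}) N d \<and> d ` carrier (free_module R {..<r}) = K"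
  have P: "?P (LEAST r. ?P r)" using LeastI_ex[OF assms] .
  moreover have "(LEAST r. ?P r) \<le> q" if "?P q" for q using Least_le[of ?P, OF that] .
  ultimately show ?thesis unfolding min_cover_def by blast
qed

lemma ex_min_resolution:
  assumes M: "module R M" and fg: "fin_gen R M"
  shows "\<exists>r d v. proj_resolution R M (\<lambda>i. free_module R {..<r i}) d v \<and>
    min_cover (r 0) M (carrier M) v \<and>
    (\<forall>i. min_cover (r (Suc i)) (free_module R {..<r i}) (d i ` carrier (free_module R {..<r (Suc i)})) (d i))"
proof -
  let ?F = "\<lambda>r::nat. free_module R {..<r}"
  obtain r0 v where v: "min_cover r0 M (carrier M) v"
    using fg ex_free_span[OF M] ex_min_cover[of M "carrier M"] unfolding fin_gen_def by metis
  then have vl: "lin R (?F r0) M v" and vi: "v ` carrier (?F r0) = carrier M" by (auto simp: min_cover_def)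
  \<comment> \<open>A state carries the rank, the kernel to be covered next, and the differential;
    minimality is imposed at every step.\<close>
  define Q where "Q s s' \<longleftrightarrow> min_cover (fst s') (?F (fst s)) (fst (snd s)) (snd (snd s')) \<and>
    fst (snd s') = {x \<in> carrier (?F (fst s')). snd (snd s') x = \<zero>\<^bsub>?F (fst s)\<^esub>}"
    for s s' :: "nat \<times> (nat \<Rightarrow> 'a) set \<times> ((nat \<Rightarrow> 'a) \<Rightarrow> nat \<Rightarrow> 'a)"
  have "\<exists>f. \<forall>n. (submodule (fst (snd (f n))) R (?F (fst (f n))) \<and>
      (n = 0 \<longrightarrow> f n = (r0, {x \<in> carrier (?F r0). v x = \<zero>\<^bsub>M\<^esub>}, \<lambda>x. x))) \<and> Q (f n) (f (Suc n))"
  proof (rule dependent_nat_choice)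
    show "\<exists>x. submodule (fst (snd x)) R (?F (fst x)) \<and>
      (0 = (0::nat) \<longrightarrow> x = (r0, {x \<in> carrier (?F r0). v x = \<zero>\<^bsub>M\<^esub>}, \<lambda>x. x))"
      using lin_kernel_submodule[OF vl free_module_module M] by simp
    fix s :: "nat \<times> (nat \<Rightarrow> 'a) set \<times> ((nat \<Rightarrow> 'a) \<Rightarrow> nat \<Rightarrow> 'a)" and n :: nat
    assume "submodule (fst (snd s)) R (?F (fst s)) \<and>
      (n = 0 \<longrightarrow> s = (r0, {x \<in> carrier (?F r0). v x = \<zero>\<^bsub>M\<^esub>}, \<lambda>x. x))"
    then obtain q d where d: "min_cover q (?F (fst s)) (fst (snd s)) d"
      using ex_min_cover[OF free_submodule_cover] by blast
    then have "lin R (?F q) (?F (fst s)) d" by (simp add: min_cover_def)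
    then show "\<exists>s'. (submodule (fst (snd s')) R (?F (fst s')) \<and>
      (Suc n = 0 \<longrightarrow> s' = (r0, {x \<in> carrier (?F r0). v x = \<zero>\<^bsub>M\<^esub>}, \<lambda>x. x))) \<and> Q s s'"
      using lin_kernel_submodule[OF _ free_module_module free_module_module] d
      by (intro exI[of _ "(q, {x \<in> carrier (?F q). d x = \<zero>\<^bsub>?F (fst s)\<^esub>}, d)"]) (simp add: Q_def)
  qed
  then obtain f where f0: "f 0 = (r0, {x \<in> carrier (?F r0). v x = \<zero>\<^bsub>M\<^esub>}, \<lambda>x. x)"
    and f: "\<And>n. Q (f n) (f (Suc n))" by blast
  let ?P = "\<lambda>n. ?F (fst (f n))"
  let ?d = "\<lambda>n. restrict (snd (snd (f (Suc n)))) (carrier (?P (Suc n)))"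
  have fd: "lin R (?P (Suc n)) (?P n) (snd (snd (f (Suc n))))"
    "snd (snd (f (Suc n))) ` carrier (?P (Suc n)) = fst (snd (f n))" for n
    using f[of n] by (simp_all add: Q_def min_cover_def)
  have dim: "?d n ` carrier (?P (Suc n)) = fst (snd (f n))" for n using fd(2)[of n] by simp
  have ker: "fst (snd (f (Suc n))) = {x \<in> carrier (?P (Suc n)). snd (snd (f (Suc n))) x = \<zero>\<^bsub>?P n\<^esub>}" for n
    using f[of n] by (simp add: Q_def)
  have "proj_resolution R M ?P ?d (restrict v (carrier (?P 0)))"
    unfolding proj_resolution_def a_kernel_eq
  proof (intro conjI allI)
    show "projective R (?P i)" for i by (rule free_projective)
    show "?d i \<in> mod_hom R (?P (Suc i)) (?P i)" for i by (rule lin_restrict[OF free_module_module fd(1)])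
    show "restrict v (carrier (?P 0)) \<in> mod_hom R (?P 0) M"
      using lin_restrict[OF free_module_module vl] by (simp add: f0)
    show "restrict v (carrier (?P 0)) ` carrier (?P 0) = carrier M" using vi by (simp add: f0)
    show "?d 0 ` carrier (?P (Suc 0)) = {x \<in> carrier (?P 0). restrict v (carrier (?P 0)) x = \<zero>\<^bsub>M\<^esub>}"
      unfolding dim by (auto simp: f0)
    show "?d (Suc i) ` carrier (?P (Suc (Suc i))) = {x \<in> carrier (?P (Suc i)). ?d i x = \<zero>\<^bsub>?P i\<^esub>}" for i
      unfolding dim ker by auto
  qed
  moreover have "min_cover (fst (f 0)) M (carrier M) (restrict v (carrier (?P 0)))"
    using v lin_cong[OF free_module_module, of "{..<r0}" "restrict v (carrier (?P 0))" v M]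
    by (simp add: f0 min_cover_def)
  moreover have "min_cover (fst (f (Suc i))) (?P i) (?d i ` carrier (?P (Suc i))) (?d i)" for i
    using f[of i] lin_cong[OF free_module_module, of "{..<fst (f (Suc i))}" "?d i" "snd (snd (f (Suc i)))" "?P i"]
    unfolding dim by (simp add: Q_def min_cover_def)
  ultimately show ?thesis
    by (intro exI[of _ "\<lambda>n. fst (f n)"] exI[of _ ?d] exI[of _ "restrict v (carrier (?P 0))"]) blast
qed

lemma min_cover_no_unit:
  assumes N: "module R N" and d: "min_cover r N K d" and l: "l \<in> carrier (free_module R {..<r})" "d l = \<zero>\<^bsub>N\<^esub>"
    and j: "j < r"
  shows "l j \<notin> Units R"
proof
  assume u: "l j \<in> Units R"
  have dK: "lin R (free_module R {..<r}) N d" "d ` carrier (free_module R {..<r}) = K"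
    using d by (auto simp: min_cover_def)
  obtain d' where "lin R (free_module R {..<r - 1}) N d'" "d' ` carrier (free_module R {..<r - 1}) = K"
    using unit_relation_drop[OF N dK(1) l j u] dK(2) by blast
  then have "r \<le> r - 1" using d unfolding min_cover_def by blast
  then show False using j by simp
qed

lemma min_cover_zero:
  assumes N: "module R N" and d: "min_cover r N {\<zero>\<^bsub>N\<^esub>} d"
  shows "r = 0"
proof -
  have "(\<lambda>_. \<zero>\<^bsub>N\<^esub>) ` carrier (free_module R {..<0::nat}) = {\<zero>\<^bsub>N\<^esub>}" 
    using mm_zero[OF free_module_module] by (intro image_constant[of "\<zero>\<^bsub>free_module R {..<0}\<^esub>"])
  then show ?thesis using d lin_zero[OF N, of "free_module R {..<0::nat}"] unfolding min_cover_def by blast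
qed

end

section \<open>Powers of ideals and the Artin-Rees lemma\<close>

context modules
begin

abbreviation ipow :: "'a set \<Rightarrow> nat \<Rightarrow> 'a set" where "ipow I n \<equiv> I [^]\<^bsub>ideals_set R\<^esub> n"

lemma ipow_ideal: "ideal I R \<Longrightarrow> ideal (ipow I n) R"
  using monoid.nat_pow_closed[OF comm_monoid.axioms(1)[OF ideals_set_is_comm_monoid], of I n]
  by (simp add: ideals_set_def)

lemma ipow_add: "ideal I R \<Longrightarrow> ipow I (m + n) = ipow I m \<cdot> ipow I n"
  using monoid.nat_pow_mult[OF comm_monoid.axioms(1)[OF ideals_set_is_comm_monoid], of I m n]
  by (simp add: ideals_set_def)

lemma ipow_mult: "ideal I R \<Longrightarrow> ipow (ipow I m) n = ipow I (m * n)"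
  using monoid.nat_pow_pow[OF comm_monoid.axioms(1)[OF ideals_set_is_comm_monoid], of I m n]
  by (simp add: ideals_set_def)

lemma ipow_one: "ideal I R \<Longrightarrow> ipow I 1 = I"
  using monoid.nat_pow_eone[OF comm_monoid.axioms(1)[OF ideals_set_is_comm_monoid], of I]
  by (simp add: ideals_set_def)

lemma ipow_antimono: "ideal I R \<Longrightarrow> m \<le> n \<Longrightarrow> ipow I n \<subseteq> ipow I m"
  using ipow_add[of I m "n - m"] ideal_prod_inter[OF ipow_ideal[of I m] ipow_ideal[of I "n - m"]] by auto

lemma ideal_prod_least:
  assumes K: "ideal K R" and "\<And>i j. i \<in> I \<Longrightarrow> j \<in> J \<Longrightarrow> i \<otimes> j \<in> K"
  shows "I \<cdot> J \<subseteq> K"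
proof
  fix x assume "x \<in> I \<cdot> J"
  then show "x \<in> K" by induction (use assms ideal_rules(3)[OF K] in auto)
qed

lemma lin_image_sub_submodule:
  assumes "lin R M N f" "module R M" "module R N" "submodule H R M"
  shows "submodule (f ` H) R N"
proof -
  have "lin R (M\<lparr>carrier := H\<rparr>) N f" using assms(1) submodule_rules(1)[OF assms(4,2)] by (auto simp: lin_def)
  from lin_image_submodule[OF this submodule_module[OF assms(4,2)] assms(3)] show ?thesis by simp
qed

lemma coords_submodule:
  fixes r :: nat
  assumes J: "ideal J R"
  shows "submodule {c \<in> carrier (free_module R {..<r}). \<forall>s<r. c s \<in> J} R (free_module R {..<r})"
    (is "submodule ?FJ R ?F")
proof -
  note Jr = ideal_rules[OF J]
  have o: "\<zero>\<^bsub>?F\<^esub> \<in> carrier ?F" "\<And>x y. x \<in> carrier ?F \<Longrightarrow> y \<in> carrier ?F \<Longrightarrow> x \<oplus>\<^bsub>?F\<^esub> y \<in> carrier ?F"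
    "\<And>a x. a \<in> carrier R \<Longrightarrow> x \<in> carrier ?F \<Longrightarrow> a \<odot>\<^bsub>?F\<^esub> x \<in> carrier ?F" by simp_all
  show ?thesis
    unfolding submodule_iff[OF free_module_module]
  proof (intro conjI ballI)
    show "\<zero>\<^bsub>?F\<^esub> \<in> ?FJ" using o(1) Jr(2) by (simp add: free_module_simps)
    show "x \<oplus>\<^bsub>?F\<^esub> y \<in> ?FJ" if "x \<in> ?FJ" "y \<in> ?FJ" for x y
      using o(2)[of x y] that Jr(3) by (simp add: free_module_simps)
    show "a \<odot>\<^bsub>?F\<^esub> x \<in> ?FJ" if "a \<in> carrier R" "x \<in> ?FJ" for a x
      using o(3)[of a x] that Jr(4) by (simp add: free_module_simps)
  qed auto
  qed

end

context noeth_modules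
begin

text \<open>Let \<open>L\<close> be maximal among the ideals above \<open>I\<close> that contain no
  power of \<open>J\<close>, and let \<open>a\<close> lie in \<open>J\<close> but not in
  \<open>L\<close>. Both the colon ideal of \<open>L\<close> by \<open>a\<close> and the sum of
  \<open>L\<close> and \<open>(a)\<close> are strictly larger, so each contains a power of
  \<open>J\<close>; but the product of these two ideals lies in \<open>L\<close>.\<close>

lemma ideal_radical_power:
  assumes I: "ideal I R" and J: "ideal J R" and rad: "\<And>a. a \<in> J \<Longrightarrow> \<exists>k::nat. a [^] k \<in> I"
  shows "\<exists>n. ipow J n \<subseteq> I"
proof (rule ccontr)
  assume no: "\<not> ?thesis"
  define \<Phi> where "\<Phi> = {I'. ideal I' R \<and> I \<subseteq> I' \<and> (\<forall>n. \<not> ipow J n \<subseteq> I')}"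
  have "I \<in> \<Phi>" using I no by (auto simp: \<Phi>_def)
  moreover have "ideal I R" if "I \<in> \<Phi>" for I using that by (simp add: \<Phi>_def)
  ultimately obtain L where L: "L \<in> \<Phi>" "\<And>L'. L' \<in> \<Phi> \<Longrightarrow> L \<subseteq> L' \<Longrightarrow> L' = L"
    using ideal_max[of I \<Phi>] by blast
  have Li: "ideal L R" and IL: "I \<subseteq> L" and Ln: "\<And>n. \<not> ipow J n \<subseteq> L" using L(1) by (auto simp: \<Phi>_def)
  note Lr = ideal_rules[OF Li] and Jr = ideal_rules[OF J]
  have bigger: "\<exists>n. ipow J n \<subseteq> L'" if "ideal L' R" "L \<subseteq> L'" "L' \<noteq> L" for L'
    using that L(2)[of L'] IL unfolding \<Phi>_def by blast
  obtain a where a: "a \<in> J" "a \<notin> L" using Ln[of 1] ipow_one[OF J] by auto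
  have ac: "a \<in> carrier R" using Jr(1) a by blast
  have ex: "\<exists>k::nat. a [^] k \<in> L" using rad[OF a(1)] IL by blast
  \<comment> \<open>With the least exponent, the preceding power of \<open>a\<close> lies in the
    colon ideal but not in \<open>L\<close>.\<close>
  define k where "k = (LEAST k::nat. a [^] k \<in> L)"
  have k: "a [^] k \<in> L" unfolding k_def using LeastI_ex[OF ex] .
  have "k \<noteq> 0"
  proof
    assume "k = 0"
    then have "\<one> \<in> L" using k by simp
    then have "x \<in> L" if "x \<in> carrier R" for x using Lr(4)[of x \<one>] that by simp
    then show False using Ln[of 0] ipow_ideal[OF J, of 0] ideal_rules(1) by blast
  qed
  then obtain k' where k': "k = Suc k'" by (cases k) auto
  have nk': "a [^] k' \<notin> L" using not_less_Least[of k' "\<lambda>k. a [^] k \<in> L"] k' unfolding k_def by simp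
  \<comment> \<open>The colon ideal of \<open>L\<close> by \<open>a\<close>.\<close>
  define Q where "Q = {x \<in> carrier R. x \<otimes> a \<in> L}"
  have "ideal Q R"
    unfolding ideal_iff_submodule submodule_iff[OF ring_module_module] Q_def
    using ac Lr(2,3,4) by (auto simp: R.l_distr R.m_assoc)
  moreover have "L \<subseteq> Q"
  proof
    fix x assume x: "x \<in> L"
    then have "x \<otimes> a = a \<otimes> x" using Lr(1) ac by (intro R.m_comm)
    then show "x \<in> Q" unfolding Q_def using Lr(1,4) ac x by simp
  qed
  moreover have "a [^] k' \<in> Q" unfolding Q_def using k k' ac by simp
  ultimately obtain n1 where n1: "ipow J n1 \<subseteq> Q" using bigger nk' by blast
  \<comment> \<open>The ideal generated by \<open>L\<close> and \<open>a\<close>.\<close>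
  define P where "P = {i \<oplus> x \<otimes> a | i x. i \<in> L \<and> x \<in> carrier R}"
  have "ideal P R"
    unfolding ideal_iff_submodule submodule_iff[OF ring_module_module]
  proof (intro conjI ballI)
    show "P \<subseteq> carrier (ring_module R)" unfolding P_def using Lr(1) ac by auto
    show "\<zero>\<^bsub>ring_module R\<^esub> \<in> P" unfolding P_def using Lr(2) ac by (auto intro!: exI[of _ \<zero>])
    show "x \<oplus>\<^bsub>ring_module R\<^esub> y \<in> P" if xy: "x \<in> P" "y \<in> P" for x y
    proof -
      obtain i u j v where "x = i \<oplus> u \<otimes> a" "i \<in> L" "u \<in> carrier R" "y = j \<oplus> v \<otimes> a" "j \<in> L" "v \<in> carrier R"
        using xy unfolding P_def by blast
      moreover from this have "x \<oplus> y = (i \<oplus> j) \<oplus> (u \<oplus> v) \<otimes> a"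
        using Lr(1)[of i] Lr(1)[of j] ac by (simp add: R.l_distr R.a_ac)
      ultimately show ?thesis unfolding P_def using Lr(3) by auto
    qed
    show "c \<odot>\<^bsub>ring_module R\<^esub> x \<in> P" if c: "c \<in> carrier R" and x: "x \<in> P" for c x
    proof -
      obtain i u where "x = i \<oplus> u \<otimes> a" "i \<in> L" "u \<in> carrier R" using x unfolding P_def by blast
      moreover from this have "c \<otimes> x = (c \<otimes> i) \<oplus> (c \<otimes> u) \<otimes> a"
        using Lr(1)[of i] ac c by (simp add: R.r_distr R.m_assoc)
      ultimately show ?thesis unfolding P_def using Lr(4)[OF c] c by auto
    qed
  qed
  moreover have "L \<subseteq> P"
  proof
    fix i assume i: "i \<in> L"
    then have "i = i \<oplus> \<zero> \<otimes> a" using Lr(1) ac by simp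
    then show "i \<in> P" unfolding P_def using i by blast
  qed
  moreover have "a \<in> P"
  proof -
    have "a = \<zero> \<oplus> \<one> \<otimes> a" using ac by simp
    then show ?thesis unfolding P_def using Lr(2) by blast
  qed
  ultimately obtain n2 where n2: "ipow J n2 \<subseteq> P" using bigger a by blast
  have "ipow J n2 \<cdot> ipow J n1 \<subseteq> L"
  proof (rule ideal_prod_least[OF Li])
    fix x y assume "x \<in> ipow J n2" "y \<in> ipow J n1"
    then obtain i u where x: "x = i \<oplus> u \<otimes> a" "i \<in> L" "u \<in> carrier R" and y: "y \<in> carrier R" "y \<otimes> a \<in> L"
      using n1 n2 unfolding P_def Q_def by blast
    have "x \<otimes> y = y \<otimes> i \<oplus> u \<otimes> (y \<otimes> a)"
      using x y ac Lr(1)[OF x(2)] by (simp add: R.l_distr R.r_distr R.m_ac)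
    then show "x \<otimes> y \<in> L" using x y Lr(3,4) by simp
  qed
  then show False using Ln ipow_add[OF J] by metis
qed

text \<open>For the image \<open>L\<close> of \<open>d\<close> in the free module G the claim is
  that J^n G meets \<open>L\<close> inside J L. A maximal submodule \<open>L'\<close> that contains
  J L and meets \<open>L\<close> only in J L turns out to contain a^k G for every a in J and
  suitable k, hence J^n G for some n. This is a Noetherian argument without graded rings.\<close>

lemma artin_rees_aux:
  fixes r q :: nat
  assumes d: "lin R (free_module R {..<r}) (free_module R {..<q}) d" and J: "ideal J R"
  shows "\<exists>n. \<forall>z\<in>carrier (free_module R {..<r}). (\<forall>t<q. d z t \<in> ipow J n) \<longrightarrow>
    (\<exists>c\<in>carrier (free_module R {..<r}). (\<forall>s<r. c s \<in> J) \<and> d z = d c)"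
proof -
  let ?F = "free_module R {..<r}" and ?G = "free_module R {..<q}"
  note dr = lin_rules[OF d] and Jr = ideal_rules[OF J]
  let ?FJ = "{c \<in> carrier ?F. \<forall>s<r. c s \<in> J}"
  have FJ: "submodule ?FJ R ?F" by (rule coords_submodule[OF J])
  define JL where "JL = d ` ?FJ"
  define L where "L = d ` carrier ?F"
  have JL: "submodule JL R ?G" unfolding JL_def by (rule lin_image_sub_submodule[OF d _ _ FJ]) simp_all
  define \<Phi> where "\<Phi> = {L'. submodule L' R ?G \<and> JL \<subseteq> L' \<and> L' \<inter> L \<subseteq> JL}"
  have "JL \<in> \<Phi>" using JL by (auto simp: \<Phi>_def)
  moreover have "submodule X R ?G" if "X \<in> \<Phi>" for X using that by (simp add: \<Phi>_def)
  ultimately obtain L' where L': "L' \<in> \<Phi>" and max: "\<And>L''. L'' \<in> \<Phi> \<Longrightarrow> L' \<subseteq> L'' \<Longrightarrow> L'' = L'"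
    using free_max_submodule[of JL \<Phi> q] by blast
  have Ls: "submodule L' R ?G" and JLL: "JL \<subseteq> L'" and cap: "\<And>x. x \<in> L' \<Longrightarrow> x \<in> L \<Longrightarrow> x \<in> JL"
    using L' by (auto simp: \<Phi>_def)
  note Lr = submodule_rules[OF Ls free_module_module]
  \<comment> \<open>The multipliers of all of G into \<open>L'\<close>. Once every element of
    \<open>J\<close> has a power in this ideal, so has \<open>J\<close> itself.\<close>
  define I where "I = {a \<in> carrier R. \<forall>g\<in>carrier ?G. a \<odot>\<^bsub>?G\<^esub> g \<in> L'}"
  have I: "ideal I R"
    unfolding ideal_iff_submodule submodule_iff[OF ring_module_module]
  proof (intro conjI ballI)
    show "I \<subseteq> carrier (ring_module R)" by (auto simp: I_def)
    show "\<zero>\<^bsub>ring_module R\<^esub> \<in> I" using Lr(2) by (simp add: I_def)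
    show "x \<oplus>\<^bsub>ring_module R\<^esub> y \<in> I" if "x \<in> I" "y \<in> I" for x y
      using that Lr(3) by (simp add: I_def mm_add_smult)
    show "b \<odot>\<^bsub>ring_module R\<^esub> x \<in> I" if "b \<in> carrier R" "x \<in> I" for b x
      using that Lr(4) by (simp add: I_def mm_smult_smult)
  qed
  have "\<exists>k::nat. a [^] k \<in> I" if a: "a \<in> J" for a
  proof -
    have ac: "a \<in> carrier R" using Jr(1) a by blast
    \<comment> \<open>The colon submodules of \<open>L'\<close> by powers of \<open>a\<close>. Where
      this chain becomes stationary, a^(k+1) g in \<open>L'\<close> implies a^k g in
      \<open>L'\<close>.\<close>
    define C where "C k = {g \<in> carrier ?G. (a [^] k) \<odot>\<^bsub>?G\<^esub> g \<in> L'}" for k :: nat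
    have "\<exists>n. \<forall>m\<ge>n. C m = C n"
    proof (rule free_chain[of q q])
      fix k
      show "submodule (C k) R ?G"
        unfolding submodule_iff[OF free_module_module]
      proof (intro conjI ballI)
        show "C k \<subseteq> carrier ?G" by (auto simp: C_def)
        show "\<zero>\<^bsub>?G\<^esub> \<in> C k" using ac Lr(2) by (simp add: C_def)
        show "x \<oplus>\<^bsub>?G\<^esub> y \<in> C k" if "x \<in> C k" "y \<in> C k" for x y
          using that ac Lr(3) by (simp add: C_def mm_smult_add)
        show "b \<odot>\<^bsub>?G\<^esub> x \<in> C k" if b: "b \<in> carrier R" and x: "x \<in> C k" for b x
        proof -
          have "(a [^] k) \<odot>\<^bsub>?G\<^esub> (b \<odot>\<^bsub>?G\<^esub> x) = b \<odot>\<^bsub>?G\<^esub> ((a [^] k) \<odot>\<^bsub>?G\<^esub> x)"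
            using b x ac by (simp add: C_def mm_smult_smult[symmetric] R.m_comm)
          then show ?thesis using b x ac Lr(4) by (simp add: C_def)
        qed
      qed
      show "C k \<subseteq> C (Suc k)"
      proof
        fix g assume g: "g \<in> C k"
        have "(a [^] Suc k) \<odot>\<^bsub>?G\<^esub> g = a \<odot>\<^bsub>?G\<^esub> ((a [^] k) \<odot>\<^bsub>?G\<^esub> g)"
          using g ac by (simp add: C_def mm_smult_smult[symmetric] R.m_comm)
        then show "g \<in> C (Suc k)" using g ac Lr(4) by (simp add: C_def)
      qed
    qed simp_all
    then obtain k where k: "C (Suc k) = C k" by (meson le_SucI order_refl)
    let ?b = "a [^] k"
    have b: "?b \<in> carrier R" using ac by simp
    \<comment> \<open>The sum of \<open>L'\<close> and a^k G. It is shown to meet \<open>L\<close>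
      only in J L, so by maximality it equals \<open>L'\<close>.\<close>
    define L2 where "L2 = {l \<oplus>\<^bsub>?G\<^esub> ?b \<odot>\<^bsub>?G\<^esub> g | l g. l \<in> L' \<and> g \<in> carrier ?G}"
    have L2i: "l \<oplus>\<^bsub>?G\<^esub> ?b \<odot>\<^bsub>?G\<^esub> g \<in> L2" if "l \<in> L'" "g \<in> carrier ?G" for l g using that by (auto simp: L2_def)
    have "submodule L2 R ?G"
      unfolding submodule_iff[OF free_module_module]
    proof (intro conjI ballI)
      show "L2 \<subseteq> carrier ?G" using Lr(1) b by (auto simp: L2_def)
      show "\<zero>\<^bsub>?G\<^esub> \<in> L2" using L2i[OF Lr(2) mm_zero[OF free_module_module]] b by simp
      show "x \<oplus>\<^bsub>?G\<^esub> y \<in> L2" if xy: "x \<in> L2" "y \<in> L2" for x y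
      proof -
        obtain l g l' g' where lg: "x = l \<oplus>\<^bsub>?G\<^esub> ?b \<odot>\<^bsub>?G\<^esub> g" "l \<in> L'" "g \<in> carrier ?G"
          "y = l' \<oplus>\<^bsub>?G\<^esub> ?b \<odot>\<^bsub>?G\<^esub> g'" "l' \<in> L'" "g' \<in> carrier ?G" using xy unfolding L2_def by blast
        then have "x \<oplus>\<^bsub>?G\<^esub> y = (l \<oplus>\<^bsub>?G\<^esub> l') \<oplus>\<^bsub>?G\<^esub> ?b \<odot>\<^bsub>?G\<^esub> (g \<oplus>\<^bsub>?G\<^esub> g')"
          using Lr(1)[of l] Lr(1)[of l'] b by (simp add: mm_smult_add mm_ac)
        then show ?thesis using L2i[of "l \<oplus>\<^bsub>?G\<^esub> l'" "g \<oplus>\<^bsub>?G\<^esub> g'"] lg Lr(3) by simp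
      qed
      show "c \<odot>\<^bsub>?G\<^esub> x \<in> L2" if c: "c \<in> carrier R" and x: "x \<in> L2" for c x
      proof -
        obtain l g where lg: "x = l \<oplus>\<^bsub>?G\<^esub> ?b \<odot>\<^bsub>?G\<^esub> g" "l \<in> L'" "g \<in> carrier ?G" using x unfolding L2_def by blast
        then have "c \<odot>\<^bsub>?G\<^esub> x = (c \<odot>\<^bsub>?G\<^esub> l) \<oplus>\<^bsub>?G\<^esub> ?b \<odot>\<^bsub>?G\<^esub> (c \<odot>\<^bsub>?G\<^esub> g)"
          using Lr(1)[of l] b c by (simp add: mm_smult_add mm_smult_smult[symmetric] R.m_comm)
        then show ?thesis using L2i[of "c \<odot>\<^bsub>?G\<^esub> l" "c \<odot>\<^bsub>?G\<^esub> g"] lg Lr(4) c by simp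
      qed
    qed
    moreover have LL2: "L' \<subseteq> L2"
    proof
      fix l assume "l \<in> L'"
      then show "l \<in> L2" using L2i[of l "\<zero>\<^bsub>?G\<^esub>"] Lr(1) b by simp
    qed
    moreover have "x \<in> JL" if x: "x \<in> L2" "x \<in> L" for x
    proof -
      obtain l g where lg: "x = l \<oplus>\<^bsub>?G\<^esub> ?b \<odot>\<^bsub>?G\<^esub> g" "l \<in> L'" "g \<in> carrier ?G" using x unfolding L2_def by blast
      obtain z where z: "z \<in> carrier ?F" "x = d z" using x(2) unfolding L_def by blast
      have "a \<odot>\<^bsub>?F\<^esub> z \<in> ?FJ"
      proof -
        have "a \<odot>\<^bsub>?F\<^esub> z \<in> carrier ?F" using z ac by simp
        moreover have "(a \<odot>\<^bsub>?F\<^esub> z) s \<in> J" if "s < r" for s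
          using that z ac a Jr(4)[of "z s" a] R.m_comm[of a "z s"] by (simp add: free_module_simps)
        ultimately show ?thesis by simp
      qed
      then have "a \<odot>\<^bsub>?G\<^esub> x \<in> JL" unfolding JL_def z(2) dr(3)[OF ac z(1), symmetric] by (rule imageI)
      then have axL: "a \<odot>\<^bsub>?G\<^esub> x \<in> L'" using JLL by blast
      have lc: "l \<in> carrier ?G" using Lr(1) lg by blast
      \<comment> \<open>Since x lies in \<open>L\<close>, a x lies in J L and hence in
        \<open>L'\<close>; subtracting a l leaves a^(k+1) g in \<open>L'\<close>, and the choice of
        \<open>k\<close> gives a^k g in \<open>L'\<close>.\<close>
      have "(a [^] Suc k) \<odot>\<^bsub>?G\<^esub> g = a \<odot>\<^bsub>?G\<^esub> x \<ominus>\<^bsub>?G\<^esub> a \<odot>\<^bsub>?G\<^esub> l"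
      proof -
        have "(a [^] Suc k) \<odot>\<^bsub>?G\<^esub> g = a \<odot>\<^bsub>?G\<^esub> (?b \<odot>\<^bsub>?G\<^esub> g)"
          using lg ac by (simp add: mm_smult_smult[symmetric] R.m_comm)
        moreover have "a \<odot>\<^bsub>?G\<^esub> x = a \<odot>\<^bsub>?G\<^esub> (?b \<odot>\<^bsub>?G\<^esub> g) \<oplus>\<^bsub>?G\<^esub> a \<odot>\<^bsub>?G\<^esub> l"
          using lg lc ac b by (simp add: mm_smult_add mm_comm[of ?G "a \<odot>\<^bsub>?G\<^esub> l"])
        ultimately show ?thesis using lg lc ac b by (simp add: a_minus_def mm_assoc)
      qed
      then have "g \<in> C (Suc k)" unfolding C_def using axL lg(2,3) ac Lr(4,6) by simp
      then have "?b \<odot>\<^bsub>?G\<^esub> g \<in> L'" unfolding k by (simp add: C_def)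
      then have "x \<in> L'" using lg Lr(3) by simp
      then show ?thesis using cap x(2) by blast
    qed
    ultimately have "L2 \<in> \<Phi>" using JLL unfolding \<Phi>_def by (intro CollectI conjI subsetI) auto
    then have "L2 = L'" using max LL2 by blast
    then have "?b \<odot>\<^bsub>?G\<^esub> g \<in> L'" if "g \<in> carrier ?G" for g
      using L2i[OF Lr(2) that] that b by simp
    then show ?thesis using b unfolding I_def by blast
  qed
  from ideal_radical_power[OF I J this] obtain n where n: "ipow J n \<subseteq> I" by blast
  show ?thesis
  proof (intro exI[of _ n] ballI impI)
    fix z assume z: "z \<in> carrier ?F" and zn: "\<forall>t<q. d z t \<in> ipow J n"
    have dz: "d z \<in> carrier ?G" using dr(1)[OF z] .
    \<comment> \<open>Every coordinate of \<open>d z\<close> multiplies G into \<open>L'\<close>, so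
      \<open>d z\<close> itself lies in \<open>L'\<close> and thus in its intersection with
      \<open>L\<close>.\<close>
    have "d z t \<odot>\<^bsub>?G\<^esub> free_basis R {..<q} t \<in> L'" if "t \<in> {..<q}" for t
      using zn n that unfolding I_def by fastforce
    then have "d z \<in> L'" by (rule lin_in_submodule[OF free_module_module Ls lin_id dz])
    moreover have "d z \<in> L" unfolding L_def using z by blast
    ultimately have "d z \<in> JL" by (rule cap)
    then show "\<exists>c\<in>carrier ?F. (\<forall>s<r. c s \<in> J) \<and> d z = d c" unfolding JL_def by blast
  qed
qed

text \<open>The preceding lemma for the ideal J^m in place of \<open>J\<close>. The exponent m k + m
  is taken instead of m k so that it is at least m also for k = 0.\<close>

lemma artin_rees:
  fixes r q m :: nat
  assumes d: "lin R (free_module R {..<r}) (free_module R {..<q}) d" and J: "ideal J R"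
  shows "\<exists>n\<ge>m. \<forall>z\<in>carrier (free_module R {..<r}). (\<forall>t<q. d z t \<in> ipow J n) \<longrightarrow>
    (\<exists>c\<in>carrier (free_module R {..<r}). (\<forall>s<r. c s \<in> ipow J m) \<and> d z = d c)"
proof -
  obtain k where k: "\<forall>z\<in>carrier (free_module R {..<r}). (\<forall>t<q. d z t \<in> ipow (ipow J m) k) \<longrightarrow>
    (\<exists>c\<in>carrier (free_module R {..<r}). (\<forall>s<r. c s \<in> ipow J m) \<and> d z = d c)"
    using artin_rees_aux[OF d ipow_ideal[OF J, of m]] by blast
  have "ipow J (m * k + m) \<subseteq> ipow (ipow J m) k" unfolding ipow_mult[OF J] by (rule ipow_antimono[OF J]) simp
  then show ?thesis using k by (intro exI[of _ "m * k + m"]) (auto simp: subset_iff)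
qed

end

section \<open>Local rings: Nakayama's lemma and finite length of the minimal free
  resolution\<close>

locale local_modules = noeth_modules R for R (structure) +
  assumes local_ring: "\<exists>!\<mm>. maximalideal \<mm> R"
begin

lemma nonunits_ideal:
  obtains \<mm> where "ideal \<mm> R" "\<And>x. x \<in> carrier R \<Longrightarrow> x \<notin> Units R \<Longrightarrow> x \<in> \<mm>" "\<And>x. x \<in> \<mm> \<Longrightarrow> x \<notin> Units R"
proof -
  obtain \<mm> where m: "maximalideal \<mm> R" and uniq: "\<And>\<nn>. maximalideal \<nn> R \<Longrightarrow> \<nn> = \<mm>" using local_ring by blast
  interpret m: maximalideal \<mm> R by fact
  have one: "I = carrier R" if "ideal I R" "\<one> \<in> I" for I
    using ideal.one_imp_carrier[OF that] .
  have mi: "ideal \<mm> R" by (rule m.is_ideal)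
  show ?thesis
  proof (rule that[OF mi])
    fix x assume x: "x \<in> carrier R" "x \<notin> Units R"
    \<comment> \<open>A proper ideal that is maximal among those containing the nonunit
      \<open>x\<close> is a maximal ideal, hence the only one.\<close>
    let ?\<Phi> = "{I. ideal I R \<and> x \<in> I \<and> \<one> \<notin> I}"
    have "\<one> \<notin> PIdl x"
    proof
      assume "\<one> \<in> PIdl x"
      then obtain y where "y \<in> carrier R" "\<one> = y \<otimes> x" by (auto simp: cgenideal_def)
      then show False using x R.m_comm[of x y] unfolding Units_def by auto
    qed
    then have "PIdl x \<in> ?\<Phi>" using cgenideal_ideal[OF x(1)] cgenideal_self[OF x(1)] by blast
    then obtain L where L: "L \<in> ?\<Phi>" "\<And>L'. L' \<in> ?\<Phi> \<Longrightarrow> L \<subseteq> L' \<Longrightarrow> L' = L"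
      using ideal_max[of "PIdl x" ?\<Phi>] by blast
    have "maximalideal L R"
    proof (rule maximalidealI)
      show "ideal L R" "carrier R \<noteq> L" using L(1) by auto
      show "J = L \<or> J = carrier R" if "ideal J R" "L \<subseteq> J" for J
        using L(1) L(2)[of J] one[OF that(1)] that by blast
    qed
    then show "x \<in> \<mm>" using uniq L(1) by blast
  next
    fix x assume x: "x \<in> \<mm>"
    show "x \<notin> Units R"
    proof
      assume u: "x \<in> Units R"
      have "inv x \<otimes> x \<in> \<mm>" using ideal_rules(4)[OF mi R.Units_inv_closed[OF u] x] .
      then show False using R.Units_l_inv[OF u] one[OF mi] m.I_notcarr by simp
    qed
  qed
qed

text \<open>Nakayama's lemma: by minimality of both covers, all coordinates of \<open>l = c e\<^sub>0\<close> and hence of the relation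
  expressing \<open>l = s l\<close> through the generators lie in the maximal ideal.\<close>

lemma min_cover_split_kernel:
  fixes r t :: nat
  assumes N: "module R N" and v: "min_cover r N K v"
    and c: "min_cover t (free_module R {..<r}) {x \<in> carrier (free_module R {..<r}). v x = \<zero>\<^bsub>N\<^esub>} c"
    and s: "lin R (free_module R {..<r}) (free_module R {..<r}) s"
    and sL: "\<And>x. x \<in> carrier (free_module R {..<r}) \<Longrightarrow> v (s x) = \<zero>\<^bsub>N\<^esub>"
    and sl: "\<And>x. x \<in> carrier (free_module R {..<r}) \<Longrightarrow> v x = \<zero>\<^bsub>N\<^esub> \<Longrightarrow> s x = x"
  shows "t = 0"
proof (rule ccontr)
  let ?F = "free_module R {..<r}" and ?E = "free_module R {..<t}"
  assume "t \<noteq> 0"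
  then have t: "0 < t" by simp
  obtain \<mm> where m: "ideal \<mm> R" and mu: "\<And>x. x \<in> carrier R \<Longrightarrow> x \<notin> Units R \<Longrightarrow> x \<in> \<mm>"
    and mn: "\<And>x. x \<in> \<mm> \<Longrightarrow> x \<notin> Units R" by (rule nonunits_ideal) blast
  note mr = ideal_rules[OF m]
  have cl: "lin R ?E ?F c" and ci: "c ` carrier ?E = {x \<in> carrier ?F. v x = \<zero>\<^bsub>N\<^esub>}"
    using c by (auto simp: min_cover_def)
  let ?e0 = "free_basis R {..<t} 0"
  have e0: "?e0 \<in> carrier ?E" using t by simp
  \<comment> \<open>The first generator of the kernel. Its coordinates are nonunits because it is a
    relation of the minimal cover \<open>v\<close>.\<close>
  define l where "l = c ?e0"
  have l: "l \<in> carrier ?F" "v l = \<zero>\<^bsub>N\<^esub>" using ci e0 unfolding l_def by auto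
  have lm: "l j \<in> \<mm>" if "j < r" for j using mu min_cover_no_unit[OF N v l that] l that by simp
  have "\<exists>w. w \<in> carrier ?E \<and> c w = s (free_basis R {..<r} j)" if "j \<in> {..<r}" for j
  proof -
    have "s (free_basis R {..<r} j) \<in> c ` carrier ?E"
      unfolding ci using lin_rules(1)[OF s] sL free_basis_carrier[OF that] by simp
    then show ?thesis by (auto simp: image_iff)
  qed
  \<comment> \<open>Lifting the values of \<open>s\<close> on the basis through \<open>c\<close>
    expresses \<open>s x\<close>, and in particular \<open>l = s l\<close>, through the generators
    of the kernel.\<close>
  then obtain w where w: "\<And>j. j \<in> {..<r} \<Longrightarrow> w j \<in> carrier ?E"
    "\<And>j. j \<in> {..<r} \<Longrightarrow> c (w j) = s (free_basis R {..<r} j)" by metis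
  let ?W = "free_map R {..<r} ?E w"
  have W: "lin R ?F ?E ?W" by (rule free_map_lin[OF free_module_module w(1)])
  have "c (?W l) = s l"
    by (rule free_lin_ext[OF free_module_module lin_comp[OF W cl] s _ l(1)])
      (use w free_map_basis[where u = w and X = "{..<r}", OF free_module_module w(1)] in simp)
  then have cWl: "c (?W l) = l" using sl l by simp
  have Wl: "?W l \<in> carrier ?E" using lin_rules(1)[OF W l(1)] .
  \<comment> \<open>A relation of \<open>c\<close> whose first coordinate is 1 minus an element of
    the maximal ideal, hence a unit; this contradicts minimality of \<open>c\<close>.\<close>
  let ?x = "?e0 \<ominus>\<^bsub>?E\<^esub> ?W l"
  have comp: "lin R ?E (ring_module R) (\<lambda>z. z 0)"
    unfolding free_module_def by (rule lin_component) (use t in simp)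
  have "?W l 0 \<in> \<mm>"
  proof (rule lin_in_submodule[OF ring_module_module iffD1[OF ideal_iff_submodule m] lin_comp[OF W comp] l(1)])
    fix j assume j: "j \<in> {..<r}"
    have "?W (free_basis R {..<r} j) 0 \<in> carrier R"
      using lin_rules(1)[OF lin_comp[OF W comp] free_basis_carrier[OF j]] by simp
    then show "l j \<odot>\<^bsub>ring_module R\<^esub> ?W (free_basis R {..<r} j) 0 \<in> \<mm>"
      using mr(4)[of "?W (free_basis R {..<r} j) 0" "l j"] lm[of j] j mr(1)[of "l j"] R.m_comm by auto
  qed
  moreover have x0: "?x 0 = \<one> \<ominus> ?W l 0"
  proof -
    have "?x 0 = ?e0 0 \<ominus>\<^bsub>ring_module R\<^esub> ?W l 0"
      using lin_rules(6)[OF comp free_module_module ring_module_module e0 Wl] .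
    also have "\<dots> = \<one> \<ominus>\<^bsub>ring_module R\<^esub> ?W l 0" using t by (simp add: free_basis_def sum_inj_def)
    also have "\<dots> = \<one> \<ominus> ?W l 0"
      by (simp add: a_minus_def a_inv_def m_inv_def ring_module_def)
    finally show ?thesis .
  qed
  moreover have "\<one> \<ominus> ?W l 0 \<in> Units R"
  proof (rule ccontr)
    assume nu: "\<one> \<ominus> ?W l 0 \<notin> Units R"
    have wc: "?W l 0 \<in> carrier R" using calculation(1) mr(1) by blast
    then have "\<one> \<ominus> ?W l 0 \<in> \<mm>" using mu nu by simp
    then have "(\<one> \<ominus> ?W l 0) \<oplus> ?W l 0 \<in> \<mm>" using mr(3) calculation(1) by blast
    then have "\<one> \<in> \<mm>" using wc by (simp add: a_minus_def R.a_assoc R.l_neg)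
    then show False using mn by blast
  qed
  ultimately have "?x 0 \<in> Units R" by simp
  moreover have "?x \<in> carrier ?E" "c ?x = \<zero>\<^bsub>?F\<^esub>"
    using e0 Wl cWl l(1) by (simp_all add: lin_rules(6)[OF cl] l_def[symmetric])
  ultimately show False using min_cover_no_unit[OF free_module_module c _ _ t] by blast
qed

text \<open>Take the image of F_(p+1) in F_p as coefficient module X. A projective resolution of
  length p shows Ext^(p+1)(M, X) = 0, and by comparison the same holds on the minimal resolution.
  The differential F_(p+1) -> X is then a coboundary, which yields a retraction of F_p onto X, and
  Nakayama's lemma gives F_(p+1) = 0.\<close>

theorem ex_finite_free_resolution:
  fixes M :: "('a, 'c, 'm) module_scheme"
  assumes M: "module R M" and fg: "fin_gen R M" and pd: "proj_dim R M = enat p"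
  shows "\<exists>(r :: nat \<Rightarrow> nat) d v. proj_resolution R M (\<lambda>i. free_module R {..<r i}) d v \<and> (\<forall>i>p. r i = 0)"
proof -
  obtain r d v where res: "proj_resolution R M (\<lambda>i. free_module R {..<r i}) d v"
    and min0: "min_cover (r 0) M (carrier M) v"
    and min: "\<And>i. min_cover (r (Suc i)) (free_module R {..<r i}) (d i ` carrier (free_module R {..<r (Suc i)})) (d i)"
    using ex_min_resolution[OF M fg] by blast
  let ?F = "\<lambda>i. free_module R {..<r i}"
  note F = proj_resolution_rules[OF res M]
  let ?A = "{enat n | n. \<exists>(P :: nat \<Rightarrow> ('a, ('a, 'c) res_elt) module) d e.
       proj_resolution R M P d e \<and> (\<forall>i>n. zero_module (P i))}"
  have "Inf ?A = enat p" using pd by (simp add: proj_dim_def)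
  \<comment> \<open>A finite infimum in \<open>enat\<close> is attained, so some projective
    resolution vanishes beyond \<open>p\<close>.\<close>
  have "?A \<noteq> {}"
  proof
    assume e: "?A = {}"
    have "Inf ?A = \<infinity>" unfolding e by (simp add: Inf_enat_def)
    then show False using \<open>Inf ?A = enat p\<close> by simp
  qed
  then obtain x where x: "x \<in> ?A" by (meson ex_in_conv)
  have "Inf ?A = (LEAST x. x \<in> ?A)" unfolding Inf_enat_def using \<open>?A \<noteq> {}\<close> by (rule if_not_P)
  then have "Inf ?A \<in> ?A" using LeastI[of "\<lambda>x. x \<in> ?A", OF x] by (simp only:)
  then have "enat p \<in> ?A" using \<open>Inf ?A = enat p\<close> by simp
  then obtain P :: "nat \<Rightarrow> ('a, ('a, 'c) res_elt) module" and d' e' where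
    P: "proj_resolution R M P d' e'" and Pz: "\<And>i. i > p \<Longrightarrow> zero_module (P i)" by auto
  let ?L = "d p ` carrier (?F (Suc p))"
  have L: "submodule ?L R (?F p)" by (rule lin_image_submodule[OF F(3)]) simp_all
  let ?X = "(?F p)\<lparr>carrier := ?L\<rparr>"
  have X: "module R ?X" by (rule submodule_module[OF L free_module_module])
  let ?Z = "?X\<lparr>carrier := {\<zero>\<^bsub>?X\<^esub>}\<rparr>"
  have "submodule {\<zero>\<^bsub>?X\<^esub>} R ?X"
    unfolding submodule_iff[OF X] using mm_zero[OF X] mm_l_zero[OF X] mm_smult_zero[OF X] by simp
  then have Z: "module R ?Z" by (rule submodule_module[OF _ X])
  let ?SP = "const_cx P d' e'" and ?SF = "const_cx ?F d v"
  have pP: "pro_res R ?SP (\<lambda>_. M) (\<lambda>_ _ y. y)" by (rule const_pro_res[OF P M])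
  have pF: "pro_res R ?SF (\<lambda>_. M) (\<lambda>_ _ y. y)" by (rule const_pro_res[OF res M])
  interpret SF: pro_res R ?SF "\<lambda>_. M" "\<lambda>_ _ y. y" by (rule pF)
  have bd: "cobd R ?X ?SP m (Suc p) h" if "cocyc R ?X ?SP m (Suc p) h" for m h
  proof -
    have "h x = \<zero>\<^bsub>?X\<^esub>" if "x \<in> carrier (P (Suc p))" for x
    proof -
      have "x = \<zero>\<^bsub>P (Suc p)\<^esub>" using that Pz[of "Suc p"] by (simp add: zero_module_def)
      moreover have "lin R (P (Suc p)) ?X h" using \<open>cocyc R ?X ?SP m (Suc p) h\<close> by (simp add: cocyc_def)
      ultimately show ?thesis using lin_rules(4)[of "P (Suc p)" ?X h] X proj_resolution_rules(2)[OF P M] by simp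
    qed
    then show ?thesis using lin_zero[OF X] by (auto simp: cobd_def intro!: exI[of _ "\<lambda>_. \<zero>\<^bsub>?X\<^esub>"])
  qed
  \<comment> \<open>In degree \<open>p + 1\<close> all cocycles on the short resolution are
    coboundaries, so the zero module presents the cohomology there.\<close>
  have "presents R ?X ?SP (Suc p) ?Z (\<lambda>_ _. \<zero>\<^bsub>?Z\<^esub>)"
  proof -
    have "cocyc R ?X ?SP 0 (Suc p) (\<lambda>_. \<zero>\<^bsub>?X\<^esub>)"
      using lin_zero[OF X, of "P (Suc p)"] by (simp add: cocyc_def)
    then show ?thesis
      unfolding presents_def
      using mm_l_zero[OF Z mm_zero[OF Z]] mm_smult_zero[OF Z] bd by auto
  qed
  from presents_transfer[OF pP pF X Z this] obtain \<psi> where \<psi>: "presents R ?X ?SF (Suc p) ?Z \<psi>" by blast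
  have "lin R (?F (Suc p)) ?X (d p)" using F(3)[of p] by (auto simp: lin_def)
  moreover have "d p (d (Suc p) x) = \<zero>\<^bsub>?F p\<^esub>" if "x \<in> carrier (?F (Suc (Suc p)))" for x
    using F(7)[of "d (Suc p) x" p] lin_rules(1)[OF F(3) that] that by blast
  ultimately have cd: "cocyc R ?X ?SF 0 (Suc p) (d p)" by (simp add: cocyc_def)
  have "\<psi> 0 (d p) = \<zero>\<^bsub>?Z\<^esub>" using SF.presents_rules(1)[OF \<psi> X Z cd] by simp
  \<comment> \<open>That the cocycle \<open>d p\<close> is a coboundary says that \<open>s\<close>
    fixes the image of \<open>d p\<close> pointwise.\<close>
  then obtain s where s: "lin R (?F p) ?X s" "\<forall>x\<in>carrier (?F (Suc p)). d p x = s (d p x)"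
    unfolding SF.presents_rules(6)[OF \<psi> X Z cd] by (auto simp: cobd_def)
  have sF: "lin R (?F p) (?F p) s" and sL: "\<And>x. x \<in> carrier (?F p) \<Longrightarrow> s x \<in> ?L"
    using s(1) submodule_rules(1)[OF L free_module_module] by (auto simp: lin_def)
  have sl: "s x = x" if "x \<in> ?L" for x using that s(2) by auto
  \<comment> \<open>The image of \<open>d p\<close> is the kernel of the preceding cover, which is
    the augmentation if \<open>p = 0\<close> and a differential otherwise.\<close>
  have rp: "r (Suc p) = 0"
  proof (cases p)
    case 0
    have L0: "?L = {x \<in> carrier (?F 0). v x = \<zero>\<^bsub>M\<^esub>}" using F(6) lin_rules(1)[OF F(3)] 0 by blast
    show ?thesis
      by (rule min_cover_split_kernel[OF M min0 _ sF[unfolded 0]]) (use min[of 0] L0 sL sl 0 in auto)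
  next
    case (Suc k)
    have L0: "?L = {x \<in> carrier (?F (Suc k)). d k x = \<zero>\<^bsub>?F k\<^esub>}" using F(7) lin_rules(1)[OF F(3)] Suc by blast
    show ?thesis
      by (rule min_cover_split_kernel[OF free_module_module min[of k] _ sF[unfolded Suc]])
        (use min[of "Suc k"] L0 sL sl Suc in auto)
  qed
  have F0: "carrier (free_module R {..<0::nat}) = {\<zero>\<^bsub>free_module R {..<0}\<^esub>}"
    by (auto simp: free_module_def direct_sum_simps)
  \<comment> \<open>Beyond the first zero module, minimality keeps all ranks at zero.\<close>
  have "r (Suc p + i) = 0" for i
  proof (induction i)
    case (Suc i)
    have "r (Suc (Suc p + i)) = 0"
    proof (rule min_cover_zero[OF free_module_module])
      let ?k = "Suc p + i"
      have "x = \<zero>\<^bsub>?F ?k\<^esub>" if "x \<in> carrier (?F ?k)" for x using that F0 Suc by simp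
      then have "d ?k ` carrier (?F (Suc ?k)) = {\<zero>\<^bsub>?F ?k\<^esub>}"
        using submodule_rules(2)[OF lin_image_submodule[OF F(3)[of ?k]]] lin_rules(1)[OF F(3)[of ?k]] by auto
      then show "min_cover (r (Suc ?k)) (?F ?k) {\<zero>\<^bsub>?F ?k\<^esub>} (d ?k)" using min[of ?k] by simp
    qed
    then show ?case by simp
  qed (simp add: rp)
  then have "r i = 0" if "i > p" for i using that less_iff_Suc_add[of p i] by auto
  then show ?thesis using res by blast
qed

end

section \<open>Double complexes with exact columns and their total complexes\<close>

section \<open>Total complexes of double complexes\<close>

definition sg :: "('a, 'b, 'm) module_scheme \<Rightarrow> nat \<Rightarrow> 'b \<Rightarrow> 'b" where
  "sg M i y = (if even i then y else \<ominus>\<^bsub>M\<^esub> y)"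

context modules
begin

lemma sg_simps [simp]:
  assumes "module R M"
  shows "y \<in> carrier M \<Longrightarrow> sg M i y \<in> carrier M" "sg M i \<zero>\<^bsub>M\<^esub> = \<zero>\<^bsub>M\<^esub>"
    "y \<in> carrier M \<Longrightarrow> sg M i (sg M i y) = y"
    "y \<in> carrier M \<Longrightarrow> sg M i y = \<zero>\<^bsub>M\<^esub> \<longleftrightarrow> y = \<zero>\<^bsub>M\<^esub>"
proof -
  show "y \<in> carrier M \<Longrightarrow> sg M i y \<in> carrier M" using assms by (simp add: sg_def)
  show z: "sg M i \<zero>\<^bsub>M\<^esub> = \<zero>\<^bsub>M\<^esub>" using assms by (simp add: sg_def)
  show s: "y \<in> carrier M \<Longrightarrow> sg M i (sg M i y) = y" using assms by (auto simp: sg_def)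
  show "sg M i y = \<zero>\<^bsub>M\<^esub> \<longleftrightarrow> y = \<zero>\<^bsub>M\<^esub>" if "y \<in> carrier M"
    using s[OF that] z by (metis (no_types))
qed

lemma sg_lin: "module R M \<Longrightarrow> lin R M M (sg M i)"
  by (rule linI) (auto simp: sg_def mm_neg_add mm_smult_neg)

lemma lin_sg: "lin R M N f \<Longrightarrow> module R M \<Longrightarrow> module R N \<Longrightarrow> x \<in> carrier M \<Longrightarrow> f (sg M i x) = sg N i (f x)"
  by (simp add: sg_def lin_rules(5))

end

locale double_cx = modules R for R (structure) +
  fixes K :: "nat \<Rightarrow> nat \<Rightarrow> nat \<Rightarrow> ('a, 'x) module" and dh dv :: "nat \<Rightarrow> nat \<Rightarrow> nat \<Rightarrow> 'x \<Rightarrow> 'x"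
    and tK :: "nat \<Rightarrow> nat \<Rightarrow> nat \<Rightarrow> nat \<Rightarrow> 'x \<Rightarrow> 'x"
  assumes K_module [simp]: "module R (K m i j)"
    and dh_lin: "lin R (K m (Suc i) j) (K m i j) (dh m i j)"
    and dv_lin: "lin R (K m i (Suc j)) (K m i j) (dv m i j)"
    and dh_dh: "x \<in> carrier (K m (Suc (Suc i)) j) \<Longrightarrow> dh m i j (dh m (Suc i) j x) = \<zero>\<^bsub>K m i j\<^esub>"
    and dv_dv: "x \<in> carrier (K m i (Suc (Suc j))) \<Longrightarrow> dv m i j (dv m i (Suc j) x) = \<zero>\<^bsub>K m i j\<^esub>"
    and dh_dv: "x \<in> carrier (K m (Suc i) (Suc j)) \<Longrightarrow> dh m i j (dv m (Suc i) j x) = dv m i j (dh m i (Suc j) x)"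
    and tK_lin: "m \<le> n \<Longrightarrow> lin R (K n i j) (K m i j) (tK m n i j)"
    and tK_refl [simp]: "x \<in> carrier (K m i j) \<Longrightarrow> tK m m i j x = x"
    and tK_tK [simp]: "l \<le> m \<Longrightarrow> m \<le> n \<Longrightarrow> x \<in> carrier (K n i j) \<Longrightarrow> tK l m i j (tK m n i j x) = tK l n i j x"
    and dh_tK: "m \<le> n \<Longrightarrow> x \<in> carrier (K n (Suc i) j) \<Longrightarrow> dh m i j (tK m n (Suc i) j x) = tK m n i j (dh n i j x)"
    and dv_tK: "m \<le> n \<Longrightarrow> x \<in> carrier (K n i (Suc j)) \<Longrightarrow> dv m i j (tK m n i (Suc j) x) = tK m n i j (dv n i j x)"
begin

text \<open>The two differentials of \<open>double_cx\<close> commute, so the sign that makes the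
  total map a differential is put on the vertical part. The component at \<open>i\<close> lies in
  column \<open>i\<close> and row \<open>k - i\<close>.\<close>

definition tot :: "(nat \<Rightarrow> 'x \<Rightarrow> 'y) \<Rightarrow> ('a, nat \<Rightarrow> 'x, 'y) pro_complex" where
  "tot ag = \<lparr>cx = \<lambda>m k. direct_sum {..k} (\<lambda>i. K m i (k - i)),
     df = \<lambda>m k x. \<lambda>i\<in>{..k}. dh m i (k - i) (x (Suc i)) \<oplus>\<^bsub>K m i (k - i)\<^esub> sg (K m i (k - i)) i (dv m i (k - i) (x i)),
     tr = \<lambda>m n k x. \<lambda>i\<in>{..k}. tK m n i (k - i) (x i), aug = \<lambda>m x. ag m (x 0)\<rparr>"

abbreviation "T m k \<equiv> direct_sum {..k} (\<lambda>i. K m i (k - i))"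
abbreviation "inK m k i \<equiv> sum_inj {..k} (\<lambda>i. K m i (k - i)) i"

lemma dh_rules [simp]: "x \<in> carrier (K m (Suc i) j) \<Longrightarrow> dh m i j x \<in> carrier (K m i j)"
  "dh m i j \<zero>\<^bsub>K m (Suc i) j\<^esub> = \<zero>\<^bsub>K m i j\<^esub>"
  using lin_rules(1,4)[OF dh_lin] by auto

lemma dv_rules [simp]: "x \<in> carrier (K m i (Suc j)) \<Longrightarrow> dv m i j x \<in> carrier (K m i j)"
  "dv m i j \<zero>\<^bsub>K m i (Suc j)\<^esub> = \<zero>\<^bsub>K m i j\<^esub>"
  using lin_rules(1,4)[OF dv_lin] by auto

lemma tK_rules [simp]: "m \<le> n \<Longrightarrow> x \<in> carrier (K n i j) \<Longrightarrow> tK m n i j x \<in> carrier (K m i j)"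
  "m \<le> n \<Longrightarrow> tK m n i j \<zero>\<^bsub>K n i j\<^esub> = \<zero>\<^bsub>K m i j\<^esub>"
  using lin_rules(1,4)[OF tK_lin] by auto

lemma T_module [simp]: "module R (T m k)"
  by (rule direct_sum_module) simp

lemma T_carrier: "x \<in> carrier (T m k) \<longleftrightarrow> x \<in> extensional {..k} \<and> (\<forall>i\<le>k. x i \<in> carrier (K m i (k - i)))"
  by (subst direct_sum_carrier_finite) (auto simp: PiE_iff)

lemma T_ops: "\<zero>\<^bsub>T m k\<^esub> = (\<lambda>i\<in>{..k}. \<zero>\<^bsub>K m i (k - i)\<^esub>)"
  "f \<oplus>\<^bsub>T m k\<^esub> g = (\<lambda>i\<in>{..k}. f i \<oplus>\<^bsub>K m i (k - i)\<^esub> g i)"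
  "a \<odot>\<^bsub>T m k\<^esub> f = (\<lambda>i\<in>{..k}. a \<odot>\<^bsub>K m i (k - i)\<^esub> f i)"
  by (simp_all add: direct_sum_simps)

lemma T_minus: "x \<in> carrier (T m k) \<Longrightarrow> y \<in> carrier (T m k) \<Longrightarrow> i \<le> k \<Longrightarrow>
    (x \<ominus>\<^bsub>T m k\<^esub> y) i = x i \<ominus>\<^bsub>K m i (k - i)\<^esub> y i"
  using lin_rules(6)[OF lin_component[of i "{..k}" "\<lambda>i. K m i (k - i)"]] by simp

lemma T_Suc:
  assumes "x \<in> carrier (T m (Suc k))" "i \<le> k"
  shows "x i \<in> carrier (K m i (Suc (k - i)))" "x (Suc i) \<in> carrier (K m (Suc i) (k - i))"
  using assms(1)[unfolded T_carrier] assms(2) by (auto simp: Suc_diff_le dest: spec[of _ i] spec[of _ "Suc i"])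

lemma tot_df_lin: "lin R (T m (Suc k)) (T m k) (df (tot ag) m k)"
proof (rule linI)
  fix x assume x: "x \<in> carrier (T m (Suc k))"
  show "df (tot ag) m k x \<in> carrier (T m k)"
    using T_Suc[OF x] by (auto simp: tot_def T_carrier)
  show "df (tot ag) m k (a \<odot>\<^bsub>T m (Suc k)\<^esub> x) = a \<odot>\<^bsub>T m k\<^esub> df (tot ag) m k x" if "a \<in> carrier R" for a
    using T_Suc[OF x] that
    by (auto simp: tot_def T_ops fun_eq_iff Suc_diff_le lin_rules(3)[OF dh_lin] lin_rules(3)[OF dv_lin]
      lin_rules(3)[OF sg_lin] mm_smult_add)
  fix y assume y: "y \<in> carrier (T m (Suc k))"
  show "df (tot ag) m k (x \<oplus>\<^bsub>T m (Suc k)\<^esub> y) = df (tot ag) m k x \<oplus>\<^bsub>T m k\<^esub> df (tot ag) m k y"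
    using T_Suc[OF x] T_Suc[OF y]
    by (auto simp: tot_def T_ops fun_eq_iff Suc_diff_le lin_rules(2)[OF dh_lin] lin_rules(2)[OF dv_lin]
      lin_rules(2)[OF sg_lin] mm_ac)
qed

lemma tot_cx [simp]: "cx (tot ag) m k = T m k" by (simp add: tot_def)

lemma tot_df: "i \<le> k \<Longrightarrow> df (tot ag) m k x i =
    dh m i (k - i) (x (Suc i)) \<oplus>\<^bsub>K m i (k - i)\<^esub> sg (K m i (k - i)) i (dv m i (k - i) (x i))"
  by (simp add: tot_def)

lemma tot_tr: "i \<le> k \<Longrightarrow> tr (tot ag) m n k x i = tK m n i (k - i) (x i)"
  by (simp add: tot_def)

lemma T_eqI: "x \<in> carrier (T m k) \<Longrightarrow> y \<in> carrier (T m k) \<Longrightarrow> (\<And>i. i \<le> k \<Longrightarrow> x i = y i) \<Longrightarrow> x = y"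
  by (rule direct_sum_eqI) auto

lemma inK_carrier [simp]: "i \<le> k \<Longrightarrow> x \<in> carrier (K m i (k - i)) \<Longrightarrow> inK m k i x \<in> carrier (T m k)"
  by (rule sum_inj_carrier) auto

lemma inK_apply: "l \<le> k \<Longrightarrow> inK m k i x l = (if l = i then x else \<zero>\<^bsub>K m l (k - l)\<^esub>)"
  by (simp add: sum_inj_def)

lemma tot_tr_lin: "m \<le> n \<Longrightarrow> lin R (T n k) (T m k) (tr (tot ag) m n k)"
  by (rule linI) (auto simp: tot_def T_carrier T_ops fun_eq_iff lin_rules(2)[OF tK_lin] lin_rules(3)[OF tK_lin])

lemma tot_pro_cx: "pro_cx R (tot ag)"
proof (intro pro_cx.intro modules_axioms pro_cx_axioms.intro)
  show "module R (cx (tot ag) m k)" for m k by simp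
  show "lin R (cx (tot ag) m (Suc k)) (cx (tot ag) m k) (df (tot ag) m k)" for m k
    using tot_df_lin by simp
  show "lin R (cx (tot ag) n k) (cx (tot ag) m k) (tr (tot ag) m n k)" if "m \<le> n" for m n k
    using tot_tr_lin[OF that] by simp
  show "tr (tot ag) m m k x = x" if x: "x \<in> carrier (cx (tot ag) m k)" for x m k
    by (rule T_eqI[of _ k m]) (use x lin_rules(1)[OF tot_tr_lin[of m m k]] in \<open>auto simp: tot_tr T_carrier\<close>)
  show "tr (tot ag) l m k (tr (tot ag) m n k x) = tr (tot ag) l n k x"
    if "l \<le> m" "m \<le> n" "x \<in> carrier (cx (tot ag) n k)" for l m n x k
    by (rule T_eqI[of _ k l])
      (use that lin_rules(1)[OF tot_tr_lin] in \<open>auto simp: tot_tr T_carrier simp del: tot_cx\<close>, simp_all add: T_carrier tot_def)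
  show "df (tot ag) m k (df (tot ag) m (Suc k) x) = \<zero>\<^bsub>cx (tot ag) m k\<^esub>"
    if "x \<in> carrier (cx (tot ag) m (Suc (Suc k)))" for x m k
  proof (rule T_eqI)
    have x: "x \<in> carrier (T m (Suc (Suc k)))" using that by simp
    have dx: "df (tot ag) m (Suc k) x \<in> carrier (T m (Suc k))" using lin_rules(1)[OF tot_df_lin x] .
    show "df (tot ag) m k (df (tot ag) m (Suc k) x) \<in> carrier (T m k)" using lin_rules(1)[OF tot_df_lin dx] .
    show "\<zero>\<^bsub>cx (tot ag) m k\<^esub> \<in> carrier (T m k)" by simp
    fix i assume i: "i \<le> k"
    let ?K = "K m i (k - i)"
    have x0: "x i \<in> carrier (K m i (Suc (Suc (k - i))))" "x (Suc i) \<in> carrier (K m (Suc i) (Suc (k - i)))"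
      using T_Suc[OF x, of i] i by (auto simp: Suc_diff_le)
    have x2: "x (Suc (Suc i)) \<in> carrier (K m (Suc (Suc i)) (k - i))"
      using T_Suc(2)[OF x, of "Suc i"] i by simp
    have "df (tot ag) m k (df (tot ag) m (Suc k) x) i =
        dh m i (k - i) (dh m (Suc i) (k - i) (x (Suc (Suc i))) \<oplus>\<^bsub>K m (Suc i) (k - i)\<^esub>
          sg (K m (Suc i) (k - i)) (Suc i) (dv m (Suc i) (k - i) (x (Suc i)))) \<oplus>\<^bsub>?K\<^esub>
        sg ?K i (dv m i (k - i) (dh m i (Suc (k - i)) (x (Suc i)) \<oplus>\<^bsub>K m i (Suc (k - i))\<^esub>
          sg (K m i (Suc (k - i))) i (dv m i (Suc (k - i)) (x i))))"
      using i by (simp add: tot_df Suc_diff_le)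
    \<comment> \<open>The two mixed terms carry the signs of \<open>i + 1\<close> and
      \<open>i\<close>, so they cancel because the differentials commute.\<close>
    also have "\<dots> = sg ?K (Suc i) (dh m i (k - i) (dv m (Suc i) (k - i) (x (Suc i)))) \<oplus>\<^bsub>?K\<^esub>
        sg ?K i (dv m i (k - i) (dh m i (Suc (k - i)) (x (Suc i))))"
      using x0 x2 by (simp add: lin_rules(2)[OF dh_lin] lin_rules(2)[OF dv_lin] lin_sg[OF dh_lin] lin_sg[OF dv_lin]
        dh_dh dv_dv)
    also have "\<dots> = \<zero>\<^bsub>?K\<^esub>" using x0 by (simp add: dh_dv sg_def)
    finally show "df (tot ag) m k (df (tot ag) m (Suc k) x) i = \<zero>\<^bsub>cx (tot ag) m k\<^esub> i"
      using i by (simp add: T_ops)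
  qed
  show "df (tot ag) m k (tr (tot ag) m n (Suc k) x) = tr (tot ag) m n k (df (tot ag) n k x)"
    if mn: "m \<le> n" and "x \<in> carrier (cx (tot ag) n (Suc k))" for m n x k
  proof (rule T_eqI)
    have x: "x \<in> carrier (T n (Suc k))" using that by simp
    show "df (tot ag) m k (tr (tot ag) m n (Suc k) x) \<in> carrier (T m k)"
      using lin_rules(1)[OF tot_df_lin lin_rules(1)[OF tot_tr_lin[OF mn] x]] .
    show "tr (tot ag) m n k (df (tot ag) n k x) \<in> carrier (T m k)"
      using lin_rules(1)[OF tot_tr_lin[OF mn] lin_rules(1)[OF tot_df_lin x]] .
    fix i assume i: "i \<le> k"
    note xi = T_Suc[OF x i]
    show "df (tot ag) m k (tr (tot ag) m n (Suc k) x) i = tr (tot ag) m n k (df (tot ag) n k x) i"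
      using i xi mn by (simp add: tot_df tot_tr Suc_diff_le lin_rules(2)[OF tK_lin[OF mn]] lin_sg[OF tK_lin[OF mn]]
        dh_tK dv_tK)
  qed
qed

end

text \<open>Each column resolves \<open>B m i\<close> exactly at every index; only the complex
  formed by the \<open>B m i\<close>, augmented to \<open>A m\<close>, is exact up to transition.
  All shifting of indices is thus concentrated in \<open>B_exact\<close>.\<close>

locale double_res = double_cx R K dh dv tK for R (structure) and K :: "nat \<Rightarrow> nat \<Rightarrow> nat \<Rightarrow> ('a, 'x) module"
    and dh dv :: "nat \<Rightarrow> nat \<Rightarrow> nat \<Rightarrow> 'x \<Rightarrow> 'x" and tK +
  fixes B :: "nat \<Rightarrow> nat \<Rightarrow> ('a, 'z) module" and b :: "nat \<Rightarrow> nat \<Rightarrow> 'z \<Rightarrow> 'z"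
    and tB :: "nat \<Rightarrow> nat \<Rightarrow> nat \<Rightarrow> 'z \<Rightarrow> 'z" and \<epsilon> :: "nat \<Rightarrow> nat \<Rightarrow> 'x \<Rightarrow> 'z"
    and A :: "nat \<Rightarrow> ('a, 'y, 's) module_scheme" and a :: "nat \<Rightarrow> nat \<Rightarrow> 'y \<Rightarrow> 'y" and \<alpha> :: "nat \<Rightarrow> 'z \<Rightarrow> 'y"
  assumes B_module [simp]: "module R (B m i)"
    and \<epsilon>_lin: "lin R (K m i 0) (B m i) (\<epsilon> m i)"
    and \<epsilon>_surj: "\<epsilon> m i ` carrier (K m i 0) = carrier (B m i)"
    and \<epsilon>_ker: "x \<in> carrier (K m i 0) \<Longrightarrow> \<epsilon> m i x = \<zero>\<^bsub>B m i\<^esub> \<longleftrightarrow> x \<in> dv m i 0 ` carrier (K m i (Suc 0))"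
    and dv_exact: "x \<in> carrier (K m i (Suc j)) \<Longrightarrow> dv m i j x = \<zero>\<^bsub>K m i j\<^esub> \<Longrightarrow>
      x \<in> dv m i (Suc j) ` carrier (K m i (Suc (Suc j)))"
    and \<epsilon>_dh: "x \<in> carrier (K m (Suc i) 0) \<Longrightarrow> \<epsilon> m i (dh m i 0 x) = b m i (\<epsilon> m (Suc i) x)"
    and \<epsilon>_tK: "m \<le> n \<Longrightarrow> x \<in> carrier (K n i 0) \<Longrightarrow> \<epsilon> m i (tK m n i 0 x) = tB m n i (\<epsilon> n i x)"
    and A_module [simp]: "module R (A m)"
    and a_lin: "m \<le> n \<Longrightarrow> lin R (A n) (A m) (a m n)"
    and a_a: "l \<le> m \<Longrightarrow> m \<le> n \<Longrightarrow> y \<in> carrier (A n) \<Longrightarrow> a l m (a m n y) = a l n y"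
    and \<alpha>_lin: "lin R (B m 0) (A m) (\<alpha> m)"
    and \<alpha>_surj: "\<alpha> m ` carrier (B m 0) = carrier (A m)"
    and \<alpha>_b: "z \<in> carrier (B m (Suc 0)) \<Longrightarrow> \<alpha> m (b m 0 z) = \<zero>\<^bsub>A m\<^esub>"
    and \<alpha>_tB: "m \<le> n \<Longrightarrow> z \<in> carrier (B n 0) \<Longrightarrow> \<alpha> m (tB m n 0 z) = a m n (\<alpha> n z)"
    and B_exact: "\<exists>n\<ge>m. \<forall>z\<in>carrier (B n k).
      (case k of 0 \<Rightarrow> \<alpha> n z = \<zero>\<^bsub>A n\<^esub> | Suc j \<Rightarrow> b n j z = \<zero>\<^bsub>B n j\<^esub>) \<longrightarrow>
      tB m n k z \<in> b m k ` carrier (B m (Suc k))"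
    and K_proj: "projective R (K m i j)"
begin

abbreviation "TT \<equiv> tot (\<lambda>m x. \<alpha> m (\<epsilon> m 0 x))"

lemma TT_pro_cx: "pro_cx R TT"
  by (rule tot_pro_cx)

lemma \<epsilon>_rules [simp]: "x \<in> carrier (K m i 0) \<Longrightarrow> \<epsilon> m i x \<in> carrier (B m i)"
  "\<epsilon> m i \<zero>\<^bsub>K m i 0\<^esub> = \<zero>\<^bsub>B m i\<^esub>"
  using lin_rules(1,4)[OF \<epsilon>_lin] by auto

lemma \<epsilon>_dv: "x \<in> carrier (K m i (Suc 0)) \<Longrightarrow> \<epsilon> m i (dv m i 0 x) = \<zero>\<^bsub>B m i\<^esub>"
  using \<epsilon>_ker[of "dv m i 0 x"] by auto

lemma TT_aug: "aug TT m x = \<alpha> m (\<epsilon> m 0 (x 0))"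
  by (simp add: tot_def)

lemma TT_aug_lin: "lin R (T m 0) (A m) (aug TT m)"
proof -
  have "lin R (T m 0) (K m 0 0) (\<lambda>x. x 0)" using lin_component[of 0 "{..0}" "\<lambda>i. K m i (0 - i)"] by simp
  from lin_comp[OF lin_comp[OF this \<epsilon>_lin] \<alpha>_lin] show ?thesis by (simp add: TT_aug[abs_def])
qed

lemma TT_aug_df:
  assumes x: "x \<in> carrier (T m (Suc 0))"
  shows "aug TT m (df TT m 0 x) = \<zero>\<^bsub>A m\<^esub>"
proof -
  have x01: "x 0 \<in> carrier (K m 0 (Suc 0))" "x (Suc 0) \<in> carrier (K m (Suc 0) 0)"
    using T_Suc[OF x, of 0] by auto
  have "aug TT m (df TT m 0 x) = \<alpha> m (\<epsilon> m 0 (dh m 0 0 (x (Suc 0)) \<oplus>\<^bsub>K m 0 0\<^esub> dv m 0 0 (x 0)))"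
    by (simp add: TT_aug tot_df sg_def)
  also have "\<dots> = \<alpha> m (b m 0 (\<epsilon> m (Suc 0) (x (Suc 0))))"
    using x01 by (simp add: lin_rules(2)[OF \<epsilon>_lin] \<epsilon>_dv \<epsilon>_dh[symmetric])
  also have "\<dots> = \<zero>\<^bsub>A m\<^esub>" using x01 by (intro \<alpha>_b) simp
  finally show ?thesis .
qed

lemma TT_cycle_minus_df:
  assumes x: "x \<in> carrier (T m k)" "aug_cycle A TT m k x" and y: "y \<in> carrier (T m (Suc k))"
  shows "aug_cycle A TT m k (x \<ominus>\<^bsub>T m k\<^esub> df TT m k y)"
proof -
  have dy: "df TT m k y \<in> carrier (T m k)" using lin_rules(1)[OF tot_df_lin y] .
  show ?thesis
  proof (cases k)
    case 0
    have "aug TT m (x \<ominus>\<^bsub>T m 0\<^esub> df TT m 0 y) = \<zero>\<^bsub>A m\<^esub>"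
      using lin_rules(6)[OF TT_aug_lin T_module A_module x(1)[unfolded 0] dy[unfolded 0]] x(2) TT_aug_df y 0
      by (simp add: aug_cycle_def)
    then show ?thesis using 0 by (simp add: aug_cycle_def)
  next
    case (Suc j)
    have "df TT m j (df TT m (Suc j) y) = \<zero>\<^bsub>T m j\<^esub>"
      using pro_cx.df_df[OF TT_pro_cx, of y m j] y Suc by simp
    moreover have "df TT m j (x \<ominus>\<^bsub>T m (Suc j)\<^esub> df TT m (Suc j) y) =
        df TT m j x \<ominus>\<^bsub>T m j\<^esub> df TT m j (df TT m (Suc j) y)"
      by (rule lin_rules(6)[OF tot_df_lin T_module T_module x(1)[unfolded Suc] dy[unfolded Suc]])
    moreover have "df TT m j x = \<zero>\<^bsub>T m j\<^esub>" using x(2) Suc by (simp add: aug_cycle_def)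
    ultimately have "df TT m j (x \<ominus>\<^bsub>T m (Suc j)\<^esub> df TT m (Suc j) y) = \<zero>\<^bsub>T m j\<^esub>"
      using mm_minus_self[OF T_module mm_zero[OF T_module]] by simp
    then show ?thesis using Suc by (simp add: aug_cycle_def)
  qed
qed

text \<open>A cycle whose components from \<open>i\<close> on vanish is turned into zero by removing
  the components below \<open>i\<close> one at a time, from the highest down, using exactness of the
  columns. At the start \<open>i = Suc k\<close> no component vanishes yet, and the condition on
  \<open>\<epsilon>\<close> gives the first step, in row 0.\<close>

lemma T_clean:
  assumes "i \<le> Suc k" "x \<in> carrier (T m k)" "aug_cycle A TT m k x" "\<And>l. i \<le> l \<Longrightarrow> l \<le> k \<Longrightarrow> x l = \<zero>\<^bsub>K m l (k - l)\<^esub>"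
    "i = Suc k \<Longrightarrow> \<epsilon> m k (x k) = \<zero>\<^bsub>B m k\<^esub>"
  shows "x \<in> df TT m k ` carrier (T m (Suc k))"
  using assms
proof (induction i arbitrary: x)
  case 0
  have "x = \<zero>\<^bsub>T m k\<^esub>" by (rule T_eqI[OF 0(2) mm_zero[OF T_module]]) (use 0 in \<open>auto simp: T_ops\<close>)
  also have "\<zero>\<^bsub>T m k\<^esub> = df TT m k \<zero>\<^bsub>T m (Suc k)\<^esub>"
    by (rule lin_rules(4)[OF tot_df_lin T_module T_module, symmetric])
  finally show ?case using mm_zero[OF T_module] by (rule image_eqI)
next
  case (Suc i)
  have ik: "i \<le> k" using Suc.prems by simp
  have xc: "x l \<in> carrier (K m l (k - l))" if "l \<le> k" for l using Suc.prems(2) that unfolding T_carrier by blast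
  \<comment> \<open>The neighbour in column \<open>i + 1\<close> is zero, so the cycle condition
    says that \<open>x i\<close> is a vertical cycle. In row 0 the kernel of
    \<open>\<epsilon>\<close> takes its place.\<close>
  have "x i \<in> dv m i (k - i) ` carrier (K m i (Suc (k - i)))"
  proof (cases "i = k")
    case True
    then show ?thesis using Suc.prems(5) \<epsilon>_ker[of "x k" m k] xc[of k] by simp
  next
    case False
    then obtain j where k: "k = Suc j" and ij: "i \<le> j" using ik by (cases k) auto
    have kj: "k - i = Suc (j - i)" using k ij by simp
    have "df TT m j x i = \<zero>\<^bsub>K m i (j - i)\<^esub>"
      using Suc.prems(3) k ij by (simp add: aug_cycle_def T_ops)
    moreover have "x (Suc i) = \<zero>\<^bsub>K m (Suc i) (j - i)\<^esub>" using Suc.prems(4)[of "Suc i"] k ij by simp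
    ultimately have "dv m i (j - i) (x i) = \<zero>\<^bsub>K m i (j - i)\<^esub>"
      using xc[OF ik] kj ij by (simp add: tot_df)
    then show ?thesis using dv_exact[of "x i" m i "j - i"] xc[OF ik] kj by simp
  qed
  then obtain w where w: "w \<in> carrier (K m i (Suc (k - i)))" "x i = dv m i (k - i) w" by blast
  have Si: "Suc k - i = Suc (k - i)" using ik by simp
  \<comment> \<open>The sign of the total differential is built in, so the component of the boundary
    in column \<open>i\<close> is exactly \<open>x i\<close>; its only other component lies in
    column \<open>i - 1\<close>.\<close>
  let ?y = "inK m (Suc k) i (sg (K m i (Suc (k - i))) i w)"
  have y: "?y \<in> carrier (T m (Suc k))" using w ik Si by (intro inK_carrier) auto
  have dy: "df TT m k ?y \<in> carrier (T m k)" using lin_rules(1)[OF tot_df_lin y] .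
  have dyl: "df TT m k ?y l = (if l = i then x i else \<zero>\<^bsub>K m l (k - l)\<^esub>)" if "i \<le> l" "l \<le> k" for l
    using that w by (auto simp: tot_df inK_apply Suc_diff_le lin_sg[OF dv_lin])
  let ?x = "x \<ominus>\<^bsub>T m k\<^esub> df TT m k ?y"
  have "?x \<in> df TT m k ` carrier (T m (Suc k))"
  proof (rule Suc.IH)
    show "i \<le> Suc k" using ik by simp
    show "?x \<in> carrier (T m k)" using Suc.prems(2) dy by simp
    show "aug_cycle A TT m k ?x" by (rule TT_cycle_minus_df[OF Suc.prems(2,3) y])
    show "?x l = \<zero>\<^bsub>K m l (k - l)\<^esub>" if "i \<le> l" "l \<le> k" for l
      using T_minus[OF Suc.prems(2) dy that(2)] dyl[OF that] Suc.prems(4)[of l] that xc[OF that(2)]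
      by (cases "l = i") auto
    show "\<epsilon> m k (?x k) = \<zero>\<^bsub>B m k\<^esub>" if "i = Suc k" using that ik by simp
  qed
  then obtain z where z: "z \<in> carrier (T m (Suc k))" "?x = df TT m k z" by blast
  have "x = df TT m k (z \<oplus>\<^bsub>T m (Suc k)\<^esub> ?y)"
    unfolding lin_rules(2)[OF tot_df_lin z(1) y] z(2)[symmetric] using Suc.prems(2) dy by simp
  moreover have "z \<oplus>\<^bsub>T m (Suc k)\<^esub> ?y \<in> carrier (T m (Suc k))" using z(1) y by simp
  ultimately show ?case by (rule image_eqI)
qed

theorem tot_pro_res: "pro_res R TT A a"
proof (intro pro_res.intro pro_res_axioms.intro)
  show "pro_cx R TT" by (rule tot_pro_cx)
  show "module R (A m)" for m by simp
  show "lin R (A n) (A m) (a m n)" if "m \<le> n" for m n by (rule a_lin[OF that])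
  show "a l m (a m n y) = a l n y" if "l \<le> m" "m \<le> n" "y \<in> carrier (A n)" for l m n y by (rule a_a[OF that])
  show "lin R (cx TT m 0) (A m) (aug TT m)" for m using TT_aug_lin by simp
  show "y \<in> aug TT m ` carrier (cx TT m 0)" if "y \<in> carrier (A m)" for y m
  proof -
    have "y \<in> \<alpha> m ` \<epsilon> m 0 ` carrier (K m 0 0)" unfolding \<epsilon>_surj \<alpha>_surj by (rule that)
    then obtain v where "v \<in> carrier (K m 0 0)" "y = \<alpha> m (\<epsilon> m 0 v)" by blast
    then show ?thesis
      using inK_apply[of 0 0 m 0 v] inK_carrier[of 0 0 v m]
      by (intro image_eqI[of _ _ "inK m 0 0 v"]) (simp_all add: TT_aug)
  qed
  show "aug TT m (df TT m 0 x) = \<zero>\<^bsub>A m\<^esub>" if "x \<in> carrier (cx TT m (Suc 0))" for x m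
    using TT_aug_df that by simp
  show "aug TT m (tr TT m n 0 x) = a m n (aug TT n x)" if "m \<le> n" "x \<in> carrier (cx TT n 0)" for m n x
    using that direct_sum_carrierD[of x "{..0}" "\<lambda>i. K n i (0 - i)" 0]
    by (simp add: TT_aug tot_tr \<epsilon>_tK \<alpha>_tB)
  show "projective R (cx TT m k)" for m k
  proof -
    \<comment> \<open>A component of degree k is a finite direct sum of entries of the double
      complex.\<close>
    have "\<forall>i. \<exists>X :: 'x set. retract_free R (K m i (k - i)) X" using K_proj projective_retract by blast
    from choice[OF this] obtain X :: "nat \<Rightarrow> 'x set" where "\<forall>i. retract_free R (K m i (k - i)) (X i)" by blast
    then have "retract_free R (T m k) (Sigma {..k} X)" by (intro retract_free_direct_sum) auto
    from retract_free_projective[OF T_module this] show ?thesis by simp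
  qed
  fix m k
  obtain n where n: "n \<ge> m" and ex: "\<forall>z\<in>carrier (B n k).
      (case k of 0 \<Rightarrow> \<alpha> n z = \<zero>\<^bsub>A n\<^esub> | Suc j \<Rightarrow> b n j z = \<zero>\<^bsub>B n j\<^esub>) \<longrightarrow>
      tB m n k z \<in> b m k ` carrier (B m (Suc k))" using B_exact by blast
  have "tr TT m n k x \<in> df TT m k ` carrier (T m (Suc k))"
    if x: "x \<in> carrier (T n k)" and cyc: "aug_cycle A TT n k x" for x
  proof -
    have xc: "x l \<in> carrier (K n l (k - l))" if "l \<le> k" for l using x that unfolding T_carrier by blast
    have xk: "x k \<in> carrier (K n k 0)" using xc[of k] by simp
    \<comment> \<open>The row 0 component of a total cycle maps to a cycle of the augmented complex
      \<open>B n\<close>, since \<open>\<epsilon>\<close> kills vertical boundaries.\<close>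
    have "case k of 0 \<Rightarrow> \<alpha> n (\<epsilon> n k (x k)) = \<zero>\<^bsub>A n\<^esub> | Suc j \<Rightarrow> b n j (\<epsilon> n k (x k)) = \<zero>\<^bsub>B n j\<^esub>"
    proof (cases k)
      case 0
      then show ?thesis using cyc by (simp add: aug_cycle_def TT_aug)
    next
      case (Suc j)
      have xj: "x j \<in> carrier (K n j (Suc 0))" using xc[of j] Suc by simp
      have "df TT n j x j = \<zero>\<^bsub>K n j 0\<^esub>" using cyc Suc by (simp add: aug_cycle_def T_ops)
      then have "\<epsilon> n j (dh n j 0 (x (Suc j)) \<oplus>\<^bsub>K n j 0\<^esub> sg (K n j 0) j (dv n j 0 (x j))) = \<zero>\<^bsub>B n j\<^esub>"
        by (simp add: tot_df)
      then have "\<epsilon> n j (dh n j 0 (x (Suc j))) = \<zero>\<^bsub>B n j\<^esub>"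
        using xk xj Suc by (simp add: lin_rules(2)[OF \<epsilon>_lin] lin_sg[OF \<epsilon>_lin] \<epsilon>_dv)
      then show ?thesis using Suc xk by (simp add: \<epsilon>_dh)
    qed
    then have "tB m n k (\<epsilon> n k (x k)) \<in> b m k ` carrier (B m (Suc k))" using ex xk by simp
    then obtain u where u: "u \<in> carrier (B m (Suc k))" "tB m n k (\<epsilon> n k (x k)) = b m k u" by blast
    have "u \<in> \<epsilon> m (Suc k) ` carrier (K m (Suc k) 0)" unfolding \<epsilon>_surj by (rule u(1))
    then obtain v where v: "v \<in> carrier (K m (Suc k) 0)" "u = \<epsilon> m (Suc k) v" by blast
    \<comment> \<open>After transition the image in \<open>B m k\<close> is a boundary, and a lift
      \<open>v\<close> of its primitive sits in column \<open>k + 1\<close>. Subtracting the total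
      boundary of \<open>v\<close> makes the image under \<open>\<epsilon>\<close> zero, which is
      the starting condition of \<open>T_clean\<close>.\<close>
    let ?y = "inK m (Suc k) (Suc k) v"
    have y: "?y \<in> carrier (T m (Suc k))" using v by (intro inK_carrier) auto
    have dy: "df TT m k ?y \<in> carrier (T m k)" using lin_rules(1)[OF tot_df_lin y] .
    have tx: "tr TT m n k x \<in> carrier (T m k)" using lin_rules(1)[OF tot_tr_lin[OF n] x] .
    have ctx: "aug_cycle A TT m k (tr TT m n k x)"
    proof (cases k)
      case 0
      have "\<alpha> n (\<epsilon> n 0 (x 0)) = \<zero>\<^bsub>A n\<^esub>" using cyc 0 by (simp add: aug_cycle_def TT_aug)
      then show ?thesis
        using 0 xk n lin_rules(4)[OF a_lin[OF n]] by (simp add: aug_cycle_def TT_aug tot_tr \<epsilon>_tK \<alpha>_tB)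
    next
      case (Suc j)
      then show ?thesis
        using cyc pro_cx.df_tr[OF TT_pro_cx, of m n x j] n x
          lin_rules(4)[OF tot_tr_lin[OF n]] by (simp add: aug_cycle_def)
    qed
    let ?x = "tr TT m n k x \<ominus>\<^bsub>T m k\<^esub> df TT m k ?y"
    have dyk: "df TT m k ?y k = dh m k 0 v" using v by (simp add: tot_df inK_apply)
    have "?x \<in> df TT m k ` carrier (T m (Suc k))"
    proof (rule T_clean[of "Suc k"])
      show "?x \<in> carrier (T m k)" using tx dy by simp
      show "aug_cycle A TT m k ?x" by (rule TT_cycle_minus_df[OF tx ctx y])
      have "?x k = tK m n k 0 (x k) \<ominus>\<^bsub>K m k 0\<^esub> dh m k 0 v"
        using T_minus[OF tx dy, of k] dyk by (simp add: tot_tr)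
      then have "\<epsilon> m k (?x k) = tB m n k (\<epsilon> n k (x k)) \<ominus>\<^bsub>B m k\<^esub> \<epsilon> m k (dh m k 0 v)"
        using xk n v by (simp add: lin_rules(6)[OF \<epsilon>_lin] \<epsilon>_tK)
      also have "tB m n k (\<epsilon> n k (x k)) = \<epsilon> m k (dh m k 0 v)" using u v by (simp add: \<epsilon>_dh)
      finally show "\<epsilon> m k (?x k) = \<zero>\<^bsub>B m k\<^esub>" using v by simp
    qed auto
    then obtain z where z: "z \<in> carrier (T m (Suc k))" "?x = df TT m k z" by blast
    have "tr TT m n k x = df TT m k (z \<oplus>\<^bsub>T m (Suc k)\<^esub> ?y)"
      unfolding lin_rules(2)[OF tot_df_lin z(1) y] z(2)[symmetric] using tx dy by simp
    moreover have "z \<oplus>\<^bsub>T m (Suc k)\<^esub> ?y \<in> carrier (T m (Suc k))" using z(1) y by simp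
    ultimately show ?thesis by (rule image_eqI)
  qed
  then show "\<exists>n\<ge>m. \<forall>x\<in>carrier (cx TT n k). aug_cycle A TT n k x \<longrightarrow>
      tr TT m n k x \<in> df TT m k ` carrier (cx TT m (Suc k))" using n by auto
qed

end

section \<open>Tensoring with finite free modules, written as powers; adic quotients\<close>

section \<open>Powers of a module\<close>

text \<open>For a linear map \<open>f\<close> between free modules, \<open>pext r q X f\<close> is \<open>f \<otimes> X : X\<^sup>r \<rightarrow> X\<^sup>q\<close>, and \<open>tens r X z x\<close> is \<open>z \<otimes> x\<close>.\<close>

definition tens :: "nat \<Rightarrow> ('a, 'x, 'm) module_scheme \<Rightarrow> (nat \<Rightarrow> 'a) \<Rightarrow> 'x \<Rightarrow> nat \<Rightarrow> 'x" where
  "tens r X z x = (\<lambda>s\<in>{..<r}. z s \<odot>\<^bsub>X\<^esub> x)"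

definition mmap :: "nat \<Rightarrow> ('x \<Rightarrow> 'y) \<Rightarrow> (nat \<Rightarrow> 'x) \<Rightarrow> nat \<Rightarrow> 'y" where
  "mmap r h x = (\<lambda>s\<in>{..<r}. h (x s))"

abbreviation mpow :: "nat \<Rightarrow> ('a, 'x, 'm) module_scheme \<Rightarrow> ('a, nat \<Rightarrow> 'x) module" where
  "mpow r X \<equiv> direct_sum {..<r} (\<lambda>_. X)"

definition pext ::
    "('a, 'r) ring_scheme \<Rightarrow> nat \<Rightarrow> nat \<Rightarrow> ('a, 'x, 'm) module_scheme \<Rightarrow> ((nat \<Rightarrow> 'a) \<Rightarrow> nat \<Rightarrow> 'a)
      \<Rightarrow> (nat \<Rightarrow> 'x) \<Rightarrow> nat \<Rightarrow> 'x"
  where "pext R r q X f = ds_map {..<r} (\<lambda>_. X) (mpow q X) (\<lambda>s. tens q X (f (free_basis R {..<r} s)))"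

context modules
begin

abbreviation "fr r \<equiv> free_module R {..<r::nat}"

lemma mpow_module [simp]: "module R X \<Longrightarrow> module R (mpow r X)"
  by (rule direct_sum_module)

lemma mpow_carrier: "x \<in> carrier (mpow r X) \<longleftrightarrow> x \<in> extensional {..<r} \<and> (\<forall>s<r. x s \<in> carrier X)"
  by (subst direct_sum_carrier_finite) (auto simp: PiE_iff)

lemma fr_eq_mpow: "fr r = mpow r (ring_module R)"
  by (simp add: free_module_def)

lemma tens_lin1: "module R X \<Longrightarrow> x \<in> carrier X \<Longrightarrow> lin R (fr r) (mpow r X) (\<lambda>z. tens r X z x)"
  by (rule linI)
    (auto simp: tens_def mpow_carrier direct_sum_simps(2-) free_module_simps fun_eq_iff mm_add_smult mm_smult_smult)

lemma tens_lin2: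
  assumes X: "module R X" and z: "z \<in> carrier (fr r)"
  shows "lin R X (mpow r X) (tens r X z)"
proof (rule linI)
  have zc: "z s \<in> carrier R" if "s < r" for s using z that by simp
  show "tens r X z x \<in> carrier (mpow r X)" if "x \<in> carrier X" for x
    using zc X that by (auto simp: tens_def mpow_carrier)
  show "tens r X z (x \<oplus>\<^bsub>X\<^esub> y) = tens r X z x \<oplus>\<^bsub>mpow r X\<^esub> tens r X z y" if "x \<in> carrier X" "y \<in> carrier X" for x y
    using zc X that by (auto simp: tens_def direct_sum_simps(2-) fun_eq_iff mm_smult_add)
  show "tens r X z (a \<odot>\<^bsub>X\<^esub> x) = a \<odot>\<^bsub>mpow r X\<^esub> tens r X z x" if "a \<in> carrier R" "x \<in> carrier X" for a x
    using zc X that by (auto simp: tens_def direct_sum_simps(2-) fun_eq_iff mm_smult_smult[symmetric] R.m_comm)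
qed

lemma tens_basis:
  "module R X \<Longrightarrow> s < r \<Longrightarrow> x \<in> carrier X \<Longrightarrow> sum_inj {..<r} (\<lambda>_. X) s x = tens r X (free_basis R {..<r} s) x"
  by (auto simp: tens_def free_basis_def sum_inj_def fun_eq_iff)

lemma mpow_lin_ext:
  assumes X: "module R X" and N: "module R N" and f: "lin R (mpow r X) N f" and g: "lin R (mpow r X) N g"
    and eq: "\<And>s x. s < r \<Longrightarrow> x \<in> carrier X \<Longrightarrow>
      f (tens r X (free_basis R {..<r} s) x) = g (tens r X (free_basis R {..<r} s) x)"
    and z: "z \<in> carrier (mpow r X)"
  shows "f z = g z"
  by (rule direct_sum_lin_ext[OF X N f g _ z]) (simp add: tens_basis[OF X] eq)

context
  fixes X :: "('a, 'x, 'm) module_scheme" and r q :: nat and f :: "(nat \<Rightarrow> 'a) \<Rightarrow> nat \<Rightarrow> 'a"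
  assumes X [simp]: "module R X" and f: "lin R (fr r) (fr q) f"
begin

lemma pext_aux: "s < r \<Longrightarrow> lin R X (mpow q X) (tens q X (f (free_basis R {..<r} s)))"
  by (rule tens_lin2[OF X lin_rules(1)[OF f]]) simp

lemma pext_lin: "lin R (mpow r X) (mpow q X) (pext R r q X f)"
  unfolding pext_def by (rule ds_map_lin) (simp_all add: pext_aux)

lemma pext_tens:
  assumes z: "z \<in> carrier (fr r)" and x: "x \<in> carrier X"
  shows "pext R r q X f (tens r X z x) = tens q X (f z) x"
proof (rule free_lin_ext[OF mpow_module[OF X] lin_comp[OF tens_lin1[OF X x] pext_lin] lin_comp[OF f tens_lin1[OF X x]] _ z])
  fix s assume s: "s \<in> {..<r}"
  have "pext R r q X f (sum_inj {..<r} (\<lambda>_. X) s x) = tens q X (f (free_basis R {..<r} s)) x"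
    unfolding pext_def by (rule ds_map_inj) (use s x in \<open>simp_all add: pext_aux\<close>)
  then show "pext R r q X f (tens r X (free_basis R {..<r} s) x) = tens q X (f (free_basis R {..<r} s)) x"
    using tens_basis[OF X _ x] s by simp
qed

text \<open>The composite is tested on the tensors of basis vectors. The properties of
  \<open>g\<close> enter as hypotheses because in this context the rules on \<open>pext\<close>
  concern the fixed map \<open>f\<close>; \<open>pext_pext\<close> supplies them.\<close>

lemma pext_pext_zero:
  assumes g: "lin R (fr q) (fr l) g" and z: "\<And>z. z \<in> carrier (fr r) \<Longrightarrow> g (f z) = \<zero>\<^bsub>fr l\<^esub>"
    and p: "\<And>z x. z \<in> carrier (fr q) \<Longrightarrow> x \<in> carrier X \<Longrightarrow> pext R q l X g (tens q X z x) = tens l X (g z) x"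
    and pl: "lin R (mpow q X) (mpow l X) (pext R q l X g)" and x: "x \<in> carrier (mpow r X)"
  shows "pext R q l X g (pext R r q X f x) = \<zero>\<^bsub>mpow l X\<^esub>"
proof (rule mpow_lin_ext[OF X _ lin_comp[OF pext_lin pl] lin_zero _ x])
  fix s x assume s: "s < r" and x: "x \<in> carrier X"
  have e: "free_basis R {..<r} s \<in> carrier (fr r)" using s by simp
  have "tens l X \<zero>\<^bsub>fr l\<^esub> x = \<zero>\<^bsub>mpow l X\<^esub>"
    using lin_rules(4)[OF tens_lin1[OF X x]] by simp
  then show "pext R q l X g (pext R r q X f (tens r X (free_basis R {..<r} s) x)) = \<zero>\<^bsub>mpow l X\<^esub>"
    using pext_tens[OF e x] p[OF lin_rules(1)[OF f e] x] z[OF e] by simp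
qed simp_all

end

lemma pext_pext:
  assumes X: "module R X" and f: "lin R (fr r) (fr q) f" and g: "lin R (fr q) (fr l) g"
    and z: "\<And>z. z \<in> carrier (fr r) \<Longrightarrow> g (f z) = \<zero>\<^bsub>fr l\<^esub>" and x: "x \<in> carrier (mpow r X)"
  shows "pext R q l X g (pext R r q X f x) = \<zero>\<^bsub>mpow l X\<^esub>"
  by (rule pext_pext_zero[OF X f g z pext_tens[OF X g] pext_lin[OF X g] x])

lemma mmap_lin: "lin R X Y h \<Longrightarrow> lin R (mpow r X) (mpow r Y) (mmap r h)"
  by (auto simp: lin_def mmap_def mpow_carrier direct_sum_simps(2-) fun_eq_iff)

lemma mmap_tens: "lin R X Y h \<Longrightarrow> z \<in> carrier (fr r) \<Longrightarrow> x \<in> carrier X \<Longrightarrow> mmap r h (tens r X z x) = tens r Y z (h x)"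
  by (auto simp: mmap_def tens_def fun_eq_iff lin_rules(3))

lemma mmap_apply [simp]: "s < r \<Longrightarrow> mmap r h x s = h (x s)"
  by (simp add: mmap_def)

lemma mmap_pext:
  assumes X: "module R X" and Y: "module R Y" and f: "lin R (fr r) (fr q) f" and h: "lin R X Y h"
    and x: "x \<in> carrier (mpow r X)"
  shows "mmap q h (pext R r q X f x) = pext R r q Y f (mmap r h x)"
proof (rule mpow_lin_ext[OF X _ lin_comp[OF pext_lin[OF X f] mmap_lin[OF h]] lin_comp[OF mmap_lin[OF h] pext_lin[OF Y f]] _ x])
  fix s x assume s: "s < r" and x: "x \<in> carrier X"
  have e: "free_basis R {..<r} s \<in> carrier (fr r)" using s by simp
  show "mmap q h (pext R r q X f (tens r X (free_basis R {..<r} s) x)) =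
      pext R r q Y f (mmap r h (tens r X (free_basis R {..<r} s) x))"
    using pext_tens[OF X f e x] mmap_tens[OF h lin_rules(1)[OF f e] x] mmap_tens[OF h e x]
      pext_tens[OF Y f e lin_rules(1)[OF h x]] by simp
qed (use Y in simp)

lemma mmap_zero_iff:
  assumes "module R Y" "lin R X Y h" "x \<in> carrier (mpow r X)"
  shows "mmap r h x = \<zero>\<^bsub>mpow r Y\<^esub> \<longleftrightarrow> (\<forall>s<r. h (x s) = \<zero>\<^bsub>Y\<^esub>)"
  using assms by (auto simp: mmap_def direct_sum_simps fun_eq_iff)

lemma mmap_image:
  assumes y: "y \<in> carrier (mpow r Y)" and im: "\<And>s. s < r \<Longrightarrow> y s \<in> h ` carrier X"
  shows "y \<in> mmap r h ` carrier (mpow r X)"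
proof -
  have "\<forall>s\<in>{..<r}. \<exists>x. x \<in> carrier X \<and> y s = h x" using im by blast
  from bchoice[OF this] obtain x where x: "\<forall>s\<in>{..<r}. x s \<in> carrier X \<and> y s = h (x s)" by blast
  have "restrict x {..<r} \<in> carrier (mpow r X)" using x by (simp add: mpow_carrier)
  moreover have "y = mmap r h (restrict x {..<r})"
    by (rule extensionalityI[of _ "{..<r}"]) (use y x in \<open>auto simp: mpow_carrier mmap_def\<close>)
  ultimately show ?thesis by blast
qed

text \<open>With the ring as coefficients F (x) R is F itself. This allows F to be compared with F
  (x) R/a^m through the projection of the coefficients.\<close>

lemma pext_ring:
  assumes f: "lin R (fr r) (fr q) f" and x: "x \<in> carrier (fr r)"
  shows "pext R r q (ring_module R) f x = f x"
proof -
  have t: "tens l (ring_module R) z a = a \<odot>\<^bsub>fr l\<^esub> z" if "z \<in> carrier (fr l)" "a \<in> carrier R" for l z a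
    using that by (auto simp: tens_def free_module_simps fun_eq_iff R.m_comm)
  show ?thesis
  proof (rule mpow_lin_ext[OF ring_module_module _ pext_lin[OF ring_module_module f] f[unfolded fr_eq_mpow] _ x[unfolded fr_eq_mpow]])
    fix s a assume s: "s < r" and a: "a \<in> carrier (ring_module R)"
    have e: "free_basis R {..<r} s \<in> carrier (fr r)" using s by simp
    show "pext R r q (ring_module R) f (tens r (ring_module R) (free_basis R {..<r} s) a) =
        f (tens r (ring_module R) (free_basis R {..<r} s) a)"
      using pext_tens[OF ring_module_module f e a] t[OF lin_rules(1)[OF f e]] t[OF e] a lin_rules(3)[OF f _ e] by simp
  qed simp
qed

text \<open>The universal property of a quotient, stated for an arbitrary surjection so that it
  covers coset modules and powers of them alike.\<close>

lemma lin_induced: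
  assumes E: "module R E" and B: "module R B" and C: "module R C" and p: "lin R E B p"
    and ps: "p ` carrier E = carrier B" and f: "lin R E C f"
    and k: "\<And>x. x \<in> carrier E \<Longrightarrow> p x = \<zero>\<^bsub>B\<^esub> \<Longrightarrow> f x = \<zero>\<^bsub>C\<^esub>"
  shows "\<exists>g. lin R B C g \<and> (\<forall>x\<in>carrier E. g (p x) = f x)"
proof -
  define g where "g y = f (SOME x. x \<in> carrier E \<and> p x = y)" for y
  have g: "g (p x) = f x" if x: "x \<in> carrier E" for x
  proof -
    let ?x = "SOME x'. x' \<in> carrier E \<and> p x' = p x"
    have x': "?x \<in> carrier E \<and> p ?x = p x" by (rule someI[of _ x]) (use x in simp)
    then have "p (?x \<ominus>\<^bsub>E\<^esub> x) = \<zero>\<^bsub>B\<^esub>" using x lin_rules(1,6)[OF p] E B by simp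
    then have "f ?x \<ominus>\<^bsub>C\<^esub> f x = \<zero>\<^bsub>C\<^esub>" using k[of "?x \<ominus>\<^bsub>E\<^esub> x"] x x' lin_rules(6)[OF f] E C by simp
    then show ?thesis using x x' lin_rules(1)[OF f] mm_minus_eq_zero[OF C] by (simp add: g_def)
  qed
  have rep: "\<exists>x\<in>carrier E. y = p x" if "y \<in> carrier B" for y using that unfolding ps[symmetric] by blast
  have "lin R B C g"
  proof (rule linI)
    show "g y \<in> carrier C" if y: "y \<in> carrier B" for y using rep[OF y] g lin_rules(1)[OF f] by auto
    show "g (y \<oplus>\<^bsub>B\<^esub> z) = g y \<oplus>\<^bsub>C\<^esub> g z" if yz: "y \<in> carrier B" "z \<in> carrier B" for y z
    proof -
      obtain u v where "u \<in> carrier E" "y = p u" "v \<in> carrier E" "z = p v" using rep yz by blast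
      then show ?thesis using g[of "u \<oplus>\<^bsub>E\<^esub> v"] g lin_rules(2)[OF p] lin_rules(2)[OF f] E by simp
    qed
    show "g (c \<odot>\<^bsub>B\<^esub> y) = c \<odot>\<^bsub>C\<^esub> g y" if c: "c \<in> carrier R" and y: "y \<in> carrier B" for c y
    proof -
      obtain u where "u \<in> carrier E" "y = p u" using rep y by blast
      then show ?thesis using g[of "c \<odot>\<^bsub>E\<^esub> u"] g c lin_rules(3)[OF p] lin_rules(3)[OF f] E by simp
    qed
  qed
  then show ?thesis using g by blast
qed

subsection \<open>Adic quotients\<close>

context
  fixes I :: "'a set" and M :: "('a, 'c, 'm) module_scheme"
  assumes I: "ideal I R" and M [simp]: "module R M"
begin

lemma adic_submodule: "submodule (ideal_power_smult R I n M) R M"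
  unfolding ideal_power_smult_def ideal_smult_def
  by (rule mod_span_submodule[OF M]) (use ideal_rules(1)[OF ipow_ideal[OF I]] in auto)

lemma adic_smult_mem: "a \<in> ipow I n \<Longrightarrow> x \<in> carrier M \<Longrightarrow> a \<odot>\<^bsub>M\<^esub> x \<in> ideal_power_smult R I n M"
  unfolding ideal_power_smult_def ideal_smult_def by (rule mod_span_superset) blast

lemma adic_least:
  "submodule H R M \<Longrightarrow> (\<And>a x. a \<in> ipow I n \<Longrightarrow> x \<in> carrier M \<Longrightarrow> a \<odot>\<^bsub>M\<^esub> x \<in> H) \<Longrightarrow> ideal_power_smult R I n M \<subseteq> H"
  unfolding ideal_power_smult_def ideal_smult_def by (rule mod_span_least) auto

lemma adic_antimono: "m \<le> n \<Longrightarrow> ideal_power_smult R I n M \<subseteq> ideal_power_smult R I m M"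
  by (rule adic_least[OF adic_submodule], rule adic_smult_mem) (use ipow_antimono[OF I] in auto)

abbreviation "apr n \<equiv> (\<lambda>x. ideal_power_smult R I n M +>\<^bsub>M\<^esub> x)"

lemma adic_module [simp]: "module R (adic_quot R I M n)"
  unfolding adic_quot_def by (rule quot_module[OF adic_submodule M])

lemma apr_lin: "lin R M (adic_quot R I M n) (apr n)"
  unfolding adic_quot_def by (rule quot_lin[OF adic_submodule M])

lemma apr_image: "apr n ` carrier M = carrier (adic_quot R I M n)"
  unfolding adic_quot_def quot_ops(1)[OF adic_submodule M] ..

lemma apr_zero_iff: "x \<in> carrier M \<Longrightarrow> apr n x = \<zero>\<^bsub>adic_quot R I M n\<^esub> \<longleftrightarrow> x \<in> ideal_power_smult R I n M"
  unfolding adic_quot_def by (rule quot_zero_iff[OF adic_submodule M])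

lemma adic_proj_apr: 
  assumes x: "x \<in> carrier M"
  shows "adic_proj R I M n (apr (Suc n) x) = apr n x"
proof -
  have "(\<Union>y\<in>apr (Suc n) x. apr n y) = apr n x"
  proof (rule SUP_eq_const)
    show "apr (Suc n) x \<noteq> {}" using coset_self[OF adic_submodule M x] by blast
    fix y assume y: "y \<in> apr (Suc n) x"
    note c = coset_memD[OF adic_submodule M x y]
    have "y \<ominus>\<^bsub>M\<^esub> x \<in> ideal_power_smult R I n M" using c(2) adic_antimono[of n "Suc n"] by auto
    then show "apr n y = apr n x" using coset_eq_iff[OF adic_submodule M c(1) x] by simp
  qed
  moreover have "apr (Suc n) x \<in> carrier (adic_quot R I M (Suc n))" using apr_image x by blast
  ultimately show ?thesis by (simp add: adic_proj_def)
qed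

lemma adic_proj_lin: "lin R (adic_quot R I M (Suc n)) (adic_quot R I M n) (adic_proj R I M n)"
proof -
  obtain g where g: "lin R (adic_quot R I M (Suc n)) (adic_quot R I M n) g"
    "\<forall>x\<in>carrier M. g (apr (Suc n) x) = apr n x"
    using lin_induced[OF M adic_module adic_module apr_lin apr_image apr_lin, of "Suc n" n]
      apr_zero_iff adic_antimono[of n "Suc n"] by auto
  have "adic_proj R I M n y = g y" if "y \<in> carrier (adic_quot R I M (Suc n))" for y
  proof -
    obtain x where "x \<in> carrier M" "y = apr (Suc n) x" using \<open>y \<in> _\<close> unfolding apr_image[symmetric] by blast
    then show ?thesis using g(2) adic_proj_apr by simp
  qed
  then show ?thesis using lin_cong[OF adic_module] g(1) by blast
qed

lemma dnt_adic_proj: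
  assumes "m \<le> n" "x \<in> carrier M"
  shows "dnt_map (adic_proj R I M) m (n - m) (apr n x) = apr m x"
proof -
  have "dnt_map (adic_proj R I M) m j (apr (m + j) x) = apr m x" for j
    by (induction j) (use adic_proj_apr assms in simp_all)
  from this[of "n - m"] show ?thesis using assms by simp
qed

end

lemma adic_ring: "ideal I R \<Longrightarrow> ideal_power_smult R I n (ring_module R) = ipow I n"
proof
  assume I: "ideal I R"
  note J = ipow_ideal[OF I, of n]
  note Jr = ideal_rules[OF J]
  show "ideal_power_smult R I n (ring_module R) \<subseteq> ipow I n"
  proof (rule adic_least[OF I ring_module_module iffD1[OF ideal_iff_submodule J]])
    fix a x assume ax: "a \<in> ipow I n" "x \<in> carrier (ring_module R)"
    then have "a \<otimes> x = x \<otimes> a" using Jr(1) by (intro R.m_comm) auto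
    then show "a \<odot>\<^bsub>ring_module R\<^esub> x \<in> ipow I n" using Jr(4)[of x a] ax by simp
  qed
  show "ipow I n \<subseteq> ideal_power_smult R I n (ring_module R)"
  proof
    fix a assume a: "a \<in> ipow I n"
    then show "a \<in> ideal_power_smult R I n (ring_module R)"
      using adic_smult_mem[OF I ring_module_module a, of \<one>] Jr(1) by simp
  qed
qed

end

section \<open>The double complex F (x) Q and the pro-resolution of the quotients M/I^m M\<close>

section \<open>A pro-resolution of the adic quotients\<close>

locale adic_res = noeth_modules R for R (structure) +
  fixes I :: "'a set" and M :: "('a, 'c, 'm) module_scheme" and r :: "nat \<Rightarrow> nat"
    and d :: "nat \<Rightarrow> (nat \<Rightarrow> 'a) \<Rightarrow> nat \<Rightarrow> 'a" and v :: "(nat \<Rightarrow> 'a) \<Rightarrow> 'c"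
  assumes I: "ideal I R" and M [simp]: "module R M"
    and res: "proj_resolution R M (\<lambda>i. free_module R {..<r i}) d v"
begin

lemmas F = proj_resolution_rules[OF res M]

lemma d_d: "x \<in> carrier (fr (r (Suc (Suc i)))) \<Longrightarrow> d i (d (Suc i) x) = \<zero>\<^bsub>fr (r i)\<^esub>"
  using F(7)[of "d (Suc i) x" i] lin_rules(1)[OF F(3)] by blast

lemma v_d: "x \<in> carrier (fr (r (Suc 0))) \<Longrightarrow> v (d 0 x) = \<zero>\<^bsub>M\<^esub>"
  using F(6)[of "d 0 x"] lin_rules(1)[OF F(3)] by blast

definition AR :: "nat \<Rightarrow> ('a, 'a set) module" where "AR = adic_quot R I (ring_module R)"
definition aR :: "nat \<Rightarrow> nat \<Rightarrow> 'a set \<Rightarrow> 'a set" where "aR m n = dnt_map (adic_proj R I (ring_module R)) m (n - m)"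
text \<open>The chosen resolutions of R/I^m with their chosen transitions. Their cohomology with
  values in \<open>N\<close> presents ordinary local cohomology, while F (x) Q will present the
  generalized one.\<close>

definition Q :: "('a, ('a, 'a set) res_elt, 'a set) pro_complex" where
  "Q = res_tower AR (adic_proj R I (ring_module R))"
definition pr :: "nat \<Rightarrow> 'a \<Rightarrow> 'a set" where "pr n x = ideal_power_smult R I n (ring_module R) +>\<^bsub>ring_module R\<^esub> x"
definition AM :: "nat \<Rightarrow> ('a, 'c set) module" where "AM = adic_quot R I M"
definition aM :: "nat \<Rightarrow> nat \<Rightarrow> 'c set \<Rightarrow> 'c set" where "aM m n = dnt_map (adic_proj R I M) m (n - m)"
definition prM :: "nat \<Rightarrow> 'c \<Rightarrow> 'c set" where "prM n x = ideal_power_smult R I n M +>\<^bsub>M\<^esub> x"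

lemma AR_module [simp]: "module R (AR m)"
  unfolding AR_def using adic_module[OF I ring_module_module] .

lemma AM_module [simp]: "module R (AM m)"
  unfolding AM_def using adic_module[OF I M] .

lemma pr_lin: "lin R (ring_module R) (AR m) (pr m)"
  unfolding AR_def pr_def[abs_def] using apr_lin[OF I ring_module_module] .

lemma prM_lin: "lin R M (AM m) (prM m)"
  unfolding AM_def prM_def[abs_def] using apr_lin[OF I M] .

lemma pr_surj: "pr m ` carrier R = carrier (AR m)"
  unfolding AR_def pr_def[abs_def] using apr_image[OF I ring_module_module, of m] by simp

lemma prM_surj: "prM m ` carrier M = carrier (AM m)"
  unfolding AM_def prM_def[abs_def] using apr_image[OF I M, of m] .

lemma pr_zero: "x \<in> carrier R \<Longrightarrow> pr m x = \<zero>\<^bsub>AR m\<^esub> \<longleftrightarrow> x \<in> ipow I m"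
  unfolding AR_def pr_def using apr_zero_iff[OF I ring_module_module, of x m] adic_ring[OF I] by simp

lemma prM_zero: "x \<in> carrier M \<Longrightarrow> prM m x = \<zero>\<^bsub>AM m\<^esub> \<longleftrightarrow> x \<in> ideal_power_smult R I m M"
  unfolding AM_def prM_def using apr_zero_iff[OF I M, of x m] .

lemma aR_pr: "m \<le> n \<Longrightarrow> x \<in> carrier R \<Longrightarrow> aR m n (pr n x) = pr m x"
  unfolding aR_def pr_def using dnt_adic_proj[OF I ring_module_module, of m n x] by simp

lemma aM_prM: "m \<le> n \<Longrightarrow> x \<in> carrier M \<Longrightarrow> aM m n (prM n x) = prM m x"
  unfolding aM_def prM_def using dnt_adic_proj[OF I M, of m n x] .

lemma Q_pro_res: "pro_res R Q AR aR"
  unfolding Q_def aR_def[abs_def]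
  by (rule res_tower_pro_res) (use adic_proj_lin[OF I ring_module_module] in \<open>simp_all add: AR_def[symmetric]\<close>)

sublocale Q: pro_res R Q AR aR
  by (rule Q_pro_res)

lemma Q_exact:
  "x \<in> carrier (cx Q m 0) \<Longrightarrow> aug Q m x = \<zero>\<^bsub>AR m\<^esub> \<Longrightarrow> x \<in> df Q m 0 ` carrier (cx Q m (Suc 0))"
  "y \<in> carrier (cx Q m (Suc j)) \<Longrightarrow> df Q m j y = \<zero>\<^bsub>cx Q m j\<^esub> \<Longrightarrow>
    y \<in> df Q m (Suc j) ` carrier (cx Q m (Suc (Suc j)))"
  using proj_resolution_rules(6,7)[OF chosen_res_resolution[OF AR_module[of m]] AR_module[of m]]
  by (simp_all add: Q_def res_tower_def)

text \<open>F_i (x) Q_(m,j), a power of Q_(m,j) because F_i is free of rank \<open>r i\<close>.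
  Horizontal maps come from F, vertical maps and transitions from \<open>Q\<close>.\<close>

abbreviation "K m i j \<equiv> mpow (r i) (cx Q m j)"
abbreviation "dh m i j \<equiv> pext R (r (Suc i)) (r i) (cx Q m j) (d i)"
abbreviation "dv m i j \<equiv> mmap (r i) (df Q m j)"
abbreviation "tK m n i j \<equiv> mmap (r i) (tr Q m n j)"

sublocale double_cx R K dh dv tK
proof (intro double_cx.intro modules_axioms double_cx_axioms.intro)
  fix m i j
  show "module R (K m i j)" by simp
  show "lin R (K m (Suc i) j) (K m i j) (dh m i j)" by (rule pext_lin[OF Q.cx_module F(3)])
  show "lin R (K m i (Suc j)) (K m i j) (dv m i j)" by (rule mmap_lin[OF Q.df_lin])
  show "dh m i j (dh m (Suc i) j x) = \<zero>\<^bsub>K m i j\<^esub>" if "x \<in> carrier (K m (Suc (Suc i)) j)" for x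
    by (rule pext_pext[OF Q.cx_module F(3) F(3) d_d that])
  show "dv m i j (dv m i (Suc j) x) = \<zero>\<^bsub>K m i j\<^esub>" if "x \<in> carrier (K m i (Suc (Suc j)))" for x
    using that by (auto simp: mmap_def mpow_carrier direct_sum_simps(2) fun_eq_iff Q.df_df)
  show "dh m i j (dv m (Suc i) j x) = dv m i j (dh m i (Suc j) x)" if "x \<in> carrier (K m (Suc i) (Suc j))" for x
    by (rule mmap_pext[OF Q.cx_module Q.cx_module F(3) Q.df_lin that, symmetric])
  fix n
  show "tK m m i j x = x" if "x \<in> carrier (K m i j)" for x
    by (rule extensionalityI[of _ "{..<r i}"]) (use that in \<open>auto simp: mmap_def mpow_carrier\<close>)
  show "lin R (K n i j) (K m i j) (tK m n i j)" if "m \<le> n" by (rule mmap_lin[OF Q.tr_lin[OF that]])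
  show "tK l m i j (tK m n i j x) = tK l n i j x" if "l \<le> m" "m \<le> n" "x \<in> carrier (K n i j)" for l x
    using that by (auto simp: mmap_def mpow_carrier fun_eq_iff)
  show "dh m i j (tK m n (Suc i) j x) = tK m n i j (dh n i j x)" if "m \<le> n" "x \<in> carrier (K n (Suc i) j)" for x
    by (rule mmap_pext[OF Q.cx_module Q.cx_module F(3) Q.tr_lin[OF that(1)] that(2), symmetric])
  show "dv m i j (tK m n i (Suc j) x) = tK m n i j (dv n i j x)" if "m \<le> n" "x \<in> carrier (K n i (Suc j))" for x
    using that by (auto simp: mmap_def mpow_carrier fun_eq_iff Q.df_tr)
qed

text \<open>F_i (x) R/I^m, the cokernel of the column \<open>i\<close>. The columns are finite
  powers of resolutions and remain exact; the homology of this complex is what Artin-Rees has to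
  control.\<close>

abbreviation "B m i \<equiv> mpow (r i) (AR m)"
abbreviation "b m i \<equiv> pext R (r (Suc i)) (r i) (AR m) (d i)"
abbreviation "tB m n i \<equiv> mmap (r i) (aR m n)"
abbreviation "\<epsilon> m i \<equiv> mmap (r i) (aug Q m)"
abbreviation "prB m i \<equiv> mmap (r i) (pr m)"

lemma prB_lin: "lin R (fr (r i)) (B m i) (prB m i)"
  unfolding fr_eq_mpow by (rule mmap_lin[OF pr_lin])

lemma prB_surj: "y \<in> carrier (B m i) \<Longrightarrow> y \<in> prB m i ` carrier (fr (r i))"
  unfolding fr_eq_mpow by (rule mmap_image) (auto simp: pr_surj mpow_carrier)

lemma prB_zero:
  assumes "x \<in> carrier (fr (r i))"
  shows "prB m i x = \<zero>\<^bsub>B m i\<^esub> \<longleftrightarrow> (\<forall>s<r i. x s \<in> ipow I m)"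
  using mmap_zero_iff[OF AR_module pr_lin assms[unfolded fr_eq_mpow], of m] assms pr_zero by simp

lemma b_prB:
  assumes "x \<in> carrier (fr (r (Suc i)))"
  shows "b m i (prB m (Suc i) x) = prB m i (d i x)"
  using mmap_pext[OF ring_module_module AR_module F(3) pr_lin, of x i m] pext_ring[OF F(3) assms] assms
  by (simp add: fr_eq_mpow)

lemma tB_prB: "m \<le> n \<Longrightarrow> x \<in> carrier (fr (r i)) \<Longrightarrow> tB m n i (prB n i x) = prB m i x"
  by (auto simp: mmap_def fun_eq_iff aR_pr)

text \<open>I^m M is the image of I^m F_0, because \<open>v\<close> is onto.\<close>

lemma coords_v:
  assumes x: "x \<in> carrier (fr (r 0))" and vx: "v x \<in> ideal_power_smult R I m M"
  shows "\<exists>c\<in>carrier (fr (r 0)). (\<forall>s<r 0. c s \<in> ipow I m) \<and> v x = v c"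
proof -
  let ?C = "{c \<in> carrier (fr (r 0)). \<forall>s<r 0. c s \<in> ipow I m}"
  note J = ipow_ideal[OF I, of m]
  have "submodule (v ` ?C) R M"
    by (rule lin_image_sub_submodule[OF F(4) free_module_module M coords_submodule[OF J]])
  then have "ideal_power_smult R I m M \<subseteq> v ` ?C"
  proof (rule adic_least[OF I M])
    fix a y assume a: "a \<in> ipow I m" and y: "y \<in> carrier M"
    have ac: "a \<in> carrier R" using ideal_rules(1)[OF J a] .
    obtain z where z: "z \<in> carrier (fr (r 0))" "y = v z" using y F(5) by blast
    have "a \<odot>\<^bsub>fr (r 0)\<^esub> z \<in> carrier (fr (r 0))" using ac z by simp
    moreover have "(a \<odot>\<^bsub>fr (r 0)\<^esub> z) s \<in> ipow I m" if s: "s < r 0" for s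
    proof -
      have "z s \<in> carrier R" using z s by simp
      then have "a \<otimes> z s = z s \<otimes> a" "z s \<otimes> a \<in> ipow I m"
        using R.m_comm[OF ac] ideal_rules(4)[OF J _ a] by simp_all
      then show ?thesis using s by (simp add: free_module_simps)
    qed
    moreover have "a \<odot>\<^bsub>M\<^esub> y = v (a \<odot>\<^bsub>fr (r 0)\<^esub> z)" using z ac lin_rules(3)[OF F(4)] by simp
    ultimately show "a \<odot>\<^bsub>M\<^esub> y \<in> v ` ?C" by blast
  qed
  then have "v x \<in> v ` ?C" using vx by blast
  then show ?thesis by blast
qed

text \<open>The map from F_0/I^m F_0 to M/I^m M induced by \<open>v\<close>.\<close>

definition \<alpha> :: "nat \<Rightarrow> (nat \<Rightarrow> 'a set) \<Rightarrow> 'c set" where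
  "\<alpha> m = (SOME g. lin R (B m 0) (AM m) g \<and> (\<forall>x\<in>carrier (fr (r 0)). g (prB m 0 x) = prM m (v x)))"

lemma \<alpha>: "lin R (B m 0) (AM m) (\<alpha> m)" "x \<in> carrier (fr (r 0)) \<Longrightarrow> \<alpha> m (prB m 0 x) = prM m (v x)"
proof -
  have "\<exists>g. lin R (B m 0) (AM m) g \<and> (\<forall>x\<in>carrier (fr (r 0)). g (prB m 0 x) = prM m (v x))"
  proof (rule lin_induced[OF free_module_module mpow_module[OF AR_module] AM_module prB_lin _ lin_comp[OF F(4) prM_lin]])
    show "prB m 0 ` carrier (fr (r 0)) = carrier (B m 0)"
      using prB_surj lin_rules(1)[OF prB_lin] by blast
    fix x assume x: "x \<in> carrier (fr (r 0))" "prB m 0 x = \<zero>\<^bsub>B m 0\<^esub>"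
    have vc: "v (free_basis R {..<r 0} s) \<in> carrier M" if "s \<in> {..<r 0}" for s
      using lin_rules(1)[OF F(4)] that by simp
    have "v x \<in> ideal_power_smult R I m M"
      by (rule lin_in_submodule[OF M adic_submodule[OF I M] F(4) x(1)], rule adic_smult_mem[OF I M])
        (use x prB_zero[OF x(1)] vc in auto)
    then show "prM m (v x) = \<zero>\<^bsub>AM m\<^esub>" using prM_zero lin_rules(1)[OF F(4) x(1)] by simp
  qed
  from someI_ex[OF this] show "lin R (B m 0) (AM m) (\<alpha> m)"
    "x \<in> carrier (fr (r 0)) \<Longrightarrow> \<alpha> m (prB m 0 x) = prM m (v x)" unfolding \<alpha>_def by blast+
qed

text \<open>A lift \<open>w\<close> has to be a boundary only up to an element of I^m F_k, which
  disappears modulo I^m.\<close>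

lemma B_exact_aux:
  assumes w: "w \<in> carrier (fr (r k))" and c: "c \<in> carrier (fr (r k))" "\<forall>s<r k. c s \<in> ipow I m"
    and u: "w \<ominus>\<^bsub>fr (r k)\<^esub> c \<in> d k ` carrier (fr (r (Suc k)))"
  shows "prB m k w \<in> b m k ` carrier (B m (Suc k))"
proof -
  obtain u where u: "u \<in> carrier (fr (r (Suc k)))" "w \<ominus>\<^bsub>fr (r k)\<^esub> c = d k u" using u by blast
  have "prB m k (w \<ominus>\<^bsub>fr (r k)\<^esub> c) = prB m k w \<ominus>\<^bsub>B m k\<^esub> prB m k c"
    using lin_rules(6)[OF prB_lin _ _ w c(1)] by simp
  also have "\<dots> = prB m k w" using prB_zero[OF c(1), of m] c(2) lin_rules(1)[OF prB_lin w, of m] by simp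
  finally have "prB m k w = b m k (prB m (Suc k) u)" using u b_prB[OF u(1)] by simp
  then show ?thesis using lin_rules(1)[OF prB_lin u(1)] by blast
qed

sublocale double_res R K dh dv tK B b tB \<epsilon> AM aM \<alpha>
proof (intro double_res.intro double_res_axioms.intro)
  show "double_cx R K dh dv tK" by (rule double_cx_axioms)
  fix m i j n
  show "module R (B m i)" by simp
  show "lin R (K m i 0) (B m i) (\<epsilon> m i)" by (rule mmap_lin[OF Q.aug_lin])
  show "\<epsilon> m i ` carrier (K m i 0) = carrier (B m i)"
  proof
    show "\<epsilon> m i ` carrier (K m i 0) \<subseteq> carrier (B m i)" using lin_rules(1)[OF mmap_lin[OF Q.aug_lin]] by blast
    show "carrier (B m i) \<subseteq> \<epsilon> m i ` carrier (K m i 0)"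
      by (intro subsetI mmap_image Q.aug_surj) (auto simp: mpow_carrier)
  qed
  show "\<epsilon> m i x = \<zero>\<^bsub>B m i\<^esub> \<longleftrightarrow> x \<in> dv m i 0 ` carrier (K m i (Suc 0))" if x: "x \<in> carrier (K m i 0)" for x
  proof
    assume "\<epsilon> m i x = \<zero>\<^bsub>B m i\<^esub>"
    then have "\<forall>s<r i. aug Q m (x s) = \<zero>\<^bsub>AR m\<^esub>" using mmap_zero_iff[OF AR_module Q.aug_lin x] by blast
    then show "x \<in> dv m i 0 ` carrier (K m i (Suc 0))"
      using x by (intro mmap_image Q_exact) (auto simp: mpow_carrier)
  next
    assume "x \<in> dv m i 0 ` carrier (K m i (Suc 0))"
    then obtain y where "y \<in> carrier (K m i (Suc 0))" "x = dv m i 0 y" by blast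
    then show "\<epsilon> m i x = \<zero>\<^bsub>B m i\<^esub>"
      unfolding mmap_zero_iff[OF AR_module Q.aug_lin x] by (auto simp: Q.aug_df mpow_carrier)
  qed
  show "x \<in> dv m i (Suc j) ` carrier (K m i (Suc (Suc j)))"
    if x: "x \<in> carrier (K m i (Suc j))" and z: "dv m i j x = \<zero>\<^bsub>K m i j\<^esub>" for x
    using x z[unfolded mmap_zero_iff[OF Q.cx_module Q.df_lin x]]
    by (intro mmap_image Q_exact) (auto simp: mpow_carrier)
  show "\<epsilon> m i (dh m i 0 x) = b m i (\<epsilon> m (Suc i) x)" if "x \<in> carrier (K m (Suc i) 0)" for x
    by (rule mmap_pext[OF Q.cx_module AR_module F(3) Q.aug_lin that])
  show "\<epsilon> m i (tK m n i 0 x) = tB m n i (\<epsilon> n i x)" if "m \<le> n" "x \<in> carrier (K n i 0)" for x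
    using that by (auto simp: mmap_def mpow_carrier fun_eq_iff Q.aug_tr)
  show "module R (AM m)" by simp
  have pl: "lin R (AM (Suc m)) (AM m) (adic_proj R I M m)" for m unfolding AM_def by (rule adic_proj_lin[OF I M])
  show "lin R (AM n) (AM m) (aM m n)" if "m \<le> n"
    using dnt_lin[where A = AM and \<alpha> = "adic_proj R I M" and B = AM and \<beta> = "adic_proj R I M" and m = m and j = "n - m",
        OF AM_module pl pl] that by (simp add: aM_def)
  show "aM l m (aM m n y) = aM l n y" if "l \<le> m" "m \<le> n" for l y
    using dnt_map_add[of "adic_proj R I M" l "m - l" "n - m" y] that by (simp add: aM_def)
  show "lin R (B m 0) (AM m) (\<alpha> m)" by (rule \<alpha>(1))
  show "\<alpha> m ` carrier (B m 0) = carrier (AM m)"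
  proof
    show "\<alpha> m ` carrier (B m 0) \<subseteq> carrier (AM m)" using lin_rules(1)[OF \<alpha>(1)] by blast
    show "carrier (AM m) \<subseteq> \<alpha> m ` carrier (B m 0)"
    proof
      fix y assume "y \<in> carrier (AM m)"
      then have "y \<in> prM m ` v ` carrier (fr (r 0))" unfolding F(5) prM_surj .
      then obtain x where x: "x \<in> carrier (fr (r 0))" "y = prM m (v x)" by blast
      then have "y = \<alpha> m (prB m 0 x)" using \<alpha>(2) by simp
      then show "y \<in> \<alpha> m ` carrier (B m 0)" using lin_rules(1)[OF prB_lin x(1)] by blast
    qed
  qed
  show "\<alpha> m (b m 0 z) = \<zero>\<^bsub>AM m\<^esub>" if z: "z \<in> carrier (B m (Suc 0))" for z
  proof -
    obtain x where x: "x \<in> carrier (fr (r (Suc 0)))" "z = prB m (Suc 0) x" using prB_surj[OF z] by blast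
    have "\<alpha> m (b m 0 z) = prM m (v (d 0 x))"
      using x b_prB[OF x(1)] \<alpha>(2) lin_rules(1)[OF F(3) x(1)] by simp
    also have "\<dots> = \<zero>\<^bsub>AM m\<^esub>" using v_d[OF x(1)] lin_rules(4)[OF prM_lin] by simp
    finally show ?thesis .
  qed
  show "\<alpha> m (tB m n 0 z) = aM m n (\<alpha> n z)" if mn: "m \<le> n" and z: "z \<in> carrier (B n 0)" for z
  proof -
    obtain x where x: "x \<in> carrier (fr (r 0))" "z = prB n 0 x" using prB_surj[OF z] by blast
    then show ?thesis using tB_prB[OF mn x(1)] \<alpha>(2) aM_prM[OF mn] lin_rules(1)[OF F(4) x(1)] by simp
  qed
  show "projective R (K m i j)"
  proof -
    obtain X :: "('a, 'a set) res_elt set" where "retract_free R (cx Q m j) X"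
      using Q.proj projective_retract by blast
    then have "retract_free R (K m i j) (Sigma {..<r i} (\<lambda>_. X))" by (intro retract_free_direct_sum) auto
    then show ?thesis by (rule retract_free_projective[OF mpow_module[OF Q.cx_module]])
  qed
  fix k
  show "\<exists>n\<ge>m. \<forall>z\<in>carrier (B n k). (case k of 0 \<Rightarrow> \<alpha> n z = \<zero>\<^bsub>AM n\<^esub> | Suc j \<Rightarrow> b n j z = \<zero>\<^bsub>B n j\<^esub>) \<longrightarrow>
      tB m n k z \<in> b m k ` carrier (B m (Suc k))"
  proof (cases k)
    case 0
    \<comment> \<open>Degree 0 costs no shift: correcting a lift by an element of I^m F_0 moves it
      into the kernel of \<open>v\<close>.\<close>
    have "tB m m 0 z \<in> b m 0 ` carrier (B m (Suc 0))" if z: "z \<in> carrier (B m 0)" "\<alpha> m z = \<zero>\<^bsub>AM m\<^esub>" for z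
    proof -
      obtain w where w: "w \<in> carrier (fr (r 0))" "z = prB m 0 w" using prB_surj[OF z(1)] by blast
      have "v w \<in> ideal_power_smult R I m M"
        using z(2) w \<alpha>(2) prM_zero lin_rules(1)[OF F(4) w(1)] by simp
      then obtain c where c: "c \<in> carrier (fr (r 0))" "\<forall>s<r 0. c s \<in> ipow I m" "v w = v c"
        using coords_v[OF w(1)] by blast
      have wc: "w \<ominus>\<^bsub>fr (r 0)\<^esub> c \<in> carrier (fr (r 0))" using w c by simp
      have "v (w \<ominus>\<^bsub>fr (r 0)\<^esub> c) = \<zero>\<^bsub>M\<^esub>"
        using lin_rules(6)[OF F(4) _ M w(1) c(1)] c(3) lin_rules(1)[OF F(4) c(1)] by simp
      then have "w \<ominus>\<^bsub>fr (r 0)\<^esub> c \<in> d 0 ` carrier (fr (r (Suc 0)))" using F(6)[OF wc] by simp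
      from B_exact_aux[OF w(1) c(1,2) this] show ?thesis using w tB_prB[of m m w 0] by simp
    qed
    then show ?thesis using 0 by (intro exI[of _ m]) simp
  next
    case (Suc j)
    \<comment> \<open>The index given by Artin-Rees. A cycle modulo I^n lifts to \<open>w\<close>
      with \<open>d j w\<close> in I^n F_j; then \<open>d j w = d j c\<close> for some
      \<open>c\<close> in I^m F_k, and \<open>w - c\<close> is a cycle of the exact complex
      F.\<close>
    obtain n where n: "n \<ge> m" and AR: "\<forall>z\<in>carrier (fr (r k)). (\<forall>t<r j. d j z t \<in> ipow I n) \<longrightarrow>
        (\<exists>c\<in>carrier (fr (r k)). (\<forall>s<r k. c s \<in> ipow I m) \<and> d j z = d j c)"
      using artin_rees[OF F(3)[of j] I, of m] unfolding Suc by blast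
    have "tB m n k z \<in> b m k ` carrier (B m (Suc k))" if z: "z \<in> carrier (B n k)" "b n j z = \<zero>\<^bsub>B n j\<^esub>" for z
    proof -
      obtain w where w: "w \<in> carrier (fr (r k))" "z = prB n k w" using prB_surj[OF z(1)] by blast
      have w': "w \<in> carrier (fr (r (Suc j)))" using w Suc by simp
      have dw: "d j w \<in> carrier (fr (r j))" using lin_rules(1)[OF F(3) w'] .
      have "prB n j (d j w) = \<zero>\<^bsub>B n j\<^esub>" using z(2) w b_prB[OF w', of n] Suc by simp
      then obtain c where c: "c \<in> carrier (fr (r k))" "\<forall>s<r k. c s \<in> ipow I m" "d j w = d j c"
        using AR w(1) prB_zero[OF dw] by blast
      have wc: "w \<ominus>\<^bsub>fr (r k)\<^esub> c \<in> carrier (fr (r k))" using w c by simp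
      have c': "c \<in> carrier (fr (r (Suc j)))" using c Suc by simp
      have "d j (w \<ominus>\<^bsub>fr (r (Suc j))\<^esub> c) = \<zero>\<^bsub>fr (r j)\<^esub>"
        using lin_rules(6)[OF F(3) _ _ w' c'] c(3) lin_rules(1)[OF F(3) c'] by simp
      then have "w \<ominus>\<^bsub>fr (r k)\<^esub> c \<in> d k ` carrier (fr (r (Suc k)))" using F(7)[of _ j] wc Suc by simp
      from B_exact_aux[OF w(1) c(1,2) this] show ?thesis using w tB_prB[OF n w(1)] by simp
    qed
    then show ?thesis using Suc n by (intro exI[of _ n]) simp
  qed
qed

text \<open>The tower of chosen resolutions and the total complexes are pro-resolutions of the same
  system M/I^m M, so the presentation of the defining colimit can be transferred.\<close>

lemma gen_local_cohomology_presented: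
  assumes N: "module R N"
  shows "\<exists>\<phi>. presents R N TT i (gen_local_cohomology R I i M N) \<phi>"
    and "module R (gen_local_cohomology R I i M N)"
proof -
  have pl: "lin R (AM (Suc m)) (AM m) (adic_proj R I M m)" for m unfolding AM_def by (rule adic_proj_lin[OF I M])
  have g: "gen_local_cohomology R I i M N =
      direct_limit R (\<lambda>n. Ext R i (AM n) N) (\<lambda>n. ext_map R i (AM (Suc n)) (AM n) N (adic_proj R I M n))"
    by (simp add: gen_local_cohomology_def AM_def)
  show m: "module R (gen_local_cohomology R I i M N)"
    unfolding g by (rule direct_limit_ext_presents(2)[where A = AM and \<alpha> = "adic_proj R I M", OF AM_module pl N])
  obtain \<phi> where "presents R N (res_tower AM (adic_proj R I M)) i (gen_local_cohomology R I i M N) \<phi>"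
    unfolding g using direct_limit_ext_presents(1)[where A = AM and \<alpha> = "adic_proj R I M", OF AM_module pl N] by blast
  moreover have "pro_res R (res_tower AM (adic_proj R I M)) AM aM"
    unfolding aM_def[abs_def] by (rule res_tower_pro_res[where A = AM and \<alpha> = "adic_proj R I M", OF AM_module pl])
  ultimately show "\<exists>\<phi>. presents R N TT i (gen_local_cohomology R I i M N) \<phi>"
    using presents_transfer[OF _ tot_pro_res N m] by blast
qed

lemma local_cohomology_presented:
  assumes N: "module R N"
  shows "\<exists>\<phi>. presents R N Q i (local_cohomology R I i N) \<phi>"
    and "module R (local_cohomology R I i N)"
proof -
  have pl: "lin R (AR (Suc m)) (AR m) (adic_proj R I (ring_module R) m)" for m
    unfolding AR_def by (rule adic_proj_lin[OF I ring_module_module])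
  have g: "local_cohomology R I i N =
      direct_limit R (\<lambda>n. Ext R i (AR n) N) (\<lambda>n. ext_map R i (AR (Suc n)) (AR n) N (adic_proj R I (ring_module R) n))"
    by (simp add: local_cohomology_def gen_local_cohomology_def AR_def)
  show "module R (local_cohomology R I i N)"
    unfolding g by (rule direct_limit_ext_presents(2)[where A = AR and \<alpha> = "adic_proj R I (ring_module R)", OF AR_module pl N])
  show "\<exists>\<phi>. presents R N Q i (local_cohomology R I i N) \<phi>"
    unfolding g Q_def by (rule direct_limit_ext_presents(1)[where A = AR and \<alpha> = "adic_proj R I (ring_module R)", OF AR_module pl N])
qed

text \<open>The same transfer for constant systems: the chosen resolution of \<open>M\<close> is
  exchanged for F.\<close>

lemma Ext_presented:
  assumes X: "module R X"
  shows "\<exists>\<phi>. presents R X (const_cx (\<lambda>i. fr (r i)) d v) i (Ext R i M X) \<phi>"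
  using presents_transfer[OF const_pro_res[OF chosen_res_resolution[OF M] M] const_pro_res[OF res M] X
      ext_module[OF M X] ext_presents[OF M X]] .

end

section \<open>Clearing columns of a total cocycle; vanishing above p + n\<close>

section \<open>Cohomology of the total complex\<close>

text \<open>Finitely many conditions that persist once they hold can be met at a common index. It is
  applied to the \<open>r i\<close> basis vectors of F_i.\<close>

lemma eventually_all_less:
  fixes m k :: nat
  assumes ex: "\<And>s. s < k \<Longrightarrow> \<exists>n\<ge>m. P s n" and mono: "\<And>s n n'. P s n \<Longrightarrow> n \<le> n' \<Longrightarrow> P s n'"
  shows "\<exists>n\<ge>m. \<forall>s<k. P s n"
  using ex
proof (induction k)
  case (Suc k)
  obtain n where n: "n \<ge> m" "\<forall>s<k. P s n" using Suc by auto
  obtain n' where n': "n' \<ge> m" "P k n'" using Suc.prems[of k] by auto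
  have "\<forall>s<Suc k. P s (max n n')" using n n' mono[of _ n "max n n'"] mono[of k n' "max n n'"] by (auto simp: less_Suc_eq)
  then show ?case using n by (intro exI[of _ "max n n'"]) simp
qed auto

context double_cx
begin

lemma tot_df_inK:
  assumes b: "b \<le> Suc k" and y: "y \<in> carrier (K m b (Suc k - b))"
  shows "df (tot ag) m k (inK m (Suc k) b y) =
    (if b \<le> k then inK m k b (sg (K m b (k - b)) b (dv m b (k - b) y)) else \<zero>\<^bsub>T m k\<^esub>) \<oplus>\<^bsub>T m k\<^esub>
    (case b of 0 \<Rightarrow> \<zero>\<^bsub>T m k\<^esub> | Suc b' \<Rightarrow> inK m k b' (dh m b' (k - b') y))" (is "?l = ?A \<oplus>\<^bsub>T m k\<^esub> ?B")
proof (rule T_eqI)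
  have A: "?A \<in> carrier (T m k)"
    using y by (auto simp: Suc_diff_le intro!: inK_carrier)
  have B: "?B \<in> carrier (T m k)"
    using y b by (cases b) (auto intro!: inK_carrier)
  show "?l \<in> carrier (T m k)" by (rule lin_rules(1)[OF tot_df_lin]) (use y b in simp)
  show "?A \<oplus>\<^bsub>T m k\<^esub> ?B \<in> carrier (T m k)" using A B by simp
  have dvc: "dv m b (k - b) y \<in> carrier (K m b (k - b))" if "b \<le> k"
    using y that by (simp add: Suc_diff_le)
  fix i assume i: "i \<le> k"
  have "?l i = dh m i (k - i) (if Suc i = b then y else \<zero>\<^bsub>K m (Suc i) (k - i)\<^esub>) \<oplus>\<^bsub>K m i (k - i)\<^esub>
      sg (K m i (k - i)) i (dv m i (k - i) (if i = b then y else \<zero>\<^bsub>K m i (Suc (k - i))\<^esub>))"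
    using i by (simp add: tot_df inK_apply Suc_diff_le)
  also have "\<dots> = (?A \<oplus>\<^bsub>T m k\<^esub> ?B) i"
    using i y b dvc by (cases b) (auto simp: T_ops inK_apply Suc_diff_le)
  finally show "?l i = (?A \<oplus>\<^bsub>T m k\<^esub> ?B) i" .
qed

lemma tot_tr_inK:
  assumes "m \<le> n" "i \<le> k" "x \<in> carrier (K n i (k - i))"
  shows "tr (tot ag) m n k (inK n k i x) = inK m k i (tK m n i (k - i) x)"
proof (rule T_eqI)
  show "tr (tot ag) m n k (inK n k i x) \<in> carrier (T m k)"
    using lin_rules(1)[OF tot_tr_lin[OF assms(1)] inK_carrier[OF assms(2,3)]] .
  show "inK m k i (tK m n i (k - i) x) \<in> carrier (T m k)" using assms by simp
qed (use assms in \<open>auto simp: tot_tr inK_apply\<close>)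

lemma T_lin_ext:
  assumes "module R N" "lin R (T m k) N f" "lin R (T m k) N g"
    and "\<And>i x. i \<le> k \<Longrightarrow> x \<in> carrier (K m i (k - i)) \<Longrightarrow> f (inK m k i x) = g (inK m k i x)"
    and "z \<in> carrier (T m k)"
  shows "f z = g z"
  by (rule direct_sum_lin_ext[OF K_module assms(1-3) _ assms(5)]) (use assms(4) in auto)

lemma inK_lin: "i \<le> k \<Longrightarrow> lin R (K m i (k - i)) (T m k) (inK m k i)"
  by (rule sum_inj_lin) auto

lemma T_proj_lin: "i \<le> k \<Longrightarrow> lin R (T m k) (K m i (k - i)) (\<lambda>x. x i)"
  by (rule lin_component) simp

text \<open>The total boundary of an element of column \<open>b\<close> has one component in column
  \<open>b\<close>, which is vertical up to sign, and one in column \<open>b - 1\<close>. A cochain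
  that vanishes on the columns before \<open>b\<close> sees only the former.\<close>

lemma dv_kill:
  assumes N: "module R N" and c: "lin R (T m k) N c" and b: "b \<le> k"
    and van: "\<And>i x. i < b \<Longrightarrow> x \<in> carrier (K m i (k - i)) \<Longrightarrow> c (inK m k i x) = \<zero>\<^bsub>N\<^esub>"
    and y: "y \<in> carrier (K m b (Suc (k - b)))" and z: "c (df (tot ag) m k (inK m (Suc k) b y)) = \<zero>\<^bsub>N\<^esub>"
  shows "c (inK m k b (dv m b (k - b) y)) = \<zero>\<^bsub>N\<^esub>"
proof -
  let ?A = "inK m k b (sg (K m b (k - b)) b (dv m b (k - b) y))"
  let ?B = "case b of 0 \<Rightarrow> \<zero>\<^bsub>T m k\<^esub> | Suc b' \<Rightarrow> inK m k b' (dh m b' (k - b') y)"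
  note cr = lin_rules[OF c]
  have y': "y \<in> carrier (K m b (Suc k - b))" using y b by (simp add: Suc_diff_le)
  have A: "?A \<in> carrier (T m k)" using y b by (intro inK_carrier) auto
  have B: "?B \<in> carrier (T m k) \<and> c ?B = \<zero>\<^bsub>N\<^esub>"
    using y' b van cr(4) N by (cases b) auto
  have "c ?A = \<zero>\<^bsub>N\<^esub>" using z tot_df_inK[OF _ y', of ag] b cr(2)[OF A] B A cr(1)[OF A] N by simp
  moreover have "c ?A = sg N b (c (inK m k b (dv m b (k - b) y)))"
    using lin_sg[OF lin_comp[OF inK_lin[OF b] c] K_module N] y by simp
  ultimately show ?thesis using sg_simps(4)[OF N] cr(1)[OF inK_carrier[OF b]] y by simp
qed

text \<open>The analogue of \<open>cobd\<close> for the vertical complex of column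
  \<open>i\<close>.\<close>

definition cobdK :: "('a, 'n, 'q) module_scheme \<Rightarrow> nat \<Rightarrow> nat \<Rightarrow> nat \<Rightarrow> ('x \<Rightarrow> 'n) \<Rightarrow> bool" where
  "cobdK N m i j h \<longleftrightarrow> (case j of 0 \<Rightarrow> \<forall>x\<in>carrier (K m i 0). h x = \<zero>\<^bsub>N\<^esub>
     | Suc l \<Rightarrow> \<exists>g. lin R (K m i l) N g \<and> (\<forall>x\<in>carrier (K m i (Suc l)). h x = g (dv m i l x)))"

text \<open>If the columns have no cohomology in the degrees concerned, a cochain of the total complex can be made to
  vanish on the columns \<open>i < b\<close> by subtracting a coboundary.\<close>

lemma tot_clean:
  assumes N: "module R N" and c: "lin R (T m k) N c" and "b \<le> Suc k"
    and z: "\<And>i y. i < b \<Longrightarrow> y \<in> carrier (K m i (Suc (k - i))) \<Longrightarrow> c (df (tot ag) m k (inK m (Suc k) i y)) = \<zero>\<^bsub>N\<^esub>"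
    and V: "\<And>i m h. i < b \<Longrightarrow> lin R (K m i (k - i)) N h \<Longrightarrow>
      (\<And>x. x \<in> carrier (K m i (Suc (k - i))) \<Longrightarrow> h (dv m i (k - i) x) = \<zero>\<^bsub>N\<^esub>) \<Longrightarrow>
      \<exists>m'\<ge>m. cobdK N m' i (k - i) (\<lambda>x. h (tK m m' i (k - i) x))"
  shows "\<exists>m'\<ge>m. \<exists>w. cobd R N (tot ag) m' k w \<and>
    (\<forall>i<b. \<forall>x\<in>carrier (K m' i (k - i)). c (tr (tot ag) m m' k (inK m' k i x)) = w (inK m' k i x))"
  using assms(3) z V
proof (induction b)
  case 0
  interpret P: pro_cx R "tot ag" by (rule tot_pro_cx)
  show ?case using P.cobd_zero[OF N, of m k] by (intro exI[of _ m]) auto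
next
  case (Suc b)
  interpret P: pro_cx R "tot ag" by (rule tot_pro_cx)
  have bk: "b \<le> k" using Suc.prems by simp
  have "\<exists>m'\<ge>m. \<exists>w. cobd R N (tot ag) m' k w \<and>
    (\<forall>i<b. \<forall>x\<in>carrier (K m' i (k - i)). c (tr (tot ag) m m' k (inK m' k i x)) = w (inK m' k i x))"
  proof (rule Suc.IH)
    show "b \<le> Suc k" using bk by simp
    show "c (df (tot ag) m k (inK m (Suc k) i y)) = \<zero>\<^bsub>N\<^esub>" if "i < b" "y \<in> carrier (K m i (Suc (k - i)))" for i y
      using Suc.prems(2)[of i y] that by simp
    show "\<exists>m'\<ge>m. cobdK N m' i (k - i) (\<lambda>x. h (tK m m' i (k - i) x))"
      if "i < b" "lin R (K m i (k - i)) N h"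
        "\<And>x. x \<in> carrier (K m i (Suc (k - i))) \<Longrightarrow> h (dv m i (k - i) x) = \<zero>\<^bsub>N\<^esub>" for i m h
      by (rule Suc.prems(3)[OF _ that(2,3)]) (use that(1) in simp)
  qed
  then obtain m1 w1 where m1: "m1 \<ge> m" and w1: "cobd R N (tot ag) m1 k w1"
    and cw: "\<forall>i<b. \<forall>x\<in>carrier (K m1 i (k - i)). c (tr (tot ag) m m1 k (inK m1 k i x)) = w1 (inK m1 k i x)"
    by blast
  have w1c: "cocyc R N (tot ag) m1 k w1" by (rule P.cobd_cocyc[OF N w1])
  then have w1l: "lin R (T m1 k) N w1" and w1d: "\<And>x. x \<in> carrier (T m1 (Suc k)) \<Longrightarrow> w1 (df (tot ag) m1 k x) = \<zero>\<^bsub>N\<^esub>"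
    by (auto simp: cocyc_def)
  \<comment> \<open>The corrected cochain vanishes on the columns before \<open>b\<close>, so by
    \<open>dv_kill\<close> its restriction to column \<open>b\<close> is a vertical cocycle.\<close>
  define c' where "c' x = c (tr (tot ag) m m1 k x) \<ominus>\<^bsub>N\<^esub> w1 x" for x
  have ctl: "lin R (T m1 k) N (\<lambda>x. c (tr (tot ag) m m1 k x))" by (rule lin_comp[OF tot_tr_lin[OF m1] c])
  have c'l: "lin R (T m1 k) N c'" unfolding c'_def by (rule lin_minus[OF N ctl w1l])
  have c'0: "c' (inK m1 k i x) = \<zero>\<^bsub>N\<^esub>" if "i < b" "x \<in> carrier (K m1 i (k - i))" for i x
    using cw that lin_rules(1)[OF w1l inK_carrier] bk N by (simp add: c'_def)
  have c'd: "c' (df (tot ag) m1 k (inK m1 (Suc k) b y)) = \<zero>\<^bsub>N\<^esub>" if y: "y \<in> carrier (K m1 b (Suc (k - b)))" for y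
  proof -
    have y': "y \<in> carrier (K m1 b (Suc k - b))" using y bk by (simp add: Suc_diff_le)
    have iy: "inK m1 (Suc k) b y \<in> carrier (T m1 (Suc k))" using y' bk by simp
    have "tr (tot ag) m m1 k (df (tot ag) m1 k (inK m1 (Suc k) b y)) =
        df (tot ag) m k (tr (tot ag) m m1 (Suc k) (inK m1 (Suc k) b y))"
      using P.df_tr[OF m1, of "inK m1 (Suc k) b y" k] iy by simp
    also have "tr (tot ag) m m1 (Suc k) (inK m1 (Suc k) b y) = inK m (Suc k) b (tK m m1 b (Suc k - b) y)"
      by (rule tot_tr_inK[OF m1 _ y']) (use bk in simp)
    finally have e: "tr (tot ag) m m1 k (df (tot ag) m1 k (inK m1 (Suc k) b y)) =
        df (tot ag) m k (inK m (Suc k) b (tK m m1 b (Suc k - b) y))" .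
    have "c (df (tot ag) m k (inK m (Suc k) b (tK m m1 b (Suc k - b) y))) = \<zero>\<^bsub>N\<^esub>" using Suc.prems(2)[of b "tK m m1 b (Suc k - b) y"] y m1 bk by (simp add: Suc_diff_le)
    then show ?thesis using e w1d[OF iy] N by (simp add: c'_def)
  qed
  define h where "h x = c' (inK m1 k b x)" for x
  have hl: "lin R (K m1 b (k - b)) N h" unfolding h_def by (rule lin_comp[OF inK_lin[OF bk] c'l])
  have "h (dv m1 b (k - b) y) = \<zero>\<^bsub>N\<^esub>" if "y \<in> carrier (K m1 b (Suc (k - b)))" for y
    unfolding h_def by (rule dv_kill[OF N c'l bk c'0 that c'd[OF that]])
  then obtain m2 where m2: "m2 \<ge> m1" and hb: "cobdK N m2 b (k - b) (\<lambda>x. h (tK m1 m2 b (k - b) x))"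
    using Suc.prems(3)[of b m1 h] hl by blast
  have "\<exists>w2. cobd R N (tot ag) m2 k w2 \<and> (\<forall>i<b. \<forall>x\<in>carrier (K m2 i (k - i)). w2 (inK m2 k i x) = \<zero>\<^bsub>N\<^esub>) \<and>
      (\<forall>x\<in>carrier (K m2 b (k - b)). w2 (inK m2 k b x) = h (tK m1 m2 b (k - b) x))"
  proof (cases "k - b")
    case 0
    then show ?thesis using P.cobd_zero[OF N, of m2 k] hb by (intro exI[of _ "\<lambda>_. \<zero>\<^bsub>N\<^esub>"]) (simp add: cobdK_def)
  next
    case (Suc l)
    then obtain k' where k: "k = Suc k'" and l: "l = k' - b" and bk': "b \<le> k'" using bk by (cases k) auto
    obtain g where g: "lin R (K m2 b l) N g"
      "\<forall>x\<in>carrier (K m2 b (Suc l)). h (tK m1 m2 b (Suc l) x) = g (dv m2 b l x)" using hb Suc by (auto simp: cobdK_def)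
    \<comment> \<open>The primitive \<open>g\<close> on column \<open>b\<close>, extended by zero to
      the other columns. Its coboundary does not touch columns before \<open>b\<close>, and on
      column \<open>b\<close> the built-in sign cancels the sign of the total differential.\<close>
    define G where "G y = g (sg (K m2 b l) b (y b))" for y :: "nat \<Rightarrow> 'x"
    have G: "lin R (T m2 k') N G"
      unfolding G_def l by (rule lin_comp[OF lin_comp[OF T_proj_lin[OF bk'] sg_lin[OF K_module]] g(1)[unfolded l]])
    let ?w = "\<lambda>x. G (df (tot ag) m2 k' x)"
    have "cobd R N (tot ag) m2 k ?w" using G unfolding k by (auto simp: cobd_def)
    moreover have "?w (inK m2 k i x) = \<zero>\<^bsub>N\<^esub>" if "i < b" "x \<in> carrier (K m2 i (k - i))" for i x
      using that bk' lin_rules(4)[OF g(1)] N unfolding k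
      by (simp add: G_def tot_df inK_apply l Suc_diff_le)
    moreover have "?w (inK m2 k b x) = h (tK m1 m2 b (k - b) x)" if x: "x \<in> carrier (K m2 b (k - b))" for x
    proof -
      have x': "x \<in> carrier (K m2 b (Suc l))" using x Suc by simp
      then show ?thesis using g(2) bk' Suc unfolding k by (simp add: G_def tot_df inK_apply l[symmetric] Suc_diff_le)
    qed
    ultimately show ?thesis by blast
  qed
  then obtain w2 where w2: "cobd R N (tot ag) m2 k w2"
    "\<forall>i<b. \<forall>x\<in>carrier (K m2 i (k - i)). w2 (inK m2 k i x) = \<zero>\<^bsub>N\<^esub>"
    "\<forall>x\<in>carrier (K m2 b (k - b)). w2 (inK m2 k b x) = h (tK m1 m2 b (k - b) x)" by blast
  have mm: "m \<le> m2" using m1 m2 by simp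
  have "cobd R N (tot ag) m2 k (\<lambda>x. w1 (tr (tot ag) m1 m2 k x) \<oplus>\<^bsub>N\<^esub> w2 x)"
    by (rule P.cobd_add[OF N P.cobd_tr[OF N w1 m2] w2(1)])
  moreover have "c (tr (tot ag) m m2 k (inK m2 k i x)) = w1 (tr (tot ag) m1 m2 k (inK m2 k i x)) \<oplus>\<^bsub>N\<^esub> w2 (inK m2 k i x)"
    if i: "i < Suc b" and x: "x \<in> carrier (K m2 i (k - i))" for i x
  proof -
    have ik: "i \<le> k" using i bk by simp
    have tx: "tK m1 m2 i (k - i) x \<in> carrier (K m1 i (k - i))" using m2 x by simp
    have t1: "tr (tot ag) m1 m2 k (inK m2 k i x) = inK m1 k i (tK m1 m2 i (k - i) x)" by (rule tot_tr_inK[OF m2 ik x])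
    have t2: "tr (tot ag) m m2 k (inK m2 k i x) = tr (tot ag) m m1 k (inK m1 k i (tK m1 m2 i (k - i) x))"
      unfolding t1[symmetric] using P.tr_tr[OF m1 m2, of "inK m2 k i x" k] ik x by simp
    have wc: "w1 (inK m1 k i (tK m1 m2 i (k - i) x)) \<in> carrier N" using lin_rules(1)[OF w1l inK_carrier[OF ik tx]] .
    have cc: "c (tr (tot ag) m m1 k (inK m1 k i (tK m1 m2 i (k - i) x))) \<in> carrier N"
      using lin_rules(1)[OF ctl inK_carrier[OF ik tx]] .
    show ?thesis
    proof (cases "i = b")
      case True
      have "w2 (inK m2 k i x) = c' (inK m1 k i (tK m1 m2 i (k - i) x))" using w2(3) x True by (simp add: h_def)
      then show ?thesis unfolding t2 t1 using wc cc N by (simp add: c'_def mm_comm[OF N wc])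
    next
      case False
      then have "i < b" using i by simp
      then show ?thesis unfolding t2 t1 using w2(2) x cw tx wc N by simp
    qed
  qed
  ultimately show ?case using mm by (intro exI[of _ m2] conjI) auto
qed

end

context adic_res
begin

sublocale TT: pro_res R TT AM aM
  by (rule tot_pro_res)

text \<open>What vanishing of local cohomology means on the complexes \<open>Q\<close>; in this form
  it can be applied to each column separately.\<close>

definition vanish :: "('a, 'n, 'q) module_scheme \<Rightarrow> nat \<Rightarrow> bool" where
  "vanish N j \<longleftrightarrow> (\<forall>m z. cocyc R N Q m j z \<longrightarrow> (\<exists>m'\<ge>m. cobd R N Q m' j (\<lambda>x. z (tr Q m m' j x))))"

lemma vanishI:
  assumes N: "module R N" and z: "zero_module (local_cohomology R I j N)"
  shows "vanish N j"
proof -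
  obtain \<phi> where \<phi>: "presents R N Q j (local_cohomology R I j N) \<phi>" using local_cohomology_presented(1)[OF N] by blast
  note P = Q.presents_rules[OF \<phi> N local_cohomology_presented(2)[OF N]]
  show ?thesis
    unfolding vanish_def
  proof (intro allI impI)
    fix m h assume h: "cocyc R N Q m j h"
    have "\<phi> m h = \<zero>\<^bsub>local_cohomology R I j N\<^esub>" using P(1)[OF h] z by (simp add: zero_module_def)
    then show "\<exists>m'\<ge>m. cobd R N Q m' j (\<lambda>x. h (tr Q m m' j x))" unfolding P(6)[OF h] .
  qed
qed

abbreviation "col m i j s \<equiv> tens (r i) (cx Q m j) (free_basis R {..<r i} s)"

lemma dv_tens: "z \<in> carrier (fr (r i)) \<Longrightarrow> x \<in> carrier (cx Q m (Suc j)) \<Longrightarrow>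
    dv m i j (tens (r i) (cx Q m (Suc j)) z x) = tens (r i) (cx Q m j) z (df Q m j x)"
  by (rule mmap_tens[OF Q.df_lin])

lemma tK_tens: "m \<le> n \<Longrightarrow> z \<in> carrier (fr (r i)) \<Longrightarrow> x \<in> carrier (cx Q n j) \<Longrightarrow>
    tK m n i j (tens (r i) (cx Q n j) z x) = tens (r i) (cx Q m j) z (tr Q m n j x)"
  by (rule mmap_tens[OF Q.tr_lin])

lemma cocyc_tens:
  assumes h: "lin R (K m i j) N h" and hd: "\<And>x. x \<in> carrier (K m i (Suc j)) \<Longrightarrow> h (dv m i j x) = \<zero>\<^bsub>N\<^esub>"
    and z: "z \<in> carrier (fr (r i))"
  shows "cocyc R N Q m j (\<lambda>q. h (tens (r i) (cx Q m j) z q))"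
  unfolding cocyc_def
proof (intro conjI ballI)
  show "lin R (cx Q m j) N (\<lambda>q. h (tens (r i) (cx Q m j) z q))" by (rule lin_comp[OF tens_lin2[OF Q.cx_module z] h])
  fix x assume x: "x \<in> carrier (cx Q m (Suc j))"
  show "h (tens (r i) (cx Q m j) z (df Q m j x)) = \<zero>\<^bsub>N\<^esub>"
    using hd[of "tens (r i) (cx Q m (Suc j)) z x"] dv_tens[OF z x] lin_rules(1)[OF tens_lin2[OF Q.cx_module z] x] by simp
qed

text \<open>Column \<open>i\<close> consists of \<open>r i\<close> copies of the complex
  \<open>Q\<close>. Primitives are found on each copy, moved to a common index, and combined into
  one map.\<close>

lemma cobdK_cols:
  assumes N: "module R N" and h: "lin R (K m i j) N h" and ev: "\<And>s. s < r i \<Longrightarrow>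
    \<exists>n\<ge>m. cobd R N Q n j (\<lambda>q. h (col m i j s (tr Q m n j q)))"
  shows "\<exists>n\<ge>m. cobdK N n i j (\<lambda>x. h (tK m n i j x))"
proof -
  have "\<exists>n\<ge>m. \<forall>s<r i. n \<ge> m \<and> cobd R N Q n j (\<lambda>q. h (col m i j s (tr Q m n j q)))"
  proof (rule eventually_all_less)
    show "\<exists>n\<ge>m. n \<ge> m \<and> cobd R N Q n j (\<lambda>q. h (col m i j s (tr Q m n j q)))" if "s < r i" for s using ev[OF that] by blast
    show "n' \<ge> m \<and> cobd R N Q n' j (\<lambda>q. h (col m i j s (tr Q m n' j q)))"
      if n: "n \<ge> m \<and> cobd R N Q n j (\<lambda>q. h (col m i j s (tr Q m n j q)))" "n \<le> n'" for s n n'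
    proof -
      have "cobd R N Q n' j (\<lambda>q. h (col m i j s (tr Q m n j (tr Q n n' j q))))"
        using Q.cobd_tr[OF N _ n(2)] n(1) by blast
      then show ?thesis
        using n Q.cobd_cong[of n' j "\<lambda>q. h (col m i j s (tr Q m n j (tr Q n n' j q)))"
            "\<lambda>q. h (col m i j s (tr Q m n' j q))" N] by simp
    qed
  qed
  then obtain n where n: "n \<ge> m" "\<And>s. s < r i \<Longrightarrow> cobd R N Q n j (\<lambda>q. h (col m i j s (tr Q m n j q)))" by blast
  let ?h = "\<lambda>x. h (tK m n i j x)"
  have hl: "lin R (K n i j) N ?h" by (rule lin_comp[OF tK_lin[OF n(1)] h])
  have hc: "?h (col n i j s q) = h (col m i j s (tr Q m n j q))" if "s < r i" "q \<in> carrier (cx Q n j)" for s q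
    using tK_tens[OF n(1) _ that(2), of "free_basis R {..<r i} s" i] that by simp
  have "cobdK N n i j ?h"
  proof (cases j)
    case 0
    have "h (tK m n i 0 x) = \<zero>\<^bsub>N\<^esub>" if "x \<in> carrier (K n i 0)" for x
    proof (rule mpow_lin_ext[OF Q.cx_module N hl[unfolded 0] lin_zero[OF N] _ that, unfolded 0])
      fix s q assume "s < r i" "q \<in> carrier (cx Q n 0)"
      then show "h (tK m n i 0 (col n i 0 s q)) = \<zero>\<^bsub>N\<^esub>" using hc[of s q] n(2)[of s] 0 by (simp add: cobd_def)
    qed
    then show ?thesis using 0 by (simp add: cobdK_def)
  next
    case (Suc l)
    have "\<forall>s\<in>{..<r i}. \<exists>g. lin R (cx Q n l) N g \<and>
        (\<forall>q\<in>carrier (cx Q n (Suc l)). h (col m i (Suc l) s (tr Q m n (Suc l) q)) = g (df Q n l q))"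
      using n(2) Suc by (auto simp: cobd_def)
    from bchoice[OF this] obtain g where g: "\<forall>s\<in>{..<r i}. lin R (cx Q n l) N (g s) \<and>
        (\<forall>q\<in>carrier (cx Q n (Suc l)). h (col m i (Suc l) s (tr Q m n (Suc l) q)) = g s (df Q n l q))" by blast
    let ?g = "ds_map {..<r i} (\<lambda>_. cx Q n l) N g"
    have gl: "lin R (K n i l) N ?g" by (rule ds_map_lin) (use g N in auto)
    have "h (tK m n i (Suc l) x) = ?g (dv n i l x)" if x: "x \<in> carrier (K n i (Suc l))" for x
    proof (rule mpow_lin_ext[OF Q.cx_module N hl[unfolded Suc] lin_comp[OF dv_lin gl] _ x, unfolded Suc])
      fix s q assume s: "s < r i" and q: "q \<in> carrier (cx Q n (Suc l))"
      have "?g (dv n i l (col n i (Suc l) s q)) = ?g (sum_inj {..<r i} (\<lambda>_. cx Q n l) s (df Q n l q))"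
        using dv_tens[OF _ q, of "free_basis R {..<r i} s" i] tens_basis[OF Q.cx_module s] s q by simp
      also have "\<dots> = g s (df Q n l q)" by (rule ds_map_inj) (use g N s q in auto)
      finally show "h (tK m n i (Suc l) (col n i (Suc l) s q)) = ?g (dv n i l (col n i (Suc l) s q))"
        using hc[of s q] s q g Suc by simp
    qed
    then show ?thesis using gl Suc by (auto simp: cobdK_def)
  qed
  then show ?thesis using n(1) by blast
qed

lemma vanish_col:
  assumes N: "module R N" and V: "vanish N j" and h: "lin R (K m i j) N h"
    and hd: "\<And>x. x \<in> carrier (K m i (Suc j)) \<Longrightarrow> h (dv m i j x) = \<zero>\<^bsub>N\<^esub>"
  shows "\<exists>n\<ge>m. cobdK N n i j (\<lambda>x. h (tK m n i j x))"
proof (rule cobdK_cols[OF N h])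
  fix s assume "s < r i"
  then have "cocyc R N Q m j (\<lambda>q. h (col m i j s q))" by (intro cocyc_tens[OF h hd]) simp_all
  then show "\<exists>n\<ge>m. cobd R N Q n j (\<lambda>q. h (col m i j s (tr Q m n j q)))" using V unfolding vanish_def by blast
qed

lemma K_trivial: "r i = 0 \<Longrightarrow> x \<in> carrier (K m i j) \<Longrightarrow> x = \<zero>\<^bsub>K m i j\<^esub>"
  by (auto simp: direct_sum_simps)

lemma clean_vanish:
  assumes N: "module R N" and c: "lin R (T m k) N c" and b: "l \<le> Suc k"
    and z: "\<And>i y. i < l \<Longrightarrow> y \<in> carrier (K m i (Suc (k - i))) \<Longrightarrow> c (df TT m k (inK m (Suc k) i y)) = \<zero>\<^bsub>N\<^esub>"
    and V: "\<And>i. i < l \<Longrightarrow> vanish N (k - i)"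
  shows "\<exists>m'\<ge>m. \<exists>w. cobd R N TT m' k w \<and>
    (\<forall>i<l. \<forall>x\<in>carrier (K m' i (k - i)). c (tr TT m m' k (inK m' k i x)) = w (inK m' k i x))"
  by (rule tot_clean[OF N c b z vanish_col[OF N V]]) assumption+

theorem gen_local_cohomology_vanishes:
  assumes N: "module R N" and rp: "\<And>i. i > p \<Longrightarrow> r i = 0" and V: "\<And>i. i \<le> p \<Longrightarrow> i \<le> k \<Longrightarrow> vanish N (k - i)"
  shows "zero_module (gen_local_cohomology R I k M N)"
proof -
  let ?H = "gen_local_cohomology R I k M N"
  obtain \<phi> where \<phi>: "presents R N TT k ?H \<phi>" using gen_local_cohomology_presented(1)[OF N] by blast
  have H: "module R ?H" by (rule gen_local_cohomology_presented(2)[OF N])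
  note P = TT.presents_rules[OF \<phi> N H]
  have "y = \<zero>\<^bsub>?H\<^esub>" if yH: "y \<in> carrier ?H" for y
  proof -
    obtain m c where c: "cocyc R N TT m k c" "\<phi> m c = y" by (rule TT.presents_surj[OF \<phi> yH])
    have cl: "lin R (T m k) N c" and cd: "\<And>x. x \<in> carrier (T m (Suc k)) \<Longrightarrow> c (df TT m k x) = \<zero>\<^bsub>N\<^esub>"
      using c(1) by (auto simp: cocyc_def)
    \<comment> \<open>The columns that occur in degree \<open>k\<close> are those up to
      \<open>k\<close>, and those beyond \<open>p\<close> are zero; clearing the columns before this
      bound therefore clears everything.\<close>
    let ?b = "min (Suc p) (Suc k)"
    have "\<exists>m'\<ge>m. \<exists>w. cobd R N TT m' k w \<and>
      (\<forall>i<?b. \<forall>x\<in>carrier (K m' i (k - i)). c (tr TT m m' k (inK m' k i x)) = w (inK m' k i x))"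
      by (rule clean_vanish[OF N cl _ cd V]) (auto simp: Suc_diff_le intro!: inK_carrier)
    then obtain m' w where m': "m' \<ge> m" and w: "cobd R N TT m' k w"
      and cw: "\<forall>i<?b. \<forall>x\<in>carrier (K m' i (k - i)). c (tr TT m m' k (inK m' k i x)) = w (inK m' k i x)" by blast
    have wl: "lin R (T m' k) N w" using TT.cobd_cocyc[OF N w] by (simp add: cocyc_def)
    have ctl: "lin R (T m' k) N (\<lambda>x. c (tr TT m m' k x))" by (rule lin_comp[OF tot_tr_lin[OF m'] cl])
    have "c (tr TT m m' k x) = w x" if x: "x \<in> carrier (T m' k)" for x
    proof (rule T_lin_ext[OF N ctl wl _ x])
      fix i x assume i: "i \<le> k" and x: "x \<in> carrier (K m' i (k - i))"
      show "c (tr TT m m' k (inK m' k i x)) = w (inK m' k i x)"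
      proof (cases "i < ?b")
        case False
        then have "x = \<zero>\<^bsub>K m' i (k - i)\<^esub>" using K_trivial[OF rp x] i by simp
        then show ?thesis
          using lin_rules(4)[OF lin_comp[OF inK_lin[OF i] ctl]] lin_rules(4)[OF lin_comp[OF inK_lin[OF i] wl]] N by simp
      qed (use cw x in blast)
    qed
    then have "cobd R N TT m' k (\<lambda>x. c (tr TT m m' k x))"
      using TT.cobd_cong[of m' k "\<lambda>x. c (tr TT m m' k x)" w N] w by simp
    then show ?thesis using P(6)[OF c(1)] m' c(2) by blast
  qed
  then show ?thesis using H by (auto simp: zero_module_def)
qed

end

section \<open>Degree p + n: from cocycles in column p to Ext^p(M, H)\<close>

context adic_res
begin

abbreviation "FC \<equiv> const_cx (\<lambda>i. fr (r i)) d v"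

end

text \<open>The cohomology modules are arbitrary modules \<open>H\<close>, \<open>HM\<close> and
  \<open>E\<close> known only through their presentations, which hides the nested coset types of the
  actual constructions.\<close>

locale top_degree = adic_res R I M r d v
  for R (structure) and I :: "'a set" and M :: "('a, 'c, 'm) module_scheme" and r :: "nat \<Rightarrow> nat"
    and d :: "nat \<Rightarrow> (nat \<Rightarrow> 'a) \<Rightarrow> nat \<Rightarrow> 'a" and v :: "(nat \<Rightarrow> 'a) \<Rightarrow> 'c" +
  fixes N :: "('a, 'n, 'q) module_scheme" and p n :: nat and H :: "('a, 'h, 'k) module_scheme"
    and HM :: "('a, 'g, 'l) module_scheme" and E :: "('a, 'e, 'o) module_scheme" and \<phi>T \<phi>Q \<phi>E
  assumes N [simp]: "module R N" and rp: "\<And>i. i > p \<Longrightarrow> r i = 0" and V: "\<And>j. j > n \<Longrightarrow> vanish N j"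
    and H [simp]: "module R H" and HM [simp]: "module R HM" and E [simp]: "module R E"
    and \<phi>T: "presents R N TT (p + n) HM \<phi>T" and \<phi>Q: "presents R N Q n H \<phi>Q" and \<phi>E: "presents R H FC p E \<phi>E"
begin

lemmas PT = TT.presents_rules[OF \<phi>T N HM]
lemmas PQ = Q.presents_rules[OF \<phi>Q N H]

text \<open>Cocycles in column \<open>i\<close> of the double complex and row \<open>n\<close>, and the linear map from \<open>F\<^sub>i\<close> to \<open>H\<close> they induce.\<close>

definition adm :: "nat \<Rightarrow> nat \<Rightarrow> ((nat \<Rightarrow> ('a, 'a set) res_elt) \<Rightarrow> 'n) \<Rightarrow> bool" where
  "adm m i h \<longleftrightarrow> lin R (K m i n) N h \<and> (\<forall>x\<in>carrier (K m i (Suc n)). h (dv m i n x) = \<zero>\<^bsub>N\<^esub>)"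

abbreviation "cls m i h z \<equiv> \<phi>Q m (\<lambda>q. h (tens (r i) (cx Q m n) z q))"

lemma adm_cocyc: "adm m i h \<Longrightarrow> z \<in> carrier (fr (r i)) \<Longrightarrow> cocyc R N Q m n (\<lambda>q. h (tens (r i) (cx Q m n) z q))"
  by (rule cocyc_tens) (auto simp: adm_def)

lemma cls_lin:
  assumes h: "adm m i h"
  shows "lin R (fr (r i)) H (cls m i h)"
proof (rule linI)
  have hl: "lin R (K m i n) N h" using h by (simp add: adm_def)
  have t: "tens (r i) (cx Q m n) z q \<in> carrier (K m i n)" if "z \<in> carrier (fr (r i))" "q \<in> carrier (cx Q m n)" for z q
    using lin_rules(1)[OF tens_lin2[OF Q.cx_module that(1)] that(2)] .
  show "cls m i h z \<in> carrier H" if "z \<in> carrier (fr (r i))" for z by (rule PQ(1)[OF adm_cocyc[OF h that]])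
  show "cls m i h (z \<oplus>\<^bsub>fr (r i)\<^esub> z') = cls m i h z \<oplus>\<^bsub>H\<^esub> cls m i h z'"
    if z: "z \<in> carrier (fr (r i))" "z' \<in> carrier (fr (r i))" for z z'
  proof -
    have zz: "z \<oplus>\<^bsub>fr (r i)\<^esub> z' \<in> carrier (fr (r i))" using z by simp
    have "cls m i h (z \<oplus>\<^bsub>fr (r i)\<^esub> z') = \<phi>Q m (\<lambda>q. h (tens (r i) (cx Q m n) z q) \<oplus>\<^bsub>N\<^esub> h (tens (r i) (cx Q m n) z' q))"
      by (rule PQ(2)[OF adm_cocyc[OF h zz]])
        (use lin_rules(2)[OF tens_lin1[OF Q.cx_module] z] lin_rules(2)[OF hl] t z in simp)
    then show ?thesis using PQ(3)[OF adm_cocyc[OF h z(1)] adm_cocyc[OF h z(2)]] by simp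
  qed
  show "cls m i h (a \<odot>\<^bsub>fr (r i)\<^esub> z) = a \<odot>\<^bsub>H\<^esub> cls m i h z" if a: "a \<in> carrier R" and z: "z \<in> carrier (fr (r i))" for a z
  proof -
    have zz: "a \<odot>\<^bsub>fr (r i)\<^esub> z \<in> carrier (fr (r i))" using a z by simp
    have "cls m i h (a \<odot>\<^bsub>fr (r i)\<^esub> z) = \<phi>Q m (\<lambda>q. a \<odot>\<^bsub>N\<^esub> h (tens (r i) (cx Q m n) z q))"
      by (rule PQ(2)[OF adm_cocyc[OF h zz]])
        (use lin_rules(3)[OF tens_lin1[OF Q.cx_module] a z] lin_rules(3)[OF hl a] t z in simp)
    then show ?thesis using PQ(4)[OF adm_cocyc[OF h z] a] by simp
  qed
qed

lemma adm_shift: "adm m i h \<Longrightarrow> m \<le> m' \<Longrightarrow> adm m' i (\<lambda>x. h (tK m m' i n x))"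
  using lin_comp[OF tK_lin, of m m' i n N h] by (auto simp: adm_def dv_tK[symmetric])

lemma cls_shift:
  assumes h: "adm m i h" and m: "m \<le> m'" and z: "z \<in> carrier (fr (r i))"
  shows "cls m' i (\<lambda>x. h (tK m m' i n x)) z = cls m i h z"
proof -
  have "cls m' i (\<lambda>x. h (tK m m' i n x)) z = \<phi>Q m' (\<lambda>q. h (tens (r i) (cx Q m n) z (tr Q m m' n q)))"
    by (rule PQ(2)[OF adm_cocyc[OF adm_shift[OF h m] z]]) (simp add: tK_tens[OF m z])
  then show ?thesis using PQ(5)[OF adm_cocyc[OF h z] m] by simp
qed

text \<open>F_i has finitely many basis vectors, so representatives of their images in
  \<open>H\<close> can be moved to one index, beyond any prescribed \<open>m0\<close>, and assembled
  into a cocycle on column \<open>i\<close>.\<close>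

lemma cls_rep:
  assumes w: "lin R (fr (r i)) H w"
  shows "\<exists>m\<ge>m0. \<exists>h. adm m i h \<and> (\<forall>z\<in>carrier (fr (r i)). cls m i h z = w z)"
proof -
  have "\<exists>m\<ge>m0. \<forall>s<r i. \<exists>h. cocyc R N Q m n h \<and> \<phi>Q m h = w (free_basis R {..<r i} s)"
  proof (rule eventually_all_less)
    fix s assume "s < r i"
    then have "w (free_basis R {..<r i} s) \<in> carrier H" using lin_rules(1)[OF w] by simp
    then obtain m h where h: "cocyc R N Q m n h" "\<phi>Q m h = w (free_basis R {..<r i} s)" by (rule Q.presents_surj[OF \<phi>Q])
    then show "\<exists>m\<ge>m0. \<exists>h. cocyc R N Q m n h \<and> \<phi>Q m h = w (free_basis R {..<r i} s)"
      using Q.cocyc_tr[OF h(1), of "max m m0"] PQ(5)[OF h(1), of "max m m0"] by (intro exI[of _ "max m m0"]) auto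
  next
    fix s m m' assume "\<exists>h. cocyc R N Q m n h \<and> \<phi>Q m h = w (free_basis R {..<r i} s)" and m: "m \<le> m'"
    then obtain h where h: "cocyc R N Q m n h" "\<phi>Q m h = w (free_basis R {..<r i} s)" by blast
    show "\<exists>h. cocyc R N Q m' n h \<and> \<phi>Q m' h = w (free_basis R {..<r i} s)"
      using Q.cocyc_tr[OF h(1) m] PQ(5)[OF h(1) m] h(2) by auto
  qed
  then obtain m where m: "m \<ge> m0" and "\<forall>s\<in>{..<r i}. \<exists>h. cocyc R N Q m n h \<and> \<phi>Q m h = w (free_basis R {..<r i} s)" by auto
  from bchoice[OF this(2)] obtain hs where hs: "\<And>s. s < r i \<Longrightarrow> cocyc R N Q m n (hs s)"
    "\<And>s. s < r i \<Longrightarrow> \<phi>Q m (hs s) = w (free_basis R {..<r i} s)" by auto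
  define h where "h = ds_map {..<r i} (\<lambda>_. cx Q m n) N hs"
  have hl: "lin R (K m i n) N h" unfolding h_def by (rule ds_map_lin) (use hs(1) in \<open>auto simp: cocyc_def\<close>)
  have hc: "h (col m i n s q) = hs s q" if "s < r i" "q \<in> carrier (cx Q m n)" for s q
    unfolding h_def tens_basis[OF Q.cx_module that, symmetric]
    by (rule ds_map_inj) (use hs(1) that in \<open>auto simp: cocyc_def\<close>)
  have "h (dv m i n x) = \<zero>\<^bsub>N\<^esub>" if x: "x \<in> carrier (K m i (Suc n))" for x
  proof (rule mpow_lin_ext[OF Q.cx_module N lin_comp[OF dv_lin hl] lin_zero[OF N] _ x])
    fix s q assume s: "s < r i" and q: "q \<in> carrier (cx Q m (Suc n))"
    have "dv m i n (col m i (Suc n) s q) = col m i n s (df Q m n q)" by (rule dv_tens[OF _ q]) (use s in simp)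
    then show "h (dv m i n (col m i (Suc n) s q)) = \<zero>\<^bsub>N\<^esub>"
      using hc[OF s, of "df Q m n q"] hs(1)[OF s] q by (simp add: cocyc_def)
  qed
  then have adm: "adm m i h" using hl by (simp add: adm_def)
  have "cls m i h z = w z" if z: "z \<in> carrier (fr (r i))" for z
  proof (rule free_lin_ext[OF H cls_lin[OF adm] w _ z])
    fix s assume "s \<in> {..<r i}"
    then have s: "s < r i" by simp
    have "cls m i h (free_basis R {..<r i} s) = \<phi>Q m (hs s)"
      by (rule PQ(2)[OF adm_cocyc[OF adm]]) (use s hc in auto)
    then show "cls m i h (free_basis R {..<r i} s) = w (free_basis R {..<r i} s)" using hs(2)[OF s] by simp
  qed
  then show ?thesis using m adm by blast
qed

lemma T_top_zero: "x \<in> carrier (T m (Suc k)) \<Longrightarrow> i \<ge> p \<Longrightarrow> i \<le> k \<Longrightarrow> x (Suc i) = \<zero>\<^bsub>K m (Suc i) (k - i)\<^esub>"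
  by (rule K_trivial[OF rp T_Suc(2)]) simp_all

lemma tot_df_top: "x \<in> carrier (T m (Suc k)) \<Longrightarrow> p \<le> k \<Longrightarrow>
    df TT m k x p = sg (K m p (k - p)) p (dv m p (k - p) (x p))"
  using T_top_zero[OF _ order_refl] T_Suc(1)[of x k m p] by (simp add: tot_df)

text \<open>Extended by zero, a cocycle on column \<open>p\<close> is a total cocycle: column
  \<open>p + 1\<close> is zero, so the component of a boundary in column \<open>p\<close> is purely
  vertical.\<close>

lemma adm_T:
  assumes h: "adm m p h"
  shows "cocyc R N TT m (p + n) (\<lambda>x. h (x p))"
proof -
  have hl: "lin R (K m p n) N h" using h by (simp add: adm_def)
  have "lin R (T m (p + n)) N (\<lambda>x. h (x p))"
    using lin_comp[OF T_proj_lin[of p "p + n" m]] hl by simp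
  moreover have "h (df TT m (p + n) x p) = \<zero>\<^bsub>N\<^esub>" if x: "x \<in> carrier (T m (Suc (p + n)))" for x
  proof -
    have xp: "x p \<in> carrier (K m p (Suc n))" using T_Suc(1)[OF x, of p] by simp
    have "h (df TT m (p + n) x p) = sg N p (h (dv m p n (x p)))"
      using tot_df_top[OF x] lin_sg[OF hl K_module N, of "dv m p n (x p)" p] xp by simp
    then show ?thesis using h xp by (simp add: adm_def)
  qed
  ultimately show ?thesis by (simp add: cocyc_def)
qed

lemma \<phi>T_shift:
  assumes h: "adm m p h" and m: "m \<le> m'"
  shows "\<phi>T m' (\<lambda>x. h (tK m m' p n (x p))) = \<phi>T m (\<lambda>x. h (x p))"
proof -
  have "\<phi>T m' (\<lambda>x. h (tK m m' p n (x p))) = \<phi>T m' (\<lambda>x. h (tr TT m m' (p + n) x p))"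
    by (rule PT(2)[OF adm_T[OF adm_shift[OF h m]]]) (simp add: tot_tr)
  then show ?thesis using PT(5)[OF adm_T[OF h] m] by simp
qed

text \<open>If the induced map F_p -> H is zero, the cochain becomes a coboundary within column
  \<open>p\<close>, and this is also a coboundary of the total complex because no column
  follows.\<close>

lemma cls_zero_imp:
  assumes D: "adm m p D" and z: "\<And>s. s < r p \<Longrightarrow> cls m p D (free_basis R {..<r p} s) = \<zero>\<^bsub>H\<^esub>"
  shows "\<phi>T m (\<lambda>x. D (x p)) = \<zero>\<^bsub>HM\<^esub>"
proof -
  have Dl: "lin R (K m p n) N D" using D by (simp add: adm_def)
  have "\<exists>m'\<ge>m. cobd R N Q m' n (\<lambda>q. D (col m p n s (tr Q m m' n q)))" if s: "s < r p" for s
    using PQ(6)[OF adm_cocyc[OF D, of "free_basis R {..<r p} s"]] z[OF s] s by simp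
  from cobdK_cols[OF N Dl this] obtain m' where m': "m' \<ge> m" and cb: "cobdK N m' p n (\<lambda>x. D (tK m m' p n x))" by blast
  have "cobd R N TT m' (p + n) (\<lambda>x. D (tK m m' p n (x p)))"
  proof (cases n)
    case 0
    have "D (tK m m' p n (x p)) = \<zero>\<^bsub>N\<^esub>" if x: "x \<in> carrier (T m' (p + n))" for x
      using cb 0 lin_rules(1)[OF T_proj_lin[of p "p + n" m'] x] by (simp add: cobdK_def)
    then show ?thesis
      using TT.cobd_cong[of m' "p + n" "\<lambda>x. D (tK m m' p n (x p))" "\<lambda>_. \<zero>\<^bsub>N\<^esub>" N] TT.cobd_zero[OF N] by simp
  next
    case (Suc l)
    then obtain Y where Y: "lin R (K m' p l) N Y"
      "\<forall>x\<in>carrier (K m' p (Suc l)). D (tK m m' p (Suc l) x) = Y (dv m' p l x)" using cb by (auto simp: cobdK_def)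
    \<comment> \<open>The primitive on column \<open>p\<close>, extended by zero, with the sign of
      the total differential compensated.\<close>
    define G where "G y = Y (sg (K m' p l) p (y p))" for y :: "nat \<Rightarrow> nat \<Rightarrow> ('a, 'a set) res_elt"
    have G: "lin R (T m' (p + l)) N G"
      unfolding G_def using lin_comp[OF lin_comp[OF T_proj_lin[of p "p + l" m'] sg_lin[OF K_module]], of N Y p] Y(1) by simp
    have "D (tK m m' p n (x p)) = G (df TT m' (p + l) x)" if x: "x \<in> carrier (T m' (Suc (p + l)))" for x
      using tot_df_top[OF x] T_Suc(1)[OF x, of p] Y(2) Suc by (simp add: G_def)
    then show ?thesis using G Suc by (auto simp: cobd_def)
  qed
  then have "\<phi>T m' (\<lambda>x. D (tK m m' p n (x p))) = \<zero>\<^bsub>HM\<^esub>" by (rule PT(7)[OF adm_T[OF adm_shift[OF D m']]])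
  then show ?thesis using \<phi>T_shift[OF D m'] by simp
qed

text \<open>Naturality of the induced map: precomposition with the horizontal differential
  corresponds to precomposition with the differential of F.\<close>

lemma adm_pext:
  assumes W: "adm m i W"
  shows "adm m (Suc i) (\<lambda>x. W (dh m i n x))"
    and "z \<in> carrier (fr (r (Suc i))) \<Longrightarrow> cls m (Suc i) (\<lambda>x. W (dh m i n x)) z = cls m i W (d i z)"
proof -
  have "lin R (K m (Suc i) n) N (\<lambda>x. W (dh m i n x))"
    by (rule lin_comp[OF dh_lin]) (use W in \<open>simp add: adm_def\<close>)
  then show a: "adm m (Suc i) (\<lambda>x. W (dh m i n x))" using W by (auto simp: adm_def dh_dv)
  show "cls m (Suc i) (\<lambda>x. W (dh m i n x)) z = cls m i W (d i z)" if z: "z \<in> carrier (fr (r (Suc i)))"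
    by (rule PQ(2)[OF adm_cocyc[OF a z]]) (simp add: pext_tens[OF Q.cx_module F(3) z])
qed

lemma adm_minus:
  assumes h: "adm m i h" and h': "adm m i h'"
  shows "adm m i (\<lambda>x. h x \<ominus>\<^bsub>N\<^esub> h' x)"
    and "z \<in> carrier (fr (r i)) \<Longrightarrow> cls m i h z = cls m i h' z \<Longrightarrow> cls m i (\<lambda>x. h x \<ominus>\<^bsub>N\<^esub> h' x) z = \<zero>\<^bsub>H\<^esub>"
proof -
  show a: "adm m i (\<lambda>x. h x \<ominus>\<^bsub>N\<^esub> h' x)" using h h' lin_minus[OF N] by (auto simp: adm_def)
  assume z: "z \<in> carrier (fr (r i))" and eq: "cls m i h z = cls m i h' z"
  have hc: "h (tens (r i) (cx Q m n) z q) \<in> carrier N" "h' (tens (r i) (cx Q m n) z q) \<in> carrier N"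
    if "q \<in> carrier (cx Q m n)" for q
    using that adm_cocyc[OF h z] adm_cocyc[OF h' z] lin_rules(1) by (auto simp: cocyc_def lin_def)
  have "cls m i h z = \<phi>Q m (\<lambda>q. (h (tens (r i) (cx Q m n) z q) \<ominus>\<^bsub>N\<^esub> h' (tens (r i) (cx Q m n) z q)) \<oplus>\<^bsub>N\<^esub> h' (tens (r i) (cx Q m n) z q))"
    by (rule PQ(2)[OF adm_cocyc[OF h z]]) (use hc in simp)
  also have "\<dots> = cls m i (\<lambda>x. h x \<ominus>\<^bsub>N\<^esub> h' x) z \<oplus>\<^bsub>H\<^esub> cls m i h' z"
    by (rule PQ(3)[OF adm_cocyc[OF a z] adm_cocyc[OF h' z]])
  finally have "cls m i h' z = cls m i (\<lambda>x. h x \<ominus>\<^bsub>N\<^esub> h' x) z \<oplus>\<^bsub>H\<^esub> cls m i h' z" using eq by simp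
  moreover have "cls m i (\<lambda>x. h x \<ominus>\<^bsub>N\<^esub> h' x) z \<in> carrier H" "cls m i h' z \<in> carrier H"
    using PQ(1) adm_cocyc[OF a z] adm_cocyc[OF h' z] by auto
  ultimately show "cls m i (\<lambda>x. h x \<ominus>\<^bsub>N\<^esub> h' x) z = \<zero>\<^bsub>H\<^esub>"
    using mm_minus_self[OF H, of "cls m i h' z"]
    by (metis (no_types, lifting) H a_minus_def mm_assoc mm_neg mm_r_neg mm_r_zero)
qed

text \<open>Let the induced map be \<open>w\<close> composed with F_p -> F_(p-1), and let
  \<open>W\<close> on column \<open>p - 1\<close> represent \<open>w\<close>. As \<open>W\<close>
  kills vertical boundaries, its total coboundary is the composite of \<open>W\<close> with the
  horizontal differential, placed on column \<open>p\<close>. That cochain and \<open>h\<close>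
  induce the same map on F_p, so they have the same total class, namely zero.\<close>

lemma cls_cobd_imp_zero:
  assumes h: "adm m p h" and c: "cobd R H FC 0 p (cls m p h)"
  shows "\<phi>T m (\<lambda>x. h (x p)) = \<zero>\<^bsub>HM\<^esub>"
proof (cases p)
  case 0
  show ?thesis
    by (rule cls_zero_imp[OF h]) (use c 0 in \<open>simp add: cobd_def\<close>)
next
  case (Suc p')
  then obtain w where w: "lin R (fr (r p')) H w" "\<And>z. z \<in> carrier (fr (r p)) \<Longrightarrow> cls m p h z = w (d p' z)"
    using c by (auto simp: cobd_def)
  obtain m1 W where m1: "m1 \<ge> m" and W: "adm m1 p' W" and cW: "\<And>z. z \<in> carrier (fr (r p')) \<Longrightarrow> cls m1 p' W z = w z"
    using cls_rep[OF w(1), of m] by blast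
  let ?h = "\<lambda>x. h (tK m m1 p n x)" and ?W = "\<lambda>x. W (dh m1 p' n x)"
  note hs = adm_shift[OF h m1]
  have Wd: "adm m1 p ?W" "\<And>z. z \<in> carrier (fr (r p)) \<Longrightarrow> cls m1 p ?W z = cls m1 p' W (d p' z)"
    using adm_pext[OF W] by (simp_all add: Suc)
  have Dz: "cls m1 p (\<lambda>x. ?h x \<ominus>\<^bsub>N\<^esub> ?W x) (free_basis R {..<r p} s) = \<zero>\<^bsub>H\<^esub>" if s: "s < r p" for s
  proof -
    have e: "free_basis R {..<r p} s \<in> carrier (fr (r p))" using s by simp
    have "cls m1 p ?h (free_basis R {..<r p} s) = cls m1 p ?W (free_basis R {..<r p} s)"
      using cls_shift[OF h m1 e] w(2)[OF e] Wd(2)[OF e] cW[of "d p' (free_basis R {..<r p} s)"]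
        lin_rules(1)[OF F(3)[of p']] e Suc by simp
    then show ?thesis by (rule adm_minus(2)[OF hs Wd(1) e])
  qed
  have z1: "\<phi>T m1 (\<lambda>x. ?h (x p) \<ominus>\<^bsub>N\<^esub> ?W (x p)) = \<zero>\<^bsub>HM\<^esub>"
    by (rule cls_zero_imp[OF adm_minus(1)[OF hs Wd(1)] Dz])
  have Wl: "lin R (K m1 p' n) N W" using W by (simp add: adm_def)
  \<comment> \<open>The component of a total boundary in column \<open>p - 1\<close> has a
    horizontal part, which gives the desired cochain, and a vertical part, which \<open>W\<close>
    annihilates.\<close>
  have Wk: "cobd R N TT m1 (p + n) (\<lambda>x. ?W (x p))"
  proof -
    have G: "lin R (T m1 (p' + n)) N (\<lambda>x. W (x p'))" using lin_comp[OF T_proj_lin[of p' "p' + n" m1]] Wl by simp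
    have "?W (x p) = W (df TT m1 (p' + n) x p')" if x: "x \<in> carrier (T m1 (Suc (p' + n)))" for x
    proof -
      have xp: "x p' \<in> carrier (K m1 p' (Suc n))" "x (Suc p') \<in> carrier (K m1 (Suc p') n)" using T_Suc[OF x, of p'] by auto
      have "W (sg (K m1 p' n) p' (dv m1 p' n (x p'))) = \<zero>\<^bsub>N\<^esub>"
        using lin_sg[OF Wl K_module N, of "dv m1 p' n (x p')" p'] W xp by (simp add: adm_def)
      then show ?thesis using xp Suc lin_rules(1)[OF Wl] by (simp add: tot_df lin_rules(2)[OF Wl])
    qed
    then show ?thesis using G Suc by (auto simp: cobd_def)
  qed
  have hc: "?h (x p) \<in> carrier N" "?W (x p) \<in> carrier N" if x: "x \<in> carrier (T m1 (p + n))" for x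
    using adm_T[OF hs] adm_T[OF Wd(1)] x by (auto simp: cocyc_def lin_def)
  have "\<phi>T m1 (\<lambda>x. ?h (x p)) = \<phi>T m1 (\<lambda>x. (?h (x p) \<ominus>\<^bsub>N\<^esub> ?W (x p)) \<oplus>\<^bsub>N\<^esub> ?W (x p))"
    by (rule PT(2)[OF adm_T[OF hs]]) (use hc in simp)
  also have "\<dots> = \<phi>T m1 (\<lambda>x. ?h (x p) \<ominus>\<^bsub>N\<^esub> ?W (x p)) \<oplus>\<^bsub>HM\<^esub> \<phi>T m1 (\<lambda>x. ?W (x p))"
    by (rule PT(3)[OF adm_T[OF adm_minus(1)[OF hs Wd(1)]] adm_T[OF Wd(1)]])
  also have "\<dots> = \<zero>\<^bsub>HM\<^esub>" using z1 PT(7)[OF adm_T[OF Wd(1)] Wk] by simp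
  finally show ?thesis using \<phi>T_shift[OF h m1] by simp
qed

end

context top_degree
begin

sublocale FC: pro_res R FC "\<lambda>_. M" "\<lambda>_ _ y. y"
  by (rule const_pro_res[OF res M])

text \<open>A primitive \<open>G\<close> of \<open>h\<close> has degree p + n - 1. On columns before
  \<open>p - 1\<close> its rows are above \<open>n\<close>, so it can be cleared there by a
  coboundary. What remains on column \<open>p\<close> in row \<open>n - 1\<close> changes
  \<open>h\<close> by a vertical coboundary, and what remains on column \<open>p - 1\<close> is a
  cocycle in row \<open>n\<close> through which the induced map of \<open>h\<close> factors.\<close>

lemma cobd_imp_cls_cobd:
  assumes h: "adm m p h" and c: "cobd R N TT m (p + n) (\<lambda>x. h (x p))"
  shows "cobd R H FC 0 p (cls m p h)"
proof (cases "p + n")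
  case 0
  have "h x = \<zero>\<^bsub>N\<^esub>" if x: "x \<in> carrier (K m 0 0)" for x
  proof -
    have "inK m 0 0 x \<in> carrier (T m 0)" by (rule inK_carrier) (use x in auto)
    then show ?thesis using c 0 inK_apply[of 0 0 m 0 x] by (auto simp: cobd_def)
  qed
  then have "cobd R N Q m n (\<lambda>q. h (tens (r p) (cx Q m n) z q))" if "z \<in> carrier (fr (r p))" for z
    using 0 lin_rules(1)[OF tens_lin2[OF Q.cx_module that]] by (auto simp: cobd_def)
  then show ?thesis using PQ(7)[OF adm_cocyc[OF h]] 0 by (simp add: cobd_def)
next
  case (Suc k)
  have pk: "p \<le> Suc k" "Suc k - p = n" using Suc by auto
  have hl: "lin R (K m p n) N h" using h by (simp add: adm_def)
  obtain G where G: "lin R (T m k) N G" and hG: "\<And>x. x \<in> carrier (T m (Suc k)) \<Longrightarrow> h (x p) = G (df TT m k x)"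
    using c unfolding Suc cobd_def by auto
  \<comment> \<open>\<open>h\<close> reads only column \<open>p\<close>, so \<open>G\<close> kills
    total boundaries coming from other columns, as clearing requires.\<close>
  have G0: "G (df TT m k (inK m (Suc k) i y)) = \<zero>\<^bsub>N\<^esub>" if i: "i < p - 1" and y: "y \<in> carrier (K m i (Suc (k - i)))" for i y
  proof -
    have ip: "i \<le> Suc k" "p \<le> Suc k" "i \<noteq> p" "Suc k - p = n" using i Suc by auto
    have y': "y \<in> carrier (K m i (Suc k - i))" using y i Suc by (simp add: Suc_diff_le)
    show ?thesis
      using hG[OF inK_carrier[OF ip(1) y']] inK_apply[OF ip(2), of m i y] ip lin_rules(4)[OF hl] N by simp
  qed
  have "\<exists>m'\<ge>m. \<exists>w. cobd R N TT m' k w \<and>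
    (\<forall>i<p-1. \<forall>x\<in>carrier (K m' i (k - i)). G (tr TT m m' k (inK m' k i x)) = w (inK m' k i x))"
    by (rule clean_vanish[OF N G _ G0 V]) (use Suc in auto)
  then obtain m' w where m': "m' \<ge> m" and w: "cobd R N TT m' k w"
    and Gw: "\<And>i x. i < p - 1 \<Longrightarrow> x \<in> carrier (K m' i (k - i)) \<Longrightarrow> G (tr TT m m' k (inK m' k i x)) = w (inK m' k i x)"
    by blast
  note wc = TT.cobd_cocyc[OF N w]
  have wl: "lin R (T m' k) N w" and wd: "\<And>x. x \<in> carrier (T m' (Suc k)) \<Longrightarrow> w (df TT m' k x) = \<zero>\<^bsub>N\<^esub>"
    using wc by (auto simp: cocyc_def)
  define G' where "G' x = G (tr TT m m' k x) \<ominus>\<^bsub>N\<^esub> w x" for x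
  have Gt: "lin R (T m' k) N (\<lambda>x. G (tr TT m m' k x))" by (rule lin_comp[OF tot_tr_lin[OF m'] G])
  have G': "lin R (T m' k) N G'" unfolding G'_def by (rule lin_minus[OF N Gt wl])
  let ?h = "\<lambda>x. h (tK m m' p n x)"
  note hs = adm_shift[OF h m']
  have hsl: "lin R (K m' p n) N ?h" using hs by (simp add: adm_def)
  have G'0: "G' (inK m' k i x) = \<zero>\<^bsub>N\<^esub>" if "i < p - 1" "x \<in> carrier (K m' i (k - i))" for i x
    unfolding G'_def Gw[OF that] by (rule mm_minus_self[OF N lin_rules(1)[OF wl inK_carrier]]) (use that Suc in auto)
  have G'h: "G' (df TT m' k x) = ?h (x p)" if x: "x \<in> carrier (T m' (Suc k))" for x
  proof -
    have "G (tr TT m m' k (df TT m' k x)) = G (df TT m k (tr TT m m' (Suc k) x))"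
      using TT.df_tr[OF m', of x k] x by simp
    also have "\<dots> = h (tr TT m m' (Suc k) x p)"
      by (rule hG[OF lin_rules(1)[OF tot_tr_lin[OF m'] x], symmetric])
    also have "\<dots> = ?h (x p)" by (simp add: tot_tr[OF pk(1)] pk(2))
    finally have e: "G (tr TT m m' k (df TT m' k x)) = ?h (x p)" .
    have "x p \<in> carrier (K m' p n)" using lin_rules(1)[OF T_proj_lin[OF pk(1), of m'] x] unfolding pk(2) .
    then show ?thesis using lin_rules(1)[OF hsl] N unfolding G'_def e wd[OF x] by simp
  qed
  \<comment> \<open>The two parts of the total boundary of an element of column \<open>p\<close>:
    \<open>A\<close> is the vertical one, which is absent if \<open>n = 0\<close>, and
    \<open>B\<close> the horizontal one, which is absent if \<open>p = 0\<close>.\<close>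
  define A where "A y = G' (if p \<le> k then inK m' k p (sg (K m' p (k - p)) p (dv m' p (k - p) y)) else \<zero>\<^bsub>T m' k\<^esub>)" for y
  define B where "B y = G' (case p of 0 \<Rightarrow> \<zero>\<^bsub>T m' k\<^esub> | Suc b' \<Rightarrow> inK m' k b' (dh m' b' (k - b') y))" for y
  have hAB: "?h y = A y \<oplus>\<^bsub>N\<^esub> B y" if y: "y \<in> carrier (K m' p n)" for y
  proof -
    have y': "y \<in> carrier (K m' p (Suc k - p))" using y pk by simp
    have "?h y = G' (df TT m' k (inK m' (Suc k) p y))"
      using G'h[OF inK_carrier[OF pk(1) y']] inK_apply[OF pk(1), of m' p y] by simp
    also have "\<dots> = A y \<oplus>\<^bsub>N\<^esub> B y"
      unfolding tot_df_inK[OF pk(1) y'] A_def B_def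
    proof (rule lin_rules(2)[OF G'])
      show "(if p \<le> k then inK m' k p (sg (K m' p (k - p)) p (dv m' p (k - p) y)) else \<zero>\<^bsub>T m' k\<^esub>) \<in> carrier (T m' k)"
        using y' by (auto simp: Suc_diff_le)
      show "(case p of 0 \<Rightarrow> \<zero>\<^bsub>T m' k\<^esub> | Suc b' \<Rightarrow> inK m' k b' (dh m' b' (k - b') y)) \<in> carrier (T m' k)"
        using y' pk by (cases p) auto
    qed
    finally show ?thesis .
  qed
  have Acobd: "cobd R N Q m' n (\<lambda>q. A (tens (r p) (cx Q m' n) z q))" if z: "z \<in> carrier (fr (r p))" for z
  proof (cases n)
    case 0
    then have "\<not> p \<le> k" using Suc by simp
    then show ?thesis using 0 lin_rules(4)[OF G'] N by (simp add: A_def cobd_def)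
  next
    case (Suc l)
    then have l: "p \<le> k" "k - p = l" using \<open>p + n = Suc k\<close> by auto
    let ?g = "\<lambda>q. G' (inK m' k p (sg (K m' p l) p (tens (r p) (cx Q m' l) z q)))"
    have "lin R (cx Q m' l) N ?g"
      using lin_comp[OF tens_lin2[OF Q.cx_module z] lin_comp[OF sg_lin[OF K_module] lin_comp[OF inK_lin[OF l(1)] G']]] l(2) by simp
    then show ?thesis using l Suc dv_tens[OF z] by (auto simp: A_def cobd_def)
  qed
  have cls: "cls m p h z = cls m' p ?h z" if "z \<in> carrier (fr (r p))" for z using cls_shift[OF h m' that] by simp
  have tz: "tens (r p) (cx Q m' n) z q \<in> carrier (K m' p n)" if "z \<in> carrier (fr (r p))" "q \<in> carrier (cx Q m' n)" for z q
    using lin_rules(1)[OF tens_lin2[OF Q.cx_module that(1)] that(2)] .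
  have Al: "A y \<in> carrier N" if "y \<in> carrier (K m' p n)" for y
    unfolding A_def by (rule lin_rules(1)[OF G']) (use that pk in \<open>auto simp: Suc_diff_le\<close>)
  show ?thesis
  proof (cases p)
    case 0
    have "cls m' p ?h z = \<zero>\<^bsub>H\<^esub>" if z: "z \<in> carrier (fr (r p))" for z
    proof (rule PQ(7)[OF adm_cocyc[OF hs z]])
      have "cobd R N Q m' n (\<lambda>q. ?h (tens (r p) (cx Q m' n) z q)) \<longleftrightarrow> cobd R N Q m' n (\<lambda>q. A (tens (r p) (cx Q m' n) z q))"
        by (rule Q.cobd_cong) (use hAB[OF tz[OF z]] Al[OF tz[OF z]] lin_rules(4)[OF G'] N 0 in \<open>simp add: B_def\<close>)
      then show "cobd R N Q m' n (\<lambda>q. ?h (tens (r p) (cx Q m' n) z q))" using Acobd[OF z] by simp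
    qed
    then show ?thesis using cls 0 by (simp add: cobd_def)
  next
    case (Suc p')
    have k: "p' \<le> k" "k - p' = n" "p - 1 = p'" using Suc \<open>p + n = Suc k\<close> by auto
    \<comment> \<open>\<open>G'\<close> on column \<open>p - 1\<close>. It is a vertical cocycle by
      \<open>dv_kill\<close>: it vanishes on all earlier columns, and \<open>h\<close> does not see
      column \<open>p - 1\<close>.\<close>
    define W where "W x = G' (inK m' k p' x)" for x
    have Wl: "lin R (K m' p' n) N W" unfolding W_def using lin_comp[OF inK_lin[OF k(1), of m'] G'] k(2) by simp
    have "W (dv m' p' n y) = \<zero>\<^bsub>N\<^esub>" if y: "y \<in> carrier (K m' p' (Suc n))" for y
    proof -
      have y': "y \<in> carrier (K m' p' (Suc k - p'))" using y k by (simp add: Suc_diff_le)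
      have "G' (df TT m' k (inK m' (Suc k) p' y)) = ?h (inK m' (Suc k) p' y p)"
        by (rule G'h[OF inK_carrier[OF _ y']]) (use k in simp)
      also have "\<dots> = \<zero>\<^bsub>N\<^esub>" using inK_apply[OF pk(1), of m' p' y] Suc pk lin_rules(4)[OF hsl] N by simp
      finally have z: "G' (df TT m' k (inK m' (Suc k) p' y)) = \<zero>\<^bsub>N\<^esub>" .
      have "G' (inK m' k p' (dv m' p' (k - p') y)) = \<zero>\<^bsub>N\<^esub>"
        by (rule dv_kill[OF N G' k(1) G'0 _ z]) (use k y in auto)
      then show ?thesis by (simp add: W_def k)
    qed
    then have W: "adm m' p' W" using Wl by (simp add: adm_def)
    have Wd: "adm m' p (\<lambda>x. W (dh m' p' n x))" "\<And>z. z \<in> carrier (fr (r p)) \<Longrightarrow> cls m' p (\<lambda>x. W (dh m' p' n x)) z = cls m' p' W (d p' z)"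
      using adm_pext[OF W] by (simp_all add: Suc)
    have Wdl: "W (dh m' p' n y) \<in> carrier N" if "y \<in> carrier (K m' p n)" for y
      using lin_rules(1)[OF Wl] that Suc by simp
    have "cls m' p ?h z = cls m' p (\<lambda>x. W (dh m' p' n x)) z" if z: "z \<in> carrier (fr (r p))" for z
    proof (rule PQ(8)[OF adm_cocyc[OF hs z] adm_cocyc[OF Wd(1) z]])
      have "?h y \<ominus>\<^bsub>N\<^esub> W (dh m' p' n y) = A y" if y: "y \<in> carrier (K m' p n)" for y
      proof -
        have "B y = W (dh m' p' n y)" using Suc k by (simp add: B_def W_def)
        then show ?thesis unfolding hAB[OF y] using Al[OF y] Wdl[OF y] mm_neg[OF N Wdl[OF y]] N
          by (simp add: a_minus_def mm_assoc)
      qed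
      then show "cobd R N Q m' n (\<lambda>q. ?h (tens (r p) (cx Q m' n) z q) \<ominus>\<^bsub>N\<^esub> W (dh m' p' n (tens (r p) (cx Q m' n) z q)))"
        using Q.cobd_cong[of m' n "\<lambda>q. ?h (tens (r p) (cx Q m' n) z q) \<ominus>\<^bsub>N\<^esub> W (dh m' p' n (tens (r p) (cx Q m' n) z q))"
            "\<lambda>q. A (tens (r p) (cx Q m' n) z q)" N] Acobd[OF z] tz[OF z] by simp
    qed
    then have "cls m p h z = cls m' p' W (d p' z)" if "z \<in> carrier (fr (r p))" for z
      using cls[OF that] Wd(2)[OF that] that by simp
    then show ?thesis using cls_lin[OF W] Suc by (auto simp: cobd_def)
  qed
qed

lemma zero_iff_cobd:
  assumes h: "adm m p h"
  shows "\<phi>T m (\<lambda>x. h (x p)) = \<zero>\<^bsub>HM\<^esub> \<longleftrightarrow> cobd R H FC 0 p (cls m p h)"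
proof
  assume "\<phi>T m (\<lambda>x. h (x p)) = \<zero>\<^bsub>HM\<^esub>"
  then obtain m' where m': "m' \<ge> m" and c: "cobd R N TT m' (p + n) (\<lambda>x. h (tr TT m m' (p + n) x p))"
    using PT(6)[OF adm_T[OF h]] by blast
  have "cobd R N TT m' (p + n) (\<lambda>x. h (tK m m' p n (x p)))"
    using c TT.cobd_cong[of m' "p + n" "\<lambda>x. h (tr TT m m' (p + n) x p)" "\<lambda>x. h (tK m m' p n (x p))" N] by (simp add: tot_tr)
  then have "cobd R H FC 0 p (cls m' p (\<lambda>x. h (tK m m' p n x)))" by (rule cobd_imp_cls_cobd[OF adm_shift[OF h m']])
  then show "cobd R H FC 0 p (cls m p h)"
    using FC.cobd_cong[of 0 p "cls m' p (\<lambda>x. h (tK m m' p n x))" "cls m p h" H] cls_shift[OF h m'] by simp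
qed (rule cls_cobd_imp_zero[OF h])

text \<open>In degree p + n the columns before \<open>p\<close> meet rows above \<open>n\<close>, so
  every class has a representative that vanishes on them; the columns after \<open>p\<close> are
  zero.\<close>

lemma adm_surj:
  assumes y: "y \<in> carrier HM"
  shows "\<exists>m h. adm m p h \<and> \<phi>T m (\<lambda>x. h (x p)) = y"
proof -
  let ?k = "p + n"
  obtain m c where c: "cocyc R N TT m ?k c" "\<phi>T m c = y" by (rule TT.presents_surj[OF \<phi>T y])
  have cl: "lin R (T m ?k) N c" and cd: "\<And>x. x \<in> carrier (T m (Suc ?k)) \<Longrightarrow> c (df TT m ?k x) = \<zero>\<^bsub>N\<^esub>"
    using c(1) by (auto simp: cocyc_def)
  have "\<exists>m'\<ge>m. \<exists>w. cobd R N TT m' ?k w \<and>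
    (\<forall>i<p. \<forall>x\<in>carrier (K m' i (?k - i)). c (tr TT m m' ?k (inK m' ?k i x)) = w (inK m' ?k i x))"
    by (rule clean_vanish[OF N cl _ cd V]) (auto simp: Suc_diff_le intro!: inK_carrier)
  then obtain m' w where m': "m' \<ge> m" and w: "cobd R N TT m' ?k w"
    and cw: "\<And>i x. i < p \<Longrightarrow> x \<in> carrier (K m' i (?k - i)) \<Longrightarrow> c (tr TT m m' ?k (inK m' ?k i x)) = w (inK m' ?k i x)" by blast
  let ?c = "\<lambda>x. c (tr TT m m' ?k x)"
  define c' where "c' x = ?c x \<ominus>\<^bsub>N\<^esub> w x" for x
  note tc = TT.cocyc_tr[OF c(1) m'] and wc = TT.cobd_cocyc[OF N w]
  have c'c: "cocyc R N TT m' ?k c'" unfolding c'_def by (rule TT.cocyc_ops(2)[OF N tc wc])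
  have c'l: "lin R (T m' ?k) N c'" and c'd: "\<And>x. x \<in> carrier (T m' (Suc ?k)) \<Longrightarrow> c' (df TT m' ?k x) = \<zero>\<^bsub>N\<^esub>"
    using c'c by (auto simp: cocyc_def)
  have wl: "lin R (T m' ?k) N w" using wc by (simp add: cocyc_def)
  have tl: "lin R (T m' ?k) N ?c" using tc by (simp add: cocyc_def)
  have c'0: "c' (inK m' ?k i x) = \<zero>\<^bsub>N\<^esub>" if "i < p" "x \<in> carrier (K m' i (?k - i))" for i x
    unfolding c'_def cw[OF that] by (rule mm_minus_self[OF N lin_rules(1)[OF wl inK_carrier]]) (use that in auto)
  define h where "h x = c' (inK m' ?k p x)" for x
  have pk: "p \<le> ?k" "?k - p = n" by auto
  have hl: "lin R (K m' p n) N h" unfolding h_def using lin_comp[OF inK_lin[OF pk(1), of m'] c'l] by simp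
  have "h (dv m' p n y) = \<zero>\<^bsub>N\<^esub>" if y: "y \<in> carrier (K m' p (Suc n))" for y
  proof -
    have "inK m' (Suc ?k) p y \<in> carrier (T m' (Suc ?k))" by (rule inK_carrier) (use y in \<open>auto simp: Suc_diff_le\<close>)
    then have "c' (inK m' ?k p (dv m' p (?k - p) y)) = \<zero>\<^bsub>N\<^esub>"
      by (intro dv_kill[OF N c'l pk(1) c'0 _ c'd]) (use y in auto)
    then show ?thesis by (simp add: h_def)
  qed
  then have h: "adm m' p h" using hl by (simp add: adm_def)
  have "c' x = h (x p)" if x: "x \<in> carrier (T m' ?k)" for x
  proof (rule T_lin_ext[OF N c'l _ _ x])
    show hp: "lin R (T m' ?k) N (\<lambda>x. h (x p))" using adm_T[OF h] by (simp add: cocyc_def)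
    fix i x assume i: "i \<le> ?k" and x: "x \<in> carrier (K m' i (?k - i))"
    consider "i < p" | "i = p" | "i > p" by linarith
    then show "c' (inK m' ?k i x) = h (inK m' ?k i x p)"
    proof cases
      case 1
      then show ?thesis using c'0[OF 1 x] inK_apply[OF pk(1), of m' i x] lin_rules(4)[OF hl] N by simp
    next
      case 2
      then show ?thesis using inK_apply[OF pk(1), of m' i x] by (simp add: h_def)
    next
      case 3
      have "x = \<zero>\<^bsub>K m' i (?k - i)\<^esub>" by (rule K_trivial[OF rp[OF 3] x])
      then show ?thesis
        using lin_rules(4)[OF lin_comp[OF inK_lin[OF i] c'l]] lin_rules(4)[OF lin_comp[OF inK_lin[OF i] hp]] N by simp
    qed
  qed
  note c'h = this
  have eq: "?c x = h (x p) \<oplus>\<^bsub>N\<^esub> w x" if x: "x \<in> carrier (T m' ?k)" for x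
    unfolding c'h[OF x, symmetric] c'_def using lin_rules(1)[OF tl x] lin_rules(1)[OF wl x] N by simp
  have "y = \<phi>T m' ?c" using PT(5)[OF c(1) m'] c(2) by simp
  also have "\<dots> = \<phi>T m' (\<lambda>x. h (x p) \<oplus>\<^bsub>N\<^esub> w x)" by (rule PT(2)[OF tc]) (use eq in simp)
  also have "\<dots> = \<phi>T m' (\<lambda>x. h (x p)) \<oplus>\<^bsub>HM\<^esub> \<phi>T m' w" by (rule PT(3)[OF adm_T[OF h] wc])
  also have "\<dots> = \<phi>T m' (\<lambda>x. h (x p))" using PT(7)[OF wc w] PT(1)[OF adm_T[OF h]] HM by simp
  finally show ?thesis using h by blast
qed

text \<open>F_(p+1) is zero, so any linear map on F_p is a cocycle.\<close>

lemma cls_cocyc: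
  assumes h: "adm m p h"
  shows "cocyc R H FC 0 p (cls m p h)"
proof -
  have "cls m p h (d p x) = \<zero>\<^bsub>H\<^esub>" if x: "x \<in> carrier (fr (r (Suc p)))" for x
  proof -
    have "r (Suc p) = 0" by (rule rp) simp
    then have "x = \<zero>\<^bsub>fr (r (Suc p))\<^esub>" using x by (auto simp: free_module_def direct_sum_simps)
    then have "d p x = \<zero>\<^bsub>fr (r p)\<^esub>" using lin_rules(4)[OF F(3)[of p]] by simp
    then show ?thesis using lin_rules(4)[OF cls_lin[OF h]] by simp
  qed
  then show ?thesis using cls_lin[OF h] by (simp add: cocyc_def)
qed

text \<open>Both modules are images of the cocycles on column \<open>p\<close>, one through the
  total class and one through the induced map F_p -> H, and \<open>zero_iff_cobd\<close> says that
  the same cocycles go to zero.\<close>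

theorem gen_local_cohomology_iso_Ext: "mod_iso R HM E"
proof -
  note PE = FC.presents_rules[OF \<phi>E H E]
  have FCm: "cobd R H FC j p u \<longleftrightarrow> cobd R H FC 0 p u" for j u by (cases p) (simp_all add: cobd_def)
  let ?I = "{(m, h). adm m p h}"
  let ?f = "\<lambda>(m, h). \<phi>T m (\<lambda>x. h (x p))" and ?g = "\<lambda>(m, h). \<phi>E 0 (cls m p h)"
  have hl: "lin R (K m p n) N h" if "adm m p h" for m h using that by (simp add: adm_def)
  show ?thesis
  proof (rule mod_iso_rel[OF HM E, where I = ?I and f = ?f and g = ?g])
    show "?f i \<in> carrier HM" if "i \<in> ?I" for i using that PT(1)[OF adm_T] by auto
    show "?g i \<in> carrier E" if "i \<in> ?I" for i using that PE(1)[OF cls_cocyc] by auto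
    show "?f i = \<zero>\<^bsub>HM\<^esub> \<longleftrightarrow> ?g i = \<zero>\<^bsub>E\<^esub>" if iI: "i \<in> ?I" for i
    proof -
      obtain m h where i: "i = (m, h)" and h: "adm m p h" using iI by blast
      have "?g i = \<zero>\<^bsub>E\<^esub> \<longleftrightarrow> cobd R H FC 0 p (cls m p h)"
        using PE(6)[OF cls_cocyc[OF h]] FCm[of _ "cls m p h"] by (auto simp: i)
      then show ?thesis using zero_iff_cobd[OF h] by (simp add: i)
    qed
    show "\<exists>i\<in>?I. ?f i = x" if "x \<in> carrier HM" for x using adm_surj[OF that] by auto
    show "\<exists>i\<in>?I. ?g i = y" if y: "y \<in> carrier E" for y
    proof -
      obtain m u where u: "cocyc R H FC m p u" "\<phi>E m u = y" by (rule FC.presents_surj[OF \<phi>E y])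
      have u0: "cocyc R H FC 0 p u" and ul: "lin R (fr (r p)) H u" using u(1) by (simp_all add: cocyc_def)
      obtain m' h where h: "adm m' p h" "\<And>z. z \<in> carrier (fr (r p)) \<Longrightarrow> cls m' p h z = u z"
        using cls_rep[OF ul, of 0] by blast
      have "\<phi>E 0 (cls m' p h) = \<phi>E 0 u" by (rule PE(2)[OF cls_cocyc[OF h(1)]]) (use h(2) in simp)
      also have "\<dots> = y" using PE(5)[OF u0, of m] u(2) by simp
      finally show ?thesis using h(1) by (intro bexI[of _ "(m', h)"]) auto
    qed
    show "\<exists>k\<in>?I. ?f k = a \<odot>\<^bsub>HM\<^esub> ?f i \<and> ?g k = a \<odot>\<^bsub>E\<^esub> ?g i" if a: "a \<in> carrier R" and iI: "i \<in> ?I" for a i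
    proof -
      obtain m h where i: "i = (m, h)" and h: "adm m p h" using iI by blast
      have ah: "adm m p (\<lambda>x. a \<odot>\<^bsub>N\<^esub> h x)" using lin_smult[OF N hl[OF h] a] h a N by (simp add: adm_def)
      have "\<phi>E 0 (cls m p (\<lambda>x. a \<odot>\<^bsub>N\<^esub> h x)) = \<phi>E 0 (\<lambda>z. a \<odot>\<^bsub>H\<^esub> cls m p h z)"
        by (rule PE(2)[OF cls_cocyc[OF ah]]) (use PQ(4)[OF adm_cocyc[OF h] a] in simp)
      then show ?thesis using ah PT(4)[OF adm_T[OF h] a] PE(4)[OF cls_cocyc[OF h] a]
        by (intro bexI[of _ "(m, \<lambda>x. a \<odot>\<^bsub>N\<^esub> h x)"]) (auto simp: i)
    qed
    show "\<exists>k\<in>?I. ?f k = ?f i \<oplus>\<^bsub>HM\<^esub> ?f j \<and> ?g k = ?g i \<oplus>\<^bsub>E\<^esub> ?g j" if iI: "i \<in> ?I" "j \<in> ?I" for i j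
    proof -
      obtain m h m' h' where i: "i = (m, h)" "j = (m', h')" and h: "adm m p h" "adm m' p h'" using iI by blast
      \<comment> \<open>Cocycles at different indices are added after moving both to the larger
        index, which changes neither of the two classes.\<close>
      let ?m = "max m m'"
      have le: "m \<le> ?m" "m' \<le> ?m" by auto
      let ?h = "\<lambda>x. h (tK m ?m p n x)" and ?h' = "\<lambda>x. h' (tK m' ?m p n x)"
      note hs = adm_shift[OF h(1) le(1)] adm_shift[OF h(2) le(2)]
      have sh: "adm ?m p (\<lambda>x. ?h x \<oplus>\<^bsub>N\<^esub> ?h' x)"
        using lin_add[OF N hl[OF hs(1)] hl[OF hs(2)]] hs N by (simp add: adm_def)
      have eE: "\<phi>E 0 (cls ?m p ?h) = \<phi>E 0 (cls m p h)" "\<phi>E 0 (cls ?m p ?h') = \<phi>E 0 (cls m' p h')"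
        by (rule PE(2)[OF cls_cocyc[OF hs(1)]], use cls_shift[OF h(1) le(1)] in simp)
          (rule PE(2)[OF cls_cocyc[OF hs(2)]], use cls_shift[OF h(2) le(2)] in simp)
      have "\<phi>E 0 (cls ?m p (\<lambda>x. ?h x \<oplus>\<^bsub>N\<^esub> ?h' x)) = \<phi>E 0 (\<lambda>z. cls ?m p ?h z \<oplus>\<^bsub>H\<^esub> cls ?m p ?h' z)"
        by (rule PE(2)[OF cls_cocyc[OF sh]]) (use PQ(3)[OF adm_cocyc[OF hs(1)] adm_cocyc[OF hs(2)]] in simp)
      also have "\<dots> = \<phi>E 0 (cls m p h) \<oplus>\<^bsub>E\<^esub> \<phi>E 0 (cls m' p h')"
        using PE(3)[OF cls_cocyc[OF hs(1)] cls_cocyc[OF hs(2)]] eE by simp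
      finally have 1: "\<phi>E 0 (cls ?m p (\<lambda>x. ?h x \<oplus>\<^bsub>N\<^esub> ?h' x)) = \<phi>E 0 (cls m p h) \<oplus>\<^bsub>E\<^esub> \<phi>E 0 (cls m' p h')" .
      have 2: "\<phi>T ?m (\<lambda>x. ?h (x p) \<oplus>\<^bsub>N\<^esub> ?h' (x p)) = \<phi>T m (\<lambda>x. h (x p)) \<oplus>\<^bsub>HM\<^esub> \<phi>T m' (\<lambda>x. h' (x p))"
        using PT(3)[OF adm_T[OF hs(1)] adm_T[OF hs(2)]] \<phi>T_shift[OF h(1) le(1)] \<phi>T_shift[OF h(2) le(2)] by simp
      show ?thesis using sh 1 2 by (intro bexI[of _ "(?m, \<lambda>x. ?h x \<oplus>\<^bsub>N\<^esub> ?h' x)"]) (auto simp: i)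
    qed
  qed
qed

end

section \<open>Tensor products, and Ext^p(M, H) as a tensor product\<close>

section \<open>Tensor products\<close>

definition tns ::
    "('a, 'r) ring_scheme \<Rightarrow> ('a, 'b, 'm) module_scheme \<Rightarrow> ('a, 'c, 'n) module_scheme \<Rightarrow> 'b \<Rightarrow> 'c
      \<Rightarrow> ('b \<times> 'c \<Rightarrow> 'a) set"
  where "tns R M N x y =
    mod_span R (free_module R (carrier M \<times> carrier N)) (tensor_relations R M N)
      +>\<^bsub>free_module R (carrier M \<times> carrier N)\<^esub> free_basis R (carrier M \<times> carrier N) (x, y)"

context modules
begin

context
  fixes M :: "('a, 'x, 'm) module_scheme" and N :: "('a, 'y, 'n) module_scheme"
  assumes M [simp]: "module R M" and N [simp]: "module R N"
begin

abbreviation (input) "TF \<equiv> free_module R (carrier M \<times> carrier N)"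
abbreviation (input) "TR \<equiv> mod_span R TF (tensor_relations R M N)"

lemma tensor_relations_carrier: "tensor_relations R M N \<subseteq> carrier TF"
  unfolding tensor_relations_def Let_def by auto

lemmas tensor_sub = mod_span_submodule[OF free_module_module tensor_relations_carrier]

lemma tensor_eq: "tensor R M N = mod_quot TF TR"
  by (simp add: tensor_def Let_def)

lemma tensor_module: "module R (tensor R M N)"
  unfolding tensor_eq by (rule quot_module[OF tensor_sub free_module_module])

lemma tns_carrier: "x \<in> carrier M \<Longrightarrow> y \<in> carrier N \<Longrightarrow> tns R M N x y \<in> carrier (tensor R M N)"
  unfolding tensor_eq tns_def using lin_rules(1)[OF quot_lin[OF tensor_sub free_module_module]] by simp

lemma tns_bilinear:
  "x \<in> carrier M \<Longrightarrow> x' \<in> carrier M \<Longrightarrow> y \<in> carrier N \<Longrightarrow>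
    tns R M N (x \<oplus>\<^bsub>M\<^esub> x') y = tns R M N x y \<oplus>\<^bsub>tensor R M N\<^esub> tns R M N x' y"
  "x \<in> carrier M \<Longrightarrow> y \<in> carrier N \<Longrightarrow> y' \<in> carrier N \<Longrightarrow>
    tns R M N x (y \<oplus>\<^bsub>N\<^esub> y') = tns R M N x y \<oplus>\<^bsub>tensor R M N\<^esub> tns R M N x y'"
  "a \<in> carrier R \<Longrightarrow> x \<in> carrier M \<Longrightarrow> y \<in> carrier N \<Longrightarrow>
    tns R M N (a \<odot>\<^bsub>M\<^esub> x) y = a \<odot>\<^bsub>tensor R M N\<^esub> tns R M N x y"
  "a \<in> carrier R \<Longrightarrow> x \<in> carrier M \<Longrightarrow> y \<in> carrier N \<Longrightarrow>
    tns R M N x (a \<odot>\<^bsub>N\<^esub> y) = a \<odot>\<^bsub>tensor R M N\<^esub> tns R M N x y"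
proof -
  let ?e = "\<lambda>x y. free_basis R (carrier M \<times> carrier N) (x, y)"
  note q = quot_ops(3,4)[OF tensor_sub free_module_module]
  have eq: "TR +>\<^bsub>TF\<^esub> u = TR +>\<^bsub>TF\<^esub> w"
    if "u \<in> carrier TF" "w \<in> carrier TF" "u \<ominus>\<^bsub>TF\<^esub> w \<in> tensor_relations R M N" for u w
    using coset_eq_iff[OF tensor_sub free_module_module that(1,2)] mod_span_superset[OF that(3)] by simp
  show "tns R M N (x \<oplus>\<^bsub>M\<^esub> x') y = tns R M N x y \<oplus>\<^bsub>tensor R M N\<^esub> tns R M N x' y"
    if x: "x \<in> carrier M" "x' \<in> carrier M" "y \<in> carrier N"
  proof -
    have "TR +>\<^bsub>TF\<^esub> ?e (x \<oplus>\<^bsub>M\<^esub> x') y = TR +>\<^bsub>TF\<^esub> (?e x y \<oplus>\<^bsub>TF\<^esub> ?e x' y)"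
      by (rule eq) (use x in \<open>auto simp: tensor_relations_def Let_def\<close>)
    then show ?thesis unfolding tns_def tensor_eq using q(1)[of "?e x y" "?e x' y"] x by simp
  qed
  show "tns R M N x (y \<oplus>\<^bsub>N\<^esub> y') = tns R M N x y \<oplus>\<^bsub>tensor R M N\<^esub> tns R M N x y'"
    if x: "x \<in> carrier M" "y \<in> carrier N" "y' \<in> carrier N"
  proof -
    have "TR +>\<^bsub>TF\<^esub> ?e x (y \<oplus>\<^bsub>N\<^esub> y') = TR +>\<^bsub>TF\<^esub> (?e x y \<oplus>\<^bsub>TF\<^esub> ?e x y')"
      by (rule eq) (use x in \<open>auto simp: tensor_relations_def Let_def\<close>)
    then show ?thesis unfolding tns_def tensor_eq using q(1)[of "?e x y" "?e x y'"] x by simp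
  qed
  show "tns R M N (a \<odot>\<^bsub>M\<^esub> x) y = a \<odot>\<^bsub>tensor R M N\<^esub> tns R M N x y"
    if x: "a \<in> carrier R" "x \<in> carrier M" "y \<in> carrier N"
  proof -
    have "TR +>\<^bsub>TF\<^esub> ?e (a \<odot>\<^bsub>M\<^esub> x) y = TR +>\<^bsub>TF\<^esub> (a \<odot>\<^bsub>TF\<^esub> ?e x y)"
      by (rule eq) (use x in \<open>auto simp: tensor_relations_def Let_def\<close>)
    then show ?thesis unfolding tns_def tensor_eq using q(2)[of a "?e x y"] x by simp
  qed
  show "tns R M N x (a \<odot>\<^bsub>N\<^esub> y) = a \<odot>\<^bsub>tensor R M N\<^esub> tns R M N x y"
    if x: "a \<in> carrier R" "x \<in> carrier M" "y \<in> carrier N"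
  proof -
    have "TR +>\<^bsub>TF\<^esub> ?e x (a \<odot>\<^bsub>N\<^esub> y) = TR +>\<^bsub>TF\<^esub> (a \<odot>\<^bsub>TF\<^esub> ?e x y)"
      by (rule eq) (use x in \<open>auto simp: tensor_relations_def Let_def\<close>)
    then show ?thesis unfolding tns_def tensor_eq using q(2)[of a "?e x y"] x by simp
  qed
qed

text \<open>Scalars are absorbed into the first factor, so sums of pure tensors already exhaust the
  module.\<close>

lemma tensor_induct:
  assumes z: "z \<in> carrier (tensor R M N)" and zero: "P \<zero>\<^bsub>tensor R M N\<^esub>"
    and gen: "\<And>x y. x \<in> carrier M \<Longrightarrow> y \<in> carrier N \<Longrightarrow> P (tns R M N x y)"
    and add: "\<And>u w. P u \<Longrightarrow> P w \<Longrightarrow> P (u \<oplus>\<^bsub>tensor R M N\<^esub> w)"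
  shows "P z"
proof -
  note ql = quot_lin[OF tensor_sub free_module_module]
  obtain u where u: "u \<in> carrier TF" "z = TR +>\<^bsub>TF\<^esub> u"
    using z unfolding tensor_eq quot_ops(1)[OF tensor_sub free_module_module] by blast
  have "P (TR +>\<^bsub>TF\<^esub> u)"
  proof (rule direct_sum_induct[OF _ u(1)[unfolded free_module_def], where P = "\<lambda>u. P (TR +>\<^bsub>TF\<^esub> u)"])
    show "P (TR +>\<^bsub>TF\<^esub> \<zero>\<^bsub>direct_sum (carrier M \<times> carrier N) (\<lambda>_. ring_module R)\<^esub>)"
      using zero unfolding tensor_eq quot_ops(2)[OF tensor_sub free_module_module] by (simp add: free_module_def)
    show "P (TR +>\<^bsub>TF\<^esub> (u \<oplus>\<^bsub>direct_sum (carrier M \<times> carrier N) (\<lambda>_. ring_module R)\<^esub> w))"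
      if "u \<in> carrier (direct_sum (carrier M \<times> carrier N) (\<lambda>_. ring_module R))"
        "w \<in> carrier (direct_sum (carrier M \<times> carrier N) (\<lambda>_. ring_module R))"
        "P (TR +>\<^bsub>TF\<^esub> u)" "P (TR +>\<^bsub>TF\<^esub> w)" for u w
      using add[OF that(3,4)] quot_ops(3)[OF tensor_sub free_module_module, of u w] that(1,2)
      unfolding tensor_eq free_module_def by simp
    fix k a assume k: "k \<in> carrier M \<times> carrier N" and "a \<in> carrier (ring_module R)"
    then have a: "a \<in> carrier R" by simp
    obtain x y where xy: "k = (x, y)" "x \<in> carrier M" "y \<in> carrier N" using k by blast
    have "TR +>\<^bsub>TF\<^esub> sum_inj (carrier M \<times> carrier N) (\<lambda>_. ring_module R) k a = a \<odot>\<^bsub>tensor R M N\<^esub> tns R M N x y"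
      unfolding free_inj_eq[OF k a] tns_def tensor_eq using quot_ops(4)[OF tensor_sub free_module_module a] xy by simp
    also have "\<dots> = tns R M N (a \<odot>\<^bsub>M\<^esub> x) y" using tns_bilinear(3)[OF a xy(2,3)] by simp
    finally show "P (TR +>\<^bsub>TF\<^esub> sum_inj (carrier M \<times> carrier N) (\<lambda>_. ring_module R) k a)"
      using gen[of "a \<odot>\<^bsub>M\<^esub> x" y] a xy by simp
  qed simp
  then show ?thesis using u(2) by simp
qed

lemma tensor_lift:
  assumes P: "module R P" and c: "\<And>x y. x \<in> carrier M \<Longrightarrow> y \<in> carrier N \<Longrightarrow> b x y \<in> carrier P"
    and b1: "\<And>x x' y. x \<in> carrier M \<Longrightarrow> x' \<in> carrier M \<Longrightarrow> y \<in> carrier N \<Longrightarrow> b (x \<oplus>\<^bsub>M\<^esub> x') y = b x y \<oplus>\<^bsub>P\<^esub> b x' y"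
    and b2: "\<And>x y y'. x \<in> carrier M \<Longrightarrow> y \<in> carrier N \<Longrightarrow> y' \<in> carrier N \<Longrightarrow> b x (y \<oplus>\<^bsub>N\<^esub> y') = b x y \<oplus>\<^bsub>P\<^esub> b x y'"
    and b3: "\<And>a x y. a \<in> carrier R \<Longrightarrow> x \<in> carrier M \<Longrightarrow> y \<in> carrier N \<Longrightarrow> b (a \<odot>\<^bsub>M\<^esub> x) y = a \<odot>\<^bsub>P\<^esub> b x y"
    and b4: "\<And>a x y. a \<in> carrier R \<Longrightarrow> x \<in> carrier M \<Longrightarrow> y \<in> carrier N \<Longrightarrow> b x (a \<odot>\<^bsub>N\<^esub> y) = a \<odot>\<^bsub>P\<^esub> b x y"
  shows "\<exists>g. lin R (tensor R M N) P g \<and> (\<forall>x\<in>carrier M. \<forall>y\<in>carrier N. g (tns R M N x y) = b x y)"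
proof -
  let ?X = "carrier M \<times> carrier N"
  let ?f = "free_map R ?X P (\<lambda>(x, y). b x y)"
  have bc: "(case k of (x, y) \<Rightarrow> b x y) \<in> carrier P" if "k \<in> ?X" for k using that c by auto
  have fl: "lin R TF P ?f" by (rule free_map_lin[OF P bc])
  have fb: "?f (free_basis R ?X (x, y)) = b x y" if "x \<in> carrier M" "y \<in> carrier N" for x y
    using free_map_basis[where u = "\<lambda>(x, y). b x y", OF P bc, of ?X "(x, y)"] that by simp
  have S: "?f u = \<zero>\<^bsub>P\<^esub>" if "u \<in> tensor_relations R M N" for u
    using that c P unfolding tensor_relations_def Let_def
    by (auto simp: lin_rules(6)[OF fl] lin_rules(2)[OF fl] lin_rules(3)[OF fl] fb b1 b2 b3 b4 mm_minus_self)
  have "\<exists>g. lin R (mod_quot TF TR) P g \<and> (\<forall>u\<in>carrier TF. g (TR +>\<^bsub>TF\<^esub> u) = ?f u)"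
  proof (rule lin_induced[OF free_module_module quot_module[OF tensor_sub free_module_module] P
      quot_lin[OF tensor_sub free_module_module] quot_ops(1)[OF tensor_sub free_module_module, symmetric] fl])
    fix u assume u: "u \<in> carrier TF" "TR +>\<^bsub>TF\<^esub> u = \<zero>\<^bsub>mod_quot TF TR\<^esub>"
    show "?f u = \<zero>\<^bsub>P\<^esub>"
      by (rule mod_span_lin_zero[OF fl free_module_module P tensor_relations_carrier S])
        (use u quot_zero_iff[OF tensor_sub free_module_module u(1)] in auto)
  qed
  then obtain g where g: "lin R (mod_quot TF TR) P g" "\<forall>u\<in>carrier TF. g (TR +>\<^bsub>TF\<^esub> u) = ?f u" by blast
  have "g (tns R M N x y) = b x y" if "x \<in> carrier M" "y \<in> carrier N" for x y
    using g(2) fb[OF that] that by (simp add: tns_def)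
  then show ?thesis using g(1) unfolding tensor_eq by blast
qed

end

lemma coord_lin: "s < q \<Longrightarrow> lin R (fr q) (ring_module R) (\<lambda>x. x s)"
  unfolding free_module_def by (rule lin_component) simp

text \<open>A linear map on R^q is the sum of the maps that multiply a coordinate into the value on
  the corresponding basis vector. The clause \<open>cong\<close> is needed because maps that agree
  on the carrier may still be different functions.\<close>

lemma lin_fr_induct:
  assumes N: "module R N" and w: "lin R (fr q) N w" and zero: "P (\<lambda>_. \<zero>\<^bsub>N\<^esub>)"
    and add: "\<And>f g. lin R (fr q) N f \<Longrightarrow> lin R (fr q) N g \<Longrightarrow> P f \<Longrightarrow> P g \<Longrightarrow> P (\<lambda>x. f x \<oplus>\<^bsub>N\<^esub> g x)"
    and coord: "\<And>s y. s < q \<Longrightarrow> y \<in> carrier N \<Longrightarrow> P (\<lambda>x. x s \<odot>\<^bsub>N\<^esub> y)"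
    and cong: "\<And>f g. lin R (fr q) N f \<Longrightarrow> P f \<Longrightarrow> (\<And>x. x \<in> carrier (fr q) \<Longrightarrow> f x = g x) \<Longrightarrow> P g"
  shows "P w"
proof -
  let ?e = "free_basis R {..<q}"
  have wc: "w (?e s) \<in> carrier N" if "s < q" for s using lin_rules(1)[OF w] that by simp
  \<comment> \<open>The partial sum over the first \<open>j\<close> coordinates, characterised by
    its values on the basis.\<close>
  have "\<exists>f. lin R (fr q) N f \<and> P f \<and> (\<forall>s<q. f (?e s) = (if s < j then w (?e s) else \<zero>\<^bsub>N\<^esub>))" if "j \<le> q" for j
    using that
  proof (induction j)
    case 0
    then show ?case using zero lin_zero[OF N] by (intro exI[of _ "\<lambda>_. \<zero>\<^bsub>N\<^esub>"]) simp
  next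
    case (Suc j)
    then obtain f where f: "lin R (fr q) N f" "P f" "\<forall>s<q. f (?e s) = (if s < j then w (?e s) else \<zero>\<^bsub>N\<^esub>)" by auto
    let ?g = "\<lambda>x. x j \<odot>\<^bsub>N\<^esub> w (?e j)"
    have j: "j < q" using Suc by simp
    have g: "lin R (fr q) N ?g" by (rule lin_comp[OF coord_lin[OF j] lin_smult_elt[OF N wc[OF j]]])
    have "f (?e s) \<oplus>\<^bsub>N\<^esub> ?g (?e s) = (if s < Suc j then w (?e s) else \<zero>\<^bsub>N\<^esub>)" if s: "s < q" for s
      using f(3) wc[OF s] wc[OF j] s j N by (auto simp: free_basis_def sum_inj_def less_Suc_eq)
    then show ?case using lin_add[OF N f(1) g] add[OF f(1) g f(2) coord[OF j wc[OF j]]]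
      by (intro exI[of _ "\<lambda>x. f x \<oplus>\<^bsub>N\<^esub> ?g x"]) simp
  qed
  from this[of q] obtain f where f: "lin R (fr q) N f" "P f" "\<forall>s<q. f (?e s) = w (?e s)" by auto
  show ?thesis
    by (rule cong[OF f(1,2)], rule free_lin_ext[OF N f(1) w]) (use f(3) in auto)
qed

end

text \<open>Right exactness in the top degree: Ext^p(M, X) is a quotient of Hom(F_p, X) for every X,
  and for finite free F_i tensoring Hom(F_i, R) with \<open>H\<close> gives Hom(F_i, H).\<close>

locale top_ext = adic_res R I M r d v
  for R (structure) and I :: "'a set" and M :: "('a, 'c, 'm) module_scheme" and r :: "nat \<Rightarrow> nat"
    and d :: "nat \<Rightarrow> (nat \<Rightarrow> 'a) \<Rightarrow> nat \<Rightarrow> 'a" and v :: "(nat \<Rightarrow> 'a) \<Rightarrow> 'c" +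
  fixes p :: nat and H :: "('a, 'h, 'k) module_scheme" and E :: "('a, 'e, 'o) module_scheme"
    and ER :: "('a, 'f, 'l) module_scheme" and \<phi>E \<phi>R
  assumes rp: "\<And>i. i > p \<Longrightarrow> r i = 0" and H [simp]: "module R H" and E [simp]: "module R E" and ER [simp]: "module R ER"
    and \<phi>E: "presents R H FC p E \<phi>E" and \<phi>R: "presents R (ring_module R) FC p ER \<phi>R"
begin

sublocale FC: pro_res R FC "\<lambda>_. M" "\<lambda>_ _ y. y"
  by (rule const_pro_res[OF res M])

lemmas PE = FC.presents_rules[OF \<phi>E H E]
lemmas PR = FC.presents_rules[OF \<phi>R ring_module_module ER]

lemma cocyc_top:
  assumes X: "module R X"
  shows "cocyc R X FC m p h \<longleftrightarrow> lin R (fr (r p)) X h"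
proof -
  have "r (Suc p) = 0" by (rule rp) simp
  then have "x = \<zero>\<^bsub>fr (r (Suc p))\<^esub>" if "x \<in> carrier (fr (r (Suc p)))" for x
    using that by (auto simp: free_module_def direct_sum_simps)
  then have "d p x = \<zero>\<^bsub>fr (r p)\<^esub>" if "x \<in> carrier (fr (r (Suc p)))" for x
    using that lin_rules(4)[OF F(3)[of p]] by simp
  then show ?thesis using lin_rules(4)[OF _ free_module_module X] by (auto simp: cocyc_def)
qed

lemmas cocyc_FC = cocyc_top[OF H] cocyc_top[OF ring_module_module]

lemma cobd_FC: "cobd R X FC m p h \<longleftrightarrow> cobd R X FC 0 p h"
  by (cases p) (simp_all add: cobd_def)

lemma
  assumes \<phi>: "presents R X FC p Y \<phi>" and X: "module R X" and Y: "module R Y"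
  shows top_zero: "lin R (fr (r p)) X h \<Longrightarrow> \<phi> 0 h = \<zero>\<^bsub>Y\<^esub> \<longleftrightarrow> cobd R X FC 0 p h"
    and top_surj: "y \<in> carrier Y \<Longrightarrow> \<exists>h. lin R (fr (r p)) X h \<and> \<phi> 0 h = y"
proof -
  note P = FC.presents_rules[OF \<phi> X Y]
  show "\<phi> 0 h = \<zero>\<^bsub>Y\<^esub> \<longleftrightarrow> cobd R X FC 0 p h" if "lin R (fr (r p)) X h"
    using P(6)[of 0 h] cobd_FC[of X _ h] that by (auto simp: cocyc_top[OF X])
  assume y: "y \<in> carrier Y"
  obtain m h where h: "cocyc R X FC m p h" "\<phi> m h = y" by (rule FC.presents_surj[OF \<phi> y])
  then have "lin R (fr (r p)) X h" by (simp add: cocyc_top[OF X])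
  then show "\<exists>h. lin R (fr (r p)) X h \<and> \<phi> 0 h = y" using P(5)[of 0 h m] h(2) by (auto simp: cocyc_top[OF X])
qed

lemmas \<phi>E_zero = top_zero[OF \<phi>E H E] and \<phi>R_zero = top_zero[OF \<phi>R ring_module_module ER]
lemmas \<phi>E_surj = top_surj[OF \<phi>E H E] and \<phi>R_surj = top_surj[OF \<phi>R ring_module_module ER]

lemma scale_lin: "lin R X (ring_module R) f \<Longrightarrow> y \<in> carrier H \<Longrightarrow> lin R X H (\<lambda>x. f x \<odot>\<^bsub>H\<^esub> y)"
  by (rule lin_comp[OF _ lin_smult_elt[OF H]])

lemma scale_zero:
  assumes f: "cobd R (ring_module R) FC 0 p f" and y: "y \<in> carrier H"
  shows "cobd R H FC 0 p (\<lambda>x. f x \<odot>\<^bsub>H\<^esub> y)"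
proof (cases p)
  case 0
  then show ?thesis using f y by (simp add: cobd_def)
next
  case (Suc q)
  then obtain g where g: "lin R (fr (r q)) (ring_module R) g" "\<forall>x\<in>carrier (fr (r p)). f x = g (d q x)"
    using f by (auto simp: cobd_def)
  then show ?thesis
    using scale_lin[OF g(1) y] Suc by (auto simp: cobd_def intro!: exI[of _ "\<lambda>z. g z \<odot>\<^bsub>H\<^esub> y"])
qed

text \<open>The assignment of f y to the pair of f and y respects classes in Ext^p(M, R): if f
  composes a map on F_(p-1) with the differential, so does f y.\<close>

lemma scale_cong:
  assumes f: "lin R (fr (r p)) (ring_module R) f" "lin R (fr (r p)) (ring_module R) f'"
    and eq: "\<phi>R 0 f = \<phi>R 0 f'" and y: "y \<in> carrier H"
  shows "\<phi>E 0 (\<lambda>x. f x \<odot>\<^bsub>H\<^esub> y) = \<phi>E 0 (\<lambda>x. f' x \<odot>\<^bsub>H\<^esub> y)"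
proof -
  let ?g = "\<lambda>x. f x \<ominus>\<^bsub>ring_module R\<^esub> f' x"
  have g: "lin R (fr (r p)) (ring_module R) ?g" by (rule lin_minus[OF ring_module_module f])
  have fc: "f x \<in> carrier R" "f' x \<in> carrier R" if "x \<in> carrier (fr (r p))" for x
    using lin_rules(1)[OF f(1) that] lin_rules(1)[OF f(2) that] by simp_all
  have gf: "f x = ?g x \<oplus>\<^bsub>ring_module R\<^esub> f' x" if "x \<in> carrier (fr (r p))" for x
    using fc[OF that] mm_minus_add_cancel[OF ring_module_module, of "f x" "f' x"] by simp
  have "\<phi>R 0 f = \<phi>R 0 (\<lambda>x. ?g x \<oplus>\<^bsub>ring_module R\<^esub> f' x)"
    by (rule PR(2)) (use f(1) gf in \<open>simp_all add: cocyc_FC\<close>)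
  also have "\<dots> = \<phi>R 0 ?g \<oplus>\<^bsub>ER\<^esub> \<phi>R 0 f'" by (rule PR(3)) (use g f(2) in \<open>simp_all add: cocyc_FC\<close>)
  finally have "\<phi>R 0 f' = \<phi>R 0 ?g \<oplus>\<^bsub>ER\<^esub> \<phi>R 0 f'" using eq by simp
  moreover have "\<phi>R 0 ?g \<in> carrier ER" "\<phi>R 0 f' \<in> carrier ER" using PR(1) g f(2) by (simp_all add: cocyc_FC)
  ultimately have "\<phi>R 0 ?g = \<zero>\<^bsub>ER\<^esub>"
    by (metis (no_types, lifting) ER a_minus_def mm_assoc mm_neg mm_r_neg mm_r_zero)
  then have "cobd R H FC 0 p (\<lambda>x. ?g x \<odot>\<^bsub>H\<^esub> y)" using scale_zero[OF _ y] \<phi>R_zero[OF g] by simp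
  moreover have "?g x \<odot>\<^bsub>H\<^esub> y \<oplus>\<^bsub>H\<^esub> f' x \<odot>\<^bsub>H\<^esub> y = f x \<odot>\<^bsub>H\<^esub> y" if x: "x \<in> carrier (fr (r p))" for x
  proof -
    have "?g x \<in> carrier R" using lin_rules(1)[OF g x] by simp
    then show ?thesis using gf[OF x] fc[OF x] y mm_add_smult[OF H, of "?g x" "f' x" y] by simp
  qed
  ultimately have z: "\<phi>E 0 (\<lambda>x. ?g x \<odot>\<^bsub>H\<^esub> y) = \<zero>\<^bsub>E\<^esub>" "\<And>x. x \<in> carrier (fr (r p)) \<Longrightarrow> f x \<odot>\<^bsub>H\<^esub> y = ?g x \<odot>\<^bsub>H\<^esub> y \<oplus>\<^bsub>H\<^esub> f' x \<odot>\<^bsub>H\<^esub> y"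
    using \<phi>E_zero[OF scale_lin[OF g y]] by simp_all
  have "\<phi>E 0 (\<lambda>x. f x \<odot>\<^bsub>H\<^esub> y) = \<phi>E 0 (\<lambda>x. ?g x \<odot>\<^bsub>H\<^esub> y \<oplus>\<^bsub>H\<^esub> f' x \<odot>\<^bsub>H\<^esub> y)"
    by (rule PE(2)) (use z(2) scale_lin[OF f(1) y] in \<open>simp_all add: cocyc_FC\<close>)
  also have "\<dots> = \<phi>E 0 (\<lambda>x. ?g x \<odot>\<^bsub>H\<^esub> y) \<oplus>\<^bsub>E\<^esub> \<phi>E 0 (\<lambda>x. f' x \<odot>\<^bsub>H\<^esub> y)"
    by (rule PE(3)) (use scale_lin[OF g y] scale_lin[OF f(2) y] in \<open>simp_all add: cocyc_FC\<close>)
  finally show ?thesis using z(1) PE(1)[of 0 "\<lambda>x. f' x \<odot>\<^bsub>H\<^esub> y"] scale_lin[OF f(2) y] by (simp add: cocyc_FC)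
qed

abbreviation "ET \<equiv> tensor R ER H"

lemmas ET_module [simp] = tensor_module[OF ER H]
lemmas tnsE = tns_bilinear[OF ER H]

lemma tns_zero: "y \<in> carrier H \<Longrightarrow> tns R ER H \<zero>\<^bsub>ER\<^esub> y = \<zero>\<^bsub>ET\<^esub>"
  using tnsE(3)[of \<zero> "\<zero>\<^bsub>ER\<^esub>" y] tns_carrier[OF ER H, of "\<zero>\<^bsub>ER\<^esub>" y] by simp

text \<open>The sum over s of the class of the s-th coordinate function tensored with h(e_s). It is
  the inverse of the isomorphism from Hom(F_p, R) (x) H to Hom(F_p, H), followed by the projection
  of Hom(F_p, R) onto Ext^p(M, R).\<close>

definition \<Phi> :: "((nat \<Rightarrow> 'a) \<Rightarrow> 'h) \<Rightarrow> ('f \<times> 'h \<Rightarrow> 'a) set" where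
  "\<Phi> h = ds_map {..<r p} (\<lambda>_. H) ET (\<lambda>s. tns R ER H (\<phi>R 0 (\<lambda>x. x s))) (\<lambda>s\<in>{..<r p}. h (free_basis R {..<r p} s))"

lemma tns_lin: "\<xi> \<in> carrier ER \<Longrightarrow> lin R H ET (tns R ER H \<xi>)"
  using tnsE tns_carrier[OF ER H] by (intro linI) auto

lemma \<phi>R_coord: "s < r p \<Longrightarrow> \<phi>R 0 (\<lambda>x. x s) \<in> carrier ER"
  using PR(1) coord_lin[of s "r p"] by (simp add: cocyc_FC)

lemma \<Phi>_lin: "lin R (mpow (r p) H) ET (ds_map {..<r p} (\<lambda>_. H) ET (\<lambda>s. tns R ER H (\<phi>R 0 (\<lambda>x. x s))))"
  by (rule ds_map_lin) (auto intro!: tns_lin \<phi>R_coord)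

lemma \<Phi>_arg: "lin R (fr (r p)) H h \<Longrightarrow> (\<lambda>s\<in>{..<r p}. h (free_basis R {..<r p} s)) \<in> carrier (mpow (r p) H)"
  using lin_rules(1)[of "fr (r p)" H h] by (auto simp: mpow_carrier)

lemma \<Phi>_rules:
  assumes h: "lin R (fr (r p)) H h"
  shows "\<Phi> h \<in> carrier ET"
    and "(\<And>x. x \<in> carrier (fr (r p)) \<Longrightarrow> h x = h' x) \<Longrightarrow> \<Phi> h = \<Phi> h'"
    and "lin R (fr (r p)) H h' \<Longrightarrow> \<Phi> (\<lambda>x. h x \<oplus>\<^bsub>H\<^esub> h' x) = \<Phi> h \<oplus>\<^bsub>ET\<^esub> \<Phi> h'"
    and "a \<in> carrier R \<Longrightarrow> \<Phi> (\<lambda>x. a \<odot>\<^bsub>H\<^esub> h x) = a \<odot>\<^bsub>ET\<^esub> \<Phi> h"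
proof -
  note L = lin_rules[OF \<Phi>_lin] and A = \<Phi>_arg[OF h]
  show "\<Phi> h \<in> carrier ET" unfolding \<Phi>_def by (rule L(1)[OF A])
  show "\<Phi> h = \<Phi> h'" if "\<And>x. x \<in> carrier (fr (r p)) \<Longrightarrow> h x = h' x"
    unfolding \<Phi>_def by (rule arg_cong[of _ _ "ds_map _ _ _ _"], rule restrict_ext) (use that in simp)
  show "\<Phi> (\<lambda>x. h x \<oplus>\<^bsub>H\<^esub> h' x) = \<Phi> h \<oplus>\<^bsub>ET\<^esub> \<Phi> h'" if "lin R (fr (r p)) H h'"
    unfolding \<Phi>_def L(2)[OF A \<Phi>_arg[OF that], symmetric]
    by (rule arg_cong[of _ _ "ds_map _ _ _ _"]) (auto simp: direct_sum_simps(3) fun_eq_iff)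
  show "\<Phi> (\<lambda>x. a \<odot>\<^bsub>H\<^esub> h x) = a \<odot>\<^bsub>ET\<^esub> \<Phi> h" if "a \<in> carrier R"
    unfolding \<Phi>_def L(3)[OF that A, symmetric]
    by (rule arg_cong[of _ _ "ds_map _ _ _ _"]) (auto simp: direct_sum_simps(4) fun_eq_iff)
qed

lemma \<Phi>_zero: "\<Phi> (\<lambda>_. \<zero>\<^bsub>H\<^esub>) = \<zero>\<^bsub>ET\<^esub>"
proof -
  have "(\<lambda>s\<in>{..<r p}. \<zero>\<^bsub>H\<^esub>) = \<zero>\<^bsub>mpow (r p) H\<^esub>" by (simp add: direct_sum_simps)
  then show ?thesis unfolding \<Phi>_def using lin_rules(4)[OF \<Phi>_lin] by simp
qed

text \<open>By additivity in \<open>f\<close> it suffices to take a coordinate function times a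
  scalar, and the scalar moves across the tensor sign.\<close>

lemma \<Phi>_scale:
  assumes f: "lin R (fr (r p)) (ring_module R) f" and y: "y \<in> carrier H"
  shows "\<Phi> (\<lambda>x. f x \<odot>\<^bsub>H\<^esub> y) = tns R ER H (\<phi>R 0 f) y"
proof (rule lin_fr_induct[OF ring_module_module f, where P = "\<lambda>f. \<Phi> (\<lambda>x. f x \<odot>\<^bsub>H\<^esub> y) = tns R ER H (\<phi>R 0 f) y"])
  have z: "lin R (fr (r p)) (ring_module R) (\<lambda>_. \<zero>)" using lin_zero[OF ring_module_module] by simp
  have "cobd R (ring_module R) FC 0 p (\<lambda>_. \<zero>)" using FC.cobd_zero[OF ring_module_module] by simp
  then have "\<phi>R 0 (\<lambda>_. \<zero>) = \<zero>\<^bsub>ER\<^esub>" using \<phi>R_zero[OF z] by simp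
  then show "\<Phi> (\<lambda>x. \<zero>\<^bsub>ring_module R\<^esub> \<odot>\<^bsub>H\<^esub> y) = tns R ER H (\<phi>R 0 (\<lambda>_. \<zero>\<^bsub>ring_module R\<^esub>)) y"
    using \<Phi>_zero tns_zero[OF y] y by simp
next
  fix f g assume f: "lin R (fr (r p)) (ring_module R) f" and g: "lin R (fr (r p)) (ring_module R) g"
    and e: "\<Phi> (\<lambda>x. f x \<odot>\<^bsub>H\<^esub> y) = tns R ER H (\<phi>R 0 f) y" "\<Phi> (\<lambda>x. g x \<odot>\<^bsub>H\<^esub> y) = tns R ER H (\<phi>R 0 g) y"
  have fg: "lin R (fr (r p)) (ring_module R) (\<lambda>x. f x \<oplus>\<^bsub>ring_module R\<^esub> g x)" by (rule lin_add[OF ring_module_module f g])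
  have fgc: "f x \<in> carrier R" "g x \<in> carrier R" if "x \<in> carrier (fr (r p))" for x
    using lin_rules(1)[OF f that] lin_rules(1)[OF g that] by simp_all
  have "\<Phi> (\<lambda>x. (f x \<oplus>\<^bsub>ring_module R\<^esub> g x) \<odot>\<^bsub>H\<^esub> y) = \<Phi> (\<lambda>x. f x \<odot>\<^bsub>H\<^esub> y \<oplus>\<^bsub>H\<^esub> g x \<odot>\<^bsub>H\<^esub> y)"
    by (rule \<Phi>_rules(2)[OF scale_lin[OF fg y]]) (use fgc y in \<open>simp add: mm_add_smult\<close>)
  also have "\<dots> = tns R ER H (\<phi>R 0 f) y \<oplus>\<^bsub>ET\<^esub> tns R ER H (\<phi>R 0 g) y"
    using \<Phi>_rules(3)[OF scale_lin[OF f y] scale_lin[OF g y]] e by simp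
  also have "\<dots> = tns R ER H (\<phi>R 0 f \<oplus>\<^bsub>ER\<^esub> \<phi>R 0 g) y"
    using tnsE(1)[of "\<phi>R 0 f" "\<phi>R 0 g" y] PR(1)[of 0 f] PR(1)[of 0 g] f g y by (simp add: cocyc_FC)
  also have "\<phi>R 0 f \<oplus>\<^bsub>ER\<^esub> \<phi>R 0 g = \<phi>R 0 (\<lambda>x. f x \<oplus>\<^bsub>ring_module R\<^esub> g x)"
    using PR(3)[of 0 f g] f g by (simp add: cocyc_FC)
  finally show "\<Phi> (\<lambda>x. (f x \<oplus>\<^bsub>ring_module R\<^esub> g x) \<odot>\<^bsub>H\<^esub> y) = tns R ER H (\<phi>R 0 (\<lambda>x. f x \<oplus>\<^bsub>ring_module R\<^esub> g x)) y" .
next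
  fix s c assume s: "s < r p" and "c \<in> carrier (ring_module R)"
  then have c: "c \<in> carrier R" by simp
  let ?x = "\<lambda>x. x s \<odot>\<^bsub>ring_module R\<^esub> c"
  have cl: "lin R (fr (r p)) (ring_module R) ?x" by (rule lin_comp[OF coord_lin[OF s] lin_smult_elt[OF ring_module_module]]) (use c in simp)
  have "(\<lambda>t\<in>{..<r p}. ?x (free_basis R {..<r p} t) \<odot>\<^bsub>H\<^esub> y) = sum_inj {..<r p} (\<lambda>_. H) s (c \<odot>\<^bsub>H\<^esub> y)"
    using s c y by (auto simp: free_basis_def sum_inj_def fun_eq_iff)
  then have "\<Phi> (\<lambda>x. ?x x \<odot>\<^bsub>H\<^esub> y) = tns R ER H (\<phi>R 0 (\<lambda>x. x s)) (c \<odot>\<^bsub>H\<^esub> y)"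
    unfolding \<Phi>_def using ds_map_inj[of "{..<r p}" "\<lambda>_. H" ET "\<lambda>s. tns R ER H (\<phi>R 0 (\<lambda>x. x s))" s "c \<odot>\<^bsub>H\<^esub> y"]
      tns_lin[OF \<phi>R_coord] s c y by simp
  also have "\<dots> = tns R ER H (c \<odot>\<^bsub>ER\<^esub> \<phi>R 0 (\<lambda>x. x s)) y" using tnsE(3,4)[OF c \<phi>R_coord[OF s] y] by simp
  also have "c \<odot>\<^bsub>ER\<^esub> \<phi>R 0 (\<lambda>x. x s) = \<phi>R 0 (\<lambda>x. c \<odot>\<^bsub>ring_module R\<^esub> x s)"
    using PR(4)[of 0 "\<lambda>x. x s" c] coord_lin[OF s] c by (simp add: cocyc_FC)
  also have "\<dots> = \<phi>R 0 ?x"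
    by (rule PR(2)) (use lin_smult[OF ring_module_module coord_lin[OF s] c] s c R.m_comm in \<open>simp_all add: cocyc_FC\<close>)
  finally show "\<Phi> (\<lambda>x. ?x x \<odot>\<^bsub>H\<^esub> y) = tns R ER H (\<phi>R 0 ?x) y" .
next
  fix f g assume f: "lin R (fr (r p)) (ring_module R) f" and e: "\<Phi> (\<lambda>x. f x \<odot>\<^bsub>H\<^esub> y) = tns R ER H (\<phi>R 0 f) y"
    and fg: "\<And>x. x \<in> carrier (fr (r p)) \<Longrightarrow> f x = g x"
  have "\<Phi> (\<lambda>x. f x \<odot>\<^bsub>H\<^esub> y) = \<Phi> (\<lambda>x. g x \<odot>\<^bsub>H\<^esub> y)" by (rule \<Phi>_rules(2)[OF scale_lin[OF f y]]) (simp add: fg)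
  moreover have "\<phi>R 0 f = \<phi>R 0 g" by (rule PR(2)) (use f fg in \<open>simp_all add: cocyc_FC\<close>)
  ultimately show "\<Phi> (\<lambda>x. g x \<odot>\<^bsub>H\<^esub> y) = tns R ER H (\<phi>R 0 g) y" using e by simp
qed

text \<open>By additivity the map \<open>w\<close> on F_(p-1) may be taken as a coordinate times an
  element y. Then \<open>w\<close> composed with the differential is a coboundary with values in R
  times y, and its image is a zero class tensored with y.\<close>

lemma \<Phi>_cobd:
  assumes h: "lin R (fr (r p)) H h" and c: "cobd R H FC 0 p h"
  shows "\<Phi> h = \<zero>\<^bsub>ET\<^esub>"
proof (cases p)
  case 0
  then have "\<Phi> h = \<Phi> (\<lambda>_. \<zero>\<^bsub>H\<^esub>)" using c by (intro \<Phi>_rules(2)[OF h]) (simp add: cobd_def)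
  then show ?thesis using \<Phi>_zero by simp
next
  case (Suc q)
  have dl: "lin R (fr (r p)) (fr (r q)) (d q)" using F(3)[of q] Suc by simp
  obtain w where w: "lin R (fr (r q)) H w" "\<And>x. x \<in> carrier (fr (r p)) \<Longrightarrow> h x = w (d q x)"
    using c Suc by (auto simp: cobd_def)
  have "\<Phi> (\<lambda>x. w (d q x)) = \<zero>\<^bsub>ET\<^esub>"
  proof (rule lin_fr_induct[OF H w(1), where P = "\<lambda>w. \<Phi> (\<lambda>x. w (d q x)) = \<zero>\<^bsub>ET\<^esub>"])
    show "\<Phi> (\<lambda>x. \<zero>\<^bsub>H\<^esub>) = \<zero>\<^bsub>ET\<^esub>" by (rule \<Phi>_zero)
    show "\<Phi> (\<lambda>x. f (d q x) \<oplus>\<^bsub>H\<^esub> g (d q x)) = \<zero>\<^bsub>ET\<^esub>"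
      if "lin R (fr (r q)) H f" "lin R (fr (r q)) H g" "\<Phi> (\<lambda>x. f (d q x)) = \<zero>\<^bsub>ET\<^esub>" "\<Phi> (\<lambda>x. g (d q x)) = \<zero>\<^bsub>ET\<^esub>" for f g
      using \<Phi>_rules(3)[OF lin_comp[OF dl that(1)] lin_comp[OF dl that(2)]] that(3,4) by simp
    show "\<Phi> (\<lambda>x. g (d q x)) = \<zero>\<^bsub>ET\<^esub>"
      if "lin R (fr (r q)) H f" "\<Phi> (\<lambda>x. f (d q x)) = \<zero>\<^bsub>ET\<^esub>" "\<And>x. x \<in> carrier (fr (r q)) \<Longrightarrow> f x = g x" for f g
      using \<Phi>_rules(2)[OF lin_comp[OF dl that(1)], of "\<lambda>x. g (d q x)"] that(2,3) lin_rules(1)[OF dl] by simp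
    fix s y assume s: "s < r q" and y: "y \<in> carrier H"
    have l: "lin R (fr (r p)) (ring_module R) (\<lambda>x. d q x s)" by (rule lin_comp[OF dl coord_lin[OF s]])
    have "cobd R (ring_module R) FC 0 p (\<lambda>x. d q x s)" using coord_lin[OF s] Suc by (auto simp: cobd_def)
    then have "\<phi>R 0 (\<lambda>x. d q x s) = \<zero>\<^bsub>ER\<^esub>" using \<phi>R_zero[OF l] by simp
    then show "\<Phi> (\<lambda>x. d q x s \<odot>\<^bsub>H\<^esub> y) = \<zero>\<^bsub>ET\<^esub>" using \<Phi>_scale[OF l y] tns_zero[OF y] by simp
  qed
  moreover have "\<Phi> h = \<Phi> (\<lambda>x. w (d q x))" by (rule \<Phi>_rules(2)[OF h w(2)])
  ultimately show ?thesis by simp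
qed

lemma tensor_to_Ext:
  "\<exists>g. lin R ET E g \<and> (\<forall>f y. lin R (fr (r p)) (ring_module R) f \<longrightarrow> y \<in> carrier H \<longrightarrow>
    g (tns R ER H (\<phi>R 0 f) y) = \<phi>E 0 (\<lambda>x. f x \<odot>\<^bsub>H\<^esub> y))"
proof -
  have "\<forall>\<xi>\<in>carrier ER. \<exists>f. lin R (fr (r p)) (ring_module R) f \<and> \<phi>R 0 f = \<xi>" using \<phi>R_surj by blast
  \<comment> \<open>Representatives of all classes in Ext^p(M, R). They need not be chosen linearly,
    since \<open>scale_cong\<close> makes \<open>b\<close> independent of the choice.\<close>
  from bchoice[OF this] obtain sel where sel: "\<And>\<xi>. \<xi> \<in> carrier ER \<Longrightarrow> lin R (fr (r p)) (ring_module R) (sel \<xi>)"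
    "\<And>\<xi>. \<xi> \<in> carrier ER \<Longrightarrow> \<phi>R 0 (sel \<xi>) = \<xi>" by blast
  define b where "b \<xi> y = \<phi>E 0 (\<lambda>x. sel \<xi> x \<odot>\<^bsub>H\<^esub> y)" for \<xi> y
  have b: "b \<xi> y = \<phi>E 0 (\<lambda>x. f x \<odot>\<^bsub>H\<^esub> y)"
    if "\<xi> \<in> carrier ER" "y \<in> carrier H" "lin R (fr (r p)) (ring_module R) f" "\<phi>R 0 f = \<xi>" for \<xi> y f
    unfolding b_def by (rule scale_cong[OF sel(1)[OF that(1)] that(3) _ that(2)]) (use that sel in simp)
  have sc: "sel \<xi> x \<in> carrier R" if "\<xi> \<in> carrier ER" "x \<in> carrier (fr (r p))" for \<xi> x
    using lin_rules(1)[OF sel(1)[OF that(1)] that(2)] by simp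
  have cc: "cocyc R H FC 0 p (\<lambda>x. sel \<xi> x \<odot>\<^bsub>H\<^esub> y)" if "\<xi> \<in> carrier ER" "y \<in> carrier H" for \<xi> y
    unfolding cocyc_FC by (rule scale_lin[OF sel(1)[OF that(1)] that(2)])
  have cr: "cocyc R (ring_module R) FC 0 p (sel \<xi>)" if "\<xi> \<in> carrier ER" for \<xi> unfolding cocyc_FC by (rule sel(1)[OF that])
  have "\<exists>g. lin R ET E g \<and> (\<forall>\<xi>\<in>carrier ER. \<forall>y\<in>carrier H. g (tns R ER H \<xi> y) = b \<xi> y)"
  proof (rule tensor_lift[OF ER H E])
    fix \<xi> y assume \<xi>: "\<xi> \<in> carrier ER" and y: "y \<in> carrier H"
    show "b \<xi> y \<in> carrier E" unfolding b_def by (rule PE(1)[OF cc[OF \<xi> y]])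
    show "b (\<xi> \<oplus>\<^bsub>ER\<^esub> \<xi>') y = b \<xi> y \<oplus>\<^bsub>E\<^esub> b \<xi>' y" if \<xi>': "\<xi>' \<in> carrier ER" for \<xi>'
    proof -
      let ?f = "\<lambda>x. sel \<xi> x \<oplus>\<^bsub>ring_module R\<^esub> sel \<xi>' x"
      have f: "lin R (fr (r p)) (ring_module R) ?f" by (rule lin_add[OF ring_module_module sel(1)[OF \<xi>] sel(1)[OF \<xi>']])
      have "\<phi>R 0 ?f = \<xi> \<oplus>\<^bsub>ER\<^esub> \<xi>'" using PR(3)[OF cr[OF \<xi>] cr[OF \<xi>']] sel(2) \<xi> \<xi>' by simp
      then have "b (\<xi> \<oplus>\<^bsub>ER\<^esub> \<xi>') y = \<phi>E 0 (\<lambda>x. ?f x \<odot>\<^bsub>H\<^esub> y)" using b[OF _ y f] \<xi> \<xi>' by simp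
      also have "\<dots> = \<phi>E 0 (\<lambda>x. sel \<xi> x \<odot>\<^bsub>H\<^esub> y \<oplus>\<^bsub>H\<^esub> sel \<xi>' x \<odot>\<^bsub>H\<^esub> y)"
        by (rule PE(2)) (use scale_lin[OF f y] sc \<xi> \<xi>' y in \<open>simp_all add: cocyc_FC mm_add_smult\<close>)
      finally show ?thesis using PE(3)[OF cc[OF \<xi> y] cc[OF \<xi>' y]] by (simp add: b_def)
    qed
    show "b \<xi> (y \<oplus>\<^bsub>H\<^esub> y') = b \<xi> y \<oplus>\<^bsub>E\<^esub> b \<xi> y'" if y': "y' \<in> carrier H" for y'
    proof -
      have yy: "y \<oplus>\<^bsub>H\<^esub> y' \<in> carrier H" using y y' by simp
      have "b \<xi> (y \<oplus>\<^bsub>H\<^esub> y') = \<phi>E 0 (\<lambda>x. sel \<xi> x \<odot>\<^bsub>H\<^esub> y \<oplus>\<^bsub>H\<^esub> sel \<xi> x \<odot>\<^bsub>H\<^esub> y')"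
        unfolding b_def by (rule PE(2)[OF cc[OF \<xi> yy]]) (use sc \<xi> y y' in \<open>simp add: mm_smult_add\<close>)
      then show ?thesis using PE(3)[OF cc[OF \<xi> y] cc[OF \<xi> y']] by (simp add: b_def)
    qed
    show "b (a \<odot>\<^bsub>ER\<^esub> \<xi>) y = a \<odot>\<^bsub>E\<^esub> b \<xi> y" if a: "a \<in> carrier R" for a
    proof -
      let ?f = "\<lambda>x. a \<odot>\<^bsub>ring_module R\<^esub> sel \<xi> x"
      have f: "lin R (fr (r p)) (ring_module R) ?f" by (rule lin_smult[OF ring_module_module sel(1)[OF \<xi>] a])
      have "\<phi>R 0 ?f = a \<odot>\<^bsub>ER\<^esub> \<xi>" using PR(4)[OF cr[OF \<xi>] a] sel(2) \<xi> by simp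
      then have "b (a \<odot>\<^bsub>ER\<^esub> \<xi>) y = \<phi>E 0 (\<lambda>x. ?f x \<odot>\<^bsub>H\<^esub> y)" using b[OF _ y f] \<xi> a by simp
      also have "\<dots> = \<phi>E 0 (\<lambda>x. a \<odot>\<^bsub>H\<^esub> (sel \<xi> x \<odot>\<^bsub>H\<^esub> y))"
        by (rule PE(2)) (use scale_lin[OF f y] sc \<xi> y a in \<open>simp_all add: cocyc_FC mm_smult_smult\<close>)
      finally show ?thesis using PE(4)[OF cc[OF \<xi> y] a] by (simp add: b_def)
    qed
    show "b \<xi> (a \<odot>\<^bsub>H\<^esub> y) = a \<odot>\<^bsub>E\<^esub> b \<xi> y" if a: "a \<in> carrier R" for a
    proof -
      have ay: "a \<odot>\<^bsub>H\<^esub> y \<in> carrier H" using a y by simp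
      have "b \<xi> (a \<odot>\<^bsub>H\<^esub> y) = \<phi>E 0 (\<lambda>x. a \<odot>\<^bsub>H\<^esub> (sel \<xi> x \<odot>\<^bsub>H\<^esub> y))"
        unfolding b_def by (rule PE(2)[OF cc[OF \<xi> ay]])
          (use sc \<xi> y a in \<open>simp add: mm_smult_smult[symmetric] R.m_comm\<close>)
      then show ?thesis using PE(4)[OF cc[OF \<xi> y] a] by (simp add: b_def)
    qed
  qed
  then obtain g where g: "lin R ET E g" "\<forall>\<xi>\<in>carrier ER. \<forall>y\<in>carrier H. g (tns R ER H \<xi> y) = b \<xi> y" by blast
  have "g (tns R ER H (\<phi>R 0 f) y) = \<phi>E 0 (\<lambda>x. f x \<odot>\<^bsub>H\<^esub> y)"
    if f: "lin R (fr (r p)) (ring_module R) f" and y: "y \<in> carrier H" for f y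
  proof -
    have "\<phi>R 0 f \<in> carrier ER" using PR(1)[of 0 f] f by (simp add: cocyc_FC)
    then show ?thesis using g(2) y b[OF _ y f] by simp
  qed
  then show ?thesis using g(1) by blast
qed

text \<open>Both sides are quotients of Hom(F_p, H), through \<open>\<phi>E 0\<close> and through
  \<open>\<Phi>\<close>. The kernel of the first lies in that of the second because
  \<open>\<Phi>\<close> kills coboundaries, and conversely because \<open>\<phi>E 0\<close> factors
  through \<open>\<Phi>\<close> by the map \<open>g\<close> on the tensor product.\<close>

theorem Ext_iso_tensor: "mod_iso R E ET"
proof -
  obtain g where g: "lin R ET E g"
    and gt: "\<And>f y. lin R (fr (r p)) (ring_module R) f \<Longrightarrow> y \<in> carrier H \<Longrightarrow>
      g (tns R ER H (\<phi>R 0 f) y) = \<phi>E 0 (\<lambda>x. f x \<odot>\<^bsub>H\<^esub> y)" using tensor_to_Ext by blast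
  have g\<Phi>: "g (\<Phi> h) = \<phi>E 0 h" if h: "lin R (fr (r p)) H h" for h
  proof (rule lin_fr_induct[OF H h, where P = "\<lambda>h. g (\<Phi> h) = \<phi>E 0 h"])
    show "g (\<Phi> (\<lambda>_. \<zero>\<^bsub>H\<^esub>)) = \<phi>E 0 (\<lambda>_. \<zero>\<^bsub>H\<^esub>)"
      using \<Phi>_zero lin_rules(4)[OF g] \<phi>E_zero[OF lin_zero[OF H]] FC.cobd_zero[OF H] by simp
    show "g (\<Phi> (\<lambda>x. f x \<oplus>\<^bsub>H\<^esub> f' x)) = \<phi>E 0 (\<lambda>x. f x \<oplus>\<^bsub>H\<^esub> f' x)"
      if f: "lin R (fr (r p)) H f" "lin R (fr (r p)) H f'" and e: "g (\<Phi> f) = \<phi>E 0 f" "g (\<Phi> f') = \<phi>E 0 f'" for f f'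
      using \<Phi>_rules(3)[OF f] lin_rules(2)[OF g \<Phi>_rules(1)[OF f(1)] \<Phi>_rules(1)[OF f(2)]] e PE(3)[of 0 f f'] f
      by (simp add: cocyc_FC)
    show "g (\<Phi> (\<lambda>x. x s \<odot>\<^bsub>H\<^esub> y)) = \<phi>E 0 (\<lambda>x. x s \<odot>\<^bsub>H\<^esub> y)" if s: "s < r p" and y: "y \<in> carrier H" for s y
      using \<Phi>_scale[OF coord_lin[OF s] y] gt[OF coord_lin[OF s] y] by simp
    show "g (\<Phi> f') = \<phi>E 0 f'" if f: "lin R (fr (r p)) H f" and e: "g (\<Phi> f) = \<phi>E 0 f"
      and eq: "\<And>x. x \<in> carrier (fr (r p)) \<Longrightarrow> f x = f' x" for f f'
    proof -
      have "\<Phi> f = \<Phi> f'" by (rule \<Phi>_rules(2)[OF f eq])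
      moreover have "\<phi>E 0 f = \<phi>E 0 f'" by (rule PE(2)) (use f eq in \<open>simp_all add: cocyc_FC\<close>)
      ultimately show ?thesis using e by simp
    qed
  qed
  let ?I = "{h. lin R (fr (r p)) H h}"
  show ?thesis
  proof (rule mod_iso_rel[OF E ET_module, where I = ?I and f = "\<phi>E 0" and g = \<Phi>])
    show "\<phi>E 0 h \<in> carrier E" if "h \<in> ?I" for h using PE(1)[of 0 h] that by (simp add: cocyc_FC)
    show "\<Phi> h \<in> carrier ET" if "h \<in> ?I" for h using \<Phi>_rules(1) that by simp
    show "\<exists>k\<in>?I. \<phi>E 0 k = \<phi>E 0 h \<oplus>\<^bsub>E\<^esub> \<phi>E 0 h' \<and> \<Phi> k = \<Phi> h \<oplus>\<^bsub>ET\<^esub> \<Phi> h'" if "h \<in> ?I" "h' \<in> ?I" for h h'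
      using that lin_add[OF H, of _ h h'] PE(3)[of 0 h h'] \<Phi>_rules(3)[of h h']
      by (intro bexI[of _ "\<lambda>x. h x \<oplus>\<^bsub>H\<^esub> h' x"]) (auto simp: cocyc_FC)
    show "\<exists>k\<in>?I. \<phi>E 0 k = a \<odot>\<^bsub>E\<^esub> \<phi>E 0 h \<and> \<Phi> k = a \<odot>\<^bsub>ET\<^esub> \<Phi> h" if "a \<in> carrier R" "h \<in> ?I" for a h
      using that lin_smult[OF H, of _ h a] PE(4)[of 0 h a] \<Phi>_rules(4)[of h a]
      by (intro bexI[of _ "\<lambda>x. a \<odot>\<^bsub>H\<^esub> h x"]) (auto simp: cocyc_FC)
    show "\<exists>h\<in>?I. \<phi>E 0 h = y" if "y \<in> carrier E" for y using \<phi>E_surj[OF that] by blast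
    show "\<exists>h\<in>?I. \<Phi> h = z" if z: "z \<in> carrier ET" for z
    proof (rule tensor_induct[OF ER H z, where P = "\<lambda>z. \<exists>h\<in>?I. \<Phi> h = z"])
      show "\<exists>h\<in>?I. \<Phi> h = \<zero>\<^bsub>ET\<^esub>" using \<Phi>_zero lin_zero[OF H] by blast
      show "\<exists>h\<in>?I. \<Phi> h = tns R ER H \<xi> y" if \<xi>: "\<xi> \<in> carrier ER" and y: "y \<in> carrier H" for \<xi> y
      proof -
        obtain f where f: "lin R (fr (r p)) (ring_module R) f" "\<phi>R 0 f = \<xi>" using \<phi>R_surj[OF \<xi>] by blast
        show ?thesis using \<Phi>_scale[OF f(1) y] scale_lin[OF f(1) y] f(2) by blast
      qed
      show "\<exists>h\<in>?I. \<Phi> h = u \<oplus>\<^bsub>ET\<^esub> w" if uw: "\<exists>h\<in>?I. \<Phi> h = u" "\<exists>h\<in>?I. \<Phi> h = w" for u w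
      proof -
        obtain h h' where h: "lin R (fr (r p)) H h" "lin R (fr (r p)) H h'" "\<Phi> h = u" "\<Phi> h' = w" using uw by blast
        then show ?thesis using \<Phi>_rules(3)[OF h(1,2)] lin_add[OF H h(1,2)] by blast
      qed
    qed
    show "\<phi>E 0 h = \<zero>\<^bsub>E\<^esub> \<longleftrightarrow> \<Phi> h = \<zero>\<^bsub>ET\<^esub>" if "h \<in> ?I" for h
    proof -
      have h: "lin R (fr (r p)) H h" using that by simp
      show ?thesis using \<phi>E_zero[OF h] \<Phi>_cobd[OF h] g\<Phi>[OF h] lin_rules(4)[OF g] by auto
    qed
  qed
qed

end

theorem corollary2p3:
  fixes R :: "('a, 'r) ring_scheme"
    and \<aa> :: "'a set"
    and M :: "('a, 'b, 'm) module_scheme"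
    and N :: "('a, 'c, 'n) module_scheme"
    and p :: nat
  assumes "noetherian_local_ring R"
    and "ideal \<aa> R"
    and "module R M" and "fin_gen R M"
    and "module R N" and "fin_gen R N"
    and "proj_dim R M = enat p"
  shows "(\<forall>i::nat. ereal (real p) + coh_dim R \<aa> N < ereal (real i)
            \<longrightarrow> zero_module (gen_local_cohomology R \<aa> i M N))
       \<and> (\<forall>n::nat. coh_dim R \<aa> N = ereal (real n)
            \<longrightarrow> mod_iso R (gen_local_cohomology R \<aa> (p + n) M N)
                          (Ext R p M (local_cohomology R \<aa> n N))
              \<and> mod_iso R (Ext R p M (local_cohomology R \<aa> n N))
                          (tensor R (Ext R p M (ring_module R)) (local_cohomology R \<aa> n N)))"
proof -
  have lm: "local_modules R"
    using assms(1) unfolding noetherian_local_ring_def local_modules_def local_modules_axioms_def noeth_modules_def modules_def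
    by blast
  interpret L: local_modules R by (rule lm)
  note M = assms(3) and N = assms(5)
  obtain r :: "nat \<Rightarrow> nat" and d v where res: "proj_resolution R M (\<lambda>i. free_module R {..<r i}) d v" and rp: "\<forall>i>p. r i = 0"
    using L.ex_finite_free_resolution[OF M assms(4) assms(7)] by blast
  interpret A: adic_res R \<aa> M r d v
    by (intro adic_res.intro adic_res_axioms.intro L.noeth_modules_axioms assms(2) M res)
  \<comment> \<open>A nonvanishing degree is bounded by the supremum; for the value minus infinity
    this covers all degrees.\<close>
  have zero: "zero_module (local_cohomology R \<aa> j N)" if "coh_dim R \<aa> N < ereal (real j)" for j
  proof (rule ccontr)
    assume "\<not> zero_module (local_cohomology R \<aa> j N)"
    then have "ereal (real j) \<le> coh_dim R \<aa> N" unfolding coh_dim_def by (intro SUP_upper) simp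
    then show False using that by simp
  qed
  show ?thesis
  proof (intro conjI allI impI)
    fix i :: nat assume i: "ereal (real p) + coh_dim R \<aa> N < ereal (real i)"
    show "zero_module (gen_local_cohomology R \<aa> i M N)"
    proof (rule A.gen_local_cohomology_vanishes[OF N])
      show "r l = 0" if "l > p" for l using rp that by simp
      fix l assume l: "l \<le> p" "l \<le> i"
      \<comment> \<open>From p + cd < i and l <= p one gets cd < i - l, so each column l meets only
        vanishing local cohomology. The case distinction treats the infinite values of the
        dimension.\<close>
      have "coh_dim R \<aa> N < ereal (real (i - l))"
        using i l by (cases "coh_dim R \<aa> N") auto
      then show "A.vanish N (i - l)" by (rule A.vanishI[OF N zero])
    qed
  next
    fix n :: nat assume n: "coh_dim R \<aa> N = ereal (real n)"
    let ?H = "local_cohomology R \<aa> n N" and ?HM = "gen_local_cohomology R \<aa> (p + n) M N"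
    note H = A.local_cohomology_presented(2)[OF N, of n]
    note E = L.ext_module[OF M H, of p] and ER = L.ext_module[OF M L.ring_module_module, of p]
    obtain \<phi>T where \<phi>T: "presents R N A.TT (p + n) ?HM \<phi>T" using A.gen_local_cohomology_presented(1)[OF N] by blast
    obtain \<phi>Q where \<phi>Q: "presents R N A.Q n ?H \<phi>Q" using A.local_cohomology_presented(1)[OF N] by blast
    obtain \<phi>E where \<phi>E: "presents R ?H A.FC p (Ext R p M ?H) \<phi>E" using A.Ext_presented[OF H] by blast
    obtain \<phi>R where \<phi>R: "presents R (ring_module R) A.FC p (Ext R p M (ring_module R)) \<phi>R"
      using A.Ext_presented[OF L.ring_module_module] by blast
    \<comment> \<open>Above the cohomological dimension all columns have vanishing cohomology, which
      is the hypothesis under which columns are cleared in degree p + n.\<close>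
    have V: "A.vanish N j" if "j > n" for j using zero[of j] n that by (intro A.vanishI[OF N]) simp
    interpret T: top_degree R \<aa> M r d v N p n ?H ?HM "Ext R p M ?H" \<phi>T \<phi>Q \<phi>E
      by (intro top_degree.intro top_degree_axioms.intro A.adic_res_axioms N V H E \<phi>T \<phi>Q \<phi>E
          A.gen_local_cohomology_presented(2)[OF N]) (use rp in simp)
    interpret X: top_ext R \<aa> M r d v p ?H "Ext R p M ?H" "Ext R p M (ring_module R)" \<phi>E \<phi>R
      by (intro top_ext.intro top_ext_axioms.intro A.adic_res_axioms H E ER \<phi>E \<phi>R) (use rp in simp)
    show "mod_iso R ?HM (Ext R p M ?H)" by (rule T.gen_local_cohomology_iso_Ext)
    show "mod_iso R (Ext R p M ?H) (tensor R (Ext R p M (ring_module R)) ?H)" by (rule X.Ext_iso_tensor)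
  qed
qed

end
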